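(* Let $\boldsymbol{\kappa}$ be a field of characteristic $0$ and $\mathbf{k}=\boldsymbol{\kappa}(\delta)$ the field of rational functions in one indeterminate $\delta$. Let $W$ be a finite complex (pseudo-)reflection group with set of reflecting hyperplanes $\mathcal{A}$, let $Br(W)$ be the generic Brauer-Chen algebra of $W$ defined over $\mathbf{k}$, and $Br_1(W)=Br(W)/I_2$. Choose a representative $H_0\in\mathcal{A}_0$ for each orbit $\mathcal{A}_0\in\mathcal{A}/W$. Then: (i) $Br_1(W)$ is a semisimple algebra. (ii) Its irreducible representations which do not factor through $\mathbf{k}W$ are (up to isomorphism) in one-to-one correspondence with the pairs $(\mathcal{A}_0,\theta)$, where $\mathcal{A}_0\in\mathcal{A}/W$ and $\theta$ is an irreducible representation (up to isomorphism) of $N(W_{H_0})/W_{H_0}$ over $\mathbf{k}$. (iii) The restriction to $W\subset Br_1(W)$ of the irreducible representation corresponding to $(\mathcal{A}_0,\theta)$ is the induced representation $\mathrm{Ind}_{N(W_{H_0})}^W\theta$, where $\theta$ is viewed as a representation of $N(W_{H_0})$ through the quotient map. (iv) The dimension of $Br_1(W)$ over $\mathbf{k}$ is $$|W|+\sum_{\mathcal{A}_0\in\mathcal{A}/W}|\mathcal{A}_0|\times |W|/|W_{H_0}|.$$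
   Context: Let $W\subset \mathrm{GL}(V)$ be a finite complex reflection group ($V$ a finite-dimensional complex vector space, $W$ generated by pseudo-reflections), $\mathcal{R}$ its set of (pseudo-)reflections (nontrivial elements $s$ with $\mathrm{Ker}(s-1)$ a hyperplane), $\mathcal{A}=\{\mathrm{Ker}(s-1) : s\in\mathcal{R}\}$. For $H\in\mathcal{A}$, $W_H$ is the pointwise stabilizer of $H$ in $W$, and $N(W_H)$ its normalizer in $W$, equal to $\{w\in W : w(H)=H\}$. Two hyperplanes $H_1,H_2\in\mathcal{A}$ are transverse if $H_1\neq H_2$ and $\{H\in\mathcal{A} : H\supset H_1\cap H_2\}=\{H_1,H_2\}$. A transverse collection is a subset $\underline{H}=\{H_1,\dots,H_r\}$ of $\mathcal{A}$ any two distinct members of which are transverse. Fix scalars $\mu_s\in\mathbf{k}$, $s\in\mathcal{R}$, with $\mu_s=\mu_t$ whenever $s,t$ are conjugate in $W$. The Brauer-Chen algebra $Br(W)$ is the unital associative $\mathbf{k}$-algebra with generators $w\in W$ and $e_H$, $H\in\mathcal{A}$, and relations: the relations of $W$; $we_H=e_{w(H)}w$ for $w\in W$, $H\in\mathcal{A}$; and (1) $e_H^2=\delta e_H$ for all $H$, and $e_Hs=se_H=e_H$ whenever $s\in\mathcal{R}$, $\mathrm{Ker}(s-1)=H$; (2) $e_{H_1}e_{H_2}=e_{H_2}e_{H_1}$ if $H_1,H_2$ are transverse; (3) if $H_1,H_2$ are distinct and not transverse, $e_{H_1}e_{H_2}=\left(\sum_{s\in\mathcal{R},\, s(H_2)=H_1}\mu_s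 s\right)e_{H_2}=e_{H_1}\left(\sum_{s\in\mathcal{R},\, s(H_2)=H_1}\mu_s s\right)$. For a transverse collection $\underline{H}=\{H_1,\dots,H_r\}$ put $e_{\underline{H}}=e_{H_1}\cdots e_{H_r}$. For $r\ge 1$, $I_r$ is the left ideal of $Br(W)$ generated by the $e_{\underline{H}}$ with $\underline{H}$ of cardinality $r$; it is a two-sided ideal, and $Br_r(W)=Br(W)/I_{r+1}$. In particular $Br_0(W)=\mathbf{k}W$ is a quotient of $Br_1(W)$ (by the images of the $e_H$); "factoring through $\mathbf{k}W$" refers to this quotient.
   Formalization: The parameters μ_s are taken in κ, not in κ(δ): for W = S_3 and μ_s = δ the algebra Br_1(W) is not semisimple. The representations θ and those attached to (A_0, θ) are realized on subsets of the sequences over k, which represent every isomorphism class. *)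

theory Defs
  imports
    "HOL-Algebra.Generated_Groups"
    "HOL-Algebra.Group_Action"
    "HOL-Algebra.QuotRing"
    "HOL-Computational_Algebra.Fraction_Field"
    "HOL-Computational_Algebra.Polynomial"
    "Jordan_Normal_Form.VS_Connect"
begin

section \<open>Associative algebras over a field\<close>

text \<open>
  The library locale \<^locale>\<open>algebra\<close> requires a commutative multiplication, so unital associative
  algebras are introduced here. The ground field is a type \<open>'k\<close>, regarded as the ring \<open>class_ring\<close>.
\<close>

definition assoc_algebra :: "('k::field, 'a) module \<Rightarrow> bool" where
  "assoc_algebra A \<longleftrightarrow> ring A \<and> vectorspace class_ring A \<and>
     (\<forall>c. \<forall>x\<in>carrier A. \<forall>y\<in>carrier A.
        (c \<odot>\<^bsub>A\<^esub> x) \<otimes>\<^bsub>A\<^esub> y = c \<odot>\<^bsub>A\<^esub> (x \<otimes>\<^bsub>A\<^esub> y) \<and> x \<otimes>\<^bsub>A\<^esub> (c \<odot>\<^bsub>A\<^esub> y) = c \<odot>\<^bsub>A\<^esub> (x \<otimes>\<^bsub>A\<^esub> y))"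

definition left_ideal :: "('k, 'a) module \<Rightarrow> 'a set \<Rightarrow> bool" where
  "left_ideal A L \<longleftrightarrow> additive_subgroup L A \<and> (\<forall>a\<in>carrier A. \<forall>x\<in>L. a \<otimes>\<^bsub>A\<^esub> x \<in> L)"

definition left_ideal_generated :: "('k, 'a) module \<Rightarrow> 'a set \<Rightarrow> 'a set" where
  "left_ideal_generated A S = \<Inter>{L. left_ideal A L \<and> S \<subseteq> L}"

definition minimal_left_ideal :: "('k, 'a) module \<Rightarrow> 'a set \<Rightarrow> bool" where
  "minimal_left_ideal A L \<longleftrightarrow> left_ideal A L \<and> L \<noteq> {\<zero>\<^bsub>A\<^esub>} \<and>
     (\<forall>L'. left_ideal A L' \<and> L' \<subseteq> L \<longrightarrow> L' = {\<zero>\<^bsub>A\<^esub>} \<or> L' = L)"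

text \<open>The left regular module is a (necessarily finite) direct sum of simple submodules.\<close>

definition semisimple_algebra :: "('k::field, 'a) module \<Rightarrow> bool" where
  "semisimple_algebra A \<longleftrightarrow> assoc_algebra A \<and>
     (\<exists>S. finite S \<and> (\<forall>L\<in>S. minimal_left_ideal A L) \<and>
        (\<forall>a\<in>carrier A. \<exists>!f. f \<in> (\<Pi>\<^sub>E L\<in>S. L) \<and> a = (\<Oplus>\<^bsub>A\<^esub>L\<in>S. f L)))"

text \<open>The ring \<^term>\<open>A Quot I\<close> together with the induced scalar multiplication.\<close>

definition quot_algebra :: "('k, 'a) module \<Rightarrow> 'a set \<Rightarrow> ('k, 'a set) module" where
  "quot_algebra A I =
     ring.extend (A Quot I) (module.fields (\<lambda>c X. \<Union>x\<in>X. I +>\<^bsub>A\<^esub> (c \<odot>\<^bsub>A\<^esub> x)))"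

text \<open>
  The free algebra on a set \<open>X\<close>: finitely supported functions on the words over \<open>X\<close>, multiplied by
  convolution along all ways of cutting a word in two.
\<close>

definition free_algebra :: "'g set \<Rightarrow> ('k::field, 'g list \<Rightarrow> 'k) module" where
  "free_algebra X =
     \<lparr>carrier = {f. finite {u. f u \<noteq> 0} \<and> {u. f u \<noteq> 0} \<subseteq> lists X},
      mult = (\<lambda>f g u. \<Sum>i\<le>length u. f (take i u) * g (drop i u)),
      one = (\<lambda>u. if u = [] then 1 else 0),
      zero = (\<lambda>u. 0),
      add = (\<lambda>f g u. f u + g u),
      smult = (\<lambda>c f u. c * f u)\<rparr>"

definition free_gen :: "'g \<Rightarrow> 'g list \<Rightarrow> 'k::field" where
  "free_gen x = (\<lambda>u. if u = [x] then 1 else 0)"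

section \<open>Representations\<close>

text \<open>
  A representation is a pair of a \<open>'k\<close>-vector space with elements in \<open>'m\<close> and an action on it.
  Only the values of the action on the elements of the group (or algebra) and on the carrier of the
  vector space matter, and the ring multiplication of the module record plays no role.

  HOL cannot quantify over all carrier types inside a formula. Irreducible representations of a
  finite group, or of a finite-dimensional algebra, are finite-dimensional, so up to isomorphism all
  of them already occur with \<open>'m = nat \<Rightarrow> 'k\<close>, which is the universe used when a representation has
  to be chosen.
\<close>

type_synonym ('k, 'a, 'm) rep = "('k, 'm) module \<times> ('a \<Rightarrow> 'm \<Rightarrow> 'm)"

definition group_rep :: "'g monoid \<Rightarrow> ('k::field, 'g, 'm) rep \<Rightarrow> bool" where
  "group_rep G = (\<lambda>(V, \<rho>). vectorspace class_ring V \<and>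
     (\<forall>g\<in>carrier G. \<rho> g \<in> LinearCombinations.module_hom class_ring V V) \<and>
     (\<forall>v\<in>carrier V. \<rho> \<one>\<^bsub>G\<^esub> v = v) \<and>
     (\<forall>g\<in>carrier G. \<forall>h\<in>carrier G. \<forall>v\<in>carrier V. \<rho> (g \<otimes>\<^bsub>G\<^esub> h) v = \<rho> g (\<rho> h v)))"

definition algebra_rep :: "('k::field, 'a) module \<Rightarrow> ('k, 'a, 'm) rep \<Rightarrow> bool" where
  "algebra_rep A = (\<lambda>(V, \<rho>). vectorspace class_ring V \<and>
     (\<forall>a\<in>carrier A. \<rho> a \<in> LinearCombinations.module_hom class_ring V V) \<and>
     (\<forall>v\<in>carrier V. \<rho> \<one>\<^bsub>A\<^esub> v = v) \<and>
     (\<forall>a\<in>carrier A. \<forall>b\<in>carrier A. \<forall>v\<in>carrier V.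
        \<rho> (a \<otimes>\<^bsub>A\<^esub> b) v = \<rho> a (\<rho> b v) \<and> \<rho> (a \<oplus>\<^bsub>A\<^esub> b) v = \<rho> a v \<oplus>\<^bsub>V\<^esub> \<rho> b v) \<and>
     (\<forall>c. \<forall>a\<in>carrier A. \<forall>v\<in>carrier V. \<rho> (c \<odot>\<^bsub>A\<^esub> a) v = c \<odot>\<^bsub>V\<^esub> \<rho> a v))"

definition irreducible_action :: "'a set \<Rightarrow> ('k::field, 'a, 'm) rep \<Rightarrow> bool" where
  "irreducible_action X = (\<lambda>(V, \<rho>). carrier V \<noteq> {\<zero>\<^bsub>V\<^esub>} \<and>
     (\<forall>U. VectorSpace.subspace class_ring U V \<and> (\<forall>x\<in>X. \<rho> x ` U \<subseteq> U)
        \<longrightarrow> U = {\<zero>\<^bsub>V\<^esub>} \<or> U = carrier V))"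

definition rep_iso :: "'a set \<Rightarrow> ('k::field, 'a, 'm) rep \<Rightarrow> ('k, 'a, 'n) rep \<Rightarrow> bool" where
  "rep_iso X = (\<lambda>(V, \<rho>) (V', \<rho>'). \<exists>\<phi>\<in>LinearCombinations.module_hom class_ring V V'.
     bij_betw \<phi> (carrier V) (carrier V') \<and>
     (\<forall>x\<in>X. \<forall>v\<in>carrier V. \<phi> (\<rho> x v) = \<rho>' x (\<phi> v)))"

definition group_irreps :: "'g monoid \<Rightarrow> ('k::field, 'g, 'm) rep set" where
  "group_irreps G = {M. group_rep G M \<and> irreducible_action (carrier G) M}"

definition algebra_irreps :: "('k::field, 'a) module \<Rightarrow> ('k, 'a, 'm) rep set" where
  "algebra_irreps A = {M. algebra_rep A M \<and> irreducible_action (carrier A) M}"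

definition factors_through_quot :: "('k::field, 'a) module \<Rightarrow> 'a set \<Rightarrow> ('k, 'a, 'm) rep \<Rightarrow> bool" where
  "factors_through_quot A J = (\<lambda>(V, \<rho>). \<exists>\<rho>'. algebra_rep (quot_algebra A J) (V, \<rho>') \<and>
     (\<forall>a\<in>carrier A. \<forall>v\<in>carrier V. \<rho> a v = \<rho>' (J +>\<^bsub>A\<^esub> a) v))"

definition inflated_rep :: "'g monoid \<Rightarrow> 'g set \<Rightarrow> ('k, 'g set, 'm) rep \<Rightarrow> ('k, 'g, 'm) rep" where
  "inflated_rep G K = (\<lambda>(V, \<rho>). (V, \<lambda>g. \<rho> (K #>\<^bsub>G\<^esub> g)))"

text \<open>
  Induction from a subgroup \<open>N\<close> to \<open>G\<close>, in the model of functions \<open>f\<close> on \<open>G\<close> with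
  \<open>f (n g) = n (f g)\<close>, on which \<open>G\<close> acts by right translation. The index of \<open>N\<close> is finite here, so
  this agrees with the model \<open>k[G] \<otimes> V\<close> (tensor product over \<open>k[N]\<close>).
\<close>

definition induced_rep :: "'g monoid \<Rightarrow> 'g set \<Rightarrow> ('k, 'g, 'm) rep \<Rightarrow> ('k, 'g, 'g \<Rightarrow> 'm) rep" where
  "induced_rep G N = (\<lambda>(V, \<rho>).
     (\<lparr>carrier = {f \<in> carrier G \<rightarrow>\<^sub>E carrier V.
                    \<forall>n\<in>N. \<forall>g\<in>carrier G. f (n \<otimes>\<^bsub>G\<^esub> g) = \<rho> n (f g)},
       mult = undefined,
       one = undefined,
       zero = (\<lambda>g\<in>carrier G. \<zero>\<^bsub>V\<^esub>),
       add = (\<lambda>f f'. \<lambda>g\<in>carrier G. f g \<oplus>\<^bsub>V\<^esub> f' g),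
       smult = (\<lambda>c f. \<lambda>g\<in>carrier G. c \<odot>\<^bsub>V\<^esub> f g)\<rparr>,
      \<lambda>g f. \<lambda>x\<in>carrier G. f (x \<otimes>\<^bsub>G\<^esub> g)))"

section \<open>Complex reflection groups\<close>

definition GL :: "(complex \<Rightarrow> 'v \<Rightarrow> 'v) \<Rightarrow> ('v::ab_group_add \<Rightarrow> 'v) monoid" where
  "GL scale = \<lparr>carrier = {g. Vector_Spaces.linear scale scale g \<and> bij g}, mult = (\<circ>), one = id\<rparr>"

definition fixed_space :: "('v \<Rightarrow> 'v) \<Rightarrow> 'v set" where
  "fixed_space s = {x. s x = x}"

definition reflections :: "(complex \<Rightarrow> 'v \<Rightarrow> 'v) \<Rightarrow> ('v::ab_group_add \<Rightarrow> 'v) set \<Rightarrow> ('v \<Rightarrow> 'v) set" where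
  "reflections scale W = {s \<in> W. s \<noteq> id \<and>
     Suc (vector_space.dim scale (fixed_space s)) = vector_space.dim scale (UNIV :: 'v set)}"

definition complex_reflection_group ::
    "(complex \<Rightarrow> 'v \<Rightarrow> 'v) \<Rightarrow> ('v::ab_group_add \<Rightarrow> 'v) set \<Rightarrow> bool" where
  "complex_reflection_group scale W \<longleftrightarrow>
     (\<exists>Basis. finite_dimensional_vector_space scale Basis) \<and>
     subgroup W (GL scale) \<and> finite W \<and> generate (GL scale) (reflections scale W) = W"

definition hyperplanes :: "(complex \<Rightarrow> 'v \<Rightarrow> 'v) \<Rightarrow> ('v::ab_group_add \<Rightarrow> 'v) set \<Rightarrow> 'v set set" where
  "hyperplanes scale W = fixed_space ` reflections scale W"

definition hyperplane_orbits ::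
    "(complex \<Rightarrow> 'v \<Rightarrow> 'v) \<Rightarrow> ('v::ab_group_add \<Rightarrow> 'v) set \<Rightarrow> 'v set set set" where
  "hyperplane_orbits scale W = (\<lambda>H. {w ` H | w. w \<in> W}) ` hyperplanes scale W"

definition pointwise_stabilizer :: "('v \<Rightarrow> 'v) set \<Rightarrow> 'v set \<Rightarrow> ('v \<Rightarrow> 'v) set" where
  "pointwise_stabilizer W H = {w \<in> W. \<forall>x\<in>H. w x = x}"

definition refl_group :: "(complex \<Rightarrow> 'v \<Rightarrow> 'v) \<Rightarrow> ('v::ab_group_add \<Rightarrow> 'v) set \<Rightarrow> ('v \<Rightarrow> 'v) monoid" where
  "refl_group scale W = (GL scale)\<lparr>carrier := W\<rparr>"

definition stab_normalizer ::
    "(complex \<Rightarrow> 'v \<Rightarrow> 'v) \<Rightarrow> ('v::ab_group_add \<Rightarrow> 'v) set \<Rightarrow> 'v set \<Rightarrow> ('v \<Rightarrow> 'v) set" where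
  "stab_normalizer scale W H = normalizer (refl_group scale W) (pointwise_stabilizer W H)"

definition stab_quotient ::
    "(complex \<Rightarrow> 'v \<Rightarrow> 'v) \<Rightarrow> ('v::ab_group_add \<Rightarrow> 'v) set \<Rightarrow> 'v set \<Rightarrow> ('v \<Rightarrow> 'v) set monoid" where
  "stab_quotient scale W H =
     (refl_group scale W)\<lparr>carrier := stab_normalizer scale W H\<rparr> Mod pointwise_stabilizer W H"

definition transverse ::
    "(complex \<Rightarrow> 'v \<Rightarrow> 'v) \<Rightarrow> ('v::ab_group_add \<Rightarrow> 'v) set \<Rightarrow> 'v set \<Rightarrow> 'v set \<Rightarrow> bool" where
  "transverse scale W H1 H2 \<longleftrightarrow>
     H1 \<noteq> H2 \<and> {H \<in> hyperplanes scale W. H1 \<inter> H2 \<subseteq> H} = {H1, H2}"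

definition transverse_collection ::
    "(complex \<Rightarrow> 'v \<Rightarrow> 'v) \<Rightarrow> ('v::ab_group_add \<Rightarrow> 'v) set \<Rightarrow> 'v set set \<Rightarrow> bool" where
  "transverse_collection scale W C \<longleftrightarrow>
     C \<subseteq> hyperplanes scale W \<and> pairwise (transverse scale W) C"

section \<open>The Brauer-Chen algebra\<close>

datatype 'v bc_gen = Elt "'v \<Rightarrow> 'v" | Hyp "'v set"

definition bc_free ::
    "(complex \<Rightarrow> 'v \<Rightarrow> 'v) \<Rightarrow> ('v::ab_group_add \<Rightarrow> 'v) set \<Rightarrow> ('k::field, 'v bc_gen list \<Rightarrow> 'k) module" where
  "bc_free scale W = free_algebra (Elt ` W \<union> Hyp ` hyperplanes scale W)"

text \<open>
  For distinct non-transverse \<open>H1\<close>, \<open>H2\<close>: the sum of \<open>\<mu> s \<cdot> s\<close> over the reflections \<open>s\<close> with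
  \<open>s(H2) = H1\<close>.
\<close>

definition bc_sum ::
    "(complex \<Rightarrow> 'v \<Rightarrow> 'v) \<Rightarrow> ('v::ab_group_add \<Rightarrow> 'v) set \<Rightarrow> (('v \<Rightarrow> 'v) \<Rightarrow> 'k::field) \<Rightarrow>
     'v set \<Rightarrow> 'v set \<Rightarrow> ('v bc_gen list \<Rightarrow> 'k)" where
  "bc_sum scale W \<mu> H1 H2 =
     (\<Oplus>\<^bsub>bc_free scale W\<^esub>s\<in>{s \<in> reflections scale W. s ` H2 = H1}.
        \<mu> s \<odot>\<^bsub>bc_free scale W\<^esub> free_gen (Elt s))"

inductive_set bc_relations ::
    "(complex \<Rightarrow> 'v \<Rightarrow> 'v) \<Rightarrow> ('v::ab_group_add \<Rightarrow> 'v) set \<Rightarrow> 'k::field \<Rightarrow> (('v \<Rightarrow> 'v) \<Rightarrow> 'k) \<Rightarrow>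
     (('v bc_gen list \<Rightarrow> 'k) \<times> ('v bc_gen list \<Rightarrow> 'k)) set"
  for scale W \<delta> \<mu> where
  group_one: "(free_gen (Elt id), \<one>\<^bsub>bc_free scale W\<^esub>) \<in> bc_relations scale W \<delta> \<mu>"
| group_mult: "w \<in> W \<Longrightarrow> w' \<in> W \<Longrightarrow>
    (free_gen (Elt w) \<otimes>\<^bsub>bc_free scale W\<^esub> free_gen (Elt w'), free_gen (Elt (w \<circ> w')))
      \<in> bc_relations scale W \<delta> \<mu>"
| conj: "w \<in> W \<Longrightarrow> H \<in> hyperplanes scale W \<Longrightarrow>
    (free_gen (Elt w) \<otimes>\<^bsub>bc_free scale W\<^esub> free_gen (Hyp H),
     free_gen (Hyp (w ` H)) \<otimes>\<^bsub>bc_free scale W\<^esub> free_gen (Elt w)) \<in> bc_relations scale W \<delta> \<mu>"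
| square: "H \<in> hyperplanes scale W \<Longrightarrow>
    (free_gen (Hyp H) \<otimes>\<^bsub>bc_free scale W\<^esub> free_gen (Hyp H),
     \<delta> \<odot>\<^bsub>bc_free scale W\<^esub> free_gen (Hyp H)) \<in> bc_relations scale W \<delta> \<mu>"
| absorb_right: "s \<in> reflections scale W \<Longrightarrow> fixed_space s = H \<Longrightarrow>
    (free_gen (Hyp H) \<otimes>\<^bsub>bc_free scale W\<^esub> free_gen (Elt s), free_gen (Hyp H))
      \<in> bc_relations scale W \<delta> \<mu>"
| absorb_left: "s \<in> reflections scale W \<Longrightarrow> fixed_space s = H \<Longrightarrow>
    (free_gen (Elt s) \<otimes>\<^bsub>bc_free scale W\<^esub> free_gen (Hyp H), free_gen (Hyp H))
      \<in> bc_relations scale W \<delta> \<mu>"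
| commute: "H1 \<in> hyperplanes scale W \<Longrightarrow> H2 \<in> hyperplanes scale W \<Longrightarrow> transverse scale W H1 H2 \<Longrightarrow>
    (free_gen (Hyp H1) \<otimes>\<^bsub>bc_free scale W\<^esub> free_gen (Hyp H2),
     free_gen (Hyp H2) \<otimes>\<^bsub>bc_free scale W\<^esub> free_gen (Hyp H1)) \<in> bc_relations scale W \<delta> \<mu>"
| nontransverse_left: "H1 \<in> hyperplanes scale W \<Longrightarrow> H2 \<in> hyperplanes scale W \<Longrightarrow> H1 \<noteq> H2 \<Longrightarrow>
    \<not> transverse scale W H1 H2 \<Longrightarrow>
    (free_gen (Hyp H1) \<otimes>\<^bsub>bc_free scale W\<^esub> free_gen (Hyp H2),
     bc_sum scale W \<mu> H1 H2 \<otimes>\<^bsub>bc_free scale W\<^esub> free_gen (Hyp H2)) \<in> bc_relations scale W \<delta> \<mu>"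
| nontransverse_right: "H1 \<in> hyperplanes scale W \<Longrightarrow> H2 \<in> hyperplanes scale W \<Longrightarrow> H1 \<noteq> H2 \<Longrightarrow>
    \<not> transverse scale W H1 H2 \<Longrightarrow>
    (free_gen (Hyp H1) \<otimes>\<^bsub>bc_free scale W\<^esub> free_gen (Hyp H2),
     free_gen (Hyp H1) \<otimes>\<^bsub>bc_free scale W\<^esub> bc_sum scale W \<mu> H1 H2) \<in> bc_relations scale W \<delta> \<mu>"

definition bc_ideal ::
    "(complex \<Rightarrow> 'v \<Rightarrow> 'v) \<Rightarrow> ('v::ab_group_add \<Rightarrow> 'v) set \<Rightarrow> 'k::field \<Rightarrow> (('v \<Rightarrow> 'v) \<Rightarrow> 'k) \<Rightarrow>
     ('v bc_gen list \<Rightarrow> 'k) set" where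
  "bc_ideal scale W \<delta> \<mu> =
     Idl\<^bsub>bc_free scale W\<^esub> {a \<ominus>\<^bsub>bc_free scale W\<^esub> b | a b. (a, b) \<in> bc_relations scale W \<delta> \<mu>}"

type_synonym ('v, 'k) bc = "('v bc_gen list \<Rightarrow> 'k) set"

definition Br ::
    "(complex \<Rightarrow> 'v \<Rightarrow> 'v) \<Rightarrow> ('v::ab_group_add \<Rightarrow> 'v) set \<Rightarrow> 'k::field \<Rightarrow> (('v \<Rightarrow> 'v) \<Rightarrow> 'k) \<Rightarrow>
     ('k, ('v, 'k) bc) module" where
  "Br scale W \<delta> \<mu> = quot_algebra (bc_free scale W) (bc_ideal scale W \<delta> \<mu>)"

definition Br_gen ::
    "(complex \<Rightarrow> 'v \<Rightarrow> 'v) \<Rightarrow> ('v::ab_group_add \<Rightarrow> 'v) set \<Rightarrow> 'k::field \<Rightarrow> (('v \<Rightarrow> 'v) \<Rightarrow> 'k) \<Rightarrow>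
     'v bc_gen \<Rightarrow> ('v, 'k) bc" where
  "Br_gen scale W \<delta> \<mu> x = bc_ideal scale W \<delta> \<mu> +>\<^bsub>bc_free scale W\<^esub> free_gen x"

text \<open>
  The product over a transverse collection does not depend on the order of the factors, as these
  commute; the generating set below contains the product along every enumeration.
\<close>

definition Br_I ::
    "(complex \<Rightarrow> 'v \<Rightarrow> 'v) \<Rightarrow> ('v::ab_group_add \<Rightarrow> 'v) set \<Rightarrow> 'k::field \<Rightarrow> (('v \<Rightarrow> 'v) \<Rightarrow> 'k) \<Rightarrow>
     nat \<Rightarrow> ('v, 'k) bc set" where
  "Br_I scale W \<delta> \<mu> r = left_ideal_generated (Br scale W \<delta> \<mu>)
     {foldr (\<lambda>H x. Br_gen scale W \<delta> \<mu> (Hyp H) \<otimes>\<^bsub>Br scale W \<delta> \<mu>\<^esub> x) Hs \<one>\<^bsub>Br scale W \<delta> \<mu>\<^esub> | Hs.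
        distinct Hs \<and> length Hs = r \<and> transverse_collection scale W (set Hs)}"

definition Br_trunc ::
    "(complex \<Rightarrow> 'v \<Rightarrow> 'v) \<Rightarrow> ('v::ab_group_add \<Rightarrow> 'v) set \<Rightarrow> 'k::field \<Rightarrow> (('v \<Rightarrow> 'v) \<Rightarrow> 'k) \<Rightarrow>
     nat \<Rightarrow> ('k, ('v, 'k) bc set) module" where
  "Br_trunc scale W \<delta> \<mu> r = quot_algebra (Br scale W \<delta> \<mu>) (Br_I scale W \<delta> \<mu> (r + 1))"

definition Br_trunc_gen ::
    "(complex \<Rightarrow> 'v \<Rightarrow> 'v) \<Rightarrow> ('v::ab_group_add \<Rightarrow> 'v) set \<Rightarrow> 'k::field \<Rightarrow> (('v \<Rightarrow> 'v) \<Rightarrow> 'k) \<Rightarrow>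
     nat \<Rightarrow> 'v bc_gen \<Rightarrow> ('v, 'k) bc set" where
  "Br_trunc_gen scale W \<delta> \<mu> r x = Br_I scale W \<delta> \<mu> (r + 1) +>\<^bsub>Br scale W \<delta> \<mu>\<^esub> Br_gen scale W \<delta> \<mu> x"

text \<open>
  The generic algebra: \<open>\<kappa>\<close> is the type \<open>'c\<close>, the field \<open>\<kappa>(\<delta>)\<close> is \<open>'c poly fract\<close>, and the
  parameters \<open>\<mu> s\<close> are constants from \<open>\<kappa>\<close>. They cannot be arbitrary elements of \<open>\<kappa>(\<delta>)\<close>: for the
  symmetric group on three letters and \<open>\<mu> s = \<delta>\<close> for all \<open>s\<close>, the truncation is not semisimple.
\<close>

definition indet :: "'c::field poly fract" where
  "indet = Fraction_Field.Fract [:0, 1:] 1"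

definition const_fract :: "'c::field \<Rightarrow> 'c poly fract" where
  "const_fract c = Fraction_Field.Fract [:c:] 1"

definition generic_Br1 ::
    "(complex \<Rightarrow> 'v \<Rightarrow> 'v) \<Rightarrow> ('v::ab_group_add \<Rightarrow> 'v) set \<Rightarrow> (('v \<Rightarrow> 'v) \<Rightarrow> 'c::field_char_0) \<Rightarrow>
     ('c poly fract, ('v, 'c poly fract) bc set) module" where
  "generic_Br1 scale W \<mu> = Br_trunc scale W indet (const_fract \<circ> \<mu>) 1"

definition generic_Br1_gen ::
    "(complex \<Rightarrow> 'v \<Rightarrow> 'v) \<Rightarrow> ('v::ab_group_add \<Rightarrow> 'v) set \<Rightarrow> (('v \<Rightarrow> 'v) \<Rightarrow> 'c::field_char_0) \<Rightarrow>
     'v bc_gen \<Rightarrow> ('v, 'c poly fract) bc set" where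
  "generic_Br1_gen scale W \<mu> x = Br_trunc_gen scale W indet (const_fract \<circ> \<mu>) 1 x"

text \<open>
  The kernel of the quotient map onto \<open>Br\<^sub>0(W)\<close>, the group algebra of \<open>W\<close>: the two-sided ideal
  generated by the images of the \<open>e\<^sub>H\<close>.
\<close>

definition Br1_to_group_kernel ::
    "(complex \<Rightarrow> 'v \<Rightarrow> 'v) \<Rightarrow> ('v::ab_group_add \<Rightarrow> 'v) set \<Rightarrow> (('v \<Rightarrow> 'v) \<Rightarrow> 'c::field_char_0) \<Rightarrow>
     ('v, 'c poly fract) bc set set" where
  "Br1_to_group_kernel scale W \<mu> =
     Idl\<^bsub>generic_Br1 scale W \<mu>\<^esub> ((\<lambda>H. generic_Br1_gen scale W \<mu> (Hyp H)) ` hyperplanes scale W)"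

definition Br1_new_irreps ::
    "(complex \<Rightarrow> 'v \<Rightarrow> 'v) \<Rightarrow> ('v::ab_group_add \<Rightarrow> 'v) set \<Rightarrow> (('v \<Rightarrow> 'v) \<Rightarrow> 'c::field_char_0) \<Rightarrow>
     ('c poly fract, ('v, 'c poly fract) bc set, 'm) rep set" where
  "Br1_new_irreps scale W \<mu> =
     {M \<in> algebra_irreps (generic_Br1 scale W \<mu>).
        \<not> factors_through_quot (generic_Br1 scale W \<mu>) (Br1_to_group_kernel scale W \<mu>) M}"

definition restrict_to_W ::
    "(complex \<Rightarrow> 'v \<Rightarrow> 'v) \<Rightarrow> ('v::ab_group_add \<Rightarrow> 'v) set \<Rightarrow> (('v \<Rightarrow> 'v) \<Rightarrow> 'c::field_char_0) \<Rightarrow>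
     ('c poly fract, ('v, 'c poly fract) bc set, 'm) rep \<Rightarrow> ('c poly fract, 'v \<Rightarrow> 'v, 'm) rep" where
  "restrict_to_W scale W \<mu> = (\<lambda>(V, \<rho>). (V, \<lambda>w. \<rho> (generic_Br1_gen scale W \<mu> (Elt w))))"

end

(*
  Cutting each w in W down to a partial map w|x, where x is a reflecting hyperplane or the whole
  space, gives a finite groupoid. In its algebra let p_H be the identity of the object H; sending w to
  the sum of the w|x and e_H to delta p_H plus a combination, with constant coefficients, of the arrows
  starting at H defines a homomorphism from Br_1(W). In the spanning set of the w and the w e_H its
  matrix is delta plus a constant matrix on the arrows that start at a hyperplane, which is invertible
  because delta is an indeterminate. So Br_1(W) is the groupoid algebra: averaging over arrows gives
  semisimplicity, the dimension is the number of arrows, and a representation M on which the e_H do not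
  all vanish is determined by the representation p_H M of the vertex group N(W_H)/W_H, from which it is
  recovered by induction.
*)
theory Submission
  imports Defs "HOL-Library.Function_Algebras"
begin

section \<open>Associative algebras\<close>

text \<open>An algebra given by generators and relations has no visible dimension. The relations
  bound it from above: modulo I_2 the w and the w e_H span, and w e_H depends only on the
  restriction of w to H, because a nontrivial element fixing H pointwise is a reflection in H, which
  e_H absorbs. That the bound is attained is seen from a map into an algebra of that dimension. Its
  formula for e_H is right multiplication by e_H on the e_K w modulo I_2, with e_K read as the
  identity arrow of K; transverse hyperplanes get product 0, so I_2 dies. The \<mu>_s are constants
  in \<delta>: in a vector of polynomials, multiplication by \<delta> raises the top degree and the
  constant matrix cannot compensate. Counting the whole space as an object places the group algebra
  of W in the same groupoid, so that one averaging argument covers it as well, and factoring through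
  kW becomes the condition that all arrows starting at a hyperplane act as 0.\<close>

lemma vectorspaceD:
  fixes V :: "('k::field, 'm) module"
  assumes "vectorspace class_ring V"
  shows "abelian_group V"
    "\<And>c v. v \<in> carrier V \<Longrightarrow> c \<odot>\<^bsub>V\<^esub> v \<in> carrier V"
    "\<And>c d v. v \<in> carrier V \<Longrightarrow> (c + d) \<odot>\<^bsub>V\<^esub> v = c \<odot>\<^bsub>V\<^esub> v \<oplus>\<^bsub>V\<^esub> d \<odot>\<^bsub>V\<^esub> v"
    "\<And>c v w. v \<in> carrier V \<Longrightarrow> w \<in> carrier V \<Longrightarrow>
       c \<odot>\<^bsub>V\<^esub> (v \<oplus>\<^bsub>V\<^esub> w) = c \<odot>\<^bsub>V\<^esub> v \<oplus>\<^bsub>V\<^esub> c \<odot>\<^bsub>V\<^esub> w"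
    "\<And>c d v. v \<in> carrier V \<Longrightarrow> (c * d) \<odot>\<^bsub>V\<^esub> v = c \<odot>\<^bsub>V\<^esub> (d \<odot>\<^bsub>V\<^esub> v)"
    "\<And>v. v \<in> carrier V \<Longrightarrow> 1 \<odot>\<^bsub>V\<^esub> v = v"
    "\<And>c. c \<odot>\<^bsub>V\<^esub> \<zero>\<^bsub>V\<^esub> = \<zero>\<^bsub>V\<^esub>"
    "\<And>v. v \<in> carrier V \<Longrightarrow> 0 \<odot>\<^bsub>V\<^esub> v = \<zero>\<^bsub>V\<^esub>"
    "\<And>v. v \<in> carrier V \<Longrightarrow> (- 1) \<odot>\<^bsub>V\<^esub> v = \<ominus>\<^bsub>V\<^esub> v"
proof -
  interpret vectorspace class_ring V by fact
  show "abelian_group V" by (rule M.abelian_group_axioms)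
  show cl: "c \<odot>\<^bsub>V\<^esub> v \<in> carrier V" if "v \<in> carrier V" for c v
    using smult_closed[of c v] that by simp
  show ad: "(c + d) \<odot>\<^bsub>V\<^esub> v = c \<odot>\<^bsub>V\<^esub> v \<oplus>\<^bsub>V\<^esub> d \<odot>\<^bsub>V\<^esub> v" if "v \<in> carrier V" for c d v
    using smult_l_distr[of c d v] that by simp
  show "c \<odot>\<^bsub>V\<^esub> (v \<oplus>\<^bsub>V\<^esub> w) = c \<odot>\<^bsub>V\<^esub> v \<oplus>\<^bsub>V\<^esub> c \<odot>\<^bsub>V\<^esub> w" if "v \<in> carrier V" "w \<in> carrier V" for c v w
    using smult_r_distr[of c v w] that by simp
  show "(c * d) \<odot>\<^bsub>V\<^esub> v = c \<odot>\<^bsub>V\<^esub> (d \<odot>\<^bsub>V\<^esub> v)" if "v \<in> carrier V" for c d v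
    using smult_assoc1[of c d v] that by simp
  show one: "1 \<odot>\<^bsub>V\<^esub> v = v" if "v \<in> carrier V" for v
    using smult_one[of v] that by simp
  show "c \<odot>\<^bsub>V\<^esub> \<zero>\<^bsub>V\<^esub> = \<zero>\<^bsub>V\<^esub>" for c
    using smult_r_null[of c] by simp
  show nul: "0 \<odot>\<^bsub>V\<^esub> v = \<zero>\<^bsub>V\<^esub>" if "v \<in> carrier V" for v
    using smult_l_null[of v] that by simp
  show "(- 1) \<odot>\<^bsub>V\<^esub> v = \<ominus>\<^bsub>V\<^esub> v" if "v \<in> carrier V" for v
  proof -
    have "(- 1) \<odot>\<^bsub>V\<^esub> v \<oplus>\<^bsub>V\<^esub> v = \<zero>\<^bsub>V\<^esub>"
      using ad[OF that, of "-1" 1] one[OF that] nul[OF that] by simp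
    then show ?thesis using M.minus_equality[of "(- 1) \<odot>\<^bsub>V\<^esub> v" v] cl[OF that, of "-1"] that by simp
  qed
qed

lemma vectorspaceI:
  fixes V :: "('k::field, 'm) module"
  assumes "abelian_group V"
    "\<And>c v. v \<in> carrier V \<Longrightarrow> c \<odot>\<^bsub>V\<^esub> v \<in> carrier V"
    "\<And>c d v. v \<in> carrier V \<Longrightarrow> (c + d) \<odot>\<^bsub>V\<^esub> v = c \<odot>\<^bsub>V\<^esub> v \<oplus>\<^bsub>V\<^esub> d \<odot>\<^bsub>V\<^esub> v"
    "\<And>c v w. v \<in> carrier V \<Longrightarrow> w \<in> carrier V \<Longrightarrow>
       c \<odot>\<^bsub>V\<^esub> (v \<oplus>\<^bsub>V\<^esub> w) = c \<odot>\<^bsub>V\<^esub> v \<oplus>\<^bsub>V\<^esub> c \<odot>\<^bsub>V\<^esub> w"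
    "\<And>c d v. v \<in> carrier V \<Longrightarrow> (c * d) \<odot>\<^bsub>V\<^esub> v = c \<odot>\<^bsub>V\<^esub> (d \<odot>\<^bsub>V\<^esub> v)"
    "\<And>v. v \<in> carrier V \<Longrightarrow> 1 \<odot>\<^bsub>V\<^esub> v = v"
  shows "vectorspace class_ring V"
proof -
  have "module class_ring V"
    by (rule moduleI) (use assms class_cring.cring_axioms in auto)
  then show ?thesis
    unfolding vectorspace_def using class_field.field_axioms by auto
qed

lemma module_homD:
  assumes "T \<in> LinearCombinations.module_hom class_ring V V'"
  shows "\<And>v. v \<in> carrier V \<Longrightarrow> T v \<in> carrier V'"
    "\<And>v w. v \<in> carrier V \<Longrightarrow> w \<in> carrier V \<Longrightarrow> T (v \<oplus>\<^bsub>V\<^esub> w) = T v \<oplus>\<^bsub>V'\<^esub> T w"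
    "\<And>c v. v \<in> carrier V \<Longrightarrow> T (c \<odot>\<^bsub>V\<^esub> v) = c \<odot>\<^bsub>V'\<^esub> T v"
  using assms unfolding LinearCombinations.module_hom_def by auto

lemma module_homI:
  assumes "\<And>v. v \<in> carrier V \<Longrightarrow> T v \<in> carrier V'"
    "\<And>v w. v \<in> carrier V \<Longrightarrow> w \<in> carrier V \<Longrightarrow> T (v \<oplus>\<^bsub>V\<^esub> w) = T v \<oplus>\<^bsub>V'\<^esub> T w"
    "\<And>c v. v \<in> carrier V \<Longrightarrow> T (c \<odot>\<^bsub>V\<^esub> v) = c \<odot>\<^bsub>V'\<^esub> T v"
  shows "T \<in> LinearCombinations.module_hom class_ring V V'"
  using assms unfolding LinearCombinations.module_hom_def by auto

lemma additive_zero: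
  assumes "abelian_group V" "abelian_group V'"
    "\<And>v. v \<in> carrier V \<Longrightarrow> T v \<in> carrier V'"
    "\<And>v w. v \<in> carrier V \<Longrightarrow> w \<in> carrier V \<Longrightarrow> T (v \<oplus>\<^bsub>V\<^esub> w) = T v \<oplus>\<^bsub>V'\<^esub> T w"
  shows "T \<zero>\<^bsub>V\<^esub> = \<zero>\<^bsub>V'\<^esub>"
proof -
  interpret V: abelian_group V by fact
  interpret V': abelian_group V' by fact
  have "T \<zero>\<^bsub>V\<^esub> = T \<zero>\<^bsub>V\<^esub> \<oplus>\<^bsub>V'\<^esub> T \<zero>\<^bsub>V\<^esub>"
    using assms(4)[of "\<zero>\<^bsub>V\<^esub>" "\<zero>\<^bsub>V\<^esub>"] by simp
  then show ?thesis using assms(3)[of "\<zero>\<^bsub>V\<^esub>"] V'.add.r_cancel_one' by simp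
qed

text \<open>The map is only asked to be additive, so that the rule serves algebra homomorphisms, the
  action of a fixed element, evaluation of an action at a fixed vector, and negation alike.\<close>

lemma additive_finsum:
  assumes "abelian_group V" "abelian_group V'"
    "\<And>v. v \<in> carrier V \<Longrightarrow> T v \<in> carrier V'"
    "\<And>v w. v \<in> carrier V \<Longrightarrow> w \<in> carrier V \<Longrightarrow> T (v \<oplus>\<^bsub>V\<^esub> w) = T v \<oplus>\<^bsub>V'\<^esub> T w"
    and f: "\<And>i. i \<in> S \<Longrightarrow> f i \<in> carrier V"
  shows "T (\<Oplus>\<^bsub>V\<^esub>i\<in>S. f i) = (\<Oplus>\<^bsub>V'\<^esub>i\<in>S. T (f i))"
proof -
  interpret V: abelian_group V by fact
  interpret V': abelian_group V' by fact
  have z: "T \<zero>\<^bsub>V\<^esub> = \<zero>\<^bsub>V'\<^esub>" using additive_zero[of V V' T] assms by blast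
  show ?thesis using f
  proof (induction S rule: infinite_finite_induct)
    case (insert x F)
    have "finsum V f F \<in> carrier V" using insert.prems by (auto intro!: V.finsum_closed)
    then show ?case
      using insert assms(3) by (simp add: V.finsum_insert V'.finsum_insert assms(4) Pi_def)
  qed (auto simp: z)
qed

definition alg_hom :: "('k::field, 'a) module \<Rightarrow> ('k, 'b) module \<Rightarrow> ('a \<Rightarrow> 'b) \<Rightarrow> bool" where
  "alg_hom A B h \<longleftrightarrow> (\<forall>x\<in>carrier A. h x \<in> carrier B) \<and>
     (\<forall>x\<in>carrier A. \<forall>y\<in>carrier A. h (x \<otimes>\<^bsub>A\<^esub> y) = h x \<otimes>\<^bsub>B\<^esub> h y \<and> h (x \<oplus>\<^bsub>A\<^esub> y) = h x \<oplus>\<^bsub>B\<^esub> h y) \<and>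
     (\<forall>c. \<forall>x\<in>carrier A. h (c \<odot>\<^bsub>A\<^esub> x) = c \<odot>\<^bsub>B\<^esub> h x) \<and> h \<one>\<^bsub>A\<^esub> = \<one>\<^bsub>B\<^esub>"

lemma alg_homD:
  assumes "alg_hom A B h"
  shows "\<And>x. x \<in> carrier A \<Longrightarrow> h x \<in> carrier B"
    "\<And>x y. x \<in> carrier A \<Longrightarrow> y \<in> carrier A \<Longrightarrow> h (x \<otimes>\<^bsub>A\<^esub> y) = h x \<otimes>\<^bsub>B\<^esub> h y"
    "\<And>x y. x \<in> carrier A \<Longrightarrow> y \<in> carrier A \<Longrightarrow> h (x \<oplus>\<^bsub>A\<^esub> y) = h x \<oplus>\<^bsub>B\<^esub> h y"
    "\<And>c x. x \<in> carrier A \<Longrightarrow> h (c \<odot>\<^bsub>A\<^esub> x) = c \<odot>\<^bsub>B\<^esub> h x"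
    "h \<one>\<^bsub>A\<^esub> = \<one>\<^bsub>B\<^esub>"
  using assms unfolding alg_hom_def by auto

lemma alg_hom_comp: "alg_hom A B g \<Longrightarrow> alg_hom B C h \<Longrightarrow> alg_hom A C (h \<circ> g)"
  unfolding alg_hom_def by simp

lemma assoc_algebraD:
  assumes "assoc_algebra A"
  shows "ring A" "vectorspace class_ring A"
    "\<And>c x y. x \<in> carrier A \<Longrightarrow> y \<in> carrier A \<Longrightarrow> (c \<odot>\<^bsub>A\<^esub> x) \<otimes>\<^bsub>A\<^esub> y = c \<odot>\<^bsub>A\<^esub> (x \<otimes>\<^bsub>A\<^esub> y)"
    "\<And>c x y. x \<in> carrier A \<Longrightarrow> y \<in> carrier A \<Longrightarrow> x \<otimes>\<^bsub>A\<^esub> (c \<odot>\<^bsub>A\<^esub> y) = c \<odot>\<^bsub>A\<^esub> (x \<otimes>\<^bsub>A\<^esub> y)"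
  using assms unfolding assoc_algebra_def by auto

lemma alg_hom_zero_minus:
  assumes "assoc_algebra A" "assoc_algebra B" "alg_hom A B h"
  shows "h \<zero>\<^bsub>A\<^esub> = \<zero>\<^bsub>B\<^esub>"
    and "\<And>x. x \<in> carrier A \<Longrightarrow> h (\<ominus>\<^bsub>A\<^esub> x) = \<ominus>\<^bsub>B\<^esub> h x"
    and "\<And>x y. x \<in> carrier A \<Longrightarrow> y \<in> carrier A \<Longrightarrow> h (x \<ominus>\<^bsub>A\<^esub> y) = h x \<ominus>\<^bsub>B\<^esub> h y"
proof -
  note A = assoc_algebraD[OF assms(1)] and B = assoc_algebraD[OF assms(2)] and h = alg_homD[OF assms(3)]
  note VA = vectorspaceD[OF A(2)] and VB = vectorspaceD[OF B(2)]
  interpret A: ring A by fact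
  interpret B: ring B by fact
  show "h \<zero>\<^bsub>A\<^esub> = \<zero>\<^bsub>B\<^esub>"
    using additive_zero[OF VA(1) VB(1), of h] h by blast
  show neg: "h (\<ominus>\<^bsub>A\<^esub> x) = \<ominus>\<^bsub>B\<^esub> h x" if "x \<in> carrier A" for x
    using VA(9)[OF that] VB(9)[OF h(1)[OF that]] h(4)[OF that, of "-1"] by simp
  show "h (x \<ominus>\<^bsub>A\<^esub> y) = h x \<ominus>\<^bsub>B\<^esub> h y" if "x \<in> carrier A" "y \<in> carrier A" for x y
    using that by (simp add: a_minus_def h neg)
qed

lemma alg_hom_kernel_ideal:
  assumes "assoc_algebra A" "assoc_algebra B" "alg_hom A B h"
  shows "ideal {x \<in> carrier A. h x = \<zero>\<^bsub>B\<^esub>} A"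
proof -
  note A = assoc_algebraD[OF assms(1)] and B = assoc_algebraD[OF assms(2)] and h = alg_homD[OF assms(3)]
  interpret A: ring A by fact
  interpret B: ring B by fact
  have "h \<in> Ring.ring_hom A B" by (rule ring_hom_memI) (use h in auto)
  then interpret ring_hom_ring A B h by (intro ring_hom_ringI2) (use A B in auto)
  show ?thesis using kernel_is_ideal unfolding a_kernel_def' .
qed

text \<open>\<open>quot_algebra\<close> is a record with an additional scalar multiplication, so it
  agrees with \<open>A Quot I\<close> only field by field; this carries the ring laws
  across.\<close>

lemma ring_cong_fields:
  assumes "ring R" "carrier S = carrier R" "mult S = mult R" "one S = one R" "zero S = zero R" "add S = add R"
  shows "ring S"
proof -
  interpret ring R by fact
  show ?thesis
  proof (rule ringI)
    show "abelian_group S"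
    proof (rule abelian_groupI, unfold assms(2-))
      fix x assume "x \<in> carrier R"
      then show "\<exists>y\<in>carrier R. y \<oplus>\<^bsub>R\<^esub> x = \<zero>\<^bsub>R\<^esub>" by (intro bexI[of _ "\<ominus>\<^bsub>R\<^esub> x"]) (auto simp: l_neg)
    qed (auto simp: a_ac)
    show "Group.monoid S"
      by (rule monoidI, unfold assms(2-)) (auto simp: m_assoc)
  qed (unfold assms(2-), auto simp: l_distr r_distr)
qed

lemma quot_algebra_simps:
  "carrier (quot_algebra A I) = carrier (A Quot I)"
  "mult (quot_algebra A I) = mult (A Quot I)"
  "one (quot_algebra A I) = one (A Quot I)"
  "zero (quot_algebra A I) = zero (A Quot I)"
  "add (quot_algebra A I) = add (A Quot I)"
  "smult (quot_algebra A I) = (\<lambda>c X. \<Union>x\<in>X. I +>\<^bsub>A\<^esub> (c \<odot>\<^bsub>A\<^esub> x))"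
  by (simp_all add: quot_algebra_def ring.extend_def module.fields_def FactRing_def)

lemma quot_algebra:
  assumes A: "assoc_algebra A" and I: "ideal I A"
  shows "assoc_algebra (quot_algebra A I)"
    and "alg_hom A (quot_algebra A I) (\<lambda>x. I +>\<^bsub>A\<^esub> x)"
    and "carrier (quot_algebra A I) = (\<lambda>x. I +>\<^bsub>A\<^esub> x) ` carrier A"
    and "\<And>x y. x \<in> carrier A \<Longrightarrow> y \<in> carrier A \<Longrightarrow> I +>\<^bsub>A\<^esub> x = I +>\<^bsub>A\<^esub> y \<longleftrightarrow> x \<ominus>\<^bsub>A\<^esub> y \<in> I"
proof -
  let ?Q = "quot_algebra A I" and ?q = "\<lambda>x. I +>\<^bsub>A\<^esub> x"
  note AD = assoc_algebraD[OF A]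
  note VA = vectorspaceD[OF AD(2)]
  interpret A: ring A by fact
  interpret I: ideal I A by fact
  have Q: "ring (A Quot I)" by (rule I.quotient_is_ring)
  have rQ: "ring ?Q" by (rule ring_cong_fields[OF Q]) (simp_all add: quot_algebra_simps)
  interpret Q: ring ?Q by fact
  show car: "carrier ?Q = ?q ` carrier A"
    unfolding quot_algebra_simps FactRing_def A_RCOSETS_def' by auto
  show eq: "?q x = ?q y \<longleftrightarrow> x \<ominus>\<^bsub>A\<^esub> y \<in> I" if "x \<in> carrier A" "y \<in> carrier A" for x y
    using A.quotient_eq_iff_same_a_r_cos[OF I that] by simp
  have hom: "?q \<in> Ring.ring_hom A (A Quot I)" by (rule I.rcos_ring_hom)
  have qcl: "?q x \<in> carrier ?Q" if "x \<in> carrier A" for x using car that by auto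
  have qm: "?q (x \<otimes>\<^bsub>A\<^esub> y) = ?q x \<otimes>\<^bsub>?Q\<^esub> ?q y" "?q (x \<oplus>\<^bsub>A\<^esub> y) = ?q x \<oplus>\<^bsub>?Q\<^esub> ?q y"
    if "x \<in> carrier A" "y \<in> carrier A" for x y
    using that hom unfolding quot_algebra_simps Ring.ring_hom_def by auto
  have q1: "?q \<one>\<^bsub>A\<^esub> = \<one>\<^bsub>?Q\<^esub>" using hom unfolding quot_algebra_simps Ring.ring_hom_def by auto
  \<comment> \<open>An ideal of a unital algebra is closed under scalars because c x = (c 1)
    x.\<close>
  have Is: "c \<odot>\<^bsub>A\<^esub> x \<in> I" if "x \<in> I" for c x
  proof -
    have xc: "x \<in> carrier A" using that I.a_subset by auto
    have "c \<odot>\<^bsub>A\<^esub> x = (c \<odot>\<^bsub>A\<^esub> \<one>\<^bsub>A\<^esub>) \<otimes>\<^bsub>A\<^esub> x" using AD(3)[of "\<one>\<^bsub>A\<^esub>" x c] xc by simp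
    then show ?thesis using I.I_l_closed[OF that, of "c \<odot>\<^bsub>A\<^esub> \<one>\<^bsub>A\<^esub>"] VA(2) by simp
  qed
  have qs: "?q (c \<odot>\<^bsub>A\<^esub> x) = c \<odot>\<^bsub>?Q\<^esub> ?q x" if x: "x \<in> carrier A" for c x
  proof -
    \<comment> \<open>Scaling any member of a coset gives the same coset, so the union in the scalar
      multiplication of \<open>quot_algebra\<close> is over a constant family.\<close>
    have "?q (c \<odot>\<^bsub>A\<^esub> y) = ?q (c \<odot>\<^bsub>A\<^esub> x)" if y: "y \<in> ?q x" for y
    proof -
      obtain i where i: "i \<in> I" "y = i \<oplus>\<^bsub>A\<^esub> x" using y by (auto simp: a_r_coset_def')
      have ic: "i \<in> carrier A" using i I.a_subset by auto
      then have yc: "y \<in> carrier A" using i x by simp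
      have "y \<ominus>\<^bsub>A\<^esub> x = i" using i ic x by (simp add: a_minus_def A.a_assoc A.r_neg)
      then have "y \<ominus>\<^bsub>A\<^esub> x \<in> I" using i by simp
      then have "c \<odot>\<^bsub>A\<^esub> (y \<ominus>\<^bsub>A\<^esub> x) \<in> I" by (rule Is)
      moreover have "c \<odot>\<^bsub>A\<^esub> (y \<ominus>\<^bsub>A\<^esub> x) = c \<odot>\<^bsub>A\<^esub> y \<ominus>\<^bsub>A\<^esub> c \<odot>\<^bsub>A\<^esub> x"
        using x yc VA(4)[of y "\<ominus>\<^bsub>A\<^esub> x" c] VA(9)[OF x] VA(5)[OF x, of c "-1"] VA(5)[OF x, of "-1" c] VA(9)[OF VA(2)[OF x], of c]
        by (simp add: a_minus_def)
      ultimately show ?thesis using eq VA(2) x yc by auto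
    qed
    moreover have "\<zero>\<^bsub>A\<^esub> \<oplus>\<^bsub>A\<^esub> x \<in> ?q x"
      unfolding a_r_coset_def' using I.zero_closed by blast
    then have "x \<in> ?q x" using x by simp
    ultimately have "(\<Union>y\<in>?q x. ?q (c \<odot>\<^bsub>A\<^esub> y)) = ?q (c \<odot>\<^bsub>A\<^esub> x)" by blast
    then show ?thesis unfolding quot_algebra_simps by simp
  qed
  show ho: "alg_hom A ?Q ?q"
    unfolding alg_hom_def by (intro conjI ballI allI; rule qcl qm q1 qs)
  have ag: "abelian_group ?Q" by (rule Q.is_abelian_group)
  have vsQ: "vectorspace class_ring ?Q"
  proof (rule vectorspaceI[OF ag])
    fix c d v w assume v: "v \<in> carrier ?Q"
    from v obtain x where x: "x \<in> carrier A" "v = ?q x" using car by auto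
    show "c \<odot>\<^bsub>?Q\<^esub> v \<in> carrier ?Q" using qs[OF x(1)] qcl VA(2) x by metis
    show "1 \<odot>\<^bsub>?Q\<^esub> v = v" using qs[OF x(1), of 1] x VA(6) by metis
    show "(c + d) \<odot>\<^bsub>?Q\<^esub> v = c \<odot>\<^bsub>?Q\<^esub> v \<oplus>\<^bsub>?Q\<^esub> d \<odot>\<^bsub>?Q\<^esub> v"
      using qs[OF x(1)] qm(2) VA(2,3) x by metis
    show "(c * d) \<odot>\<^bsub>?Q\<^esub> v = c \<odot>\<^bsub>?Q\<^esub> (d \<odot>\<^bsub>?Q\<^esub> v)"
      using qs VA(2,5) x by metis
    assume w: "w \<in> carrier ?Q"
    from w obtain y where y: "y \<in> carrier A" "w = ?q y" using car by auto
    show "c \<odot>\<^bsub>?Q\<^esub> (v \<oplus>\<^bsub>?Q\<^esub> w) = c \<odot>\<^bsub>?Q\<^esub> v \<oplus>\<^bsub>?Q\<^esub> c \<odot>\<^bsub>?Q\<^esub> w"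
      using qs qm(2) VA(2,4) x y A.add.m_closed by metis
  qed
  show "assoc_algebra ?Q" unfolding assoc_algebra_def
  proof (intro conjI rQ vsQ allI ballI)
    fix c v w assume "v \<in> carrier ?Q" "w \<in> carrier ?Q"
    then obtain x y where x: "x \<in> carrier A" "v = ?q x" and y: "y \<in> carrier A" "w = ?q y" using car by auto
    show "(c \<odot>\<^bsub>?Q\<^esub> v) \<otimes>\<^bsub>?Q\<^esub> w = c \<odot>\<^bsub>?Q\<^esub> (v \<otimes>\<^bsub>?Q\<^esub> w)"
      using AD(3)[OF x(1) y(1)] x y qs qm(1) VA(2) A.m_closed by metis
    show "v \<otimes>\<^bsub>?Q\<^esub> (c \<odot>\<^bsub>?Q\<^esub> w) = c \<odot>\<^bsub>?Q\<^esub> (v \<otimes>\<^bsub>?Q\<^esub> w)"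
      using AD(4)[OF x(1) y(1)] x y qs qm(1) VA(2) A.m_closed by metis
  qed
qed

text \<open>The induced map is evaluated at chosen representatives; the kernel condition makes its
  values independent of the choice, and every identity is then read off in \<open>A\<close>.\<close>

lemma alg_hom_factor:
  assumes q: "alg_hom A Q q" and surj: "carrier Q = q ` carrier A" and h: "alg_hom A B h"
    and A: "assoc_algebra A"
    and ker: "\<And>x y. x \<in> carrier A \<Longrightarrow> y \<in> carrier A \<Longrightarrow> q x = q y \<Longrightarrow> h x = h y"
  obtains h' where "alg_hom Q B h'" "\<And>x. x \<in> carrier A \<Longrightarrow> h' (q x) = h x"
proof -
  interpret A: ring A using assoc_algebraD[OF A] by blast
  note VA = vectorspaceD[OF assoc_algebraD(2)[OF A]]
  define s where "s X = (SOME x. x \<in> carrier A \<and> q x = X)" for X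
  have s: "s (q x) \<in> carrier A \<and> q (s (q x)) = q x" if "x \<in> carrier A" for x
    unfolding s_def by (rule someI[of _ x]) (use that in auto)
  define h' where "h' X = h (s X)" for X
  have h': "h' (q x) = h x" if "x \<in> carrier A" for x
    unfolding h'_def using ker s that by blast
  note qD = alg_homD[OF q] and hD = alg_homD[OF h]
  have "alg_hom Q B h'" unfolding alg_hom_def
  proof (intro conjI ballI allI)
    fix X c assume "X \<in> carrier Q"
    then obtain x where x: "x \<in> carrier A" "X = q x" using surj by auto
    show "h' X \<in> carrier B" using h' x hD by metis
    show "h' (c \<odot>\<^bsub>Q\<^esub> X) = c \<odot>\<^bsub>B\<^esub> h' X" using h' x hD(4) qD(4) VA(2) by metis
    fix Y assume "Y \<in> carrier Q"
    then obtain y where y: "y \<in> carrier A" "Y = q y" using surj by auto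
    show "h' (X \<otimes>\<^bsub>Q\<^esub> Y) = h' X \<otimes>\<^bsub>B\<^esub> h' Y" using h' x y hD(2) qD(2) A.m_closed by metis
    show "h' (X \<oplus>\<^bsub>Q\<^esub> Y) = h' X \<oplus>\<^bsub>B\<^esub> h' Y" using h' x y hD(3) qD(3) A.a_closed by metis
  next
    show "h' \<one>\<^bsub>Q\<^esub> = \<one>\<^bsub>B\<^esub>" using h'[of "\<one>\<^bsub>A\<^esub>"] qD(5) hD(5) by simp
  qed
  then show thesis using that h' by blast
qed

section \<open>Representations\<close>

lemma algebra_repD:
  assumes "algebra_rep A (V, \<rho>)"
  shows "vectorspace class_ring V"
    "\<And>a v. a \<in> carrier A \<Longrightarrow> v \<in> carrier V \<Longrightarrow> \<rho> a v \<in> carrier V"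
    "\<And>a v w. a \<in> carrier A \<Longrightarrow> v \<in> carrier V \<Longrightarrow> w \<in> carrier V \<Longrightarrow> \<rho> a (v \<oplus>\<^bsub>V\<^esub> w) = \<rho> a v \<oplus>\<^bsub>V\<^esub> \<rho> a w"
    "\<And>a c v. a \<in> carrier A \<Longrightarrow> v \<in> carrier V \<Longrightarrow> \<rho> a (c \<odot>\<^bsub>V\<^esub> v) = c \<odot>\<^bsub>V\<^esub> \<rho> a v"
    "\<And>v. v \<in> carrier V \<Longrightarrow> \<rho> \<one>\<^bsub>A\<^esub> v = v"
    "\<And>a b v. a \<in> carrier A \<Longrightarrow> b \<in> carrier A \<Longrightarrow> v \<in> carrier V \<Longrightarrow> \<rho> (a \<otimes>\<^bsub>A\<^esub> b) v = \<rho> a (\<rho> b v)"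
    "\<And>a b v. a \<in> carrier A \<Longrightarrow> b \<in> carrier A \<Longrightarrow> v \<in> carrier V \<Longrightarrow> \<rho> (a \<oplus>\<^bsub>A\<^esub> b) v = \<rho> a v \<oplus>\<^bsub>V\<^esub> \<rho> b v"
    "\<And>a c v. a \<in> carrier A \<Longrightarrow> v \<in> carrier V \<Longrightarrow> \<rho> (c \<odot>\<^bsub>A\<^esub> a) v = c \<odot>\<^bsub>V\<^esub> \<rho> a v"
  using assms module_homD[of "\<rho> _" V V] unfolding algebra_rep_def by auto

lemma algebra_repI:
  assumes "vectorspace class_ring V"
    "\<And>a v. a \<in> carrier A \<Longrightarrow> v \<in> carrier V \<Longrightarrow> \<rho> a v \<in> carrier V"
    "\<And>a v w. a \<in> carrier A \<Longrightarrow> v \<in> carrier V \<Longrightarrow> w \<in> carrier V \<Longrightarrow> \<rho> a (v \<oplus>\<^bsub>V\<^esub> w) = \<rho> a v \<oplus>\<^bsub>V\<^esub> \<rho> a w"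
    "\<And>a c v. a \<in> carrier A \<Longrightarrow> v \<in> carrier V \<Longrightarrow> \<rho> a (c \<odot>\<^bsub>V\<^esub> v) = c \<odot>\<^bsub>V\<^esub> \<rho> a v"
    "\<And>v. v \<in> carrier V \<Longrightarrow> \<rho> \<one>\<^bsub>A\<^esub> v = v"
    "\<And>a b v. a \<in> carrier A \<Longrightarrow> b \<in> carrier A \<Longrightarrow> v \<in> carrier V \<Longrightarrow> \<rho> (a \<otimes>\<^bsub>A\<^esub> b) v = \<rho> a (\<rho> b v)"
    "\<And>a b v. a \<in> carrier A \<Longrightarrow> b \<in> carrier A \<Longrightarrow> v \<in> carrier V \<Longrightarrow> \<rho> (a \<oplus>\<^bsub>A\<^esub> b) v = \<rho> a v \<oplus>\<^bsub>V\<^esub> \<rho> b v"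
    "\<And>a c v. a \<in> carrier A \<Longrightarrow> v \<in> carrier V \<Longrightarrow> \<rho> (c \<odot>\<^bsub>A\<^esub> a) v = c \<odot>\<^bsub>V\<^esub> \<rho> a v"
  shows "algebra_rep A (V, \<rho>)"
  unfolding algebra_rep_def using assms by (auto intro!: module_homI)

lemma algebra_rep_pullback:
  assumes "algebra_rep B (V, \<rho>)" "alg_hom A B h"
  shows "algebra_rep A (V, \<lambda>a. \<rho> (h a))"
  by (rule algebra_repI; use algebra_repD[OF assms(1)] alg_homD[OF assms(2)] in simp)

text \<open>The descent of \<open>alg_hom_factor\<close>, for actions. Agreement is required on
  \<open>carrier V\<close> only, since an action is arbitrary elsewhere.\<close>

lemma algebra_rep_factor:
  assumes q: "alg_hom A Q q" and surj: "carrier Q = q ` carrier A" and h: "algebra_rep A (V, \<rho>)"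
    and A: "assoc_algebra A"
    and ker: "\<And>x y v. x \<in> carrier A \<Longrightarrow> y \<in> carrier A \<Longrightarrow> q x = q y \<Longrightarrow> v \<in> carrier V \<Longrightarrow> \<rho> x v = \<rho> y v"
  obtains \<rho>' where "algebra_rep Q (V, \<rho>')" "\<And>x v. x \<in> carrier A \<Longrightarrow> v \<in> carrier V \<Longrightarrow> \<rho>' (q x) v = \<rho> x v"
proof -
  interpret A: ring A using assoc_algebraD[OF A] by blast
  note VA = vectorspaceD[OF assoc_algebraD(2)[OF A]]
  define s where "s X = (SOME x. x \<in> carrier A \<and> q x = X)" for X
  have s: "s (q x) \<in> carrier A \<and> q (s (q x)) = q x" if "x \<in> carrier A" for x
    unfolding s_def by (rule someI[of _ x]) (use that in auto)
  define h' where "h' X = \<rho> (s X)" for X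
  have h': "h' (q x) v = \<rho> x v" if "x \<in> carrier A" "v \<in> carrier V" for x v
    unfolding h'_def using ker s that by blast
  note qD = alg_homD[OF q] and hD = algebra_repD[OF h]
  have ex: "\<exists>x\<in>carrier A. X = q x" if "X \<in> carrier Q" for X using surj that by auto
  have "algebra_rep Q (V, h')"
  proof (rule algebra_repI)
    show "vectorspace class_ring V" by (rule hD(1))
    show "h' X v \<in> carrier V" if "X \<in> carrier Q" "v \<in> carrier V" for X v
      using ex[OF that(1)] h' hD(2) that by metis
    show "h' X (v \<oplus>\<^bsub>V\<^esub> w) = h' X v \<oplus>\<^bsub>V\<^esub> h' X w" if "X \<in> carrier Q" "v \<in> carrier V" "w \<in> carrier V" for X v w
      using ex[OF that(1)] h' hD(3) that abelian_monoid.a_closed[OF abelian_group.axioms(1)[OF vectorspaceD(1)[OF hD(1)]]] by metis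
    show "h' X (c \<odot>\<^bsub>V\<^esub> v) = c \<odot>\<^bsub>V\<^esub> h' X v" if "X \<in> carrier Q" "v \<in> carrier V" for X v c
      using ex[OF that(1)] h' hD(4) that vectorspaceD(2)[OF hD(1)] by metis
    show "h' \<one>\<^bsub>Q\<^esub> v = v" if "v \<in> carrier V" for v
      using h'[of "\<one>\<^bsub>A\<^esub>" v] qD(5) hD(5) that by simp
    show "h' (X \<otimes>\<^bsub>Q\<^esub> Y) v = h' X (h' Y v)" if "X \<in> carrier Q" "Y \<in> carrier Q" "v \<in> carrier V" for X Y v
      using ex[OF that(1)] ex[OF that(2)] h' hD(2,6) that qD(2) A.m_closed by metis
    show "h' (X \<oplus>\<^bsub>Q\<^esub> Y) v = h' X v \<oplus>\<^bsub>V\<^esub> h' Y v" if "X \<in> carrier Q" "Y \<in> carrier Q" "v \<in> carrier V" for X Y v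
      using ex[OF that(1)] ex[OF that(2)] h' hD(7) that qD(3) A.a_closed by metis
    show "h' (c \<odot>\<^bsub>Q\<^esub> X) v = c \<odot>\<^bsub>V\<^esub> h' X v" if "X \<in> carrier Q" "v \<in> carrier V" for X v c
      using ex[OF that(1)] h' hD(8) that qD(4) VA(2) by metis
  qed
  then show thesis using that h' by blast
qed

section \<open>Free algebras\<close>

text \<open>Cuts of a word are kept as pairs of words rather than as positions, so that
  associativity of the convolution becomes a bijection between sets of triples.\<close>

definition splits :: "'g list \<Rightarrow> ('g list \<times> 'g list) set" where
  "splits u = {(v, w). v @ w = u}"

lemma splits_eq: "splits u = (\<lambda>i. (take i u, drop i u)) ` {..length u}"
proof -
  have "(v, w) \<in> (\<lambda>i. (take i (v @ w), drop i (v @ w))) ` {..length (v @ w)}" for v w :: "'g list"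
    by (rule image_eqI[of _ _ "length v"]) auto
  then show ?thesis unfolding splits_def by auto
qed

lemma finite_splits [simp]: "finite (splits u)"
  unfolding splits_eq by simp

lemma free_mult:
  "(f \<otimes>\<^bsub>free_algebra X\<^esub> g) u = (\<Sum>(v, w)\<in>splits u. f v * g w)"
proof -
  have "inj_on (\<lambda>i. (take i u, drop i u)) {..length u}"
    by (rule inj_onI) (metis atMost_iff length_take min_absorb2 prod.inject)
  then show ?thesis
    unfolding splits_eq by (simp add: free_algebra_def sum.reindex)
qed

lemma free_simps:
  "carrier (free_algebra X) = {f. finite {u. f u \<noteq> 0} \<and> {u. f u \<noteq> 0} \<subseteq> lists X}"
  "one (free_algebra X) = (\<lambda>u. if u = [] then 1 else 0)"
  "zero (free_algebra X) = (\<lambda>u. 0)"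
  "add (free_algebra X) = (\<lambda>f g u. f u + g u)"
  "smult (free_algebra X) = (\<lambda>c f u. c * f u)"
  by (simp_all add: free_algebra_def)

lemma free_carrierD:
  assumes "f \<in> carrier (free_algebra X)"
  shows "finite {u. f u \<noteq> 0}" "\<And>u. f u \<noteq> 0 \<Longrightarrow> u \<in> lists X" "{u. f u \<noteq> 0} \<subseteq> lists X"
  using assms unfolding free_simps by blast+

lemma free_mult_assoc:
  fixes f g h :: "'g list \<Rightarrow> 'k::field"
  shows "(f \<otimes>\<^bsub>free_algebra X\<^esub> g) \<otimes>\<^bsub>free_algebra X\<^esub> h = f \<otimes>\<^bsub>free_algebra X\<^esub> (g \<otimes>\<^bsub>free_algebra X\<^esub> h)"
proof
  fix u :: "'g list"
  \<comment> \<open>Both ways of bracketing are sums over the cuts of \<open>u\<close> into three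
    pieces.\<close>
  define T where "T = {(a, b, c). a @ b @ c = u}"
  have L: "((f \<otimes>\<^bsub>free_algebra X\<^esub> g) \<otimes>\<^bsub>free_algebra X\<^esub> h) u = (\<Sum>(a, b, c)\<in>T. f a * g b * h c)"
  proof -
    have "((f \<otimes>\<^bsub>free_algebra X\<^esub> g) \<otimes>\<^bsub>free_algebra X\<^esub> h) u
        = (\<Sum>p\<in>splits u. \<Sum>q\<in>splits (fst p). f (fst q) * g (snd q) * h (snd p))"
      by (simp add: free_mult case_prod_beta sum_distrib_right)
    also have "\<dots> = (\<Sum>(p, q)\<in>(SIGMA p:splits u. splits (fst p)). f (fst q) * g (snd q) * h (snd p))"
      by (rule sum.Sigma) auto
    also have "\<dots> = (\<Sum>(a, b, c)\<in>T. f a * g b * h c)"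
      by (rule sum.reindex_bij_witness[of _ "\<lambda>(a, b, c). ((a @ b, c), (a, b))" "\<lambda>(p, q). (fst q, snd q, snd p)"])
        (auto simp: T_def splits_def)
    finally show ?thesis .
  qed
  have R: "(f \<otimes>\<^bsub>free_algebra X\<^esub> (g \<otimes>\<^bsub>free_algebra X\<^esub> h)) u = (\<Sum>(a, b, c)\<in>T. f a * g b * h c)"
  proof -
    have "(f \<otimes>\<^bsub>free_algebra X\<^esub> (g \<otimes>\<^bsub>free_algebra X\<^esub> h)) u
        = (\<Sum>p\<in>splits u. \<Sum>q\<in>splits (snd p). f (fst p) * g (fst q) * h (snd q))"
      by (simp add: free_mult case_prod_beta sum_distrib_left mult.assoc)
    also have "\<dots> = (\<Sum>(p, q)\<in>(SIGMA p:splits u. splits (snd p)). f (fst p) * g (fst q) * h (snd q))"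
      by (rule sum.Sigma) auto
    also have "\<dots> = (\<Sum>(a, b, c)\<in>T. f a * g b * h c)"
      by (rule sum.reindex_bij_witness[of _ "\<lambda>(a, b, c). ((a, b @ c), (b, c))" "\<lambda>(p, q). (fst p, fst q, snd q)"])
        (auto simp: T_def splits_def)
    finally show ?thesis .
  qed
  show "((f \<otimes>\<^bsub>free_algebra X\<^esub> g) \<otimes>\<^bsub>free_algebra X\<^esub> h) u = (f \<otimes>\<^bsub>free_algebra X\<^esub> (g \<otimes>\<^bsub>free_algebra X\<^esub> h)) u"
    using L R by simp
qed

definition free_word :: "'g list \<Rightarrow> 'g list \<Rightarrow> 'k::field" where
  "free_word v = (\<lambda>u. if u = v then 1 else 0)"

lemma free_word_closed: "v \<in> lists X \<Longrightarrow> free_word v \<in> carrier (free_algebra X)"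
  by (auto simp: free_simps free_word_def)

lemma free_word_mult:
  "free_word v \<otimes>\<^bsub>free_algebra X\<^esub> free_word w = (free_word (v @ w) :: 'g list \<Rightarrow> 'k::field)"
proof
  fix u
  have "(free_word v \<otimes>\<^bsub>free_algebra X\<^esub> free_word w) u
      = (\<Sum>p\<in>splits u. if p = (v, w) then 1 else (0::'k))"
    unfolding free_mult by (rule sum.cong) (auto simp: free_word_def split: if_splits)
  also have "\<dots> = free_word (v @ w) u"
    unfolding sum.delta[OF finite_splits] by (auto simp: free_word_def splits_def)
  finally show "(free_word v \<otimes>\<^bsub>free_algebra X\<^esub> free_word w) u = (free_word (v @ w) u :: 'k)" .
qed

lemma free_word_Nil: "\<one>\<^bsub>free_algebra X\<^esub> = free_word []"
  by (simp add: free_simps free_word_def)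

lemma free_gen_word: "free_gen x = free_word [x]"
  by (simp add: free_gen_def free_word_def)

lemma assoc_algebra_free: "assoc_algebra (free_algebra X :: ('k::field, 'g list \<Rightarrow> 'k) module)"
proof -
  let ?F = "free_algebra X :: ('k, 'g list \<Rightarrow> 'k) module"
  have fin: "finite {u. f u + g u \<noteq> 0}" "{u. f u + g u \<noteq> 0} \<subseteq> lists X"
    if "finite {u. f u \<noteq> 0}" "{u. f u \<noteq> 0} \<subseteq> lists X" "finite {u. g u \<noteq> 0}" "{u. g u \<noteq> 0} \<subseteq> lists X"
    for f g :: "'g list \<Rightarrow> 'k"
  proof -
    have "{u. f u + g u \<noteq> 0} \<subseteq> {u. f u \<noteq> 0} \<union> {u. g u \<noteq> 0}" by auto
    then show "finite {u. f u + g u \<noteq> 0}" "{u. f u + g u \<noteq> 0} \<subseteq> lists X"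
      using that finite_subset[of "{u. f u + g u \<noteq> 0}" "{u. f u \<noteq> 0} \<union> {u. g u \<noteq> 0}"] by blast+
  qed
  have fs: "finite {u. c * f u \<noteq> 0}" "{u. c * f u \<noteq> 0} \<subseteq> lists X"
    if "finite {u. f u \<noteq> 0}" "{u. f u \<noteq> 0} \<subseteq> lists X" for f :: "'g list \<Rightarrow> 'k" and c
  proof -
    have "{u. c * f u \<noteq> 0} \<subseteq> {u. f u \<noteq> 0}" by auto
    then show "finite {u. c * f u \<noteq> 0}" "{u. c * f u \<noteq> 0} \<subseteq> lists X"
      using that finite_subset by blast+
  qed
  have ag: "abelian_group ?F"
  proof (rule abelian_groupI)
    fix f assume f: "f \<in> carrier ?F"
    show "\<exists>g\<in>carrier ?F. g \<oplus>\<^bsub>?F\<^esub> f = \<zero>\<^bsub>?F\<^esub>"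
      by (rule bexI[of _ "\<lambda>u. - f u"]) (use f in \<open>auto simp: free_simps\<close>)
  qed (auto simp: free_simps fin add_ac)
  have vs: "vectorspace class_ring ?F"
    by (rule vectorspaceI[OF ag]) (auto simp: free_simps fs algebra_simps)
  have mcl: "f \<otimes>\<^bsub>?F\<^esub> g \<in> carrier ?F" if "f \<in> carrier ?F" "g \<in> carrier ?F" for f g
  proof -
    \<comment> \<open>The support of a product lies among the concatenations of words of the two
      supports, hence is finite.\<close>
    have "{u. (f \<otimes>\<^bsub>?F\<^esub> g) u \<noteq> 0} \<subseteq> (\<lambda>(v, w). v @ w) ` ({u. f u \<noteq> 0} \<times> {u. g u \<noteq> 0})"
    proof
      fix u assume "u \<in> {u. (f \<otimes>\<^bsub>?F\<^esub> g) u \<noteq> 0}"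
      then have "(\<Sum>(v, w)\<in>splits u. f v * g w) \<noteq> 0" by (simp add: free_mult)
      then obtain p where "p \<in> splits u" "(case p of (v, w) \<Rightarrow> f v * g w) \<noteq> 0"
        using sum.neutral[of "splits u" "\<lambda>(v, w). f v * g w"] by blast
      then show "u \<in> (\<lambda>(v, w). v @ w) ` ({u. f u \<noteq> 0} \<times> {u. g u \<noteq> 0})"
        by (auto simp: splits_def)
    qed
    moreover have "finite ((\<lambda>(v, w). v @ w) ` ({u. f u \<noteq> 0} \<times> {u. g u \<noteq> 0}))"
      using that by (auto simp: free_simps)
    moreover have "v \<in> lists X" if "f v \<noteq> 0" for v
      using that \<open>f \<in> carrier ?F\<close> unfolding free_simps by blast
    moreover have "v \<in> lists X" if "g v \<noteq> 0" for v
      using that \<open>g \<in> carrier ?F\<close> unfolding free_simps by blast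
    moreover from calculation(3,4) have
      "(\<lambda>(v, w). v @ w) ` ({u. f u \<noteq> 0} \<times> {u. g u \<noteq> 0}) \<subseteq> lists X"
      by (force simp del: in_lists_conv_set)
    ultimately show ?thesis
      using finite_subset unfolding free_simps by blast
  qed
  have one: "(\<one>\<^bsub>?F\<^esub> \<otimes>\<^bsub>?F\<^esub> f) = f" "(f \<otimes>\<^bsub>?F\<^esub> \<one>\<^bsub>?F\<^esub>) = f" for f
  proof -
    show "\<one>\<^bsub>?F\<^esub> \<otimes>\<^bsub>?F\<^esub> f = f"
    proof
      fix u
      have "(\<one>\<^bsub>?F\<^esub> \<otimes>\<^bsub>?F\<^esub> f) u = (\<Sum>p\<in>splits u. if p = ([], u) then f u else 0)"
        unfolding free_mult by (rule sum.cong) (auto simp: free_simps splits_def split: if_splits)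
      also have "\<dots> = f u" unfolding sum.delta[OF finite_splits] by (simp add: splits_def)
      finally show "(\<one>\<^bsub>?F\<^esub> \<otimes>\<^bsub>?F\<^esub> f) u = f u" .
    qed
    show "f \<otimes>\<^bsub>?F\<^esub> \<one>\<^bsub>?F\<^esub> = f"
    proof
      fix u
      have "(f \<otimes>\<^bsub>?F\<^esub> \<one>\<^bsub>?F\<^esub>) u = (\<Sum>p\<in>splits u. if p = (u, []) then f u else 0)"
        unfolding free_mult by (rule sum.cong) (auto simp: free_simps splits_def split: if_splits)
      also have "\<dots> = f u" unfolding sum.delta[OF finite_splits] by (simp add: splits_def)
      finally show "(f \<otimes>\<^bsub>?F\<^esub> \<one>\<^bsub>?F\<^esub>) u = f u" .
    qed
  qed
  have rg: "ring ?F"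
  proof (rule ringI[OF ag])
    have "\<one>\<^bsub>?F\<^esub> \<in> carrier ?F" by (auto simp: free_simps)
    then show "Group.monoid ?F" by (intro monoidI) (auto simp: mcl one free_mult_assoc)
  qed (auto simp: free_mult free_simps case_prod_beta algebra_simps sum.distrib)
  show ?thesis unfolding assoc_algebra_def
    using rg vs by (auto simp: free_mult free_simps case_prod_beta algebra_simps sum_distrib_left)
qed

text \<open>The words form a basis. The induction runs over a finite set containing the support and
  splits off one word at a time.\<close>

lemma free_algebra_induct [consumes 1, case_names word add smult]:
  assumes f: "f \<in> carrier (free_algebra X :: ('k::field, 'g list \<Rightarrow> 'k) module)"
    and w: "\<And>u. u \<in> lists X \<Longrightarrow> P (free_word u)"
    and a: "\<And>f g. f \<in> carrier (free_algebra X) \<Longrightarrow> g \<in> carrier (free_algebra X) \<Longrightarrow> P f \<Longrightarrow> P g \<Longrightarrow>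
      P (f \<oplus>\<^bsub>free_algebra X\<^esub> g)"
    and s: "\<And>c f. f \<in> carrier (free_algebra X) \<Longrightarrow> P f \<Longrightarrow> P (c \<odot>\<^bsub>free_algebra X\<^esub> f)"
  shows "P f"
proof -
  have "\<forall>f. f \<in> carrier (free_algebra X) \<longrightarrow> {u. f u \<noteq> 0} \<subseteq> S \<longrightarrow> P f" if "finite S"
    for S :: "'g list set"
    using that
  proof induction
    case empty
    \<comment> \<open>No case is given for the zero element, so it is reached as 0 times the empty
      word.\<close>
    have "P (0 \<odot>\<^bsub>free_algebra X\<^esub> free_word [])"
      using s[of "free_word []" 0] w[of "[]"] free_word_closed[of "[]" X] by simp
    then have "P (\<lambda>u. 0)" by (simp add: free_simps)
    show ?case
    proof (intro allI impI)
      fix f :: "'g list \<Rightarrow> 'k" assume "{u. f u \<noteq> 0} \<subseteq> {}"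
      then have "f = (\<lambda>u. 0)" by (intro ext) blast
      then show "P f" using \<open>P (\<lambda>u. 0)\<close> by simp
    qed
  next
    case (insert v S)
    show ?case
    proof (intro allI impI)
      fix f :: "'g list \<Rightarrow> 'k"
      assume f: "f \<in> carrier (free_algebra X)" "{u. f u \<noteq> 0} \<subseteq> insert v S"
      show "P f"
      proof (cases "f v = 0")
        case True
        then show ?thesis using f insert.IH by auto
      next
        case False
        then have v: "v \<in> lists X" using f(1) unfolding free_simps by blast
        define g where "g = f(v := 0)"
        have g1: "{u. g u \<noteq> 0} \<subseteq> {u. f u \<noteq> 0}" "{u. g u \<noteq> 0} \<subseteq> S" using f by (auto simp: g_def)
        have gc: "g \<in> carrier (free_algebra X)"
          using f(1) g1(1) finite_subset[OF g1(1)] unfolding free_simps by auto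
        have "P g" using insert.IH gc g1 by blast
        moreover have "P (f v \<odot>\<^bsub>free_algebra X\<^esub> free_word v)" by (rule s[OF free_word_closed[OF v] w[OF v]])
        moreover have "f v \<odot>\<^bsub>free_algebra X\<^esub> free_word v \<in> carrier (free_algebra X)"
          using vectorspaceD(2)[OF assoc_algebraD(2)[OF assoc_algebra_free] free_word_closed[OF v]] .
        ultimately have "P (g \<oplus>\<^bsub>free_algebra X\<^esub> f v \<odot>\<^bsub>free_algebra X\<^esub> free_word v)" by (intro a gc)
        moreover have "g \<oplus>\<^bsub>free_algebra X\<^esub> f v \<odot>\<^bsub>free_algebra X\<^esub> free_word v = f"
          by (rule ext) (simp add: free_simps g_def free_word_def)
        ultimately show ?thesis by (simp only:)
      qed
    qed
  qed
  from this[of "{u. f u \<noteq> 0}"] f show ?thesis unfolding free_simps by blast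
qed

text \<open>The universal property: a word has to go to the product of the values of its letters,
  and linearity determines the rest. Multiplicativity is bilinear and is therefore reduced to pairs
  of words.\<close>

lemma free_algebra_extend:
  fixes B :: "('k::field, 'b) module" and \<phi> :: "'g \<Rightarrow> 'b"
  assumes B: "assoc_algebra B" and \<phi>: "\<And>x. x \<in> X \<Longrightarrow> \<phi> x \<in> carrier B"
  obtains h where "alg_hom (free_algebra X) B h" "\<And>x. x \<in> X \<Longrightarrow> h (free_gen x) = \<phi> x"
proof -
  let ?F = "free_algebra X :: ('k, 'g list \<Rightarrow> 'k) module"
  interpret B: ring B by (rule assoc_algebraD[OF B])
  note VB = vectorspaceD[OF assoc_algebraD(2)[OF B]]
  have F: "assoc_algebra ?F" by (rule assoc_algebra_free)
  interpret F: ring ?F by (rule assoc_algebraD[OF F])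
  note VF = vectorspaceD[OF assoc_algebraD(2)[OF F]]
  define wp where "wp u = foldr (\<lambda>x y. \<phi> x \<otimes>\<^bsub>B\<^esub> y) u \<one>\<^bsub>B\<^esub>" for u
  have wpc: "wp u \<in> carrier B" if "u \<in> lists X" for u
    using that by (induction u) (auto simp: wp_def \<phi>)
  have wpa: "wp (u @ v) = wp u \<otimes>\<^bsub>B\<^esub> wp v" if "u \<in> lists X" "v \<in> lists X" for u v
    using that
  proof (induction u)
    case (Cons x u)
    then show ?case using wpc[of u] wpc[of v] \<phi>[of x] by (simp add: wp_def B.m_assoc)
  qed (use wpc in \<open>simp add: wp_def\<close>)
  define h where "h f = (\<Oplus>\<^bsub>B\<^esub>u\<in>{u. f u \<noteq> 0}. f u \<odot>\<^bsub>B\<^esub> wp u)" for f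
  \<comment> \<open>Two elements have different supports; adding their images requires both sums to
    be taken over a common finite set of words.\<close>
  have hT: "h f = (\<Oplus>\<^bsub>B\<^esub>u\<in>T. f u \<odot>\<^bsub>B\<^esub> wp u)"
    if "finite T" "T \<subseteq> lists X" "{u. f u \<noteq> 0} \<subseteq> T" for f T
    unfolding h_def
    by (rule B.add.finprod_mono_neutral_cong_left) (use that in \<open>auto simp: VB wpc subset_iff simp del: in_lists_conv_set\<close>)
  have hc: "h f \<in> carrier B" if "f \<in> carrier ?F" for f
    unfolding h_def by (rule B.finsum_closed) (use free_carrierD(2)[OF that] in \<open>auto simp: VB wpc simp del: in_lists_conv_set\<close>)
  have hadd: "h (f \<oplus>\<^bsub>?F\<^esub> g) = h f \<oplus>\<^bsub>B\<^esub> h g" if f: "f \<in> carrier ?F" and g: "g \<in> carrier ?F" for f g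
  proof -
    let ?T = "{u. f u \<noteq> 0} \<union> {u. g u \<noteq> 0}"
    have T: "finite ?T" "?T \<subseteq> lists X" using free_carrierD[OF f] free_carrierD[OF g] by blast+
    have "h (f \<oplus>\<^bsub>?F\<^esub> g) = (\<Oplus>\<^bsub>B\<^esub>u\<in>?T. (f u + g u) \<odot>\<^bsub>B\<^esub> wp u)"
      unfolding free_simps by (rule hT[OF T]) auto
    also have "\<dots> = (\<Oplus>\<^bsub>B\<^esub>u\<in>?T. f u \<odot>\<^bsub>B\<^esub> wp u \<oplus>\<^bsub>B\<^esub> g u \<odot>\<^bsub>B\<^esub> wp u)"
      by (rule B.finsum_cong') (use T in \<open>auto simp: VB wpc subset_iff simp del: in_lists_conv_set\<close>)
    also have "\<dots> = (\<Oplus>\<^bsub>B\<^esub>u\<in>?T. f u \<odot>\<^bsub>B\<^esub> wp u) \<oplus>\<^bsub>B\<^esub> (\<Oplus>\<^bsub>B\<^esub>u\<in>?T. g u \<odot>\<^bsub>B\<^esub> wp u)"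
      by (rule B.finsum_addf) (use T in \<open>auto simp: VB wpc subset_iff simp del: in_lists_conv_set\<close>)
    also have "\<dots> = h f \<oplus>\<^bsub>B\<^esub> h g" using hT[OF T, of f] hT[OF T, of g] by force
    finally show ?thesis .
  qed
  have hsm: "h (c \<odot>\<^bsub>?F\<^esub> f) = c \<odot>\<^bsub>B\<^esub> h f" if f: "f \<in> carrier ?F" for c f
  proof -
    let ?T = "{u. f u \<noteq> 0}"
    have T: "finite ?T" "?T \<subseteq> lists X" using free_carrierD[OF f] by blast+
    have "h (c \<odot>\<^bsub>?F\<^esub> f) = (\<Oplus>\<^bsub>B\<^esub>u\<in>?T. (c * f u) \<odot>\<^bsub>B\<^esub> wp u)"
      unfolding free_simps by (rule hT[OF T]) auto
    also have "\<dots> = (\<Oplus>\<^bsub>B\<^esub>u\<in>?T. c \<odot>\<^bsub>B\<^esub> (f u \<odot>\<^bsub>B\<^esub> wp u))"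
      by (rule B.finsum_cong') (use T in \<open>auto simp: VB wpc subset_iff simp del: in_lists_conv_set\<close>)
    also have "\<dots> = c \<odot>\<^bsub>B\<^esub> h f"
      unfolding h_def by (rule additive_finsum[symmetric, of B B "\<lambda>v. c \<odot>\<^bsub>B\<^esub> v"])
        (use T in \<open>auto simp: VB wpc subset_iff simp del: in_lists_conv_set\<close>)
    finally show ?thesis .
  qed
  have hw: "h (free_word u) = wp u" if u: "u \<in> lists X" for u
  proof -
    have "h (free_word u) = (\<Oplus>\<^bsub>B\<^esub>v\<in>{u}. free_word u v \<odot>\<^bsub>B\<^esub> wp v)"
      by (rule hT) (use u in \<open>auto simp: free_word_def\<close>)
    also have "\<dots> = wp u" using wpc[OF u] by (simp add: free_word_def VB)
    finally show ?thesis .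
  qed
  have hmult: "h (f \<otimes>\<^bsub>?F\<^esub> g) = h f \<otimes>\<^bsub>B\<^esub> h g" if f: "f \<in> carrier ?F" and g: "g \<in> carrier ?F" for f g
    using f
  proof (induction rule: free_algebra_induct)
    case (word u)
    have u: "free_word u \<in> carrier ?F" by (rule free_word_closed[OF word])
    show ?case using g
    proof (induction rule: free_algebra_induct)
      case (word v)
      then show ?case using \<open>u \<in> lists X\<close> wpa[of u v] by (simp add: free_word_mult hw)
    next
      case (add f g)
      then show ?case using u by (simp add: F.r_distr hadd hc B.r_distr)
    next
      case (smult c f)
      then show ?case using u by (simp add: assoc_algebraD(4)[OF F] assoc_algebraD(4)[OF B] hsm hc)
    qed
  next
    case (add f1 f2)
    then show ?case using g by (simp add: F.l_distr hadd hc B.l_distr)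
  next
    case (smult c f)
    then show ?case using g by (simp add: assoc_algebraD(3)[OF F] assoc_algebraD(3)[OF B] hsm hc)
  qed
  have h1: "h \<one>\<^bsub>?F\<^esub> = \<one>\<^bsub>B\<^esub>" using hw[of "[]"] by (simp add: free_word_Nil wp_def)
  have "alg_hom ?F B h" unfolding alg_hom_def using hc hadd hsm hmult h1 by blast
  moreover have "h (free_gen x) = \<phi> x" if "x \<in> X" for x
    using hw[of "[x]"] that \<phi> by (simp add: free_gen_word wp_def)
  ultimately show thesis using that by blast
qed

text \<open>For properties of the form "multiplication by f preserves a given subspace": closure
  under products reduces them from words to single generators.\<close>

lemma free_algebra_gen_induct [consumes 1, case_names one gen mult add smult]:
  assumes f: "f \<in> carrier (free_algebra X :: ('k::field, 'g list \<Rightarrow> 'k) module)"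
    and o: "P \<one>\<^bsub>free_algebra X\<^esub>"
    and w: "\<And>x. x \<in> X \<Longrightarrow> P (free_gen x)"
    and m: "\<And>f g. f \<in> carrier (free_algebra X) \<Longrightarrow> g \<in> carrier (free_algebra X) \<Longrightarrow> P f \<Longrightarrow> P g \<Longrightarrow>
      P (f \<otimes>\<^bsub>free_algebra X\<^esub> g)"
    and a: "\<And>f g. f \<in> carrier (free_algebra X) \<Longrightarrow> g \<in> carrier (free_algebra X) \<Longrightarrow> P f \<Longrightarrow> P g \<Longrightarrow>
      P (f \<oplus>\<^bsub>free_algebra X\<^esub> g)"
    and s: "\<And>c f. f \<in> carrier (free_algebra X) \<Longrightarrow> P f \<Longrightarrow> P (c \<odot>\<^bsub>free_algebra X\<^esub> f)"
  shows "P f"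
  using f
proof (induction rule: free_algebra_induct)
  case (word u)
  then show ?case
  proof (induction u)
    case Nil
    then show ?case using o by (simp add: free_word_Nil)
  next
    case (Cons x u)
    then have "P (free_gen x \<otimes>\<^bsub>free_algebra X\<^esub> free_word u)"
      using m[of "free_gen x" "free_word u"] w free_word_closed[of "[x]" X] free_word_closed[of u X]
      by (simp add: free_gen_word)
    then show ?case by (simp add: free_gen_word free_word_mult)
  qed
next
  case (add f g)
  then show ?case by (rule a)
next
  case (smult c f)
  then show ?case by (rule s)
qed

section \<open>Spaces of functions\<close>

text \<open>The full function type is the ambient space, in general of infinite dimension; the
  finite-dimensional coordinate spaces are its subspaces \<open>supported S\<close> with
  \<open>S\<close> finite.\<close>

interpretation fv: vector_space "\<lambda>(c::'k::field) (f::'m \<Rightarrow> 'k) u. c * f u"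
  by standard (auto simp: fun_eq_iff algebra_simps)

interpretation fvp: vector_space_pair "\<lambda>(c::'k::field) (f::'m \<Rightarrow> 'k) u. c * f u"
  "\<lambda>(c::'k::field) (f::'n \<Rightarrow> 'k) u. c * f u"
  by standard

lemma sum_fun_apply: "(\<Sum>i\<in>I. f i) x = (\<Sum>i\<in>I. f i x)"
  by (induction I rule: infinite_finite_induct) auto

definition dlt :: "'m \<Rightarrow> 'm \<Rightarrow> 'k::field" where
  "dlt m = (\<lambda>n. if n = m then 1 else 0)"

definition supported :: "'m set \<Rightarrow> ('m \<Rightarrow> 'k::field) set" where
  "supported S = {f. \<forall>m. m \<notin> S \<longrightarrow> f m = 0}"

lemma supported_sum_dlt:
  assumes "finite S" "f \<in> supported S"
  shows "f = (\<Sum>m\<in>S. (\<lambda>u. f m * dlt m u))"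
proof
  fix x
  have "(\<Sum>m\<in>S. (\<lambda>u. f m * dlt m u)) x = (\<Sum>m\<in>S. if m = x then f x else 0)"
    unfolding sum_fun_apply by (rule sum.cong) (auto simp: dlt_def)
  also have "\<dots> = f x" using assms by (simp add: supported_def)
  finally show "f x = (\<Sum>m\<in>S. (\<lambda>u. f m * dlt m u)) x" by simp
qed

lemma subspace_supported: "fv.subspace (supported S)"
  unfolding fv.subspace_def supported_def by auto

lemma span_dlt:
  fixes S :: "'m set"
  assumes "finite S" shows "fv.span (dlt ` S :: ('m \<Rightarrow> 'k::field) set) = supported S"
proof
  show "fv.span (dlt ` S :: ('m \<Rightarrow> 'k) set) \<subseteq> supported S"
    by (rule fv.span_minimal[OF _ subspace_supported]) (auto simp: supported_def dlt_def)
  show "supported S \<subseteq> fv.span (dlt ` S :: ('m \<Rightarrow> 'k) set)"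
  proof
    fix f :: "'m \<Rightarrow> 'k" assume "f \<in> supported S"
    have "(\<Sum>m\<in>S. (\<lambda>u. f m * dlt m u)) \<in> fv.span (dlt ` S)"
    proof (rule fv.span_sum)
      fix m assume "m \<in> S"
      then have "dlt m \<in> fv.span (dlt ` S :: ('m \<Rightarrow> 'k) set)" by (intro fv.span_base) blast
      then show "(\<lambda>u. f m * dlt m u) \<in> fv.span (dlt ` S)" by (rule fv.span_scale)
    qed
    then show "f \<in> fv.span (dlt ` S)"
      using supported_sum_dlt[OF assms \<open>f \<in> supported S\<close>] by simp
  qed
qed

lemma inj_dlt: "inj (dlt :: 'm \<Rightarrow> 'm \<Rightarrow> 'k::field)"
proof (rule injI)
  fix m n :: 'm assume "dlt m = (dlt n :: 'm \<Rightarrow> 'k)"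
  then have "dlt m m = (dlt n m :: 'k)" by simp
  then show "m = n" by (auto simp: dlt_def split: if_splits)
qed

text \<open>Inside \<open>supported S\<close> independent sets are finite, being bounded by the
  spanning set \<open>dlt\<close> of \<open>S\<close>. A basis of the smaller space together with a
  vector outside it is then an independent subset of the larger one.\<close>

lemma dim_less_if_psubset:
  fixes L L' :: "('m \<Rightarrow> 'k::field) set"
  assumes S: "finite S" and L: "fv.subspace L" "fv.subspace L'" "L \<subset> L'" "L' \<subseteq> supported S"
  shows "fv.dim L < fv.dim L'"
proof -
  have fin: "finite B \<and> card B \<le> card (dlt ` S :: ('m \<Rightarrow> 'k) set)"
    if "fv.independent B" "B \<subseteq> supported S" for B :: "('m \<Rightarrow> 'k) set"
    using fv.independent_span_bound[of "dlt ` S" B] that S span_dlt[OF S] by blast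
  obtain B where B: "B \<subseteq> L" "fv.independent B" "L \<subseteq> fv.span B" "card B = fv.dim L"
    using fv.basis_exists by blast
  obtain C where C: "C \<subseteq> L'" "fv.independent C" "L' \<subseteq> fv.span C" "card C = fv.dim L'"
    using fv.basis_exists by blast
  obtain v where v: "v \<in> L'" "v \<notin> L" using L by blast
  have fB: "finite B" using fin[OF B(2)] B(1) L by blast
  have fC: "finite C" using fin[OF C(2)] C(1) L by blast
  have spB: "fv.span B \<subseteq> L" using B(1) L(1) by (rule fv.span_minimal)
  then have "v \<notin> fv.span B" using v by blast
  then have "fv.independent (insert v B)" using B(2) by (rule fv.independent_insertI)
  moreover have "insert v B \<subseteq> fv.span C" using v B(1) L C(3) by blast
  ultimately have "card (insert v B) \<le> card C" using fv.independent_span_bound[OF fC] by blast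
  moreover have "v \<notin> B" using v B(1) by blast
  ultimately show ?thesis using fB B(4) C(4) by simp
qed

text \<open>A linear left inverse of the inclusion of \<open>L\<close>. It is the raw material that
  Maschke's argument averages.\<close>

lemma projection_exists:
  fixes L :: "('m \<Rightarrow> 'k::field) set"
  assumes "fv.subspace L"
  obtains \<pi> :: "('m \<Rightarrow> 'k) \<Rightarrow> 'm \<Rightarrow> 'k"
  where "\<And>v. \<pi> v \<in> L" "\<And>v. v \<in> L \<Longrightarrow> \<pi> v = v" "\<And>v w. \<pi> (v + w) = \<pi> v + \<pi> w"
    "\<And>c v. \<pi> (\<lambda>u. c * v u) = (\<lambda>u. c * \<pi> v u)"
proof -
  obtain \<pi> where \<pi>: "\<pi> ` UNIV \<subseteq> L" "Vector_Spaces.linear (\<lambda>(c::'k) (f::'m \<Rightarrow> 'k) u. c * f u) (\<lambda>(c::'k) (f::'m \<Rightarrow> 'k) u. c * f u) \<pi>"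
    "\<forall>v\<in>L. \<pi> (id v) = v"
    using fvp.linear_exists_left_inverse_on[OF fv.linear_id assms] by auto
  interpret Vector_Spaces.linear "\<lambda>(c::'k) (f::'m \<Rightarrow> 'k) u. c * f u" "\<lambda>(c::'k) (f::'m \<Rightarrow> 'k) u. c * f u" \<pi>
    by (rule \<pi>(2))
  show thesis by (rule that[of \<pi>]) (use \<pi> add scale in auto)
qed

text \<open>Otherwise the image would be a proper subspace, hence of smaller dimension, although it
  contains the independent image of a basis.\<close>

lemma injective_imp_surjective_on_supported:
  fixes T :: "('m \<Rightarrow> 'k::field) \<Rightarrow> ('m \<Rightarrow> 'k)"
  assumes S: "finite S"
    and lin: "Vector_Spaces.linear (\<lambda>(c::'k) (f::'m \<Rightarrow> 'k) u. c * f u) (\<lambda>(c::'k) (f::'m \<Rightarrow> 'k) u. c * f u) T"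
    and cl: "\<And>f. f \<in> supported S \<Longrightarrow> T f \<in> supported S"
    and inj: "\<And>f. f \<in> supported S \<Longrightarrow> T f = 0 \<Longrightarrow> f = 0"
    and g: "g \<in> supported S"
  shows "\<exists>f\<in>supported S. T f = g"
proof (rule ccontr)
  let ?U = "supported S :: ('m \<Rightarrow> 'k) set"
  assume not: "\<not> ?thesis"
  interpret T: Vector_Spaces.linear "\<lambda>(c::'k) (f::'m \<Rightarrow> 'k) u. c * f u" "\<lambda>(c::'k) (f::'m \<Rightarrow> 'k) u. c * f u" T
    by (rule lin)
  have im: "fv.subspace (T ` ?U)"
    using T.subspace_image[OF subspace_supported] .
  have sub: "T ` ?U \<subset> ?U"
  proof (rule psubsetI)
    show "T ` ?U \<subseteq> ?U" by (rule image_subsetI) (rule cl)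
    show "T ` ?U \<noteq> ?U" using not g by (metis imageE)
  qed
  have d: "fv.dim (T ` ?U) < fv.dim (?U)"
    using dim_less_if_psubset[OF S im subspace_supported sub order_refl] .
  have injT: "inj_on T (?U)"
  proof (rule inj_onI)
    fix x y assume xy: "x \<in> ?U" "y \<in> ?U" "T x = T y"
    then have "x - y \<in> ?U" "T (x - y) = 0"
      by (simp_all add: fv.subspace_diff[OF subspace_supported] T.diff)
    then have "x - y = 0" by (rule inj)
    then show "x = y" by simp
  qed
  obtain B where B: "B \<subseteq> ?U" "fv.independent B" "?U \<subseteq> fv.span B" "card B = fv.dim (?U)"
    using fv.basis_exists by blast
  have spB: "fv.span B = ?U" using B(3) fv.span_minimal[OF B(1) subspace_supported] by blast
  have iB: "fv.independent (T ` B)"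
    by (rule T.independent_injective_image[OF B(2)]) (use injT spB in simp)
  have "card (T ` B) = card B" by (rule card_image[OF inj_on_subset[OF injT B(1)]])
  moreover have "card (T ` B) \<le> fv.dim (T ` ?U)"
  proof -
    obtain C where C: "C \<subseteq> T ` ?U" "fv.independent C" "T ` ?U \<subseteq> fv.span C" "card C = fv.dim (T ` ?U)"
      using fv.basis_exists by blast
    have "C \<subseteq> fv.span (dlt ` S)" unfolding span_dlt[OF S] using C(1) sub by (meson order.trans psubset_imp_subset)
    then have "finite C" using fv.independent_span_bound[of "dlt ` S" C] C(2) S by simp
    moreover have "T ` B \<subseteq> fv.span C" using image_mono[OF B(1), of T] C(3) by (rule order.trans)
    ultimately show ?thesis using fv.independent_span_bound[of C "T ` B"] iB C(4) by simp
  qed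
  ultimately show False using d B(4) by simp
qed

subsection \<open>Perturbations of the indeterminate\<close>

lemma Fract_one_hom:
  fixes p q :: "'c::field poly"
  shows "Fraction_Field.Fract (p + q) 1 = Fraction_Field.Fract p 1 + Fraction_Field.Fract q 1"
    "Fraction_Field.Fract (p * q) 1 = Fraction_Field.Fract p 1 * Fraction_Field.Fract q 1"
    "Fraction_Field.Fract p 1 = 0 \<longleftrightarrow> p = 0"
  by (simp_all add: Zero_fract_def eq_fract)

lemma Fract_one_sum:
  fixes p :: "'i \<Rightarrow> 'c::field poly"
  shows "Fraction_Field.Fract (\<Sum>i\<in>I. p i) 1 = (\<Sum>i\<in>I. Fraction_Field.Fract (p i) 1)"
  by (induction I rule: infinite_finite_induct) (auto simp: Fract_one_hom Zero_fract_def[symmetric])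

text \<open>Clearing denominators turns a linear system over rational functions into one over
  polynomials, where degrees can be compared.\<close>

lemma common_denominator:
  fixes f :: "'m \<Rightarrow> 'c::field poly fract"
  assumes "finite S"
  shows "\<exists>q p. q \<noteq> 0 \<and> (\<forall>i\<in>S. Fraction_Field.Fract q 1 * f i = Fraction_Field.Fract (p i) 1)"
  using assms
proof induction
  case empty
  show ?case by (intro exI[of _ "1"]) auto
next
  case (insert j S)
  then obtain q p where q: "q \<noteq> 0" "\<forall>i\<in>S. Fraction_Field.Fract q 1 * f i = Fraction_Field.Fract (p i) 1" by blast
  obtain a b where ab: "f j = Fraction_Field.Fract a b" "b \<noteq> 0" by (cases "f j") auto
  have "Fraction_Field.Fract (b * q) 1 * f i = Fraction_Field.Fract (if i = j then q * a else b * p i) 1"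
    if i: "i \<in> insert j S" for i
  proof (cases "i = j")
    case True
    then show ?thesis using ab by (simp add: eq_fract)
  next
    case False
    then have "i \<in> S" using i by simp
    then show ?thesis using q(2) False by (simp add: Fract_one_hom mult.assoc del: mult_fract)
  qed
  then show ?case using q(1) ab(2)
    by (intro exI[of _ "b * q"] exI[of _ "\<lambda>i. if i = j then q * a else b * p i"]) auto
qed

text \<open>
  Multiplication by the indeterminate raises degrees, whereas the constant matrix \<open>M\<close> does not: look
  at an entry of maximal degree.
\<close>

lemma indet_plus_const_injective:
  fixes f :: "'m \<Rightarrow> 'c::field poly fract"
  assumes S: "finite S" and f: "f \<in> supported S"
    and eq: "\<And>i. i \<in> S \<Longrightarrow> indet * f i + (\<Sum>j\<in>S. const_fract (M i j) * f j) = 0"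
  shows "f = 0"
proof (rule ccontr)
  let ?i = "\<lambda>p::'c poly. Fraction_Field.Fract p 1"
  assume "f \<noteq> 0"
  then obtain i0 where i0: "f i0 \<noteq> 0" by (auto simp: fun_eq_iff)
  then have i0S: "i0 \<in> S" using f by (auto simp: supported_def)
  obtain q p where q: "q \<noteq> 0" and p: "\<And>i. i \<in> S \<Longrightarrow> ?i q * f i = ?i (p i)"
    using common_denominator[OF S, of f] by blast
  have pe: "[:0, 1:] * p i + (\<Sum>j\<in>S. [:M i j:] * p j) = 0" if i: "i \<in> S" for i
  proof -
    have "?i ([:0, 1:] * p i + (\<Sum>j\<in>S. [:M i j:] * p j))
        = indet * ?i (p i) + (\<Sum>j\<in>S. const_fract (M i j) * ?i (p j))"
      unfolding Fract_one_hom Fract_one_sum indet_def const_fract_def ..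
    also have "\<dots> = indet * (?i q * f i) + (\<Sum>j\<in>S. const_fract (M i j) * (?i q * f j))"
      using p i by simp
    also have "\<dots> = ?i q * (indet * f i + (\<Sum>j\<in>S. const_fract (M i j) * f j))"
      by (simp add: algebra_simps sum_distrib_left)
    also have "\<dots> = 0" using eq[OF i] by simp
    finally show ?thesis by (simp only: Fract_one_hom(3))
  qed
  \<comment> \<open>Zero entries are left out because the zero polynomial also has degree 0, and the
    entry that attains the maximum must have a nonzero leading coefficient.\<close>
  define d where "d = Max (degree ` p ` {i\<in>S. p i \<noteq> 0})"
  have "?i (p i0) \<noteq> 0" using p[OF i0S] i0 q Fract_one_hom(3)[of q] by (metis mult_eq_0_iff)
  then have ne: "{i\<in>S. p i \<noteq> 0} \<noteq> {}" using i0S Fract_one_hom(3)[of "p i0"] by blast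
  have fin: "finite (degree ` p ` {i\<in>S. p i \<noteq> 0})" using S by simp
  have "d \<in> degree ` p ` {i\<in>S. p i \<noteq> 0}" unfolding d_def using fin ne by (intro Max_in) auto
  then obtain i where i: "i \<in> S" "p i \<noteq> 0" "degree (p i) = d" by auto
  have dj: "coeff (p j) (Suc d) = 0" if "j \<in> S" for j
  proof (cases "p j = 0")
    case False
    then have "degree (p j) \<le> d" unfolding d_def using fin that by (intro Max_ge) auto
    then show ?thesis by (simp add: coeff_eq_0)
  qed simp
  have "coeff ([:0, 1:] * p i + (\<Sum>j\<in>S. [:M i j:] * p j)) (Suc d) = coeff (p i) d + (\<Sum>j\<in>S. M i j * coeff (p j) (Suc d))"
    by (simp add: coeff_sum)
  also have "\<dots> = coeff (p i) d" using dj by simp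
  also have "\<dots> \<noteq> 0" using i by auto
  finally show False unfolding pe[OF i(1)] by simp
qed

section \<open>Semisimplicity\<close>

lemma left_idealD:
  assumes A: "assoc_algebra A" and L: "left_ideal A L"
  shows "L \<subseteq> carrier A" "\<zero>\<^bsub>A\<^esub> \<in> L"
    "\<And>x y. x \<in> L \<Longrightarrow> y \<in> L \<Longrightarrow> x \<oplus>\<^bsub>A\<^esub> y \<in> L"
    "\<And>a x. a \<in> carrier A \<Longrightarrow> x \<in> L \<Longrightarrow> a \<otimes>\<^bsub>A\<^esub> x \<in> L"
    "\<And>c x. x \<in> L \<Longrightarrow> c \<odot>\<^bsub>A\<^esub> x \<in> L"
    "\<And>x. x \<in> L \<Longrightarrow> \<ominus>\<^bsub>A\<^esub> x \<in> L"
proof -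
  interpret A: ring A by (rule assoc_algebraD[OF A])
  note VA = vectorspaceD[OF assoc_algebraD(2)[OF A]]
  interpret additive_subgroup L A using L unfolding left_ideal_def by blast
  show sub: "L \<subseteq> carrier A" by (rule a_subset)
  show "\<zero>\<^bsub>A\<^esub> \<in> L" by (rule zero_closed)
  show "\<And>x y. x \<in> L \<Longrightarrow> y \<in> L \<Longrightarrow> x \<oplus>\<^bsub>A\<^esub> y \<in> L" by (rule a_closed)
  show mult: "\<And>a x. a \<in> carrier A \<Longrightarrow> x \<in> L \<Longrightarrow> a \<otimes>\<^bsub>A\<^esub> x \<in> L"
    using L unfolding left_ideal_def by blast
  \<comment> \<open>\<open>left_ideal\<close> demands no closure under scalars; it follows from
    multiplication by c times the unit.\<close>
  show sm: "c \<odot>\<^bsub>A\<^esub> x \<in> L" if "x \<in> L" for c x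
  proof -
    have xc: "x \<in> carrier A" using that sub by blast
    have "c \<odot>\<^bsub>A\<^esub> x = (c \<odot>\<^bsub>A\<^esub> \<one>\<^bsub>A\<^esub>) \<otimes>\<^bsub>A\<^esub> x"
      using assoc_algebraD(3)[OF A, of "\<one>\<^bsub>A\<^esub>" x c] xc by simp
    then show ?thesis using mult[OF _ that, of "c \<odot>\<^bsub>A\<^esub> \<one>\<^bsub>A\<^esub>"] VA(2)[of "\<one>\<^bsub>A\<^esub>" c] by simp
  qed
  show "\<ominus>\<^bsub>A\<^esub> x \<in> L" if "x \<in> L" for x
    using sm[OF that, of "-1"] VA(9)[of x] that sub by auto
qed

lemma left_idealI:
  assumes A: "assoc_algebra A" and L: "L \<subseteq> carrier A" "\<zero>\<^bsub>A\<^esub> \<in> L"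
    "\<And>x y. x \<in> L \<Longrightarrow> y \<in> L \<Longrightarrow> x \<oplus>\<^bsub>A\<^esub> y \<in> L"
    "\<And>a x. a \<in> carrier A \<Longrightarrow> x \<in> L \<Longrightarrow> a \<otimes>\<^bsub>A\<^esub> x \<in> L"
  shows "left_ideal A L"
proof -
  interpret A: ring A by (rule assoc_algebraD[OF A])
  have neg: "\<ominus>\<^bsub>A\<^esub> x \<in> L" if "x \<in> L" for x
  proof -
    have "(\<ominus>\<^bsub>A\<^esub> \<one>\<^bsub>A\<^esub>) \<otimes>\<^bsub>A\<^esub> x = \<ominus>\<^bsub>A\<^esub> x" using that L(1) A.l_minus[of "\<one>\<^bsub>A\<^esub>" x] by auto
    then show ?thesis using L(4)[OF _ that, of "\<ominus>\<^bsub>A\<^esub> \<one>\<^bsub>A\<^esub>"] by simp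
  qed
  have "subgroup L (add_monoid A)"
  proof (rule A.add.subgroupI)
    show "L \<noteq> {}" using L(2) by blast
  qed (use L neg in \<open>auto simp: a_inv_def\<close>)
  then have "additive_subgroup L A" by (rule additive_subgroupI)
  then show ?thesis unfolding left_ideal_def using L(4) by blast
qed

text \<open>A maximal independent family of minimal left ideals spans, since its sum has a complement.\<close>

lemma semisimple_if_complemented:
  fixes A :: "('k::field, 'a) module" and d :: "'a set \<Rightarrow> nat"
  assumes A: "assoc_algebra A"
    and d: "\<And>L L'. left_ideal A L \<Longrightarrow> left_ideal A L' \<Longrightarrow> L \<subset> L' \<Longrightarrow> d L < d L'"
    and compl: "\<And>L. left_ideal A L \<Longrightarrow> \<exists>C. left_ideal A C \<and> L \<inter> C = {\<zero>\<^bsub>A\<^esub>} \<and>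
      (\<forall>a\<in>carrier A. \<exists>x\<in>L. \<exists>y\<in>C. a = x \<oplus>\<^bsub>A\<^esub> y)"
  shows "semisimple_algebra A"
proof -
  interpret A: ring A by (rule assoc_algebraD[OF A])
  note li = left_idealD[OF A]
  define sm where "sm S = {\<Oplus>\<^bsub>A\<^esub>L\<in>S. f L | f. f \<in> (\<Pi> L\<in>S. L)}" for S :: "'a set set"
  define indep where "indep S \<longleftrightarrow> (\<forall>f\<in>(\<Pi> L\<in>S. L). (\<Oplus>\<^bsub>A\<^esub>L\<in>S. f L) = \<zero>\<^bsub>A\<^esub> \<longrightarrow> (\<forall>L\<in>S. f L = \<zero>\<^bsub>A\<^esub>))"
    for S :: "'a set set"
  define Q where "Q S \<longleftrightarrow> finite S \<and> (\<forall>L\<in>S. minimal_left_ideal A L) \<and> indep S" for S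
  have Qli: "left_ideal A L" if "Q S" "L \<in> S" for S L
    using that unfolding Q_def minimal_left_ideal_def by blast
  have pc: "f \<in> S \<rightarrow> carrier A" if "Q S" "f \<in> (\<Pi> L\<in>S. L)" for S f
    using li(1)[OF Qli[OF that(1)]] that(2) by (auto simp: Pi_iff)
  have smI: "(\<Oplus>\<^bsub>A\<^esub>L\<in>S. f L) \<in> sm S" if "f \<in> (\<Pi> L\<in>S. L)" for S f
    using that unfolding sm_def by blast
  have smli: "left_ideal A (sm S)" if Q: "Q S" for S
  proof (rule left_idealI[OF A])
    show "sm S \<subseteq> carrier A" unfolding sm_def using pc[OF Q] by (auto intro: A.finsum_closed)
    have "(\<Oplus>\<^bsub>A\<^esub>L\<in>S. \<zero>\<^bsub>A\<^esub>) \<in> sm S" by (rule smI) (use li(2)[OF Qli[OF Q]] in blast)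
    then show "\<zero>\<^bsub>A\<^esub> \<in> sm S" by simp
    fix x assume "x \<in> sm S"
    then obtain f where f: "f \<in> (\<Pi> L\<in>S. L)" "x = (\<Oplus>\<^bsub>A\<^esub>L\<in>S. f L)" unfolding sm_def by blast
    show "a \<otimes>\<^bsub>A\<^esub> x \<in> sm S" if a: "a \<in> carrier A" for a
    proof -
      have "a \<otimes>\<^bsub>A\<^esub> x = (\<Oplus>\<^bsub>A\<^esub>L\<in>S. a \<otimes>\<^bsub>A\<^esub> f L)"
        unfolding f(2) by (rule A.finsum_rdistr) (use Q pc[OF Q f(1)] a in \<open>auto simp: Q_def\<close>)
      moreover have "(\<lambda>L. a \<otimes>\<^bsub>A\<^esub> f L) \<in> (\<Pi> L\<in>S. L)" using li(4)[OF Qli[OF Q]] a f(1) by auto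
      ultimately show ?thesis using smI[of "\<lambda>L. a \<otimes>\<^bsub>A\<^esub> f L" S] by simp
    qed
    fix y assume "y \<in> sm S"
    then obtain g where g: "g \<in> (\<Pi> L\<in>S. L)" "y = (\<Oplus>\<^bsub>A\<^esub>L\<in>S. g L)" unfolding sm_def by blast
    have "x \<oplus>\<^bsub>A\<^esub> y = (\<Oplus>\<^bsub>A\<^esub>L\<in>S. f L \<oplus>\<^bsub>A\<^esub> g L)"
      unfolding f(2) g(2) by (rule A.finsum_addf[symmetric]) (use pc[OF Q] f(1) g(1) in auto)
    moreover have "(\<lambda>L. f L \<oplus>\<^bsub>A\<^esub> g L) \<in> (\<Pi> L\<in>S. L)" 
    proof (rule Pi_I)
      fix L assume "L \<in> S"
      then show "f L \<oplus>\<^bsub>A\<^esub> g L \<in> L"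
        using li(3)[OF Qli[OF Q], of L "f L" "g L"] f(1) g(1) by (simp add: Pi_iff)
    qed
    ultimately show "x \<oplus>\<^bsub>A\<^esub> y \<in> sm S" using smI[of "\<lambda>L. f L \<oplus>\<^bsub>A\<^esub> g L" S] by simp
  qed
  have carli: "left_ideal A (carrier A)" by (rule left_idealI[OF A]) auto
  have member_sm: "L \<subseteq> sm S" if Q: "Q S" and L: "L \<in> S" for L S
  proof
    fix x assume x: "x \<in> L"
    have xc: "x \<in> carrier A" using li(1)[OF Qli[OF Q L]] x by blast
    have "(\<Oplus>\<^bsub>A\<^esub>M\<in>S. if L = M then x else \<zero>\<^bsub>A\<^esub>) = x"
      using A.finsum_singleton[of L S "\<lambda>_. x"] L Q xc by (simp add: Q_def)
    moreover have "(\<lambda>M. if L = M then x else \<zero>\<^bsub>A\<^esub>) \<in> (\<Pi> M\<in>S. M)"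
      using x li(2)[OF Qli[OF Q]] by auto
    ultimately show "x \<in> sm S" using smI[of "\<lambda>M. if L = M then x else \<zero>\<^bsub>A\<^esub>" S] by simp
  qed
  have step: "\<exists>L. Q (insert L S) \<and> sm S \<subset> sm (insert L S)" if Q: "Q S" and ne: "sm S \<noteq> carrier A" for S
  proof -
    obtain C where C: "left_ideal A C" "sm S \<inter> C = {\<zero>\<^bsub>A\<^esub>}"
      "\<forall>a\<in>carrier A. \<exists>x\<in>sm S. \<exists>y\<in>C. a = x \<oplus>\<^bsub>A\<^esub> y" using compl[OF smli[OF Q]] by blast
    have smc: "sm S \<subseteq> carrier A" by (rule li(1)[OF smli[OF Q]])
    have "C \<noteq> {\<zero>\<^bsub>A\<^esub>}"
    proof
      assume C0: "C = {\<zero>\<^bsub>A\<^esub>}"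
      have "carrier A \<subseteq> sm S"
      proof
        fix a assume "a \<in> carrier A"
        then obtain x where "x \<in> sm S" "a = x \<oplus>\<^bsub>A\<^esub> \<zero>\<^bsub>A\<^esub>" using C(3) C0 by blast
        then show "a \<in> sm S" using smc by auto
      qed
      then show False using ne smc by blast
    qed
    \<comment> \<open>Among the nonzero left ideals inside the complement, one with least
      \<open>d\<close> is minimal, since \<open>d\<close> is strictly monotone.\<close>
    then have "\<exists>L. (left_ideal A L \<and> L \<noteq> {\<zero>\<^bsub>A\<^esub>} \<and> L \<subseteq> C) \<and>
       (\<forall>L'. (left_ideal A L' \<and> L' \<noteq> {\<zero>\<^bsub>A\<^esub>} \<and> L' \<subseteq> C) \<longrightarrow> d L \<le> d L')"
      using C(1) by (intro ex_has_least_nat[of _ C]) blast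
    then obtain L where L: "left_ideal A L" "L \<noteq> {\<zero>\<^bsub>A\<^esub>}" "L \<subseteq> C"
      and least: "\<And>L'. left_ideal A L' \<Longrightarrow> L' \<noteq> {\<zero>\<^bsub>A\<^esub>} \<Longrightarrow> L' \<subseteq> C \<Longrightarrow> d L \<le> d L'" by blast
    have minL: "minimal_left_ideal A L" unfolding minimal_left_ideal_def
    proof (intro conjI allI impI L)
      fix L' assume L': "left_ideal A L' \<and> L' \<subseteq> L"
      show "L' = {\<zero>\<^bsub>A\<^esub>} \<or> L' = L"
      proof (rule ccontr)
        assume "\<not> ?thesis"
        then have "L' \<noteq> {\<zero>\<^bsub>A\<^esub>}" "L' \<subset> L" using L' by blast+
        then show False using least[of L'] d[of L' L] L' L by (meson leD order.trans)
      qed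
    qed
    have cap: "L \<inter> sm S \<subseteq> {\<zero>\<^bsub>A\<^esub>}" using C(2) L(3) by blast
    have Lns: "\<not> L \<subseteq> sm S" using cap L(2) li(2)[OF L(1)] by blast
    then have LS: "L \<notin> S" using member_sm[OF Q] by blast
    have fin: "finite S" using Q unfolding Q_def by blast
    have ins: "(\<Oplus>\<^bsub>A\<^esub>M\<in>insert L S. f M) = f L \<oplus>\<^bsub>A\<^esub> (\<Oplus>\<^bsub>A\<^esub>M\<in>S. f M)"
      and fcl: "f L \<in> carrier A" "(\<Oplus>\<^bsub>A\<^esub>M\<in>S. f M) \<in> sm S" "f L \<in> L"
      if "f \<in> (\<Pi> M\<in>insert L S. M)" for f
    proof -
      show "f L \<in> L" using that by auto
      then show "f L \<in> carrier A" using li(1)[OF L(1)] by blast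
      moreover have fS: "f \<in> (\<Pi> M\<in>S. M)" using that by auto
      ultimately show "(\<Oplus>\<^bsub>A\<^esub>M\<in>insert L S. f M) = f L \<oplus>\<^bsub>A\<^esub> (\<Oplus>\<^bsub>A\<^esub>M\<in>S. f M)"
        using A.finsum_insert[OF fin LS] pc[OF Q fS] by blast
      show "(\<Oplus>\<^bsub>A\<^esub>M\<in>S. f M) \<in> sm S" by (rule smI[OF fS])
    qed
    have "indep (insert L S)" unfolding indep_def
    proof (intro ballI impI)
      fix f M assume f: "f \<in> (\<Pi> M\<in>insert L S. M)" and z: "(\<Oplus>\<^bsub>A\<^esub>M\<in>insert L S. f M) = \<zero>\<^bsub>A\<^esub>" and M: "M \<in> insert L S"
      let ?s = "\<Oplus>\<^bsub>A\<^esub>M\<in>S. f M"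
      have s: "?s \<in> carrier A" using fcl(2)[OF f] smc by blast
      have "f L \<oplus>\<^bsub>A\<^esub> ?s = \<zero>\<^bsub>A\<^esub>" using ins[OF f] z by simp
      then have "f L = \<ominus>\<^bsub>A\<^esub> ?s" using A.minus_equality[of "f L" ?s] s fcl(1)[OF f] by simp
      then have "f L \<in> sm S" using li(6)[OF smli[OF Q] fcl(2)[OF f]] by simp
      then have fL: "f L = \<zero>\<^bsub>A\<^esub>" using cap fcl(3)[OF f] by blast
      then have "?s = \<zero>\<^bsub>A\<^esub>" using ins[OF f] z s by simp
      moreover have "f \<in> (\<Pi> M\<in>S. M)" using f by auto
      ultimately show "f M = \<zero>\<^bsub>A\<^esub>" using Q fL M unfolding Q_def indep_def by blast
    qed
    then have QL: "Q (insert L S)" using Q minL unfolding Q_def by blast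
    have "sm S \<subseteq> sm (insert L S)"
    proof
      fix x assume "x \<in> sm S"
      then obtain f where f: "f \<in> (\<Pi> L\<in>S. L)" "x = (\<Oplus>\<^bsub>A\<^esub>L\<in>S. f L)" unfolding sm_def by blast
      define g where "g = f(L := \<zero>\<^bsub>A\<^esub>)"
      have g: "g \<in> (\<Pi> M\<in>insert L S. M)" using f(1) LS li(2)[OF L(1)] by (auto simp: g_def)
      have "(\<Oplus>\<^bsub>A\<^esub>M\<in>S. g M) = x" unfolding f(2)
        by (rule A.finsum_cong') (use LS pc[OF Q f(1)] in \<open>auto simp: g_def\<close>)
      then have "(\<Oplus>\<^bsub>A\<^esub>M\<in>insert L S. g M) = x" using ins[OF g] \<open>x \<in> sm S\<close> smc by (auto simp: g_def)
      then show "x \<in> sm (insert L S)" using smI[OF g] by simp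
    qed
    moreover have "L \<subseteq> sm (insert L S)" by (rule member_sm[OF QL]) simp
    ultimately show ?thesis using QL Lns by blast
  qed
  have Q0: "Q {}" by (simp add: Q_def indep_def)
  \<comment> \<open>The values of \<open>d\<close> are bounded by the one of the whole algebra, so
    some independent family has a sum with largest \<open>d\<close>; \<open>step\<close> shows that
    this sum cannot be proper.\<close>
  have bound: "d (sm S) < Suc (d (carrier A))" if "Q S" for S
  proof (cases "sm S = carrier A")
    case False
    then have "sm S \<subset> carrier A" using li(1)[OF smli[OF that]] by (rule psubsetI[rotated])
    then show ?thesis using d[OF smli[OF that] carli] by simp
  qed simp
  have "\<exists>S. Q S \<and> (\<forall>S'. Q S' \<longrightarrow> d (sm S') \<le> d (sm S))"
    using ex_has_greatest_nat[of Q "{}" "\<lambda>S. d (sm S)" "Suc (d (carrier A))"] Q0 bound by blast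
  then obtain S where Q: "Q S" and gr: "\<And>S'. Q S' \<Longrightarrow> d (sm S') \<le> d (sm S)" by blast
  have full: "sm S = carrier A"
  proof (rule ccontr)
    assume "sm S \<noteq> carrier A"
    then obtain L where "Q (insert L S)" "sm S \<subset> sm (insert L S)" using step[OF Q] by blast
    then show False using gr[of "insert L S"] d[OF smli[OF Q] smli[of "insert L S"]] by simp
  qed
  show ?thesis unfolding semisimple_algebra_def
  proof (intro conjI A exI[of _ S] ballI)
    show "finite S" using Q unfolding Q_def by blast
    show "minimal_left_ideal A L" if "L \<in> S" for L using Q that unfolding Q_def by blast
    fix a assume "a \<in> carrier A"
    then obtain f where f: "f \<in> (\<Pi> L\<in>S. L)" "a = (\<Oplus>\<^bsub>A\<^esub>L\<in>S. f L)" using full unfolding sm_def by blast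
    show "\<exists>!f. f \<in> (\<Pi>\<^sub>E L\<in>S. L) \<and> a = (\<Oplus>\<^bsub>A\<^esub>L\<in>S. f L)"
    \<comment> \<open>Uniqueness can hold for extensional functions only, hence the restriction. Two
      decompositions of \<open>a\<close> differ by a decomposition of zero, to which independence
      applies.\<close>
    proof (rule ex1I[of _ "restrict f S"])
      have "(\<Oplus>\<^bsub>A\<^esub>L\<in>S. restrict f S L) = a" unfolding f(2)
        by (rule A.finsum_cong') (use pc[OF Q f(1)] in auto)
      then show "restrict f S \<in> (\<Pi>\<^sub>E L\<in>S. L) \<and> a = (\<Oplus>\<^bsub>A\<^esub>L\<in>S. restrict f S L)" using f(1) by auto
      fix g assume g: "g \<in> (\<Pi>\<^sub>E L\<in>S. L) \<and> a = (\<Oplus>\<^bsub>A\<^esub>L\<in>S. g L)"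
      then have gP: "g \<in> (\<Pi> L\<in>S. L)" by auto
      note fc = pc[OF Q f(1)] and gc = pc[OF Q gP]
      have mg: "(\<lambda>L. \<ominus>\<^bsub>A\<^esub> g L) \<in> (\<Pi> L\<in>S. L)" using li(6)[OF Qli[OF Q]] gP by auto
      have h: "(\<lambda>L. f L \<oplus>\<^bsub>A\<^esub> \<ominus>\<^bsub>A\<^esub> g L) \<in> (\<Pi> L\<in>S. L)" 
      proof (rule Pi_I)
        fix L assume "L \<in> S"
        then show "f L \<oplus>\<^bsub>A\<^esub> \<ominus>\<^bsub>A\<^esub> g L \<in> L"
          using li(3)[OF Qli[OF Q], of L "f L" "\<ominus>\<^bsub>A\<^esub> g L"] f(1) mg by (simp add: Pi_iff)
      qed
      have sc: "(\<Oplus>\<^bsub>A\<^esub>L\<in>S. \<ominus>\<^bsub>A\<^esub> g L) = \<ominus>\<^bsub>A\<^esub> (\<Oplus>\<^bsub>A\<^esub>L\<in>S. g L)"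
        by (rule additive_finsum[symmetric, of A A "\<lambda>x. \<ominus>\<^bsub>A\<^esub> x"])
          (use gc A.is_abelian_group in \<open>auto simp: A.minus_add Pi_iff\<close>)
      have "(\<Oplus>\<^bsub>A\<^esub>L\<in>S. f L \<oplus>\<^bsub>A\<^esub> \<ominus>\<^bsub>A\<^esub> g L) = (\<Oplus>\<^bsub>A\<^esub>L\<in>S. f L) \<oplus>\<^bsub>A\<^esub> (\<Oplus>\<^bsub>A\<^esub>L\<in>S. \<ominus>\<^bsub>A\<^esub> g L)"
        by (rule A.finsum_addf) (use fc gc in auto)
      also have "\<dots> = a \<oplus>\<^bsub>A\<^esub> \<ominus>\<^bsub>A\<^esub> a" unfolding sc using g f(2) by simp
      also have "\<dots> = \<zero>\<^bsub>A\<^esub>" using \<open>a \<in> carrier A\<close> by (rule A.r_neg)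
      finally have z: "\<forall>L\<in>S. f L \<oplus>\<^bsub>A\<^esub> \<ominus>\<^bsub>A\<^esub> g L = \<zero>\<^bsub>A\<^esub>"
        using Q h unfolding Q_def indep_def by blast
      show "g = restrict f S"
      proof (rule extensionalityI[of _ S])
        show "g \<in> extensional S" using g by (auto simp: PiE_def)
        fix L assume L: "L \<in> S"
        then have "f L \<oplus>\<^bsub>A\<^esub> \<ominus>\<^bsub>A\<^esub> g L = \<zero>\<^bsub>A\<^esub>" "f L \<in> carrier A" "g L \<in> carrier A" using z fc gc by auto
        then have "f L = g L" using A.minus_equality[of "f L" "\<ominus>\<^bsub>A\<^esub> g L"] by simp
        then show "g L = restrict f S L" using L by simp
      qed simp
    qed
  qed
qed

lemma alg_hom_left_ideal:
  assumes A: "assoc_algebra A" and B: "assoc_algebra B" and h: "alg_hom A B h" and surj: "h ` carrier A = carrier B"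
    and L: "left_ideal A L"
  shows "left_ideal B (h ` L)"
proof (rule left_idealI[OF B])
  note li = left_idealD[OF A L] and hD = alg_homD[OF h]
  show "h ` L \<subseteq> carrier B" using li(1) surj by blast
  show "\<zero>\<^bsub>B\<^esub> \<in> h ` L" using alg_hom_zero_minus(1)[OF A B h] li(2) by (metis imageI)
  fix x assume "x \<in> h ` L"
  then obtain u where u: "u \<in> L" "x = h u" by blast
  then have uc: "u \<in> carrier A" using li(1) by blast
  {
    fix y assume "y \<in> h ` L"
    then obtain v where v: "v \<in> L" "y = h v" by blast
    then have "x \<oplus>\<^bsub>B\<^esub> y = h (u \<oplus>\<^bsub>A\<^esub> v)" using hD(3)[of u v] u uc li(1) by auto
    then show "x \<oplus>\<^bsub>B\<^esub> y \<in> h ` L" using li(3)[OF u(1) v(1)] by simp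
  next
    fix b assume "b \<in> carrier B"
    then obtain a where a: "a \<in> carrier A" "b = h a" using surj by blast
    then have "b \<otimes>\<^bsub>B\<^esub> x = h (a \<otimes>\<^bsub>A\<^esub> u)" using hD(2)[of a u] u uc by simp
    then show "b \<otimes>\<^bsub>B\<^esub> x \<in> h ` L" using li(4)[OF a(1) u(1)] by simp
  }
qed

lemma alg_hom_inverse:
  assumes A: "assoc_algebra A" and h: "alg_hom A B h" and bij: "bij_betw h (carrier A) (carrier B)"
  shows "alg_hom B A (inv_into (carrier A) h)"
proof -
  interpret A: ring A by (rule assoc_algebraD[OF A])
  note VA = vectorspaceD[OF assoc_algebraD(2)[OF A]] and hD = alg_homD[OF h]
  let ?g = "inv_into (carrier A) h"
  have g: "?g (h x) = x" if "x \<in> carrier A" for x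
    using bij that by (rule bij_betw_inv_into_left)
  have ex: "\<exists>x\<in>carrier A. y = h x" if "y \<in> carrier B" for y using bij that unfolding bij_betw_def by blast
  show ?thesis unfolding alg_hom_def
  proof (intro conjI ballI allI)
    show "?g \<one>\<^bsub>B\<^esub> = \<one>\<^bsub>A\<^esub>" using g[of "\<one>\<^bsub>A\<^esub>"] hD(5) by simp
    fix x c assume "x \<in> carrier B"
    then obtain u where u: "u \<in> carrier A" "x = h u" using ex by blast
    show "?g x \<in> carrier A" using u g by simp
    show "?g (c \<odot>\<^bsub>B\<^esub> x) = c \<odot>\<^bsub>A\<^esub> ?g x" using u g hD(4)[OF u(1), of c] VA(2)[OF u(1), of c] by metis
    fix y assume "y \<in> carrier B"
    then obtain v where v: "v \<in> carrier A" "y = h v" using ex by blast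
    show "?g (x \<otimes>\<^bsub>B\<^esub> y) = ?g x \<otimes>\<^bsub>A\<^esub> ?g y" using u v g hD(2)[OF u(1) v(1)] A.m_closed by metis
    show "?g (x \<oplus>\<^bsub>B\<^esub> y) = ?g x \<oplus>\<^bsub>A\<^esub> ?g y" using u v g hD(3)[OF u(1) v(1)] A.a_closed by metis
  qed
qed

section \<open>Groupoid algebras\<close>

text \<open>Reduces linear statements about the groupoid algebra to single arrows, its basis
  vectors.\<close>

lemma supported_induct [consumes 2, case_names zero dlt add smult]:
  fixes f :: "'m \<Rightarrow> 'k::field"
  assumes S: "finite S" and f: "f \<in> supported S"
    and z: "P 0" and d: "\<And>m. m \<in> S \<Longrightarrow> P (dlt m)"
    and a: "\<And>f g. f \<in> supported S \<Longrightarrow> g \<in> supported S \<Longrightarrow> P f \<Longrightarrow> P g \<Longrightarrow> P (f + g)"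
    and s: "\<And>c f. f \<in> supported S \<Longrightarrow> P f \<Longrightarrow> P (\<lambda>u. c * f u)"
  shows "P f"
proof -
  have ds: "(\<lambda>u. c * dlt m u) \<in> (supported S :: ('m \<Rightarrow> 'k) set)" if "m \<in> S" for m c
    using that by (auto simp: supported_def dlt_def)
  have Pd: "P (\<lambda>u. c * dlt m u)" if "m \<in> S" for m c
    by (rule s) (use that ds[of m 1] d in auto)
  have "P (\<Sum>m\<in>T. (\<lambda>u. f m * dlt m u)) \<and> (\<Sum>m\<in>T. (\<lambda>u. f m * dlt m u)) \<in> supported S"
    if "finite T" "T \<subseteq> S" for T
    using that
  proof induction
    case empty
    show ?case unfolding sum.empty using z fv.subspace_0[OF subspace_supported] by blast
  next
    case (insert m T)
    let ?r = "\<Sum>m\<in>T. (\<lambda>u. f m * dlt m u)"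
    have r: "P ?r" "?r \<in> supported S" using insert by auto
    have m: "m \<in> S" using insert by auto
    have "P ((\<lambda>u. f m * dlt m u) + ?r)" by (rule a[OF ds[OF m] r(2) Pd[OF m] r(1)])
    moreover have "(\<lambda>u. f m * dlt m u) + ?r \<in> supported S"
      by (rule fv.subspace_add[OF subspace_supported ds[OF m] r(2)])
    ultimately show ?case unfolding sum.insert[OF insert.hyps] by blast
  qed
  from this[OF S subset_refl] show ?thesis using supported_sum_dlt[OF S f] by metis
qed

lemma fun_zero_fold [simp]: "(\<lambda>_. 0) = (0 :: 'm \<Rightarrow> 'k::zero)"
  by (simp add: zero_fun_def)

text \<open>Composition is a total function whose laws are asked for composable pairs only;
  \<open>cmp m n\<close> means \<open>m\<close> after \<open>n\<close>, whence the condition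
  \<open>src m = tgt n\<close>.\<close>

locale fin_groupoid =
  fixes Ar :: "'m set" and Ob :: "'x set" and src tgt :: "'m \<Rightarrow> 'x"
    and cmp :: "'m \<Rightarrow> 'm \<Rightarrow> 'm" and idn :: "'x \<Rightarrow> 'm" and ivs :: "'m \<Rightarrow> 'm"
  assumes fin_Ar: "finite Ar" and fin_Ob: "finite Ob"
    and src_Ob: "\<And>m. m \<in> Ar \<Longrightarrow> src m \<in> Ob" and tgt_Ob: "\<And>m. m \<in> Ar \<Longrightarrow> tgt m \<in> Ob"
    and cmp_Ar: "\<And>m n. m \<in> Ar \<Longrightarrow> n \<in> Ar \<Longrightarrow> src m = tgt n \<Longrightarrow> cmp m n \<in> Ar"
    and src_cmp: "\<And>m n. m \<in> Ar \<Longrightarrow> n \<in> Ar \<Longrightarrow> src m = tgt n \<Longrightarrow> src (cmp m n) = src n"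
    and tgt_cmp: "\<And>m n. m \<in> Ar \<Longrightarrow> n \<in> Ar \<Longrightarrow> src m = tgt n \<Longrightarrow> tgt (cmp m n) = tgt m"
    and cmp_assoc: "\<And>l m n. l \<in> Ar \<Longrightarrow> m \<in> Ar \<Longrightarrow> n \<in> Ar \<Longrightarrow> src l = tgt m \<Longrightarrow> src m = tgt n \<Longrightarrow>
      cmp (cmp l m) n = cmp l (cmp m n)"
    and idn_Ar: "\<And>x. x \<in> Ob \<Longrightarrow> idn x \<in> Ar"
    and src_idn: "\<And>x. x \<in> Ob \<Longrightarrow> src (idn x) = x" and tgt_idn: "\<And>x. x \<in> Ob \<Longrightarrow> tgt (idn x) = x"
    and idn_left: "\<And>m. m \<in> Ar \<Longrightarrow> cmp (idn (tgt m)) m = m"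
    and idn_right: "\<And>m. m \<in> Ar \<Longrightarrow> cmp m (idn (src m)) = m"
    and ivs_Ar: "\<And>m. m \<in> Ar \<Longrightarrow> ivs m \<in> Ar"
    and src_ivs: "\<And>m. m \<in> Ar \<Longrightarrow> src (ivs m) = tgt m" and tgt_ivs: "\<And>m. m \<in> Ar \<Longrightarrow> tgt (ivs m) = src m"
    and cmp_ivs: "\<And>m. m \<in> Ar \<Longrightarrow> cmp m (ivs m) = idn (tgt m)"
    and ivs_cmp: "\<And>m. m \<in> Ar \<Longrightarrow> cmp (ivs m) m = idn (src m)"
begin

lemmas groupoid_simps = src_Ob tgt_Ob cmp_Ar src_cmp tgt_cmp idn_Ar src_idn tgt_idn idn_left idn_right
  ivs_Ar src_ivs tgt_ivs cmp_ivs ivs_cmp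

text \<open>Convolution, summed over all pairs of arrows with 0 for those that do not compose. This
  makes bilinearity termwise, so that the algebra laws need checking on arrows only.\<close>

definition gm :: "('m \<Rightarrow> 'k::field) \<Rightarrow> ('m \<Rightarrow> 'k) \<Rightarrow> 'm \<Rightarrow> 'k" where
  "gm a b = (\<lambda>m. \<Sum>p\<in>Ar. \<Sum>q\<in>Ar. if src p = tgt q \<and> cmp p q = m then a p * b q else 0)"

definition gone :: "'m \<Rightarrow> 'k::field" where
  "gone = (\<Sum>x\<in>Ob. dlt (idn x))"

definition galg :: "('k::field, 'm \<Rightarrow> 'k) module" where
  "galg = \<lparr>carrier = supported Ar, mult = gm, one = gone, zero = 0, add = (+), smult = (\<lambda>c f u. c * f u)\<rparr>"

lemma galg_simps:
  "carrier galg = supported Ar" "mult galg = gm" "one galg = gone" "zero galg = 0" "add galg = (+)"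
  "smult galg = (\<lambda>c f u. c * f u)"
  by (simp_all add: galg_def)

lemma gm_add_left: "gm (a + a') b = gm a b + gm a' b"
  unfolding gm_def fun_eq_iff plus_fun_apply sum.distrib[symmetric]
  by (intro allI sum.cong refl) (simp add: distrib_left distrib_right)

lemma gm_add_right: "gm a (b + b') = gm a b + gm a b'"
  unfolding gm_def fun_eq_iff plus_fun_apply sum.distrib[symmetric]
  by (intro allI sum.cong refl) (simp add: distrib_left distrib_right)

lemma gm_smult_left: "gm (\<lambda>u. c * a u) b = (\<lambda>u. c * gm a b u)"
  unfolding gm_def fun_eq_iff sum_distrib_left
  by (intro allI sum.cong refl) (simp add: mult_ac)

lemma gm_smult_right: "gm a (\<lambda>u. c * b u) = (\<lambda>u. c * gm a b u)"
  unfolding gm_def fun_eq_iff sum_distrib_left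
  by (intro allI sum.cong refl) (simp add: mult_ac)

lemma gm_zero [simp]: "gm 0 b = 0" "gm a 0 = 0"
  by (auto simp: gm_def fun_eq_iff)

lemma gm_sum_left: "gm (\<Sum>i\<in>I. a i) b = (\<Sum>i\<in>I. gm (a i) b)"
  by (induction I rule: infinite_finite_induct)
    (simp_all only: sum.infinite sum.empty sum.insert gm_zero gm_add_left not_False_eq_True)

lemma gm_sum_right: "gm a (\<Sum>i\<in>I. b i) = (\<Sum>i\<in>I. gm a (b i))"
  by (induction I rule: infinite_finite_induct)
    (simp_all only: sum.infinite sum.empty sum.insert gm_zero gm_add_right not_False_eq_True)

lemma gm_dlt:
  assumes "p \<in> Ar" "q \<in> Ar"
  shows "gm (dlt p) (dlt q) = (if src p = tgt q then dlt (cmp p q) else (0 :: 'm \<Rightarrow> 'k::field))"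
proof
  fix m
  have "gm (dlt p) (dlt q) m = (\<Sum>p'\<in>Ar. \<Sum>q'\<in>Ar. if q' = q then if p' = p then
      if src p = tgt q \<and> cmp p q = m then 1 else 0 else (0::'k) else 0)"
    unfolding gm_def by (intro sum.cong refl) (auto simp: dlt_def)
  also have "\<dots> = (if src p = tgt q \<and> cmp p q = m then 1 else 0)"
    using assms fin_Ar by simp
  finally show "gm (dlt p) (dlt q) m = (if src p = tgt q then dlt (cmp p q) else (0 :: 'm \<Rightarrow> 'k)) m"
    by (auto simp: dlt_def)
qed

lemma dlt_closed: "m \<in> Ar \<Longrightarrow> dlt m \<in> supported Ar"
  by (auto simp: supported_def dlt_def)

lemma gm_closed: "gm a b \<in> supported Ar"
proof -
  have "gm a b m = 0" if m: "m \<notin> Ar" for m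
    unfolding gm_def by (intro sum.neutral ballI) (use cmp_Ar m in auto)
  then show ?thesis by (simp add: supported_def)
qed

lemma gm_assoc:
  assumes a: "a \<in> supported Ar" and b: "b \<in> supported Ar" and c: "(c :: 'm \<Rightarrow> 'k::field) \<in> supported Ar"
  shows "gm (gm a b) c = gm a (gm b c)"
  using fin_Ar a
proof (induction rule: supported_induct)
  case (dlt l)
  show ?case using fin_Ar b
  proof (induction rule: supported_induct)
    case (dlt m)
    show ?case using fin_Ar c
    proof (induction rule: supported_induct)
      case (dlt n)
      show ?case
        using \<open>l \<in> Ar\<close> \<open>m \<in> Ar\<close> \<open>n \<in> Ar\<close>
        by (auto simp: gm_dlt cmp_assoc groupoid_simps)
    qed (simp_all only: gm_zero gm_add_right gm_smult_right)
  qed (simp_all only: gm_zero gm_add_right gm_smult_right gm_add_left gm_smult_left)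
qed (simp_all only: gm_zero gm_add_left gm_smult_left)

lemma gone_closed: "gone \<in> supported Ar"
  unfolding gone_def by (rule fv.subspace_sum[OF subspace_supported]) (rule dlt_closed[OF idn_Ar])

lemma gm_gone:
  assumes "(a :: 'm \<Rightarrow> 'k::field) \<in> supported Ar"
  shows "gm gone a = a" "gm a gone = a"
proof -
  show "gm gone a = a" using fin_Ar assms
  proof (induction rule: supported_induct)
    case (dlt m)
    have "gm gone (dlt m) = (\<Sum>x\<in>Ob. if x = tgt m then dlt m else (0 :: 'm \<Rightarrow> 'k))"
      unfolding gone_def gm_sum_left by (rule sum.cong) (use dlt in \<open>auto simp: gm_dlt groupoid_simps\<close>)
    then show ?case using fin_Ob tgt_Ob[OF dlt] by simp
  qed (simp_all only: gm_zero gm_add_right gm_smult_right)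
  show "gm a gone = a" using fin_Ar assms
  proof (induction rule: supported_induct)
    case (dlt m)
    have "gm (dlt m) gone = (\<Sum>x\<in>Ob. if x = src m then dlt m else (0 :: 'm \<Rightarrow> 'k))"
      unfolding gone_def gm_sum_right by (rule sum.cong) (use dlt in \<open>auto simp: gm_dlt groupoid_simps\<close>)
    then show ?case using fin_Ob src_Ob[OF dlt] by simp
  qed (simp_all only: gm_zero gm_add_left gm_smult_left)
qed

lemma assoc_algebra_galg: "assoc_algebra (galg :: ('k::field, 'm \<Rightarrow> 'k) module)"
proof -
  let ?A = "galg :: ('k, 'm \<Rightarrow> 'k) module"
  note sub = subspace_supported[of Ar]
  have ag: "abelian_group ?A"
  proof (rule abelian_groupI, unfold galg_simps)
    fix f :: "'m \<Rightarrow> 'k" assume f: "f \<in> supported Ar"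
    show "\<exists>g\<in>supported Ar. g + f = 0"
      by (rule bexI[of _ "- f"]) (use fv.subspace_neg[OF sub f] in auto)
  qed (simp_all only: fv.subspace_add[OF sub] fv.subspace_0[OF sub] add.assoc add.commute add_0_left add_0_right add.left_commute)
  have vs: "vectorspace class_ring ?A"
  proof (rule vectorspaceI[OF ag]; unfold galg_simps)
    show "(\<lambda>u. c * v u) \<in> supported Ar" if "v \<in> supported Ar" for c and v :: "'m \<Rightarrow> 'k"
      by (rule fv.subspace_scale[OF sub that])
    fix c d :: 'k and v w :: "'m \<Rightarrow> 'k"
    show "(\<lambda>u. (c + d) * v u) = (\<lambda>u. c * v u) + (\<lambda>u. d * v u)"
      by (rule ext) (simp only: plus_fun_apply distrib_right)
    show "(\<lambda>u. c * (v + w) u) = (\<lambda>u. c * v u) + (\<lambda>u. c * w u)"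
      by (rule ext) (simp only: plus_fun_apply distrib_left)
    show "(\<lambda>u. c * d * v u) = (\<lambda>u. c * (d * v u))"
      by (rule ext) (simp only: mult.assoc)
    show "(\<lambda>u. 1 * v u) = v"
      by (rule ext) (simp only: mult_1)
  qed
  have rg: "ring ?A"
    by (rule ringI[OF ag]; (rule monoidI)?; unfold galg_simps)
      (simp_all add: gm_closed gone_closed gm_assoc gm_gone gm_add_left gm_add_right)
  show ?thesis unfolding assoc_algebra_def using rg vs
    by (simp add: galg_simps gm_smult_left gm_smult_right)
qed

lemma galg_left_ideal_subspace:
  assumes "left_ideal (galg :: ('k::field, 'm \<Rightarrow> 'k) module) L"
  shows "fv.subspace L" "L \<subseteq> supported Ar"
  using left_idealD(1,2,3,5)[OF assoc_algebra_galg assms] unfolding fv.subspace_def galg_simps by blast+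

lemma galg_dim_less:
  assumes "left_ideal (galg :: ('k::field, 'm \<Rightarrow> 'k) module) L" "left_ideal galg L'" "L \<subset> L'"
  shows "fv.dim L < fv.dim L'"
  by (rule dim_less_if_psubset[OF fin_Ar galg_left_ideal_subspace(1)[OF assms(1)]
        galg_left_ideal_subspace(1)[OF assms(2)] assms(3) galg_left_ideal_subspace(2)[OF assms(2)]])

text \<open>Maschke: a linear projection onto a left ideal is averaged over the arrows with a common target.\<close>

lemma galg_complement:
  fixes L :: "('m \<Rightarrow> 'k::field) set"
  assumes char_0: "\<And>n. n \<noteq> 0 \<Longrightarrow> of_nat n \<noteq> (0 :: 'k)" and L: "left_ideal galg L"
  shows "\<exists>C. left_ideal galg C \<and> L \<inter> C = {0} \<and> (\<forall>a\<in>supported Ar. \<exists>x\<in>L. \<exists>y\<in>C. a = x + y)"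
proof -
  note LD = left_idealD[OF assoc_algebra_galg L, unfolded galg_simps]
  note Ls = galg_left_ideal_subspace[OF L]
  obtain \<pi> where \<pi>: "\<And>v. \<pi> v \<in> L" "\<And>v. v \<in> L \<Longrightarrow> \<pi> v = v" "\<And>v w. \<pi> (v + w) = \<pi> v + \<pi> w"
    "\<And>c v. \<pi> (\<lambda>u. c * v u) = (\<lambda>u. c * \<pi> v u)"
    using projection_exists[OF Ls(1)] by blast
  \<comment> \<open>The weight of an arrow is one over the number of arrows with the same target;
    \<open>cc\<close> below shows that this number does not change along an arrow.\<close>
  define c :: "'x \<Rightarrow> 'k" where "c x = 1 / of_nat (card {m\<in>Ar. tgt m = x})" for x
  \<comment> \<open>The projection conjugated by the arrow \<open>m\<close>: carried back along
    \<open>m\<close>, projected, and carried forward again.\<close>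
  define \<phi> where "\<phi> m v = gm (dlt m) (\<pi> (gm (dlt (ivs m)) v))" for m v
  define \<psi> where "\<psi> v = (\<Sum>m\<in>Ar. (\<lambda>u. c (tgt m) * \<phi> m v u))" for v
  have \<phi>L: "\<phi> m v \<in> L" if "m \<in> Ar" for m v
    unfolding \<phi>_def by (rule LD(4)[OF dlt_closed[OF that] \<pi>(1)])
  have \<psi>L: "\<psi> v \<in> L" for v
    unfolding \<psi>_def by (rule fv.subspace_sum[OF Ls(1)], rule fv.subspace_scale[OF Ls(1)], rule \<phi>L)
  have \<psi>_add: "\<psi> (v + w) = \<psi> v + \<psi> w" for v w
    unfolding \<psi>_def \<phi>_def gm_add_right \<pi>(3) sum.distrib[symmetric]
    by (rule sum.cong) (auto simp: fun_eq_iff algebra_simps)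
  have tsum: "(\<Sum>m\<in>Ar. F m) = (\<Sum>x\<in>Ob. \<Sum>m\<in>{m\<in>Ar. tgt m = x}. F m)" for F :: "'m \<Rightarrow> 'm \<Rightarrow> 'k"
    by (rule sum.group[OF fin_Ar fin_Ob, symmetric]) (rule image_subsetI, rule tgt_Ob)
  have \<psi>_id: "\<psi> v = v" if v: "v \<in> L" for v
  proof -
    have vs: "v \<in> supported Ar" using v Ls by blast
    have e: "\<phi> m v = gm (dlt (idn (tgt m))) v" if m: "m \<in> Ar" for m
    proof -
      have "gm (dlt (ivs m)) v \<in> L" by (rule LD(4)[OF dlt_closed[OF ivs_Ar[OF m]] v])
      then have "\<phi> m v = gm (dlt m) (gm (dlt (ivs m)) v)" unfolding \<phi>_def by (simp add: \<pi>(2))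
      also have "\<dots> = gm (gm (dlt m) (dlt (ivs m))) v"
        by (rule gm_assoc[symmetric]) (use m vs in \<open>auto intro: dlt_closed ivs_Ar\<close>)
      also have "\<dots> = gm (dlt (idn (tgt m))) v" using m by (simp add: gm_dlt groupoid_simps)
      finally show ?thesis .
    qed
    have "\<psi> v = (\<Sum>x\<in>Ob. \<Sum>m\<in>{m\<in>Ar. tgt m = x}. (\<lambda>u. c x * gm (dlt (idn x)) v u))"
      unfolding \<psi>_def tsum by (intro sum.cong refl) (auto simp: e)
    also have "\<dots> = (\<Sum>x\<in>Ob. gm (dlt (idn x)) v)"
    proof (rule sum.cong[OF refl])
      fix x assume x: "x \<in> Ob"
      then have "idn x \<in> {m\<in>Ar. tgt m = x}" by (simp add: groupoid_simps)
      then have "card {m\<in>Ar. tgt m = x} \<noteq> 0" using fin_Ar by auto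
      then have "of_nat (card {m\<in>Ar. tgt m = x}) \<noteq> (0 :: 'k)" by (rule char_0)
      then show "(\<Sum>m\<in>{m\<in>Ar. tgt m = x}. (\<lambda>u. c x * gm (dlt (idn x)) v u)) = gm (dlt (idn x)) v"
        by (simp add: fun_eq_iff sum_fun_apply c_def)
    qed
    also have "\<dots> = gm gone v" by (simp add: gone_def gm_sum_left)
    also have "\<dots> = v" by (rule gm_gone(1)[OF vs])
    finally show ?thesis .
  qed
  have \<psi>_equiv: "\<psi> (gm (dlt g) v) = gm (dlt g) (\<psi> v)" if g: "g \<in> Ar" and v: "v \<in> supported Ar" for g v
  proof -
    \<comment> \<open>Composition with \<open>g\<close> permutes the terms of the average, from the
      arrows ending at its source to those ending at its target. All other terms vanish because they
      are not composable.\<close>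
    have bij: "bij_betw (\<lambda>m. cmp g m) {m\<in>Ar. tgt m = src g} {m\<in>Ar. tgt m = tgt g}"
    proof (rule bij_betw_byWitness[of _ "\<lambda>m. cmp (ivs g) m"])
      show "\<forall>m\<in>{m\<in>Ar. tgt m = src g}. cmp (ivs g) (cmp g m) = m"
        using g by (auto simp: cmp_assoc[symmetric] groupoid_simps) (metis idn_left)
      show "\<forall>m\<in>{m\<in>Ar. tgt m = tgt g}. cmp g (cmp (ivs g) m) = m"
        using g by (auto simp: cmp_assoc[symmetric] groupoid_simps) (metis idn_left)
    qed (use g in \<open>auto simp: groupoid_simps\<close>)
    have cc: "c (tgt g) = c (src g)" unfolding c_def using bij_betw_same_card[OF bij] by simp
    have zer: "\<phi> m (gm (dlt g) v) = 0" if m: "m \<in> Ar" "tgt m \<noteq> tgt g" for m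
    proof -
      have "gm (dlt (ivs m)) (gm (dlt g) v) = gm (gm (dlt (ivs m)) (dlt g)) v"
        by (rule gm_assoc[symmetric]) (use m g v in \<open>auto intro: dlt_closed ivs_Ar\<close>)
      also have "\<dots> = 0" using m g by (simp add: gm_dlt groupoid_simps)
      finally show ?thesis unfolding \<phi>_def using \<pi>(2)[OF LD(2)] by simp
    qed
    have zer': "gm (dlt g) (\<phi> m v) = 0" if m: "m \<in> Ar" "tgt m \<noteq> src g" for m
    proof -
      have "gm (dlt g) (\<phi> m v) = gm (gm (dlt g) (dlt m)) (\<pi> (gm (dlt (ivs m)) v))"
        unfolding \<phi>_def by (rule gm_assoc[symmetric]) (use m g \<pi>(1) Ls in \<open>auto intro: dlt_closed\<close>)
      then show ?thesis using m g by (simp add: gm_dlt)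
    qed
    have tr: "\<phi> (cmp g m) (gm (dlt g) v) = gm (dlt g) (\<phi> m v)" if m: "m \<in> Ar" "tgt m = src g" for m
    proof -
      \<comment> \<open>Inverses are given through their two cancellation laws, so (g m)^-1 g = m^-1
        is obtained by composing with m m^-1 on the right and regrouping.\<close>
      have ic: "cmp (ivs (cmp g m)) g = ivs m"
      proof -
        have gm': "cmp g m \<in> Ar" using g m by (simp add: groupoid_simps)
        have il: "cmp (idn (src m)) (ivs m) = ivs m"
          using idn_left[OF ivs_Ar[OF m(1)]] unfolding tgt_ivs[OF m(1)] .
        have "cmp (ivs (cmp g m)) g \<in> Ar" "src (cmp (ivs (cmp g m)) g) = src g"
          using g m gm' by (simp_all add: groupoid_simps)
        then have ir: "cmp (cmp (ivs (cmp g m)) g) (idn (src g)) = cmp (ivs (cmp g m)) g"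
          using idn_right by metis
        have "cmp (cmp (ivs (cmp g m)) g) (cmp m (ivs m)) = cmp (cmp (cmp (ivs (cmp g m)) g) m) (ivs m)"
          by (rule cmp_assoc[symmetric]) (use g m gm' in \<open>simp_all add: groupoid_simps\<close>)
        also have "cmp (cmp (ivs (cmp g m)) g) m = cmp (ivs (cmp g m)) (cmp g m)"
          by (rule cmp_assoc) (use g m gm' in \<open>simp_all add: groupoid_simps\<close>)
        also have "cmp (ivs (cmp g m)) (cmp g m) = idn (src m)"
          using g m gm' by (simp add: groupoid_simps)
        finally have "cmp (cmp (ivs (cmp g m)) g) (cmp m (ivs m)) = cmp (idn (src m)) (ivs m)" .
        then show ?thesis unfolding cmp_ivs[OF m(1)] m(2) ir il .
      qed
      have "gm (dlt (ivs (cmp g m))) (gm (dlt g) v) = gm (gm (dlt (ivs (cmp g m))) (dlt g)) v"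
        by (rule gm_assoc[symmetric]) (use m g v in \<open>auto intro!: dlt_closed ivs_Ar cmp_Ar\<close>)
      also have "\<dots> = gm (dlt (ivs m)) v" using m g by (simp add: gm_dlt groupoid_simps ic)
      finally have "\<phi> (cmp g m) (gm (dlt g) v) = gm (dlt (cmp g m)) (\<pi> (gm (dlt (ivs m)) v))"
        unfolding \<phi>_def by simp
      also have "dlt (cmp g m) = gm (dlt g) (dlt m :: 'm \<Rightarrow> 'k)" using m g by (simp add: gm_dlt)
      also have "gm (gm (dlt g) (dlt m)) (\<pi> (gm (dlt (ivs m)) v)) = gm (dlt g) (\<phi> m v)"
        unfolding \<phi>_def by (rule gm_assoc) (use m g \<pi>(1) Ls in \<open>auto intro: dlt_closed\<close>)
      finally show ?thesis .
    qed
    have "\<psi> (gm (dlt g) v) = (\<Sum>m\<in>{m\<in>Ar. tgt m = tgt g}. (\<lambda>u. c (tgt m) * \<phi> m (gm (dlt g) v) u))"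
      unfolding \<psi>_def by (rule sum.mono_neutral_right) (use fin_Ar zer in \<open>auto simp: fun_eq_iff\<close>)
    also have "\<dots> = (\<Sum>m\<in>{m\<in>Ar. tgt m = src g}. (\<lambda>u. c (tgt (cmp g m)) * \<phi> (cmp g m) (gm (dlt g) v) u))"
      by (rule sum.reindex_bij_betw[OF bij, symmetric])
    also have "\<dots> = (\<Sum>m\<in>{m\<in>Ar. tgt m = src g}. (\<lambda>u. c (tgt m) * gm (dlt g) (\<phi> m v) u))"
      by (rule sum.cong) (use g in \<open>auto simp: tr cc tgt_cmp\<close>)
    also have "\<dots> = (\<Sum>m\<in>Ar. (\<lambda>u. c (tgt m) * gm (dlt g) (\<phi> m v) u))"
      by (rule sum.mono_neutral_left) (use fin_Ar zer' in \<open>auto simp: fun_eq_iff\<close>)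
    also have "\<dots> = gm (dlt g) (\<psi> v)" unfolding \<psi>_def gm_sum_right gm_smult_right ..
    finally show ?thesis .
  qed
  define C where "C = {v \<in> supported Ar. \<psi> v = 0}"
  have \<psi>0: "\<psi> 0 = 0" using \<psi>_id[OF LD(2)] .
  have C: "left_ideal galg C"
  proof (rule left_idealI[OF assoc_algebra_galg], unfold galg_simps)
    show "C \<subseteq> supported Ar" by (auto simp: C_def)
    show "0 \<in> C" using \<psi>0 fv.subspace_0[OF subspace_supported] by (simp add: C_def)
    show add: "x + y \<in> C" if "x \<in> C" "y \<in> C" for x y
      using that by (simp add: C_def \<psi>_add fv.subspace_add[OF subspace_supported])
    have sc: "(\<lambda>u. k * x u) \<in> C" if "x \<in> C" for x k
    proof -
      have "\<psi> (\<lambda>u. k * x u) = (\<lambda>u. k * \<psi> x u)"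
        unfolding \<psi>_def \<phi>_def gm_smult_right \<pi>(4) fun_eq_iff sum_fun_apply sum_distrib_left
        by (intro allI sum.cong refl mult.left_commute)
      then show ?thesis
        using that fv.subspace_scale[OF subspace_supported, of x Ar k] by (simp add: C_def fun_eq_iff)
    qed
    show "gm a x \<in> C" if "a \<in> supported Ar" "x \<in> C" for a x
      using fin_Ar that(1)
    proof (induction rule: supported_induct)
      case zero
      then show ?case using \<open>0 \<in> C\<close> by simp
    next
      case (dlt m)
      then show ?case using \<open>x \<in> C\<close> \<psi>_equiv[of m x] gm_closed by (simp add: C_def)
    next
      case (add f g)
      show ?case unfolding gm_add_left
        by (rule \<open>\<And>y x. x \<in> C \<Longrightarrow> y \<in> C \<Longrightarrow> x + y \<in> C\<close>) (fact add)+
    next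
      case (smult k f)
      show ?case unfolding gm_smult_left by (rule sc) (fact smult)
    qed
  qed
  moreover have "L \<inter> C = {0}"
  proof
    show "L \<inter> C \<subseteq> {0}" using \<psi>_id by (auto simp: C_def)
    show "{0} \<subseteq> L \<inter> C" using LD(2) left_idealD(2)[OF assoc_algebra_galg C] by (simp add: galg_simps)
  qed
  moreover have "\<exists>x\<in>L. \<exists>y\<in>C. a = x + y" if a: "a \<in> supported Ar" for a
  proof (intro bexI)
    \<comment> \<open>The averaged map is an equivariant projection onto \<open>L\<close>, so the
      complement is its kernel.\<close>
    show "a = \<psi> a + (a - \<psi> a)" by simp
    have "\<psi> a = \<psi> (\<psi> a + (a - \<psi> a))" by simp
    also have "\<dots> = \<psi> a + \<psi> (a - \<psi> a)" unfolding \<psi>_add \<psi>_id[OF \<psi>L] ..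
    finally have "\<psi> (a - \<psi> a) = 0" by simp
    then show "a - \<psi> a \<in> C"
      using fv.subspace_diff[OF subspace_supported a, of "\<psi> a"] \<psi>L[of a] Ls(2) by (simp add: C_def subset_iff)
  qed (rule \<psi>L)
  ultimately show ?thesis by blast
qed

end

section \<open>The groupoid of restrictions of a reflection group\<close>

text \<open>
  The restriction of \<open>w\<close> to \<open>x\<close>, as a partial map: its domain and range are \<open>x\<close> and \<open>w ` x\<close>, and
  \<open>pm w x = pm u x\<close> iff \<open>w\<close> and \<open>u\<close> differ by the pointwise stabilizer of \<open>x\<close>.
\<close>

definition pm :: "('v \<Rightarrow> 'v) \<Rightarrow> 'v set \<Rightarrow> 'v \<Rightarrow> 'v option" where
  "pm w x = (\<lambda>v. if v \<in> x then Some (w v) else None)"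

lemma dom_pm [simp]: "dom (pm w x) = x"
  by (auto simp: pm_def split: if_splits)

lemma ran_pm [simp]: "ran (pm w x) = w ` x"
  by (auto simp: pm_def ran_def)

lemma pm_eq_iff: "pm w x = pm u y \<longleftrightarrow> x = y \<and> (\<forall>v\<in>x. w v = u v)"
proof
  assume e: "pm w x = pm u y"
  then have "x = y" using dom_pm by metis
  moreover have "w v = u v" if "v \<in> x" for v
    using fun_cong[OF e, of v] that \<open>x = y\<close> by (simp add: pm_def)
  ultimately show "x = y \<and> (\<forall>v\<in>x. w v = u v)" by blast
qed (auto simp: pm_def)

lemma pm_comp: "u ` x = y \<Longrightarrow> pm w y \<circ>\<^sub>m pm u x = pm (w \<circ> u) x"
  by (auto simp: pm_def map_comp_def fun_eq_iff)

locale refl_grp =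
  fixes scale :: "complex \<Rightarrow> 'v \<Rightarrow> 'v::ab_group_add" and W :: "('v \<Rightarrow> 'v) set"
  assumes crg: "complex_reflection_group scale W"
begin

abbreviation "R \<equiv> reflections scale W"
abbreviation "Hy \<equiv> hyperplanes scale W"
abbreviation "tv \<equiv> transverse scale W"

text \<open>The objects of the groupoid. A restriction to the whole space is an element of W itself,
  so this object accounts for the group algebra.\<close>

definition X :: "'v set set" where "X = insert UNIV Hy"

lemma finite_W: "finite W"
  using crg by (simp add: complex_reflection_group_def)

lemma W_linear: "w \<in> W \<Longrightarrow> Vector_Spaces.linear scale scale w"
  and W_bij: "w \<in> W \<Longrightarrow> bij w"
  using crg subgroup.subset[of W "GL scale"] by (auto simp: complex_reflection_group_def GL_def)

lemma id_W: "id \<in> W"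
  using crg subgroup.one_closed[of W "GL scale"] by (simp add: complex_reflection_group_def GL_def)

lemma comp_W: "w \<in> W \<Longrightarrow> u \<in> W \<Longrightarrow> w \<circ> u \<in> W"
  using crg subgroup.m_closed[of W "GL scale" w u] by (simp add: complex_reflection_group_def GL_def)

abbreviation "iv \<equiv> inv_into (UNIV :: 'v set)"

lemma iv_comp: "w \<in> W \<Longrightarrow> iv w \<circ> w = id" "w \<in> W \<Longrightarrow> w \<circ> iv w = id"
  using W_bij by (auto simp: fun_eq_iff bij_is_inj bij_is_surj surj_f_inv_f)

lemma iv_apply: "w \<in> W \<Longrightarrow> iv w (w v) = v" "w \<in> W \<Longrightarrow> w (iv w v) = v"
  using W_bij by (auto simp: bij_is_inj bij_is_surj surj_f_inv_f)

lemma iv_image: "w \<in> W \<Longrightarrow> iv w ` w ` x = x" "w \<in> W \<Longrightarrow> w ` iv w ` x = x"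
  by (simp_all add: image_comp iv_comp)

text \<open>Composition with \<open>w\<close> is an injective self-map of the finite set
  \<open>W\<close>, hence hits \<open>id\<close>. This identifies the inverse map of
  \<open>w\<close> as an element of \<open>W\<close> without passing through the inverse of the
  record \<open>GL\<close>.\<close>

lemma iv_W: assumes w: "w \<in> W" shows "iv w \<in> W"
proof -
  have "inj_on (\<lambda>u. w \<circ> u) W"
    by (rule inj_onI) (metis comp_assoc iv_comp(1)[OF w] id_comp)
  moreover have "(\<lambda>u. w \<circ> u) ` W \<subseteq> W" using comp_W[OF w] by blast
  ultimately have "(\<lambda>u. w \<circ> u) ` W = W" using finite_W by (simp add: endo_inj_surj)
  then obtain u where "u \<in> W" "id = w \<circ> u" using id_W by blast
  moreover have "u = iv w" using calculation iv_comp(1)[OF w] by (metis comp_assoc comp_id id_comp)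
  ultimately show ?thesis by simp
qed

lemma R_W: "s \<in> R \<Longrightarrow> s \<in> W" by (simp add: reflections_def)

lemma finite_R: "finite R"
  using finite_W by (simp add: reflections_def)

lemma finite_Hy: "finite Hy"
  using finite_R by (simp add: hyperplanes_def)

lemma finite_X: "finite X"
  using finite_Hy by (simp add: X_def)

lemma UNIV_notin_Hy: "UNIV \<notin> Hy"
  by (auto simp: hyperplanes_def reflections_def fixed_space_def fun_eq_iff)

lemma fin_dim_space: "\<exists>Basis. finite_dimensional_vector_space scale Basis"
  using crg by (simp add: complex_reflection_group_def)

lemma dim_image: assumes "w \<in> W" shows "vector_space.dim scale (w ` S) = vector_space.dim scale S"
proof -
  obtain Basis where "finite_dimensional_vector_space scale Basis" using fin_dim_space by blast
  then interpret V: finite_dimensional_vector_space scale Basis .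
  interpret V1: finite_dimensional_vector_space_pair_1 scale Basis scale by standard
  show ?thesis
    by (rule V1.dim_image_eq[OF W_linear[OF assms]]) (use W_bij[OF assms] in \<open>auto simp: bij_def intro: inj_on_subset\<close>)
qed

lemma conj_R:
  assumes w: "w \<in> W" and s: "s \<in> R"
  shows "w \<circ> s \<circ> iv w \<in> R" "fixed_space (w \<circ> s \<circ> iv w) = w ` fixed_space s"
proof -
  have sW: "s \<in> W" and sid: "s \<noteq> id" using s by (auto simp: reflections_def)
  show fs: "fixed_space (w \<circ> s \<circ> iv w) = w ` fixed_space s"
  proof -
    have "v \<in> w ` fixed_space s" if "w (s (iv w v)) = v" for v
    proof (rule image_eqI[of _ _ "iv w v"])
      show "v = w (iv w v)" using iv_apply(2)[OF w, of v] by simp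
      show "iv w v \<in> fixed_space s"
        using that iv_apply(1)[OF w, of "s (iv w v)"] by (simp add: fixed_space_def)
    qed
    then show ?thesis using iv_apply(1)[OF w] by (auto simp: fixed_space_def)
  qed
  have "w \<circ> s \<circ> iv w \<noteq> id"
  proof
    assume "w \<circ> s \<circ> iv w = id"
    then have "w ` fixed_space s = UNIV" using fs by (auto simp: fixed_space_def)
    then have "fixed_space s = UNIV" using W_bij[OF w] by (metis bij_def inj_image_eq_iff)
    then show False using sid by (auto simp: fixed_space_def fun_eq_iff)
  qed
  then show "w \<circ> s \<circ> iv w \<in> R"
    using s fs dim_image[OF w, of "fixed_space s"] comp_W iv_W w sW by (simp add: reflections_def)
qed

lemma W_Hy: "w \<in> W \<Longrightarrow> H \<in> Hy \<Longrightarrow> w ` H \<in> Hy"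
  unfolding hyperplanes_def using conj_R by (metis (no_types, lifting) imageE imageI)

lemma W_X: "w \<in> W \<Longrightarrow> x \<in> X \<Longrightarrow> w ` x \<in> X"
  using W_Hy W_bij by (auto simp: X_def bij_def)

text \<open>The fixed space contains \<open>H\<close> and is not everything, so the dimension leaves
  no room beyond \<open>H\<close>. Thus a nontrivial element of the pointwise stabilizer of
  \<open>H\<close> is one of the reflections that relation (1) lets e_H absorb.\<close>

lemma fixes_hyperplane:
  assumes w: "w \<in> W" and H: "H \<in> Hy" and fx: "\<And>v. v \<in> H \<Longrightarrow> w v = v" and ne: "w \<noteq> id"
  shows "w \<in> R" "fixed_space w = H"
proof -
  obtain Basis where "finite_dimensional_vector_space scale Basis" using fin_dim_space by blast
  then interpret V: finite_dimensional_vector_space scale Basis .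
  have subfix: "V.subspace (fixed_space u)" if "u \<in> W" for u
  proof -
    interpret u: Vector_Spaces.linear scale scale u by (rule W_linear[OF that])
    show ?thesis by (rule V.subspaceI) (auto simp: fixed_space_def u.add u.scale)
  qed
  obtain s where s: "s \<in> R" "H = fixed_space s" using H by (auto simp: hyperplanes_def)
  have sub: "H \<subseteq> fixed_space w" using fx by (auto simp: fixed_space_def)
  have "fixed_space w \<noteq> UNIV" using ne by (auto simp: fixed_space_def fun_eq_iff)
  then have lt: "V.dim (fixed_space w) < V.dim (UNIV :: 'v set)"
    using V.dim_psubset[of "fixed_space w" UNIV] subfix[OF w] V.subspace_UNIV V.span_eq_iff by (metis psubset_eq subset_UNIV)
  have sd: "Suc (V.dim H) = V.dim (UNIV :: 'v set)" using s by (simp add: reflections_def)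
  have "V.dim H \<le> V.dim (fixed_space w)" by (rule V.dim_subset[OF sub])
  then have d: "V.dim (fixed_space w) = V.dim H" using lt sd by simp
  show "fixed_space w = H"
    using V.subspace_dim_equal[OF _ subfix[OF w] sub] d subfix[OF R_W[OF s(1)]] s(2) by simp
  then show "w \<in> R" using w ne sd by (simp add: reflections_def)
qed

lemma tv_sym: "tv H1 H2 \<Longrightarrow> tv H2 H1"
  by (auto simp: transverse_def insert_commute Int_commute)

text \<open>Elements of W permute the hyperplanes and preserve inclusions and intersections, so the
  hyperplanes above the intersection correspond under \<open>w\<close>.\<close>

lemma tv_image:
  assumes w: "w \<in> W" and t: "tv H1 H2"
  shows "tv (w ` H1) (w ` H2)"
proof -
  have inj: "inj w" using W_bij[OF w] by (simp add: bij_def)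
  have ne: "w ` H1 \<noteq> w ` H2" using t inj by (simp add: transverse_def inj_image_eq_iff)
  have key: "H \<in> Hy \<and> w ` H1 \<inter> w ` H2 \<subseteq> H \<longleftrightarrow> H = w ` H1 \<or> H = w ` H2" for H
  proof -
    have "H \<in> Hy \<longleftrightarrow> iv w ` H \<in> Hy" using W_Hy[OF w] W_Hy[OF iv_W[OF w]] iv_image(2)[OF w] by metis
    moreover have "w ` H1 \<inter> w ` H2 \<subseteq> H \<longleftrightarrow> H1 \<inter> H2 \<subseteq> iv w ` H"
      unfolding image_Int[OF inj, symmetric] using iv_image[OF w] inj by (metis image_mono)
    moreover have "iv w ` H \<in> Hy \<and> H1 \<inter> H2 \<subseteq> iv w ` H \<longleftrightarrow> iv w ` H = H1 \<or> iv w ` H = H2"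
    proof -
      have "{H \<in> Hy. H1 \<inter> H2 \<subseteq> H} = {H1, H2}" using t by (simp add: transverse_def)
      from eqset_imp_iff[OF this, of "iv w ` H"] show ?thesis by simp
    qed
    ultimately show ?thesis using iv_image[OF w] by metis
  qed
  have "{H \<in> Hy. w ` H1 \<inter> w ` H2 \<subseteq> H} = {w ` H1, w ` H2}"
    by (rule Set.set_eqI) (simp only: mem_Collect_eq key insert_iff empty_iff simp_thms)
  then show ?thesis using ne by (simp only: transverse_def simp_thms not_False_eq_True)
qed

lemma tv_image_iff: "w \<in> W \<Longrightarrow> tv (w ` H1) (w ` H2) \<longleftrightarrow> tv H1 H2"
  using tv_image[of w H1 H2] tv_image[OF iv_W, of w "w ` H1" "w ` H2"] iv_image(1) by metis

definition Ar :: "('v \<Rightarrow> 'v option) set" where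
  "Ar = (\<lambda>(w, x). pm w x) ` (W \<times> X)"

lemma ArI: "w \<in> W \<Longrightarrow> x \<in> X \<Longrightarrow> pm w x \<in> Ar"
  by (auto simp: Ar_def)

lemma ArE: assumes "m \<in> Ar" obtains w x where "w \<in> W" "x \<in> X" "m = pm w x"
  using assms by (auto simp: Ar_def)

text \<open>A restriction does not remember the element it comes from, so the inverse is chosen by
  its properties; for \<open>pm w x\<close> the restriction of \<open>iv w\<close> to the image of
  \<open>x\<close> is a witness.\<close>

definition ivs :: "('v \<Rightarrow> 'v option) \<Rightarrow> 'v \<Rightarrow> 'v option" where
  "ivs m = (SOME n. n \<in> Ar \<and> dom n = ran m \<and> ran n = dom m \<and>
     m \<circ>\<^sub>m n = pm id (ran m) \<and> n \<circ>\<^sub>m m = pm id (dom m))"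

lemma ivs: assumes "m \<in> Ar"
  shows "ivs m \<in> Ar \<and> dom (ivs m) = ran m \<and> ran (ivs m) = dom m \<and>
     m \<circ>\<^sub>m ivs m = pm id (ran m) \<and> ivs m \<circ>\<^sub>m m = pm id (dom m)"
proof -
  obtain w x where m: "w \<in> W" "x \<in> X" "m = pm w x" using assms by (rule ArE)
  show ?thesis unfolding ivs_def
    by (rule someI[of _ "pm (iv w) (w ` x)"])
      (use m in \<open>simp add: ArI iv_W W_X iv_image pm_comp iv_comp id_def\<close>)
qed

sublocale fin_groupoid Ar X dom ran "(\<circ>\<^sub>m)" "pm id" ivs
proof (unfold_locales)
  show "finite Ar" by (simp add: Ar_def finite_W finite_X)
  show "finite X" by (rule finite_X)
  fix m assume m: "m \<in> Ar"
  then obtain w x where mw: "w \<in> W" "x \<in> X" "m = pm w x" by (rule ArE)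
  show "dom m \<in> X" "ran m \<in> X" using mw W_X by auto
  show "pm id (ran m) \<circ>\<^sub>m m = m" "m \<circ>\<^sub>m pm id (dom m) = m" using mw by (auto simp: pm_comp)
  show "ivs m \<in> Ar" "dom (ivs m) = ran m" "ran (ivs m) = dom m" "m \<circ>\<^sub>m ivs m = pm id (ran m)"
    "ivs m \<circ>\<^sub>m m = pm id (dom m)" using ivs[OF m] by auto
  fix n assume n: "n \<in> Ar" and mn: "dom m = ran n"
  then obtain u y where nu: "u \<in> W" "y \<in> X" "n = pm u y" by (elim ArE)
  have xy: "x = u ` y" using mn mw nu by simp
  have c: "m \<circ>\<^sub>m n = pm (w \<circ> u) y" using mw nu xy by (simp add: pm_comp)
  show "m \<circ>\<^sub>m n \<in> Ar" unfolding c by (rule ArI) (use comp_W mw nu in auto)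
  show "dom (m \<circ>\<^sub>m n) = dom n" "ran (m \<circ>\<^sub>m n) = ran m" unfolding c using mw nu xy by (auto simp: image_comp)
next
  show "l \<circ>\<^sub>m m \<circ>\<^sub>m n = l \<circ>\<^sub>m (m \<circ>\<^sub>m n)" for l m n :: "'v \<Rightarrow> 'v option"
    by (auto simp: map_comp_def fun_eq_iff split: option.splits)
qed (auto simp: ArI id_W)

definition gw :: "('v \<Rightarrow> 'v) \<Rightarrow> ('v \<Rightarrow> 'v option) \<Rightarrow> 'k::field" where
  "gw w = (\<Sum>x\<in>X. dlt (pm w x))"

lemma gw_closed: "w \<in> W \<Longrightarrow> gw w \<in> supported Ar"
  unfolding gw_def by (rule fv.subspace_sum[OF subspace_supported]) (rule dlt_closed[OF ArI])

text \<open>Exactly one of the restrictions of \<open>w\<close> starts where the given arrow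
  ends.\<close>

lemma gw_dlt:
  assumes "w \<in> W" "u \<in> W" "x \<in> X"
  shows "gm (gw w) (dlt (pm u x)) = (dlt (pm (w \<circ> u) x) :: _ \<Rightarrow> 'k::field)"
proof -
  have "gm (gw w) (dlt (pm u x)) = (\<Sum>y\<in>X. if y = u ` x then dlt (pm (w \<circ> u) x) else (0 :: _ \<Rightarrow> 'k))"
    unfolding gw_def gm_sum_left by (rule sum.cong[OF refl]) (use assms in \<open>simp add: gm_dlt ArI pm_comp\<close>)
  also have "\<dots> = dlt (pm (w \<circ> u) x)"
    unfolding sum.delta[OF finite_X] using W_X assms by simp
  finally show ?thesis .
qed

lemma dlt_gw:
  assumes "w \<in> W" "u \<in> W" "x \<in> X"
  shows "gm (dlt (pm u (w ` x))) (gw w) = (dlt (pm (u \<circ> w) x) :: _ \<Rightarrow> 'k::field)"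
proof -
  have inj: "inj w" using W_bij[OF assms(1)] by (simp add: bij_def)
  have "gm (dlt (pm u (w ` x))) (gw w) = (\<Sum>y\<in>X. if y = x then dlt (pm (u \<circ> w) x) else (0 :: _ \<Rightarrow> 'k))"
    unfolding gw_def gm_sum_right
    by (rule sum.cong[OF refl]) (use assms inj in \<open>auto simp: gm_dlt ArI pm_comp W_X inj_image_eq_iff\<close>)
  also have "\<dots> = dlt (pm (u \<circ> w) x)"
    unfolding sum.delta[OF finite_X] using assms by simp
  finally show ?thesis .
qed

lemma gw_id: "gw id = gone"
  by (simp add: gw_def gone_def)

lemma gw_mult: "w \<in> W \<Longrightarrow> u \<in> W \<Longrightarrow> gm (gw w) (gw u) = (gw (w \<circ> u) :: _ \<Rightarrow> 'k::field)"
  unfolding gw_def[of u] gw_def[of "w \<circ> u"] gm_sum_right by (rule sum.cong) (auto simp: gw_dlt)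

text \<open>The reflections that occur in relation (3) when \<open>H\<close> is the second
  hyperplane.\<close>

definition Tr :: "'v set \<Rightarrow> ('v \<Rightarrow> 'v) set" where
  "Tr H = {s \<in> R. s ` H \<noteq> H \<and> \<not> tv (s ` H) H}"

lemma finite_Tr: "finite (Tr H)" using finite_R by (simp add: Tr_def)

lemma Tr_W: "s \<in> Tr H \<Longrightarrow> s \<in> W" using R_W by (simp add: Tr_def)

end

section \<open>The Brauer-Chen relations\<close>

text \<open>The scalar multiplication of \<open>galg\<close>, named so that linear identities can be
  stated without abstracting over arrows.\<close>

definition sc :: "'k::field \<Rightarrow> ('m \<Rightarrow> 'k) \<Rightarrow> 'm \<Rightarrow> 'k" where
  "sc c f = (\<lambda>u. c * f u)"

lemma sc_closed: "f \<in> supported S \<Longrightarrow> sc c f \<in> supported S"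
  unfolding sc_def by (rule fv.subspace_scale[OF subspace_supported])

lemma sc_zero: "sc c 0 = 0"
  by (rule ext) (simp only: sc_def zero_fun_apply mult_zero_right)

lemma (in fin_groupoid) gm_sc_left: "gm (sc c a) b = sc c (gm a b)"
  unfolding sc_def by (rule gm_smult_left)

lemma (in fin_groupoid) gm_sc_right: "gm a (sc c b) = sc c (gm a b)"
  unfolding sc_def by (rule gm_smult_right)

lemma (in fin_groupoid) galg_smult: "c \<odot>\<^bsub>galg\<^esub> f = sc c f"
  by (simp only: galg_simps sc_def)

text \<open>Connects the two kinds of sums: the relations are stated with the finite sum of the
  algebra record, while arrows are computed with \<open>sum\<close> on functions.\<close>

lemma (in fin_groupoid) galg_finsum:
  assumes "\<And>i. i \<in> I \<Longrightarrow> f i \<in> supported Ar"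
  shows "(\<Oplus>\<^bsub>galg\<^esub>i\<in>I. f i) = (\<Sum>i\<in>I. (f i :: 'm \<Rightarrow> 'k::field))"
proof -
  interpret A: ring "galg :: ('k, 'm \<Rightarrow> 'k) module" by (rule assoc_algebraD(1)[OF assoc_algebra_galg])
  show ?thesis using assms
  proof (induction I rule: infinite_finite_induct)
    case (infinite I)
    show ?case unfolding A.finsum_infinite[OF infinite(1)] sum.infinite[OF infinite(1)] galg_simps ..
  next
    case empty
    show ?case unfolding A.finsum_empty sum.empty galg_simps ..
  next
    case (insert i I)
    have "(\<Oplus>\<^bsub>galg\<^esub>i\<in>insert i I. f i) = f i \<oplus>\<^bsub>galg\<^esub> (\<Oplus>\<^bsub>galg\<^esub>i\<in>I. f i)"
      by (rule A.finsum_insert) (use insert in \<open>auto simp only: galg_simps\<close>)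
    also have "\<dots> = f i + (\<Sum>i\<in>I. f i)" using insert by (simp add: galg_simps(5))
    finally show ?case unfolding sum.insert[OF insert.hyps] .
  qed
qed

text \<open>The homomorphism to the groupoid algebra exists for every \<delta> and every \<nu>
  constant on conjugacy classes; that \<delta> is an indeterminate enters only when bijectivity is
  at stake.\<close>

locale refl_alg = refl_grp scale W for scale :: "complex \<Rightarrow> 'v \<Rightarrow> 'v::ab_group_add" and W +
  fixes \<delta> :: "'k::field" and \<nu> :: "('v \<Rightarrow> 'v) \<Rightarrow> 'k"
  assumes \<nu>_conj: "\<And>s t w. s \<in> reflections scale W \<Longrightarrow> t \<in> reflections scale W \<Longrightarrow> w \<in> W \<Longrightarrow>
    w \<circ> s = t \<circ> w \<Longrightarrow> \<nu> s = \<nu> t"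
begin

definition ph :: "'v set \<Rightarrow> ('v \<Rightarrow> 'v option) \<Rightarrow> 'k" where "ph x = dlt (pm id x)"

text \<open>Modulo I_2, right multiplication by e_H sends e_K to \<delta> e_K if K = H, to 0 if K
  and H are transverse, and otherwise to the combination of the e_K s over reflections s with s(H) =
  K. With e_K read as the identity arrow of K, each e_K s becomes the restriction of s to H, and the
  terms for all K add up to this formula.\<close>

definition eh :: "'v set \<Rightarrow> ('v \<Rightarrow> 'v option) \<Rightarrow> 'k" where
  "eh H = sc \<delta> (ph H) + (\<Sum>s\<in>Tr H. sc (\<nu> s) (dlt (pm s H)))"

lemma Hy_X: "H \<in> Hy \<Longrightarrow> H \<in> X" by (simp add: X_def)

lemma ph_closed: "x \<in> X \<Longrightarrow> ph x \<in> supported Ar"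
  unfolding ph_def by (rule dlt_closed[OF ArI[OF id_W]])

lemma eh_closed: "H \<in> Hy \<Longrightarrow> eh H \<in> supported Ar"
  unfolding eh_def
  by (intro fv.subspace_add[OF subspace_supported] fv.subspace_sum[OF subspace_supported] sc_closed
      dlt_closed ArI ph_closed Hy_X Tr_W)

lemma gm_dlt_pm:
  assumes "w \<in> W" "u \<in> W" "x \<in> X" "y \<in> X"
  shows "gm (dlt (pm w y)) (dlt (pm u x)) = (if u ` x = y then dlt (pm (w \<circ> u) x) else (0 :: _ \<Rightarrow> 'k))"
  using assms by (simp add: gm_dlt ArI pm_comp eq_commute[of y])

lemma ph_dlt:
  assumes "u \<in> W" "x \<in> X" "y \<in> X"
  shows "gm (ph y) (dlt (pm u x)) = (if u ` x = y then dlt (pm u x) else 0)"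
  using gm_dlt_pm[OF id_W assms(1,2,3)] unfolding ph_def by (simp only: id_comp)

lemma eh_dlt:
  assumes "H \<in> Hy" "u \<in> W" "x \<in> X"
  shows "gm (eh H) (dlt (pm u x)) = (if u ` x = H
    then sc \<delta> (dlt (pm u x)) + (\<Sum>s\<in>Tr H. sc (\<nu> s) (dlt (pm (s \<circ> u) x))) else 0)"
proof -
  have s: "gm (dlt (pm s H)) (dlt (pm u x)) = (if u ` x = H then dlt (pm (s \<circ> u) x) else (0 :: _ \<Rightarrow> 'k))"
    if "s \<in> Tr H" for s
    by (rule gm_dlt_pm) (use that Tr_W assms Hy_X in auto)
  have e: "gm (eh H) (dlt (pm u x)) = sc \<delta> (gm (ph H) (dlt (pm u x)))
      + (\<Sum>s\<in>Tr H. sc (\<nu> s) (gm (dlt (pm s H)) (dlt (pm u x))))"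
    unfolding eh_def gm_add_left gm_sum_left gm_sc_left ..
  show ?thesis
  proof (cases "u ` x = H")
    case True
    have "(\<Sum>s\<in>Tr H. sc (\<nu> s) (gm (dlt (pm s H)) (dlt (pm u x)))) = (\<Sum>s\<in>Tr H. sc (\<nu> s) (dlt (pm (s \<circ> u) x)))"
      by (rule sum.cong[OF refl]) (simp only: s True if_True simp_thms)
    then show ?thesis unfolding e ph_dlt[OF assms(2,3) Hy_X[OF assms(1)]] using True by (simp only: if_True simp_thms)
  next
    case False
    have "(\<Sum>s\<in>Tr H. sc (\<nu> s) (gm (dlt (pm s H)) (dlt (pm u x)))) = 0"
    proof (rule sum.neutral, rule ballI)
      fix s assume "s \<in> Tr H"
      then show "sc (\<nu> s) (gm (dlt (pm s H)) (dlt (pm u x))) = 0"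
        using s[of s] False by (simp only: if_False sc_zero)
    qed
    then show ?thesis unfolding e ph_dlt[OF assms(2,3) Hy_X[OF assms(1)]] using False
      by (simp only: if_False sc_zero simp_thms add_0_left)
  qed
qed

lemma eh_ph:
  assumes "H1 \<in> Hy" "H2 \<in> Hy"
  shows "gm (eh H1) (ph H2) = (if H1 = H2 then eh H1 else 0)"
  using eh_dlt[OF assms(1) id_W Hy_X[OF assms(2)]] unfolding ph_def[symmetric] image_id id_apply comp_id
  by (auto simp only: eh_def split: if_splits)

text \<open>The restriction of \<open>s\<close> to \<open>H2\<close> is the identity of its range
  times \<open>gw s\<close>, and all arrows in \<open>eh H1\<close> start at \<open>H1\<close>. This
  turns arrows back into elements of W, the form in which relation (3) is stated.\<close>

lemma eh_dlt_gw:
  assumes H: "H1 \<in> Hy" "H2 \<in> Hy" and s: "s \<in> W"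
  shows "gm (eh H1) (dlt (pm s H2)) = (if s ` H2 = H1 then gm (eh H1) (gw s) else 0)"
proof -
  have "gm (dlt (pm id (s ` H2))) (gw s) = (dlt (pm (id \<circ> s) H2) :: _ \<Rightarrow> 'k)"
    by (rule dlt_gw[OF s id_W Hy_X[OF H(2)]])
  then have "dlt (pm s H2) = gm (ph (s ` H2)) (gw s)" by (simp only: ph_def id_comp)
  then have "gm (eh H1) (dlt (pm s H2)) = gm (gm (eh H1) (ph (s ` H2))) (gw s)"
    using gm_assoc[OF eh_closed[OF H(1)] ph_closed[OF Hy_X[OF W_Hy[OF s H(2)]]] gw_closed[OF s]] by (simp only:)
  then show ?thesis using eh_ph[OF H(1) W_Hy[OF s H(2)]] by (auto simp only: gm_zero split: if_splits)
qed

lemma Tr_conj: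
  assumes w: "w \<in> W" and s: "s \<in> Tr H"
  shows "w \<circ> s \<circ> iv w \<in> Tr (w ` H)" "\<nu> (w \<circ> s \<circ> iv w) = \<nu> s"
proof -
  have sR: "s \<in> R" using s by (simp add: Tr_def)
  have inj: "inj w" using W_bij[OF w] by (simp add: bij_def)
  have i: "(w \<circ> s \<circ> iv w) ` w ` H = w ` s ` H"
    using iv_image(1)[OF w, of H] by (simp only: image_comp[symmetric])
  show "w \<circ> s \<circ> iv w \<in> Tr (w ` H)"
    using s conj_R(1)[OF w sR] tv_image_iff[OF w, of "s ` H" H] inj unfolding Tr_def mem_Collect_eq i
    by (simp only: inj_image_eq_iff simp_thms)
  have "w \<circ> s = w \<circ> s \<circ> iv w \<circ> w" using iv_comp(1)[OF w] by (metis comp_assoc comp_id)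
  then show "\<nu> (w \<circ> s \<circ> iv w) = \<nu> s" using \<nu>_conj[OF sR conj_R(1)[OF w sR] w] by simp
qed

lemma gw_eh_expand:
  assumes w: "w \<in> W" and H: "H \<in> Hy"
  shows "gm (gw w) (eh H) = sc \<delta> (dlt (pm w H)) + (\<Sum>s\<in>Tr H. sc (\<nu> s) (dlt (pm (w \<circ> s) H)))"
proof -
  have "(\<Sum>s\<in>Tr H. sc (\<nu> s) (gm (gw w) (dlt (pm s H)))) = (\<Sum>s\<in>Tr H. sc (\<nu> s) (dlt (pm (w \<circ> s) H)))"
    by (rule sum.cong[OF refl]) (simp only: gw_dlt[OF w Tr_W Hy_X[OF H]])
  then show ?thesis
    unfolding eh_def gm_add_right gm_sum_right gm_sc_right ph_def gw_dlt[OF w id_W Hy_X[OF H]] comp_id by (simp only:)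
qed

text \<open>Conjugation by \<open>w\<close> matches the reflections of \<open>Tr\<close> at
  \<open>H\<close> with those at its image, and \<nu> is unchanged under it.\<close>

lemma gw_eh:
  assumes w: "w \<in> W" and H: "H \<in> Hy"
  shows "gm (gw w) (eh H) = gm (eh (w ` H)) (gw w)"
proof -
  have wH: "w ` H \<in> Hy" by (rule W_Hy[OF w H])
  have iviv: "iv (iv w) = w" using W_bij[OF w] by (rule inv_inv_eq)
  have R: "gm (eh (w ` H)) (gw w) = sc \<delta> (dlt (pm w H)) + (\<Sum>s\<in>Tr (w ` H). sc (\<nu> s) (dlt (pm (s \<circ> w) H)))"
  proof -
    have "(\<Sum>s\<in>Tr (w ` H). sc (\<nu> s) (gm (dlt (pm s (w ` H))) (gw w))) = (\<Sum>s\<in>Tr (w ` H). sc (\<nu> s) (dlt (pm (s \<circ> w) H)))"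
      by (rule sum.cong[OF refl]) (simp only: dlt_gw[OF w Tr_W Hy_X[OF H]])
    then show ?thesis
      unfolding eh_def gm_add_left gm_sum_left gm_sc_left ph_def dlt_gw[OF w id_W Hy_X[OF H]] id_comp by (simp only:)
  qed
  have "(\<Sum>s\<in>Tr H. sc (\<nu> s) (dlt (pm (w \<circ> s) H))) = (\<Sum>s\<in>Tr (w ` H). sc (\<nu> s) (dlt (pm (s \<circ> w) H)))"
  proof (rule sum.reindex_bij_witness[of _ "\<lambda>s. iv w \<circ> s \<circ> w" "\<lambda>s. w \<circ> s \<circ> iv w"])
    fix s assume s: "s \<in> Tr H"
    show "iv w \<circ> (w \<circ> s \<circ> iv w) \<circ> w = s"
      using iv_apply(1)[OF w] by (simp add: fun_eq_iff)
    show "w \<circ> s \<circ> iv w \<in> Tr (w ` H)" by (rule Tr_conj(1)[OF w s])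
    have "w \<circ> s \<circ> iv w \<circ> w = w \<circ> s" using iv_apply(1)[OF w] by (simp add: fun_eq_iff)
    then show "sc (\<nu> (w \<circ> s \<circ> iv w)) (dlt (pm (w \<circ> s \<circ> iv w \<circ> w) H)) = sc (\<nu> s) (dlt (pm (w \<circ> s) H))"
      unfolding Tr_conj(2)[OF w s] by (simp only:)
  next
    fix s assume s: "s \<in> Tr (w ` H)"
    show "w \<circ> (iv w \<circ> s \<circ> w) \<circ> iv w = s"
      using iv_apply(2)[OF w] by (simp add: fun_eq_iff)
    show "iv w \<circ> s \<circ> w \<in> Tr H"
      using Tr_conj(1)[OF iv_W[OF w] s] unfolding iviv iv_image(1)[OF w] .
  qed
  then show ?thesis unfolding gw_eh_expand[OF w H] R by (simp only:)
qed

text \<open>Of the terms of \<open>eh H2\<close> only those ending at \<open>H1\<close> survive: the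
  identity arrow if the hyperplanes agree, none if they are transverse, and otherwise every
  reflection taking \<open>H2\<close> to \<open>H1\<close>. In particular transverse products
  vanish, so the map will factor through Br_1.\<close>

lemma eh_eh:
  assumes H: "H1 \<in> Hy" "H2 \<in> Hy"
  shows "gm (eh H1) (eh H2) = (if H1 = H2 then sc \<delta> (eh H1) else if tv H1 H2 then 0
    else (\<Sum>s\<in>{s\<in>R. s ` H2 = H1}. sc (\<nu> s) (gm (eh H1) (gw s))))"
proof -
  have "gm (eh H1) (eh H2) = sc \<delta> (gm (eh H1) (ph H2)) + (\<Sum>s\<in>Tr H2. sc (\<nu> s) (gm (eh H1) (dlt (pm s H2))))"
    unfolding eh_def[of H2] gm_add_right gm_sum_right gm_sc_right ..
  also have "(\<Sum>s\<in>Tr H2. sc (\<nu> s) (gm (eh H1) (dlt (pm s H2))))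
      = (\<Sum>s\<in>{s\<in>Tr H2. s ` H2 = H1}. sc (\<nu> s) (gm (eh H1) (gw s)))"
  proof -
    have "(\<Sum>s\<in>Tr H2. sc (\<nu> s) (gm (eh H1) (dlt (pm s H2))))
        = (\<Sum>s\<in>Tr H2. if s ` H2 = H1 then sc (\<nu> s) (gm (eh H1) (gw s)) else 0)"
      by (rule sum.cong[OF refl]) (auto simp only: eh_dlt_gw[OF H Tr_W] sc_zero split: if_splits)
    also have "\<dots> = (\<Sum>s\<in>{s\<in>Tr H2. s ` H2 = H1}. sc (\<nu> s) (gm (eh H1) (gw s)))"
      by (rule sum.inter_filter[OF finite_Tr, symmetric])
    finally show ?thesis .
  qed
  also have "{s\<in>Tr H2. s ` H2 = H1} = (if H1 = H2 \<or> tv H1 H2 then {} else {s\<in>R. s ` H2 = H1})"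
    by (auto simp: Tr_def)
  finally show ?thesis
    unfolding eh_ph[OF H] by (auto simp only: sc_zero sum.empty add_0_left add_0_right simp_thms if_True if_False split: if_splits)
qed

abbreviation F :: "('k, 'v bc_gen list \<Rightarrow> 'k) module" where "F \<equiv> bc_free scale W"

lemma F_eq: "F = free_algebra (Elt ` W \<union> Hyp ` Hy)"
  by (simp add: bc_free_def)

lemma F_alg: "assoc_algebra F" unfolding F_eq by (rule assoc_algebra_free)

lemma Elt_F: "w \<in> W \<Longrightarrow> free_gen (Elt w) \<in> carrier F"
  and Hyp_F: "H \<in> Hy \<Longrightarrow> free_gen (Hyp H) \<in> carrier F"
  unfolding F_eq free_gen_word by (auto intro!: free_word_closed)

lemma bc_sum_F: "bc_sum scale W \<nu> H1 H2 \<in> carrier F"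
proof -
  interpret F: ring F by (rule assoc_algebraD(1)[OF F_alg])
  show ?thesis unfolding bc_sum_def
    by (rule F.finsum_closed)
      (use Elt_F R_W vectorspaceD(2)[OF assoc_algebraD(2)[OF F_alg]] in auto)
qed

lemma bc_relations_F:
  assumes "(a, b) \<in> bc_relations scale W \<delta> \<nu>"
  shows "a \<in> carrier F \<and> b \<in> carrier F"
proof -
  interpret F: ring F by (rule assoc_algebraD(1)[OF F_alg])
  note VF = vectorspaceD(2)[OF assoc_algebraD(2)[OF F_alg]]
  show ?thesis using assms
  proof cases
    case (absorb_right s H)
    then have "H \<in> Hy" by (auto simp: hyperplanes_def)
    then show ?thesis using absorb_right Hyp_F Elt_F R_W by auto
  next
    case (absorb_left s H)
    then have "H \<in> Hy" by (auto simp: hyperplanes_def)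
    then show ?thesis using absorb_left Hyp_F Elt_F R_W by auto
  qed (use Elt_F Hyp_F id_W comp_W W_Hy VF bc_sum_F in auto)
qed

lemma hom_bc_sum:
  assumes B: "assoc_algebra B" and h: "alg_hom F B h"
  shows "h (bc_sum scale W \<nu> H1 H2) = (\<Oplus>\<^bsub>B\<^esub>s\<in>{s\<in>R. s ` H2 = H1}. \<nu> s \<odot>\<^bsub>B\<^esub> h (free_gen (Elt s)))"
proof -
  note hD = alg_homD[OF h] and VF = vectorspaceD[OF assoc_algebraD(2)[OF F_alg]]
    and VB = vectorspaceD[OF assoc_algebraD(2)[OF B]]
  interpret B: ring B by (rule assoc_algebraD(1)[OF B])
  have "h (bc_sum scale W \<nu> H1 H2) = (\<Oplus>\<^bsub>B\<^esub>s\<in>{s\<in>R. s ` H2 = H1}. h (\<nu> s \<odot>\<^bsub>F\<^esub> free_gen (Elt s)))"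
    unfolding bc_sum_def
    by (rule additive_finsum[OF VF(1) VB(1)]) (use hD VF(2) Elt_F R_W in auto)
  also have "\<dots> = (\<Oplus>\<^bsub>B\<^esub>s\<in>{s\<in>R. s ` H2 = H1}. \<nu> s \<odot>\<^bsub>B\<^esub> h (free_gen (Elt s)))"
    by (rule B.finsum_cong') (use hD VB(2) Elt_F R_W in auto)
  finally show ?thesis .
qed

lemma galg_representation:
  obtains h where "alg_hom F galg h" "\<And>w. w \<in> W \<Longrightarrow> h (free_gen (Elt w)) = gw w"
    "\<And>H. H \<in> Hy \<Longrightarrow> h (free_gen (Hyp H)) = eh H"
    "\<And>a b. (a, b) \<in> bc_relations scale W \<delta> \<nu> \<Longrightarrow> h a = h b"
proof -
  define \<phi> where "\<phi> y = (case y of Elt w \<Rightarrow> gw w | Hyp H \<Rightarrow> eh H)" for y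
  have \<phi>: "\<phi> y \<in> carrier galg" if "y \<in> Elt ` W \<union> Hyp ` Hy" for y
    using that gw_closed eh_closed unfolding galg_simps \<phi>_def by auto
  obtain h where h: "alg_hom F galg h" "\<And>y. y \<in> Elt ` W \<union> Hyp ` Hy \<Longrightarrow> h (free_gen y) = \<phi> y"
    using free_algebra_extend[of "galg :: ('k, ('v \<Rightarrow> 'v option) \<Rightarrow> 'k) module" "Elt ` W \<union> Hyp ` Hy" \<phi>] assoc_algebra_galg \<phi> unfolding F_eq by metis
  have hE: "h (free_gen (Elt w)) = gw w" if "w \<in> W" for w using h(2)[of "Elt w"] that by (simp add: \<phi>_def)
  have hH: "h (free_gen (Hyp H)) = eh H" if "H \<in> Hy" for H using h(2)[of "Hyp H"] that by (simp add: \<phi>_def)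
  note hD = alg_homD[OF h(1)]
  have hs: "h (bc_sum scale W \<nu> H1 H2) = (\<Sum>s\<in>{s\<in>R. s ` H2 = H1}. sc (\<nu> s) (gw s))" for H1 H2
  proof -
    have "h (bc_sum scale W \<nu> H1 H2) = (\<Oplus>\<^bsub>galg\<^esub>s\<in>{s\<in>R. s ` H2 = H1}. sc (\<nu> s) (h (free_gen (Elt s))))"
      unfolding hom_bc_sum[OF assoc_algebra_galg h(1)] galg_smult ..
    also have "\<dots> = (\<Sum>s\<in>{s\<in>R. s ` H2 = H1}. sc (\<nu> s) (h (free_gen (Elt s))))"
      by (rule galg_finsum) (auto simp: hE R_W intro!: sc_closed gw_closed)
    also have "\<dots> = (\<Sum>s\<in>{s\<in>R. s ` H2 = H1}. sc (\<nu> s) (gw s))"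
      by (rule sum.cong[OF refl]) (use hE R_W in auto)
    finally show ?thesis .
  qed
  have ab_right: "gm (eh H) (gw s) = eh H" if s: "s \<in> R" "fixed_space s = H" for s H
  proof -
    have H: "H \<in> Hy" using s by (auto simp: hyperplanes_def)
    \<comment> \<open>A reflection in \<open>H\<close> restricts to the identity arrow of
      \<open>H\<close>.\<close>
    have sH: "s ` H = H" and "pm s H = pm id H" using s(2) by (auto simp: fixed_space_def pm_eq_iff image_iff)
    then show ?thesis using eh_dlt_gw[OF H H R_W[OF s(1)]] eh_ph[OF H H] by (simp only: ph_def if_True simp_thms)
  qed
  have ab_left: "gm (gw s) (eh H) = eh H" if s: "s \<in> R" "fixed_space s = H" for s H
  proof -
    have H: "H \<in> Hy" using s by (auto simp: hyperplanes_def)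
    have sH: "s ` H = H" using s(2) by (auto simp: fixed_space_def image_iff)
    show ?thesis using gw_eh[OF R_W[OF s(1)] H] ab_right[OF s] by (simp only: sH)
  qed
  have rel: "h a = h b" if ab: "(a, b) \<in> bc_relations scale W \<delta> \<nu>" for a b
    using ab
  proof cases
    case group_one
    then show ?thesis using hD(5) hE[OF id_W] by (simp only: gw_id galg_simps)
  next
    case (group_mult w w')
    then show ?thesis using hD(2)[OF Elt_F Elt_F] hE comp_W by (simp only: gw_mult galg_simps)
  next
    case (conj w H)
    then show ?thesis using hD(2)[OF Elt_F Hyp_F] hD(2)[OF Hyp_F Elt_F] hE hH W_Hy
      by (simp only: gw_eh galg_simps)
  next
    case (square H)
    then have "h a = gm (eh H) (eh H)" using hD(2)[OF Hyp_F Hyp_F] hH by (simp only: galg_simps)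
    moreover have "h b = sc \<delta> (eh H)" using square hD(4)[OF Hyp_F] hH by (simp only: galg_smult)
    ultimately show ?thesis using eh_eh square by (simp only: if_True simp_thms)
  next
    case (absorb_right s H)
    then have H: "H \<in> Hy" by (auto simp: hyperplanes_def)
    show ?thesis using absorb_right hD(2)[OF Hyp_F[OF H] Elt_F[OF R_W]] hE R_W hH[OF H] ab_right by (simp only: galg_simps)
  next
    case (absorb_left s H)
    then have H: "H \<in> Hy" by (auto simp: hyperplanes_def)
    show ?thesis using absorb_left hD(2)[OF Elt_F[OF R_W] Hyp_F[OF H]] hE R_W hH[OF H] ab_left by (simp only: galg_simps)
  next
    case (commute H1 H2)
    have "H1 \<noteq> H2" "H2 \<noteq> H1" using commute by (auto simp: transverse_def)
    then show ?thesis using commute hD(2)[OF Hyp_F Hyp_F] hH eh_eh[of H1 H2] eh_eh[of H2 H1] tv_sym[of H1 H2]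
      by (simp only: galg_simps if_True if_False simp_thms)
  next
    case (nontransverse_left H1 H2)
    have "h b = gm (\<Sum>s\<in>{s\<in>R. s ` H2 = H1}. sc (\<nu> s) (gw s)) (eh H2)"
      using nontransverse_left hD(2)[OF bc_sum_F Hyp_F] hH by (simp only: hs galg_simps)
    \<comment> \<open>For \<open>s\<close> taking \<open>H2\<close> to \<open>H1\<close>, moving
      \<open>gw s\<close> past \<open>eh H2\<close> turns the latter into \<open>eh H1\<close>; this
      is why the left and the right form of relation (3) have the same image.\<close>
    also have "\<dots> = (\<Sum>s\<in>{s\<in>R. s ` H2 = H1}. sc (\<nu> s) (gm (eh H1) (gw s)))"
      unfolding gm_sum_left gm_sc_left
      by (rule sum.cong[OF refl]) (use gw_eh[OF R_W] nontransverse_left in auto)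
    also have "\<dots> = gm (eh H1) (eh H2)"
      using nontransverse_left eh_eh[of H1 H2] by (simp only: if_False simp_thms)
    also have "\<dots> = h a" using nontransverse_left hD(2)[OF Hyp_F Hyp_F] hH by (simp only: galg_simps)
    finally show ?thesis ..
  next
    case (nontransverse_right H1 H2)
    have "h b = gm (eh H1) (\<Sum>s\<in>{s\<in>R. s ` H2 = H1}. sc (\<nu> s) (gw s))"
      using nontransverse_right hD(2)[OF Hyp_F bc_sum_F] hH by (simp only: hs galg_simps)
    also have "\<dots> = (\<Sum>s\<in>{s\<in>R. s ` H2 = H1}. sc (\<nu> s) (gm (eh H1) (gw s)))"
      unfolding gm_sum_right gm_sc_right ..
    also have "\<dots> = gm (eh H1) (eh H2)"
      using nontransverse_right eh_eh[of H1 H2] by (simp only: if_False simp_thms)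
    also have "\<dots> = h a" using nontransverse_right hD(2)[OF Hyp_F Hyp_F] hH by (simp only: galg_simps)
    finally show ?thesis ..
  qed
  show thesis by (rule that[OF h(1) hE hH rel])
qed

end

section \<open>Quotients of the free algebra in which the relations hold\<close>

lemma alg_hom_quot:
  assumes A: "assoc_algebra A" and B: "assoc_algebra B" and h: "alg_hom A B h" and I: "ideal I A"
    and ker: "\<And>x. x \<in> I \<Longrightarrow> h x = \<zero>\<^bsub>B\<^esub>"
  obtains h' where "alg_hom (quot_algebra A I) B h'" "\<And>x. x \<in> carrier A \<Longrightarrow> h' (I +>\<^bsub>A\<^esub> x) = h x"
proof (rule alg_hom_factor[OF quot_algebra(2,3)[OF A I] h A])
  interpret B: ring B by (rule assoc_algebraD(1)[OF B])
  fix x y assume xy: "x \<in> carrier A" "y \<in> carrier A" "I +>\<^bsub>A\<^esub> x = I +>\<^bsub>A\<^esub> y"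
  then have "h (x \<ominus>\<^bsub>A\<^esub> y) = \<zero>\<^bsub>B\<^esub>" using quot_algebra(4)[OF A I xy(1,2)] ker by blast
  then have "h x \<ominus>\<^bsub>B\<^esub> h y = \<zero>\<^bsub>B\<^esub>" using alg_hom_zero_minus(3)[OF A B h xy(1,2)] by simp
  then show "h x = h y"
    using B.minus_equality[of "h x" "\<ominus>\<^bsub>B\<^esub> h y"] alg_homD(1)[OF h] xy by (simp add: a_minus_def)
qed (rule that)

text \<open>Any image of the free algebra that respects the relations. It is interpreted both for Br
  and for Br_1, so that the calculations with generators are done once.\<close>

locale bc_quot = refl_alg scale W \<delta> \<nu>
  for scale :: "complex \<Rightarrow> 'v \<Rightarrow> 'v::ab_group_add" and W and \<delta> :: "'k::field" and \<nu> +
  fixes B :: "('k, 'b) module" and \<pi> :: "('v bc_gen list \<Rightarrow> 'k) \<Rightarrow> 'b"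
  assumes B: "assoc_algebra B" and \<pi>: "alg_hom F B \<pi>"
    and \<pi>_rel: "\<And>a b. (a, b) \<in> bc_relations scale W \<delta> \<nu> \<Longrightarrow> \<pi> a = \<pi> b"
begin

sublocale B: ring B by (rule assoc_algebraD(1)[OF B])

lemmas VB = vectorspaceD[OF assoc_algebraD(2)[OF B]]
lemmas B_smult = assoc_algebraD(3,4)[OF B]
lemmas \<pi>D = alg_homD[OF \<pi>]

definition g :: "('v \<Rightarrow> 'v) \<Rightarrow> 'b" where "g w = \<pi> (free_gen (Elt w))"
definition e :: "'v set \<Rightarrow> 'b" where "e H = \<pi> (free_gen (Hyp H))"
definition sm :: "'v set \<Rightarrow> 'v set \<Rightarrow> 'b" where
  "sm H1 H2 = (\<Oplus>\<^bsub>B\<^esub>s\<in>{s\<in>R. s ` H2 = H1}. \<nu> s \<odot>\<^bsub>B\<^esub> g s)"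

lemma g_closed [simp]: "w \<in> W \<Longrightarrow> g w \<in> carrier B"
  unfolding g_def by (rule \<pi>D(1)[OF Elt_F])

lemma e_closed [simp]: "H \<in> Hy \<Longrightarrow> e H \<in> carrier B"
  unfolding e_def by (rule \<pi>D(1)[OF Hyp_F])

lemma sm_closed [simp]: "sm H1 H2 \<in> carrier B"
  unfolding sm_def by (rule B.finsum_closed) (auto intro!: VB(2) g_closed R_W)

lemma \<pi>_sum: "\<pi> (bc_sum scale W \<nu> H1 H2) = sm H1 H2"
  unfolding sm_def g_def by (rule hom_bc_sum[OF B \<pi>])

lemma g_id: "g id = \<one>\<^bsub>B\<^esub>"
  using \<pi>_rel[OF bc_relations.group_one] \<pi>D(5) by (simp add: g_def)

lemma g_mult: "w \<in> W \<Longrightarrow> u \<in> W \<Longrightarrow> g w \<otimes>\<^bsub>B\<^esub> g u = g (w \<circ> u)"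
  using \<pi>_rel[OF bc_relations.group_mult, of w u] \<pi>D(2)[OF Elt_F Elt_F, of w u] by (simp add: g_def)

lemma g_e: "w \<in> W \<Longrightarrow> H \<in> Hy \<Longrightarrow> g w \<otimes>\<^bsub>B\<^esub> e H = e (w ` H) \<otimes>\<^bsub>B\<^esub> g w"
  using \<pi>_rel[OF bc_relations.conj, of w H] \<pi>D(2)[OF Elt_F Hyp_F, of w H] \<pi>D(2)[OF Hyp_F Elt_F, of "w ` H" w]
  by (simp add: g_def e_def W_Hy)

lemma e_square: "H \<in> Hy \<Longrightarrow> e H \<otimes>\<^bsub>B\<^esub> e H = \<delta> \<odot>\<^bsub>B\<^esub> e H"
  using \<pi>_rel[OF bc_relations.square, of H] \<pi>D(2)[OF Hyp_F Hyp_F, of H H] \<pi>D(4)[OF Hyp_F, of H]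
  by (simp add: e_def)

lemma g_absorb: "s \<in> R \<Longrightarrow> g s \<otimes>\<^bsub>B\<^esub> e (fixed_space s) = e (fixed_space s)"
  using \<pi>_rel[OF bc_relations.absorb_left[of s scale W "fixed_space s"]] \<pi>D(2)[OF Elt_F Hyp_F, of s "fixed_space s"]
  by (simp add: g_def e_def R_W hyperplanes_def)

lemma e_commute: "H1 \<in> Hy \<Longrightarrow> H2 \<in> Hy \<Longrightarrow> tv H1 H2 \<Longrightarrow> e H1 \<otimes>\<^bsub>B\<^esub> e H2 = e H2 \<otimes>\<^bsub>B\<^esub> e H1"
  using \<pi>_rel[OF bc_relations.commute, of H1 H2] \<pi>D(2)[OF Hyp_F Hyp_F, of H1 H2] \<pi>D(2)[OF Hyp_F Hyp_F, of H2 H1]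
  by (simp add: e_def)

lemma e_nontv:
  assumes "H1 \<in> Hy" "H2 \<in> Hy" "H1 \<noteq> H2" "\<not> tv H1 H2"
  shows "e H1 \<otimes>\<^bsub>B\<^esub> e H2 = sm H1 H2 \<otimes>\<^bsub>B\<^esub> e H2" "e H1 \<otimes>\<^bsub>B\<^esub> e H2 = e H1 \<otimes>\<^bsub>B\<^esub> sm H1 H2"
proof -
  show "e H1 \<otimes>\<^bsub>B\<^esub> e H2 = sm H1 H2 \<otimes>\<^bsub>B\<^esub> e H2"
    using \<pi>_rel[OF bc_relations.nontransverse_left[OF assms]] \<pi>D(2)[OF Hyp_F[OF assms(1)] Hyp_F[OF assms(2)]]
      \<pi>D(2)[OF bc_sum_F Hyp_F[OF assms(2)]] by (simp add: e_def \<pi>_sum)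
  show "e H1 \<otimes>\<^bsub>B\<^esub> e H2 = e H1 \<otimes>\<^bsub>B\<^esub> sm H1 H2"
    using \<pi>_rel[OF bc_relations.nontransverse_right[OF assms]] \<pi>D(2)[OF Hyp_F[OF assms(1)] Hyp_F[OF assms(2)]]
      \<pi>D(2)[OF Hyp_F[OF assms(1)] bc_sum_F] by (simp add: e_def \<pi>_sum)
qed

lemma e_g: assumes "w \<in> W" "H \<in> Hy" shows "e H \<otimes>\<^bsub>B\<^esub> g w = g w \<otimes>\<^bsub>B\<^esub> e (iv w ` H)"
  using g_e[OF assms(1) W_Hy[OF iv_W[OF assms(1)] assms(2)]] iv_image(2)[OF assms(1)] by simp

text \<open>The generators of I_2, written inside \<open>B\<close>.\<close>

definition te :: "'b set" where
  "te = {e H1 \<otimes>\<^bsub>B\<^esub> e H2 | H1 H2. H1 \<in> Hy \<and> H2 \<in> Hy \<and> tv H1 H2}"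

text \<open>The reason why the left ideal I_2 is two-sided. Group elements pass to the left of e_H1
  e_H2 and conjugate it. A factor e_H yields \<delta> if H is one of the pair; it turns into a sum
  of group elements by relation (3) if it is not transverse to one of them, that one being moved
  next to it; and it commutes to the front if it is transverse to both.\<close>

lemma te_right_closed:
  assumes L: "left_ideal B L" and te: "te \<subseteq> L"
    and t: "t \<in> te" and b: "b \<in> g ` W \<union> e ` Hy"
  shows "t \<otimes>\<^bsub>B\<^esub> b \<in> L"
proof -
  note LD = left_idealD[OF B L]
  have gcase: "t \<otimes>\<^bsub>B\<^esub> g w \<in> L" if t: "t \<in> te" and w: "w \<in> W" for t w
  proof -
    obtain H1 H2 where H: "H1 \<in> Hy" "H2 \<in> Hy" "tv H1 H2" "t = e H1 \<otimes>\<^bsub>B\<^esub> e H2" using t unfolding te_def by blast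
    let ?J1 = "iv w ` H1" and ?J2 = "iv w ` H2"
    have J: "?J1 \<in> Hy" "?J2 \<in> Hy" "tv ?J1 ?J2" using H W_Hy[OF iv_W[OF w]] tv_image[OF iv_W[OF w]] by auto
    have "t \<otimes>\<^bsub>B\<^esub> g w = e H1 \<otimes>\<^bsub>B\<^esub> (e H2 \<otimes>\<^bsub>B\<^esub> g w)" unfolding H(4) by (rule B.m_assoc) (use H w in auto)
    also have "\<dots> = (e H1 \<otimes>\<^bsub>B\<^esub> g w) \<otimes>\<^bsub>B\<^esub> e ?J2" unfolding e_g[OF w H(2)] by (rule B.m_assoc[symmetric]) (use H J w in auto)
    also have "\<dots> = g w \<otimes>\<^bsub>B\<^esub> (e ?J1 \<otimes>\<^bsub>B\<^esub> e ?J2)" unfolding e_g[OF w H(1)] by (rule B.m_assoc) (use H J w in auto)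
    also have "\<dots> \<in> L" by (rule LD(4)) (use te J w in \<open>auto simp: te_def\<close>)
    finally show ?thesis .
  qed
  have smcase: "t \<otimes>\<^bsub>B\<^esub> sm H1 H2 \<in> L" if t: "t \<in> te" for t H1 H2
  proof -
    have tc: "t \<in> carrier B" using t te LD(1) by blast
    have c: "(\<lambda>s. \<nu> s \<odot>\<^bsub>B\<^esub> g s) \<in> {s\<in>R. s ` H2 = H1} \<rightarrow> carrier B" by (auto intro!: VB(2) g_closed R_W)
    have "t \<otimes>\<^bsub>B\<^esub> sm H1 H2 = (\<Oplus>\<^bsub>B\<^esub>s\<in>{s\<in>R. s ` H2 = H1}. t \<otimes>\<^bsub>B\<^esub> (\<nu> s \<odot>\<^bsub>B\<^esub> g s))"
      unfolding sm_def by (rule B.finsum_rdistr) (use finite_R tc c in auto)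
    also have "\<dots> = (\<Oplus>\<^bsub>B\<^esub>s\<in>{s\<in>R. s ` H2 = H1}. \<nu> s \<odot>\<^bsub>B\<^esub> (t \<otimes>\<^bsub>B\<^esub> g s))"
      by (rule B.finsum_cong') (use tc R_W in \<open>auto simp: B_smult intro!: VB(2)\<close>)
    also have "\<dots> \<in> L"
    proof -
      have "(\<Oplus>\<^bsub>B\<^esub>s\<in>S. \<nu> s \<odot>\<^bsub>B\<^esub> (t \<otimes>\<^bsub>B\<^esub> g s)) \<in> L" if "finite S" "S \<subseteq> R" for S
        using that
      proof induction
        case (insert s S)
        have c: "\<nu> u \<odot>\<^bsub>B\<^esub> (t \<otimes>\<^bsub>B\<^esub> g u) \<in> L" if "u \<in> R" for u
          by (rule LD(5)[OF gcase[OF t R_W[OF that]]])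
        have "(\<Oplus>\<^bsub>B\<^esub>s\<in>insert s S. \<nu> s \<odot>\<^bsub>B\<^esub> (t \<otimes>\<^bsub>B\<^esub> g s)) = \<nu> s \<odot>\<^bsub>B\<^esub> (t \<otimes>\<^bsub>B\<^esub> g s) \<oplus>\<^bsub>B\<^esub> (\<Oplus>\<^bsub>B\<^esub>s\<in>S. \<nu> s \<odot>\<^bsub>B\<^esub> (t \<otimes>\<^bsub>B\<^esub> g s))"
          by (rule B.finsum_insert) (use insert c LD(1) in blast)+
        then show ?case using LD(3)[OF c[of s]] insert by simp
      qed (simp add: LD(2))
      then show ?thesis using finite_R by simp
    qed
    finally show ?thesis .
  qed
  obtain H1 H2 where H: "H1 \<in> Hy" "H2 \<in> Hy" "tv H1 H2" "t = e H1 \<otimes>\<^bsub>B\<^esub> e H2" using t unfolding te_def by blast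
  have t2: "t = e H2 \<otimes>\<^bsub>B\<^esub> e H1" using e_commute[OF H(1,2,3)] H(4) by simp
  have tc: "t \<in> carrier B" using H by simp
  have tL: "t \<in> L" using t te by blast
  have ecase: "t \<otimes>\<^bsub>B\<^esub> e H \<in> L" if h: "H \<in> Hy" for H
  proof -
    have a1: "t \<otimes>\<^bsub>B\<^esub> e H = e H1 \<otimes>\<^bsub>B\<^esub> (e H2 \<otimes>\<^bsub>B\<^esub> e H)" unfolding H(4) by (rule B.m_assoc) (use H h in auto)
    have a2: "t \<otimes>\<^bsub>B\<^esub> e H = e H2 \<otimes>\<^bsub>B\<^esub> (e H1 \<otimes>\<^bsub>B\<^esub> e H)" unfolding t2 by (rule B.m_assoc) (use H h in auto)
    consider "H = H2" | "H = H1" | "H2 \<noteq> H" "\<not> tv H2 H" | "H1 \<noteq> H" "\<not> tv H1 H" | "tv H1 H" "tv H2 H" by blast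
    then show ?thesis
    proof cases
      case 1
      have "t \<otimes>\<^bsub>B\<^esub> e H = \<delta> \<odot>\<^bsub>B\<^esub> t" unfolding a1 unfolding 1 e_square[OF H(2)] H(4) using H by (simp add: B_smult)
      then show ?thesis using LD(5)[OF tL] by simp
    next
      case 2
      have "t \<otimes>\<^bsub>B\<^esub> e H = \<delta> \<odot>\<^bsub>B\<^esub> t" unfolding a2 unfolding 2 e_square[OF H(1)] t2 using H by (simp add: B_smult)
      then show ?thesis using LD(5)[OF tL] by simp
    next
      case 3
      have "t \<otimes>\<^bsub>B\<^esub> e H = e H1 \<otimes>\<^bsub>B\<^esub> (e H2 \<otimes>\<^bsub>B\<^esub> sm H2 H)" using a1 e_nontv(2)[OF H(2) h 3] by simp
      also have "\<dots> = t \<otimes>\<^bsub>B\<^esub> sm H2 H" unfolding H(4) by (rule B.m_assoc[symmetric]) (use H in auto)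
      finally have "t \<otimes>\<^bsub>B\<^esub> e H = t \<otimes>\<^bsub>B\<^esub> sm H2 H" .
      then show ?thesis using smcase[OF t] by simp
    next
      case 4
      have "t \<otimes>\<^bsub>B\<^esub> e H = e H2 \<otimes>\<^bsub>B\<^esub> (e H1 \<otimes>\<^bsub>B\<^esub> sm H1 H)" using a2 e_nontv(2)[OF H(1) h 4] by simp
      also have "\<dots> = t \<otimes>\<^bsub>B\<^esub> sm H1 H" unfolding t2 by (rule B.m_assoc[symmetric]) (use H in auto)
      finally have "t \<otimes>\<^bsub>B\<^esub> e H = t \<otimes>\<^bsub>B\<^esub> sm H1 H" .
      then show ?thesis using smcase[OF t] by simp
    next
      case 5
      have "t \<otimes>\<^bsub>B\<^esub> e H = (e H1 \<otimes>\<^bsub>B\<^esub> e H) \<otimes>\<^bsub>B\<^esub> e H2"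
        unfolding a1 e_commute[OF H(2) h 5(2)] by (rule B.m_assoc[symmetric]) (use H h in auto)
      also have "\<dots> = e H \<otimes>\<^bsub>B\<^esub> t"
        unfolding e_commute[OF H(1) h 5(1)] H(4) by (rule B.m_assoc) (use H h in auto)
      finally show ?thesis using LD(4)[OF e_closed[OF h] tL] by simp
    qed
  qed
  show ?thesis using b gcase[OF t] ecase by blast
qed

lemma te_ideal:
  assumes surj: "carrier B = \<pi> ` carrier F"
  shows "ideal (left_ideal_generated B te) B" "left_ideal B (left_ideal_generated B te)"
    "te \<subseteq> left_ideal_generated B te"
    "\<And>L. left_ideal B L \<Longrightarrow> te \<subseteq> L \<Longrightarrow> left_ideal_generated B te \<subseteq> L"
proof -
  let ?L = "left_ideal_generated B te"
  have tec: "te \<subseteq> carrier B" by (auto simp: te_def)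
  have carli: "left_ideal B (carrier B)" by (rule left_idealI[OF B]) auto
  show sub: "te \<subseteq> ?L" unfolding left_ideal_generated_def by blast
  show min: "?L \<subseteq> L" if "left_ideal B L" "te \<subseteq> L" for L
    unfolding left_ideal_generated_def using that by blast
  show li: "left_ideal B ?L"
  proof (rule left_idealI[OF B])
    show "?L \<subseteq> carrier B" by (rule min[OF carli tec])
    show "\<zero>\<^bsub>B\<^esub> \<in> ?L" unfolding left_ideal_generated_def using left_idealD(2)[OF B] by blast
    show "x \<oplus>\<^bsub>B\<^esub> y \<in> ?L" if "x \<in> ?L" "y \<in> ?L" for x y
      using that left_idealD(3)[OF B] unfolding left_ideal_generated_def by blast
    show "a \<otimes>\<^bsub>B\<^esub> x \<in> ?L" if "a \<in> carrier B" "x \<in> ?L" for a x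
      using that left_idealD(4)[OF B] unfolding left_ideal_generated_def by blast
  qed
  note LD = left_idealD[OF B li]
  have Lc: "x \<in> carrier B" if "x \<in> ?L" for x using that LD(1) by blast
  have gens: "\<forall>x\<in>?L. x \<otimes>\<^bsub>B\<^esub> b \<in> ?L" if b: "b \<in> g ` W \<union> e ` Hy" for b
  proof -
    have bc: "b \<in> carrier B" using b by auto
    \<comment> \<open>The elements that stay in the ideal when multiplied by \<open>b\<close> on the
      right form a left ideal; it contains the generators, hence everything they generate.\<close>
    have "left_ideal B {x \<in> carrier B. x \<otimes>\<^bsub>B\<^esub> b \<in> ?L}"
      by (rule left_idealI[OF B]) (use bc LD in \<open>auto simp: B.l_distr B.m_assoc\<close>)
    moreover have "te \<subseteq> {x \<in> carrier B. x \<otimes>\<^bsub>B\<^esub> b \<in> ?L}" using te_right_closed[OF li sub _ b] tec by blast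
    ultimately show ?thesis using min by blast
  qed
  \<comment> \<open>Right stability passes from the generators to all of \<open>B\<close>, because
    every element of \<open>B\<close> is the image of an element of the free algebra.\<close>
  have right: "\<forall>x\<in>?L. x \<otimes>\<^bsub>B\<^esub> \<pi> f \<in> ?L" if "f \<in> carrier F" for f
    using that unfolding F_eq
  proof (induction rule: free_algebra_gen_induct)
    case one
    then show ?case using \<pi>D(5) Lc unfolding F_eq by simp
  next
    case (gen x)
    then show ?case using gens[of "\<pi> (free_gen x)"] by (auto simp: g_def e_def)
  next
    case (mult f h)
    then show ?case using \<pi>D(1,2) Lc unfolding F_eq by (simp add: B.m_assoc[symmetric])
  next
    case (add f h)
    then show ?case using \<pi>D(1,3) Lc LD(3) unfolding F_eq by (simp add: B.r_distr)
  next
    case (smult c f)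
    then show ?case using \<pi>D(1,4) Lc LD(5) unfolding F_eq by (simp add: B_smult)
  qed
  show "ideal ?L B"
  proof (rule idealI[OF B.ring_axioms])
    show "subgroup ?L (add_monoid B)"
      using li unfolding left_ideal_def additive_subgroup_def by blast
    show "a \<otimes>\<^bsub>B\<^esub> x \<in> ?L" if "x \<in> ?L" "a \<in> carrier B" for a x using LD(4) that by blast
    show "x \<otimes>\<^bsub>B\<^esub> a \<in> ?L" if x: "x \<in> ?L" and a: "a \<in> carrier B" for a x
    proof -
      obtain f where "f \<in> carrier F" "a = \<pi> f" using a surj by auto
      then show ?thesis using right x by simp
    qed
  qed
qed

end

section \<open>The truncated algebra is a groupoid algebra\<close>

lemma const_fract_sum: "const_fract (\<Sum>i\<in>I. c i) = (\<Sum>i\<in>I. const_fract (c i :: 'c::field))"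
proof -
  have "[:\<Sum>i\<in>I. c i:] = (\<Sum>i\<in>I. [:c i:])"
  proof (induction I rule: infinite_finite_induct)
    case (insert x I)
    have "[:c x + (\<Sum>i\<in>I. c i):] = [:c x:] + [:\<Sum>i\<in>I. c i:]" by simp
    then show ?case unfolding sum.insert[OF insert.hyps] insert.IH .
  qed auto
  then show ?thesis unfolding const_fract_def by (simp only: Fract_one_sum)
qed

text \<open>Br_1 with both of its bounds: the surjection from the free algebra together with the
  vanishing transverse products gives a spanning family, and \<open>h\<close> is the homomorphism
  under which this family will turn out to be independent.\<close>

locale bc_trunc = bc_quot scale W "indet :: 'c::field_char_0 poly fract" "const_fract \<circ> \<mu>" B \<pi>
  for scale :: "complex \<Rightarrow> 'v \<Rightarrow> 'v::ab_group_add" and W and \<mu> :: "('v \<Rightarrow> 'v) \<Rightarrow> 'c::field_char_0"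
    and B :: "('c::field_char_0 poly fract, 'b) module" and \<pi> +
  fixes h :: "'b \<Rightarrow> ('v \<Rightarrow> 'v option) \<Rightarrow> 'c::field_char_0 poly fract"
  assumes surj: "carrier B = \<pi> ` carrier F"
    and tv_zero: "\<And>H1 H2. H1 \<in> Hy \<Longrightarrow> H2 \<in> Hy \<Longrightarrow> tv H1 H2 \<Longrightarrow> e H1 \<otimes>\<^bsub>B\<^esub> e H2 = \<zero>\<^bsub>B\<^esub>"
    and h: "alg_hom B galg h"
    and h_g: "\<And>w. w \<in> W \<Longrightarrow> h (g w) = gw w" and h_e: "\<And>H. H \<in> Hy \<Longrightarrow> h (e H) = eh H"
begin

abbreviation "\<delta>' \<equiv> indet :: 'c poly fract"
abbreviation "\<nu>' \<equiv> const_fract \<circ> \<mu>"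

lemmas hD = alg_homD[OF h]

text \<open>The two elements differ by one that fixes \<open>H\<close> pointwise, that is, by the
  identity or a reflection in \<open>H\<close>, and e_H absorbs it.\<close>

lemma g_e_cong:
  assumes w: "w \<in> W" and u: "u \<in> W" and H: "H \<in> Hy" and eq: "pm w H = pm u H"
  shows "g w \<otimes>\<^bsub>B\<^esub> e H = g u \<otimes>\<^bsub>B\<^esub> e H"
proof -
  define k where "k = iv w \<circ> u"
  have k: "k \<in> W" unfolding k_def by (rule comp_W[OF iv_W[OF w] u])
  have wk: "w \<circ> k = u" unfolding k_def by (simp only: comp_assoc[symmetric] iv_comp(2)[OF w] id_comp)
  have fx: "k v = v" if "v \<in> H" for v
    using eq that iv_apply(1)[OF w, of v] by (simp add: k_def pm_eq_iff)
  have ke: "g k \<otimes>\<^bsub>B\<^esub> e H = e H"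
  proof (cases "k = id")
    case True
    then show ?thesis using H by (simp only: g_id B.l_one e_closed)
  next
    case False
    show ?thesis using g_absorb[OF fixes_hyperplane(1)[OF k H fx False]] fixes_hyperplane(2)[OF k H fx False] by simp
  qed
  have "g u \<otimes>\<^bsub>B\<^esub> e H = (g w \<otimes>\<^bsub>B\<^esub> g k) \<otimes>\<^bsub>B\<^esub> e H" using g_mult[OF w k] by (simp only: wk)
  also have "\<dots> = g w \<otimes>\<^bsub>B\<^esub> (g k \<otimes>\<^bsub>B\<^esub> e H)" by (rule B.m_assoc) (use w k H in auto)
  finally show ?thesis unfolding ke ..
qed

definition rp :: "('v \<Rightarrow> 'v option) \<Rightarrow> 'v \<Rightarrow> 'v" where
  "rp m = (SOME w. w \<in> W \<and> pm w (dom m) = m)"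

lemma rp: assumes "m \<in> Ar" shows "rp m \<in> W" "pm (rp m) (dom m) = m"
proof -
  obtain w x where "w \<in> W" "m = pm w x" using assms by (elim ArE)
  then have "\<exists>w. w \<in> W \<and> pm w (dom m) = m" by auto
  from someI_ex[OF this] show "rp m \<in> W" "pm (rp m) (dom m) = m" by (auto simp: rp_def)
qed

text \<open>The spanning family, indexed by arrows: those starting at the whole space stand for the
  w, the others for the w e_H. By \<open>g_e_cong\<close> the choice made in \<open>rp\<close> does
  not affect the second kind; for the first kind it is forced.\<close>

definition bas :: "('v \<Rightarrow> 'v option) \<Rightarrow> 'b" where
  "bas m = (if dom m = UNIV then g (rp m) else g (rp m) \<otimes>\<^bsub>B\<^esub> e (dom m))"

lemma bas_UNIV: assumes w: "w \<in> W" shows "bas (pm w UNIV) = g w"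
proof -
  have "UNIV \<in> X" by (simp add: X_def)
  then have "pm (rp (pm w UNIV)) UNIV = pm w UNIV" using rp(2)[OF ArI[OF w]] by simp
  then have "rp (pm w UNIV) = w" by (auto simp: pm_eq_iff)
  then show ?thesis by (simp add: bas_def)
qed

lemma bas_Hy: assumes w: "w \<in> W" and H: "H \<in> Hy" shows "bas (pm w H) = g w \<otimes>\<^bsub>B\<^esub> e H"
proof -
  note r = rp[OF ArI[OF w Hy_X[OF H]], unfolded dom_pm]
  have "H \<noteq> UNIV" using H UNIV_notin_Hy by blast
  then show ?thesis unfolding bas_def dom_pm using g_e_cong[OF r(1) w H r(2)] by (simp only: if_False)
qed

lemma bas_cases [consumes 1]:
  assumes "m \<in> Ar"
  obtains (UNIV) w where "w \<in> W" "m = pm w UNIV" "bas m = g w"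
    | (Hy) w H where "w \<in> W" "H \<in> Hy" "m = pm w H" "bas m = g w \<otimes>\<^bsub>B\<^esub> e H"
  using assms
proof (rule ArE)
  fix w x assume wx: "w \<in> W" "x \<in> X" "m = pm w x"
  show thesis
  proof (cases "x = UNIV")
    case True
    then show thesis using UNIV[of w] wx bas_UNIV by simp
  next
    case False
    then show thesis using Hy[of w x] wx bas_Hy by (simp add: X_def)
  qed
qed

lemma bas_closed: "m \<in> Ar \<Longrightarrow> bas m \<in> carrier B"
  by (erule bas_cases) auto

definition \<theta> :: "(('v \<Rightarrow> 'v option) \<Rightarrow> 'c poly fract) \<Rightarrow> 'b" where
  "\<theta> f = (\<Oplus>\<^bsub>B\<^esub>m\<in>Ar. f m \<odot>\<^bsub>B\<^esub> bas m)"

lemma \<theta>_closed: "\<theta> f \<in> carrier B"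
  unfolding \<theta>_def by (rule B.finsum_closed) (auto intro!: VB(2) bas_closed)

lemma \<theta>_add: "\<theta> (f + f') = \<theta> f \<oplus>\<^bsub>B\<^esub> \<theta> f'"
proof -
  have "\<theta> (f + f') = (\<Oplus>\<^bsub>B\<^esub>m\<in>Ar. f m \<odot>\<^bsub>B\<^esub> bas m \<oplus>\<^bsub>B\<^esub> f' m \<odot>\<^bsub>B\<^esub> bas m)"
    unfolding \<theta>_def by (rule B.finsum_cong') (auto simp: VB(2,3) bas_closed)
  also have "\<dots> = \<theta> f \<oplus>\<^bsub>B\<^esub> \<theta> f'"
    unfolding \<theta>_def by (rule B.finsum_addf) (auto simp: VB(2) bas_closed)
  finally show ?thesis .
qed

lemma \<theta>_sc: "\<theta> (sc c f) = c \<odot>\<^bsub>B\<^esub> \<theta> f"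
proof -
  have "\<theta> (sc c f) = (\<Oplus>\<^bsub>B\<^esub>m\<in>Ar. c \<odot>\<^bsub>B\<^esub> (f m \<odot>\<^bsub>B\<^esub> bas m))"
    unfolding \<theta>_def by (rule B.finsum_cong') (auto simp: VB(2,5) bas_closed sc_def)
  also have "\<dots> = c \<odot>\<^bsub>B\<^esub> \<theta> f"
    unfolding \<theta>_def by (rule additive_finsum[symmetric, OF VB(1) VB(1)]) (auto simp: VB(2,4) bas_closed)
  finally show ?thesis .
qed

lemma \<theta>_dlt: assumes "m \<in> Ar" shows "\<theta> (dlt m) = bas m"
proof -
  have "\<theta> (dlt m) = (\<Oplus>\<^bsub>B\<^esub>n\<in>Ar. if m = n then bas n else \<zero>\<^bsub>B\<^esub>)"
    unfolding \<theta>_def by (rule B.finsum_cong') (auto simp: VB(6,8) bas_closed dlt_def)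
  also have "\<dots> = bas m" by (rule B.finsum_singleton[OF assms fin_Ar]) (auto simp: bas_closed)
  finally show ?thesis .
qed

text \<open>The span of the family \<open>bas\<close>.\<close>

definition Sp :: "'b set" where "Sp = \<theta> ` supported Ar"

lemma SpI: "f \<in> supported Ar \<Longrightarrow> \<theta> f \<in> Sp"
  by (simp add: Sp_def)

lemma Sp_add: assumes "x \<in> Sp" "y \<in> Sp" shows "x \<oplus>\<^bsub>B\<^esub> y \<in> Sp"
proof -
  obtain f f' where f: "f \<in> supported Ar" "x = \<theta> f" "f' \<in> supported Ar" "y = \<theta> f'"
    using assms by (auto simp: Sp_def)
  show ?thesis unfolding f(2,4) \<theta>_add[symmetric]
    by (rule SpI[OF fv.subspace_add[OF subspace_supported f(1,3)]])
qed

lemma Sp_sc: assumes "x \<in> Sp" shows "c \<odot>\<^bsub>B\<^esub> x \<in> Sp"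
proof -
  obtain f where f: "f \<in> supported Ar" "x = \<theta> f" using assms by (auto simp: Sp_def)
  show ?thesis unfolding f(2) \<theta>_sc[symmetric] by (rule SpI[OF sc_closed[OF f(1)]])
qed

lemma Sp_bas: assumes "m \<in> Ar" shows "bas m \<in> Sp"
  unfolding \<theta>_dlt[OF assms, symmetric] by (rule SpI[OF dlt_closed[OF assms]])

lemma Sp_carrier: "x \<in> Sp \<Longrightarrow> x \<in> carrier B"
  unfolding Sp_def using \<theta>_closed by auto

lemma Sp_zero: "\<zero>\<^bsub>B\<^esub> \<in> Sp"
proof -
  have "0 \<odot>\<^bsub>B\<^esub> bas (pm id UNIV) \<in> Sp" by (rule Sp_sc[OF Sp_bas[OF ArI[OF id_W]]]) (simp add: X_def)
  then show ?thesis using VB(8) bas_UNIV[OF id_W] id_W by simp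
qed

lemma Sp_finsum: assumes "finite S" "\<And>i. i \<in> S \<Longrightarrow> f i \<in> Sp" shows "(\<Oplus>\<^bsub>B\<^esub>i\<in>S. f i) \<in> Sp"
  using assms
proof (induction S)
  case (insert i S)
  have "(\<Oplus>\<^bsub>B\<^esub>i\<in>insert i S. f i) = f i \<oplus>\<^bsub>B\<^esub> (\<Oplus>\<^bsub>B\<^esub>i\<in>S. f i)"
    by (rule B.finsum_insert) (use insert Sp_carrier in auto)
  then show ?case using insert Sp_add by simp
qed (simp add: Sp_zero)

lemma g_bas: assumes w: "w \<in> W" and m: "m \<in> Ar" shows "g w \<otimes>\<^bsub>B\<^esub> bas m \<in> Sp"
  using m
proof (cases rule: bas_cases)
  case (UNIV u)
  then have "g w \<otimes>\<^bsub>B\<^esub> bas m = bas (pm (w \<circ> u) UNIV)" using bas_UNIV[OF comp_W[OF w]] g_mult[OF w] by simp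
  then show ?thesis using Sp_bas[OF ArI[OF comp_W[OF w UNIV(1)]], of UNIV] by (simp add: X_def)
next
  case (Hy u H)
  then have "g w \<otimes>\<^bsub>B\<^esub> bas m = bas (pm (w \<circ> u) H)"
    using bas_Hy[OF comp_W[OF w Hy(1)] Hy(2)] g_mult[OF w Hy(1)] B.m_assoc[of "g w" "g u" "e H"] w by simp
  then show ?thesis using Sp_bas[OF ArI[OF comp_W[OF w Hy(1)] Hy_X[OF Hy(2)]]] by simp
qed

lemma Sp_mult:
  assumes "a \<in> carrier B" "\<And>m. m \<in> Ar \<Longrightarrow> a \<otimes>\<^bsub>B\<^esub> bas m \<in> Sp" "x \<in> Sp"
  shows "a \<otimes>\<^bsub>B\<^esub> x \<in> Sp"
proof -
  obtain f where f: "x = \<theta> f" using assms(3) unfolding Sp_def by blast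
  have "a \<otimes>\<^bsub>B\<^esub> x = (\<Oplus>\<^bsub>B\<^esub>m\<in>Ar. a \<otimes>\<^bsub>B\<^esub> (f m \<odot>\<^bsub>B\<^esub> bas m))"
    unfolding f \<theta>_def by (rule B.finsum_rdistr[OF fin_Ar]) (use assms(1) in \<open>auto simp: VB(2) bas_closed\<close>)
  also have "\<dots> \<in> Sp"
    by (rule Sp_finsum[OF fin_Ar]) (use assms(1,2) in \<open>simp add: B_smult bas_closed Sp_sc\<close>)
  finally show ?thesis .
qed

lemma g_Sp: "w \<in> W \<Longrightarrow> x \<in> Sp \<Longrightarrow> g w \<otimes>\<^bsub>B\<^esub> x \<in> Sp"
  by (rule Sp_mult) (auto intro: g_bas)

lemma gge_Sp: "w \<in> W \<Longrightarrow> H \<in> Hy \<Longrightarrow> g w \<otimes>\<^bsub>B\<^esub> e H \<in> Sp"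
  using Sp_bas[OF ArI[OF _ Hy_X]] bas_Hy by metis

text \<open>Moving e_H past \<open>u\<close> leaves a product e_K e_J on the right of
  \<open>u\<close>. It is \<delta> e_J by relation (1), 0 by the truncation, or a combination of the
  s e_J by relation (3).\<close>

lemma e_bas: assumes H: "H \<in> Hy" and m: "m \<in> Ar" shows "e H \<otimes>\<^bsub>B\<^esub> bas m \<in> Sp"
  using m
proof (cases rule: bas_cases)
  case (UNIV u)
  then show ?thesis using e_g[OF UNIV(1) H] gge_Sp[OF UNIV(1) W_Hy[OF iv_W[OF UNIV(1)] H]] by simp
next
  case (Hy u J)
  let ?K = "iv u ` H"
  have K: "?K \<in> Hy" by (rule W_Hy[OF iv_W[OF Hy(1)] H])
  have "e H \<otimes>\<^bsub>B\<^esub> bas m = (e H \<otimes>\<^bsub>B\<^esub> g u) \<otimes>\<^bsub>B\<^esub> e J"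
    unfolding Hy(4) by (rule B.m_assoc[symmetric]) (use Hy H in auto)
  also have "\<dots> = g u \<otimes>\<^bsub>B\<^esub> (e ?K \<otimes>\<^bsub>B\<^esub> e J)"
    unfolding e_g[OF Hy(1) H] by (rule B.m_assoc) (use Hy K in auto)
  finally have eq: "e H \<otimes>\<^bsub>B\<^esub> bas m = g u \<otimes>\<^bsub>B\<^esub> (e ?K \<otimes>\<^bsub>B\<^esub> e J)" .
  have "e ?K \<otimes>\<^bsub>B\<^esub> e J \<in> Sp"
  proof -
    have eJ: "e J \<in> Sp" using gge_Sp[OF id_W Hy(2)] Hy(2) by (simp add: g_id)
    consider "?K = J" | "?K \<noteq> J" "tv ?K J" | "?K \<noteq> J" "\<not> tv ?K J" by blast
    then show ?thesis
    proof cases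
      case 1
      then show ?thesis using e_square[OF Hy(2)] Sp_sc[OF eJ] by simp
    next
      case 2
      then show ?thesis using tv_zero[OF K Hy(2)] Sp_zero by simp
    next
      case 3
      have "e ?K \<otimes>\<^bsub>B\<^esub> e J = (\<Oplus>\<^bsub>B\<^esub>s\<in>{s\<in>R. s ` J = ?K}. (\<nu>' s \<odot>\<^bsub>B\<^esub> g s) \<otimes>\<^bsub>B\<^esub> e J)"
        unfolding e_nontv(1)[OF K Hy(2) 3] sm_def
        by (rule B.finsum_ldistr) (use finite_R Hy(2) R_W in \<open>auto simp: VB(2)\<close>)
      also have "\<dots> \<in> Sp"
        by (rule Sp_finsum) (use finite_R Hy(2) R_W in \<open>auto simp: B_smult intro!: Sp_sc gge_Sp\<close>)
      finally show ?thesis .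
    qed
  qed
  then show ?thesis unfolding eq by (rule g_Sp[OF Hy(1)])
qed

lemma e_Sp: "H \<in> Hy \<Longrightarrow> x \<in> Sp \<Longrightarrow> e H \<otimes>\<^bsub>B\<^esub> x \<in> Sp"
  by (rule Sp_mult) (auto intro: e_bas)

text \<open>The span contains the unit and is stable under left multiplication by the generators, so
  it is stable under the whole algebra and contains each of its elements.\<close>

lemma Sp_all: "Sp = carrier B"
proof
  show "Sp \<subseteq> carrier B" using Sp_carrier by blast
  have one: "\<one>\<^bsub>B\<^esub> \<in> Sp" using Sp_bas[OF ArI[OF id_W], of UNIV] bas_UNIV[OF id_W] by (simp add: X_def g_id)
  have all: "\<forall>x\<in>Sp. \<pi> f \<otimes>\<^bsub>B\<^esub> x \<in> Sp" if "f \<in> carrier F" for f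
    using that unfolding F_eq
  proof (induction rule: free_algebra_gen_induct)
    case one
    then show ?case using \<pi>D(5) Sp_carrier unfolding F_eq by simp
  next
    case (gen x)
    then show ?case using g_Sp e_Sp by (auto simp: g_def e_def)
  next
    case (mult f k)
    then show ?case using \<pi>D(1,2) Sp_carrier unfolding F_eq by (simp add: B.m_assoc)
  next
    case (add f k)
    then show ?case using \<pi>D(1,3) Sp_carrier Sp_add unfolding F_eq by (simp add: B.l_distr)
  next
    case (smult c f)
    then show ?case using \<pi>D(1,4) Sp_carrier Sp_sc unfolding F_eq by (simp add: B_smult)
  qed
  show "carrier B \<subseteq> Sp"
  proof
    fix a assume a: "a \<in> carrier B"
    then obtain f where "f \<in> carrier F" "a = \<pi> f" using surj by auto
    then have "a \<otimes>\<^bsub>B\<^esub> \<one>\<^bsub>B\<^esub> \<in> Sp" using all one by simp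
    then show "a \<in> Sp" using a by simp
  qed
qed

end

section \<open>The matrix of the homomorphism to the groupoid algebra\<close>

context bc_trunc
begin

text \<open>The matrix of \<open>h\<close> from the coordinates of the family \<open>bas\<close> to
  the basis of arrows. Unlike \<open>h\<close> it is an endomorphism of one coordinate space, so
  injectivity implies surjectivity.\<close>

definition T :: "(('v \<Rightarrow> 'v option) \<Rightarrow> 'c poly fract) \<Rightarrow> ('v \<Rightarrow> 'v option) \<Rightarrow> 'c poly fract" where
  "T f = (\<Sum>m\<in>Ar. sc (f m) (h (bas m)))"

lemma h_supported: "x \<in> carrier B \<Longrightarrow> h x \<in> supported Ar"
  using hD(1) by (simp add: galg_simps)

lemma h_\<theta>: "h (\<theta> f) = T f"
proof -
  have "h (\<theta> f) = (\<Oplus>\<^bsub>galg\<^esub>m\<in>Ar. h (f m \<odot>\<^bsub>B\<^esub> bas m))"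
    unfolding \<theta>_def
    by (rule additive_finsum[OF VB(1) vectorspaceD(1)[OF assoc_algebraD(2)[OF assoc_algebra_galg]]])
      (use hD VB(2) bas_closed in auto)
  also have "\<dots> = (\<Sum>m\<in>Ar. h (f m \<odot>\<^bsub>B\<^esub> bas m))"
    by (rule galg_finsum) (rule h_supported[OF VB(2)[OF bas_closed]])
  also have "\<dots> = T f" unfolding T_def
    by (rule sum.cong[OF refl]) (simp only: hD(4)[OF bas_closed] galg_smult)
  finally show ?thesis .
qed

lemma h_bas_UNIV: "w \<in> W \<Longrightarrow> h (bas (pm w UNIV)) = gw w"
  by (simp add: bas_UNIV h_g)

lemma h_bas_Hy:
  assumes "w \<in> W" "H \<in> Hy"
  shows "h (bas (pm w H)) = sc \<delta>' (dlt (pm w H)) + (\<Sum>s\<in>Tr H. sc (\<nu>' s) (dlt (pm (w \<circ> s) H)))"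
proof -
  have "h (bas (pm w H)) = gm (gw w) (eh H)"
    unfolding bas_Hy[OF assms] hD(2)[OF g_closed[OF assms(1)] e_closed[OF assms(2)]] h_g[OF assms(1)] h_e[OF assms(2)]
    by (simp only: galg_simps)
  then show ?thesis using gw_eh_expand[OF assms] by (simp only:)
qed

text \<open>The rows of the arrows starting at the whole space form an identity block:
  \<open>w\<close> has one such restriction, which determines it, and w e_H has only arrows starting
  at \<open>H\<close> in its image.\<close>

lemma h_bas_at_UNIV:
  assumes m: "m \<in> Ar" and n: "n \<in> Ar" "dom n = UNIV"
  shows "h (bas m) n = (if m = n then 1 else 0)"
  using m
proof (cases rule: bas_cases)
  case (UNIV w)
  have "h (bas m) n = (\<Sum>x\<in>X. dlt (pm w x) n)"
    unfolding UNIV(2) h_bas_UNIV[OF UNIV(1)] gw_def sum_fun_apply ..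
  also have "\<dots> = (\<Sum>x\<in>X. if x = UNIV then (if m = n then 1 else 0) else 0)"
    by (rule sum.cong[OF refl]) (use n UNIV in \<open>auto simp: dlt_def\<close>)
  also have "\<dots> = (if m = n then 1 else 0)" unfolding sum.delta[OF finite_X] by (simp add: X_def)
  finally show ?thesis .
next
  case (Hy w H)
  have ne: "pm u H \<noteq> n" for u using n Hy(2) UNIV_notin_Hy by auto
  have "h (bas m) n = 0"
    unfolding Hy(3) h_bas_Hy[OF Hy(1,2)] plus_fun_apply sum_fun_apply
    using ne by (simp add: sc_def dlt_def eq_commute[of n])
  then show ?thesis using ne Hy by auto
qed

text \<open>Different reflections may lead to the same arrow, so their coefficients are collected.
  This exhibits the columns of the w e_H as \<delta> times unit columns plus constants, the form to
  which the degree argument applies.\<close>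

lemma h_bas_at_Hy:
  assumes m: "m \<in> Ar" "dom m \<noteq> UNIV"
  shows "h (bas m) n = \<delta>' * dlt m n
    + const_fract (\<Sum>s\<in>Tr (dom m). if n = pm (rp m \<circ> s) (dom m) then \<mu> s else 0)"
proof -
  have H: "dom m \<in> Hy" using src_Ob[OF m(1)] m(2) by (simp add: X_def)
  have c0: "const_fract (0 :: 'c) = 0" by (simp add: const_fract_def Zero_fract_def)
  have e: "h (bas m) = sc \<delta>' (dlt m) + (\<Sum>s\<in>Tr (dom m). sc (\<nu>' s) (dlt (pm (rp m \<circ> s) (dom m))))"
    using h_bas_Hy[OF rp(1)[OF m(1)] H] unfolding rp(2)[OF m(1)] .
  have "h (bas m) n = \<delta>' * dlt m n + (\<Sum>s\<in>Tr (dom m). \<nu>' s * dlt (pm (rp m \<circ> s) (dom m)) n)"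
    unfolding e plus_fun_apply sum_fun_apply sc_def ..
  also have "(\<Sum>s\<in>Tr (dom m). \<nu>' s * dlt (pm (rp m \<circ> s) (dom m)) n)
      = (\<Sum>s\<in>Tr (dom m). const_fract (if n = pm (rp m \<circ> s) (dom m) then \<mu> s else 0))"
    by (rule sum.cong[OF refl]) (simp add: dlt_def c0)
  finally show ?thesis unfolding const_fract_sum .
qed

text \<open>The matrix is block triangular: the identity block forces the coordinates at the w to
  vanish, and what remains is \<delta> plus a constant matrix on the arrows starting at a
  hyperplane.\<close>

lemma T_injective:
  assumes f: "f \<in> supported Ar" and T0: "T f = 0"
  shows "f = 0"
proof -
  define ArH where "ArH = {m\<in>Ar. dom m \<noteq> UNIV}"
  have T_at: "(\<Sum>m\<in>Ar. f m * h (bas m) n) = 0" for n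
    using fun_cong[OF T0, of n] by (simp only: T_def sum_fun_apply sc_def zero_fun_apply)
  have f_UNIV: "f n = 0" if n: "n \<in> Ar" "dom n = UNIV" for n
  proof -
    have "(\<Sum>m\<in>Ar. f m * h (bas m) n) = (\<Sum>m\<in>Ar. if m = n then f n else 0)"
      by (rule sum.cong[OF refl]) (simp add: h_bas_at_UNIV[OF _ n])
    then show ?thesis using T_at[of n] n fin_Ar by simp
  qed
  have fH: "f \<in> supported ArH" using f f_UNIV by (auto simp: supported_def ArH_def)
  have finH: "finite ArH" using fin_Ar by (simp add: ArH_def)
  show "f = 0"
  proof (rule indet_plus_const_injective[OF finH fH])
    fix n assume n: "n \<in> ArH"
    let ?M = "\<lambda>n m. \<Sum>s\<in>Tr (dom m). if n = pm (rp m \<circ> s) (dom m) then \<mu> s else 0"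
    have "0 = (\<Sum>m\<in>Ar. f m * h (bas m) n)" using T_at by simp
    also have "\<dots> = (\<Sum>m\<in>ArH. f m * h (bas m) n)"
      by (rule sum.mono_neutral_right[OF fin_Ar]) (use f_UNIV in \<open>auto simp: ArH_def\<close>)
    also have "\<dots> = (\<Sum>m\<in>ArH. (if m = n then \<delta>' * f n else 0) + const_fract (?M n m) * f m)"
      by (rule sum.cong[OF refl]) (auto simp: ArH_def h_bas_at_Hy dlt_def algebra_simps)
    also have "\<dots> = \<delta>' * f n + (\<Sum>m\<in>ArH. const_fract (?M n m) * f m)"
      unfolding sum.distrib sum.delta[OF finH] using n by simp
    finally show "\<delta>' * f n + (\<Sum>m\<in>ArH. const_fract (?M n m) * f m) = 0" ..
  qed
qed

lemma T_linear: "Vector_Spaces.linear (\<lambda>c f u. c * f u) (\<lambda>c f u. c * f u) T"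
proof (unfold_locales)
  fix f f' :: "('v \<Rightarrow> 'v option) \<Rightarrow> 'c poly fract" and c
  show "T (f + f') = T f + T f'"
    unfolding T_def sum.distrib[symmetric]
    by (rule sum.cong[OF refl], rule ext) (simp only: sc_def plus_fun_apply distrib_right)
  show "T (\<lambda>u. c * f u) = (\<lambda>u. c * T f u)"
    unfolding T_def sum_fun_apply sum_distrib_left
    by (rule ext) (simp only: sum_fun_apply sc_def mult.assoc)
qed

text \<open>Every element is a combination of the family \<open>bas\<close>, so injectivity of
  \<open>T\<close> gives injectivity of \<open>h\<close>, and surjectivity of \<open>T\<close> on
  the finite coordinate space gives surjectivity.\<close>

lemma h_bij: "bij_betw h (carrier B) (supported Ar)"
proof (rule bij_betw_imageI)
  show "inj_on h (carrier B)"
  proof (rule inj_onI)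
    fix x y assume xy: "x \<in> carrier B" "y \<in> carrier B" "h x = h y"
    obtain f where f: "f \<in> supported Ar" "x = \<theta> f" using xy(1) Sp_all by (auto simp: Sp_def)
    obtain f' where f': "f' \<in> supported Ar" "y = \<theta> f'" using xy(2) Sp_all by (auto simp: Sp_def)
    have "T f = T f'" using xy(3) f f' by (simp only: h_\<theta>)
    moreover have "T (f - f') = T f - T f'"
      unfolding T_def sum_subtractf[symmetric]
      by (rule sum.cong[OF refl], rule ext) (simp add: sc_def left_diff_distrib)
    ultimately have "f - f' = 0"
      by (intro T_injective[OF fv.subspace_diff[OF subspace_supported f(1) f'(1)]]) simp
    then show "x = y" using f(2) f'(2) by simp
  qed
  show "h ` carrier B = supported Ar"
  proof
    show "h ` carrier B \<subseteq> supported Ar" using h_supported by blast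
    show "supported Ar \<subseteq> h ` carrier B"
    proof
      fix a :: "('v \<Rightarrow> 'v option) \<Rightarrow> 'c poly fract" assume a: "a \<in> supported Ar"
      have cl: "T f \<in> supported Ar" for f
        unfolding h_\<theta>[symmetric] by (rule h_supported[OF \<theta>_closed])
      obtain f where "f \<in> supported Ar" "T f = a"
        using injective_imp_surjective_on_supported[OF fin_Ar T_linear cl T_injective a] by blast
      then show "a \<in> h ` carrier B" using \<theta>_closed[of f] h_\<theta>[of f] by (metis imageI)
    qed
  qed
qed

end

section \<open>Br and Br_1 as quotients of the free algebra\<close>

context refl_alg
begin

abbreviation "Brel \<equiv> {a \<ominus>\<^bsub>F\<^esub> b | a b. (a, b) \<in> bc_relations scale W \<delta> \<nu>}"

lemma bc_ideal_ideal: "ideal (bc_ideal scale W \<delta> \<nu>) F" "Brel \<subseteq> bc_ideal scale W \<delta> \<nu>"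
  "\<And>I. ideal I F \<Longrightarrow> Brel \<subseteq> I \<Longrightarrow> bc_ideal scale W \<delta> \<nu> \<subseteq> I"
proof -
  interpret F: ring F by (rule assoc_algebraD(1)[OF F_alg])
  have c: "Brel \<subseteq> carrier F" using bc_relations_F by auto
  show "ideal (bc_ideal scale W \<delta> \<nu>) F" unfolding bc_ideal_def by (rule F.genideal_ideal[OF c])
  show "Brel \<subseteq> bc_ideal scale W \<delta> \<nu>" unfolding bc_ideal_def by (rule F.genideal_self[OF c])
  show "\<And>I. ideal I F \<Longrightarrow> Brel \<subseteq> I \<Longrightarrow> bc_ideal scale W \<delta> \<nu> \<subseteq> I" unfolding bc_ideal_def by (rule F.genideal_minimal)
qed

abbreviation "BrA \<equiv> Br scale W \<delta> \<nu>"
abbreviation "pBr f \<equiv> bc_ideal scale W \<delta> \<nu> +>\<^bsub>F\<^esub> f"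

lemmas Br_quot = quot_algebra[OF F_alg bc_ideal_ideal(1), folded Br_def]

lemma Br_bc_quot: "bc_quot scale W \<delta> \<nu> BrA pBr"
proof (unfold_locales)
  show "assoc_algebra BrA" "alg_hom F BrA pBr" by (rule Br_quot(1), rule Br_quot(2))
  fix a b assume ab: "(a, b) \<in> bc_relations scale W \<delta> \<nu>"
  then have "a \<ominus>\<^bsub>F\<^esub> b \<in> bc_ideal scale W \<delta> \<nu>" using bc_ideal_ideal(2) by blast
  then show "pBr a = pBr b" using Br_quot(4) bc_relations_F[OF ab] by blast
qed

sublocale Q: bc_quot scale W \<delta> \<nu> BrA pBr by (rule Br_bc_quot)

text \<open>An enumeration of a transverse collection of two members is an ordered transverse pair.
  Hence the general definition of I_2 reduces to the generators for which right stability was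
  shown.\<close>

lemma Br_I_te: "Br_I scale W \<delta> \<nu> (1 + 1) = left_ideal_generated BrA Q.te"
proof -
  have gen: "Br_gen scale W \<delta> \<nu> (Hyp H) = Q.e H" for H by (simp add: Br_gen_def Q.e_def)
  have "{foldr (\<lambda>H x. Br_gen scale W \<delta> \<nu> (Hyp H) \<otimes>\<^bsub>BrA\<^esub> x) Hs \<one>\<^bsub>BrA\<^esub> | Hs.
        distinct Hs \<and> length Hs = 1 + 1 \<and> transverse_collection scale W (set Hs)} = Q.te" (is "?L = _")
  proof
    show "?L \<subseteq> Q.te"
    proof
      fix y assume "y \<in> ?L"
      then obtain Hs where Hs: "distinct Hs" "length Hs = 1 + 1" "transverse_collection scale W (set Hs)"
        and y: "y = foldr (\<lambda>H x. Q.e H \<otimes>\<^bsub>BrA\<^esub> x) Hs \<one>\<^bsub>BrA\<^esub>" unfolding gen by blast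
      obtain H1 H2 where e: "Hs = [H1, H2]"
        using Hs(2) by (auto simp: length_Suc_conv)
      have H: "H1 \<in> Hy" "H2 \<in> Hy" "tv H1 H2"
        using Hs e by (auto simp: transverse_collection_def pairwise_def)
      have "y = Q.e H1 \<otimes>\<^bsub>BrA\<^esub> Q.e H2" using H unfolding y e by simp
      then show "y \<in> Q.te" using H unfolding Q.te_def by blast
    qed
    show "Q.te \<subseteq> ?L"
    proof
      fix y assume "y \<in> Q.te"
      then obtain H1 H2 where H: "H1 \<in> Hy" "H2 \<in> Hy" "tv H1 H2" "y = Q.e H1 \<otimes>\<^bsub>BrA\<^esub> Q.e H2"
        unfolding Q.te_def by blast
      have "y = foldr (\<lambda>H x. Q.e H \<otimes>\<^bsub>BrA\<^esub> x) [H1, H2] \<one>\<^bsub>BrA\<^esub>" using H by simp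
      moreover have "distinct [H1, H2]" "length [H1, H2] = 1 + 1" "transverse_collection scale W (set [H1, H2])"
        using H tv_sym[OF H(3)] by (auto simp: transverse_collection_def pairwise_def transverse_def)
      ultimately show "y \<in> ?L" unfolding gen by blast
    qed
  qed
  then show ?thesis unfolding Br_I_def by simp
qed

abbreviation "I2 \<equiv> Br_I scale W \<delta> \<nu> (1 + 1)"
abbreviation "Br1 \<equiv> Br_trunc scale W \<delta> \<nu> 1"
abbreviation "pBr1 f \<equiv> I2 +>\<^bsub>BrA\<^esub> pBr f"

lemmas I2 = Q.te_ideal[OF Br_quot(3), folded Br_I_te]
lemmas Br1_quot = quot_algebra[OF Br_quot(1) I2(1), folded Br_trunc_def]

lemma pBr1_hom: "alg_hom F Br1 pBr1" "carrier Br1 = pBr1 ` carrier F"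
proof -
  show "alg_hom F Br1 pBr1" using alg_hom_comp[OF Br_quot(2) Br1_quot(2)] by (simp add: comp_def)
  show "carrier Br1 = pBr1 ` carrier F" unfolding Br1_quot(3) Br_quot(3) image_image ..
qed

lemma Br1_bc_quot: "bc_quot scale W \<delta> \<nu> Br1 pBr1"
proof (unfold_locales)
  show "assoc_algebra Br1" "alg_hom F Br1 pBr1" by (rule Br1_quot(1), rule pBr1_hom(1))
  fix a b assume "(a, b) \<in> bc_relations scale W \<delta> \<nu>"
  then show "pBr1 a = pBr1 b" using Q.\<pi>_rel by simp
qed

text \<open>The homomorphism descends twice: through the relations to Br, and then through I_2,
  whose generators it kills because \<open>eh_eh\<close> is 0 on transverse pairs.\<close>

lemma Br1_to_galg:
  obtains h where "alg_hom Br1 galg h" "\<And>w. w \<in> W \<Longrightarrow> h (pBr1 (free_gen (Elt w))) = gw w"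
    "\<And>H. H \<in> Hy \<Longrightarrow> h (pBr1 (free_gen (Hyp H))) = eh H"
proof -
  have G: "assoc_algebra (galg :: ('k, ('v \<Rightarrow> 'v option) \<Rightarrow> 'k) module)" by (rule assoc_algebra_galg)
  interpret G: ring "galg :: ('k, ('v \<Rightarrow> 'v option) \<Rightarrow> 'k) module" by (rule assoc_algebraD(1)[OF G])
  obtain h0 where h0: "alg_hom F galg h0" "\<And>w. w \<in> W \<Longrightarrow> h0 (free_gen (Elt w)) = gw w"
    "\<And>H. H \<in> Hy \<Longrightarrow> h0 (free_gen (Hyp H)) = eh H"
    "\<And>a b. (a, b) \<in> bc_relations scale W \<delta> \<nu> \<Longrightarrow> h0 a = h0 b" using galg_representation by blast
  have "Brel \<subseteq> {x \<in> carrier F. h0 x = \<zero>\<^bsub>galg\<^esub>}"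
  proof
    interpret F: ring F by (rule assoc_algebraD(1)[OF F_alg])
    fix x assume "x \<in> Brel"
    then obtain a b where ab: "(a, b) \<in> bc_relations scale W \<delta> \<nu>" "x = a \<ominus>\<^bsub>F\<^esub> b" by blast
    note c = bc_relations_F[OF ab(1)]
    have "h0 x = h0 b \<ominus>\<^bsub>galg\<^esub> h0 b"
      unfolding ab(2) using alg_hom_zero_minus(3)[OF F_alg G h0(1)] c h0(4)[OF ab(1)] by simp
    also have "\<dots> = \<zero>\<^bsub>galg\<^esub>" using alg_homD(1)[OF h0(1)] c by (simp add: a_minus_def G.r_neg)
    finally show "x \<in> {x \<in> carrier F. h0 x = \<zero>\<^bsub>galg\<^esub>}" using c ab(2) by simp
  qed
  then have "bc_ideal scale W \<delta> \<nu> \<subseteq> {x \<in> carrier F. h0 x = \<zero>\<^bsub>galg\<^esub>}"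
    by (rule bc_ideal_ideal(3)[OF alg_hom_kernel_ideal[OF F_alg G h0(1)]])
  then obtain h1 where h1: "alg_hom BrA galg h1" "\<And>x. x \<in> carrier F \<Longrightarrow> h1 (pBr x) = h0 x"
    using alg_hom_quot[OF F_alg G h0(1) bc_ideal_ideal(1)] unfolding Br_def by blast
  have e1: "h1 (Q.e H) = eh H" if "H \<in> Hy" for H
    using h1(2)[OF Hyp_F[OF that]] h0(3)[OF that] by (simp add: Q.e_def)
  have "left_ideal BrA {x \<in> carrier BrA. h1 x = \<zero>\<^bsub>galg\<^esub>}"
  proof -
    interpret K: ideal "{x \<in> carrier BrA. h1 x = \<zero>\<^bsub>galg\<^esub>}" BrA
      by (rule alg_hom_kernel_ideal[OF Br_quot(1) G h1(1)])
    show ?thesis unfolding left_ideal_def using K.additive_subgroup_axioms K.I_l_closed by blast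
  qed
  moreover have "Q.te \<subseteq> {x \<in> carrier BrA. h1 x = \<zero>\<^bsub>galg\<^esub>}"
  proof
    fix x assume "x \<in> Q.te"
    then obtain H1 H2 where H: "H1 \<in> Hy" "H2 \<in> Hy" "tv H1 H2" "x = Q.e H1 \<otimes>\<^bsub>BrA\<^esub> Q.e H2"
      unfolding Q.te_def by blast
    have ne: "H1 \<noteq> H2" using H(3) by (simp add: transverse_def)
    have "h1 x = gm (eh H1) (eh H2)"
      unfolding H(4) alg_homD(2)[OF h1(1) Q.e_closed[OF H(1)] Q.e_closed[OF H(2)]] e1[OF H(1)] e1[OF H(2)] galg_simps ..
    also have "\<dots> = \<zero>\<^bsub>galg\<^esub>" using eh_eh[OF H(1,2)] ne H(3) by (simp only: if_False if_True galg_simps)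
    finally show "x \<in> {x \<in> carrier BrA. h1 x = \<zero>\<^bsub>galg\<^esub>}" using H by simp
  qed
  ultimately have "I2 \<subseteq> {x \<in> carrier BrA. h1 x = \<zero>\<^bsub>galg\<^esub>}" by (rule I2(4))
  then obtain h where h: "alg_hom Br1 galg h" "\<And>x. x \<in> carrier BrA \<Longrightarrow> h (I2 +>\<^bsub>BrA\<^esub> x) = h1 x"
    using alg_hom_quot[OF Br_quot(1) G h1(1) I2(1)] unfolding Br_trunc_def by blast
  show thesis
  proof (rule that[OF h(1)])
    show "h (pBr1 (free_gen (Elt w))) = gw w" if "w \<in> W" for w
      using h(2)[OF alg_homD(1)[OF Br_quot(2) Elt_F[OF that]]] h1(2)[OF Elt_F[OF that]] h0(2)[OF that] by simp
    show "h (pBr1 (free_gen (Hyp H))) = eh H" if "H \<in> Hy" for H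
      using h(2)[OF alg_homD(1)[OF Br_quot(2) Hyp_F[OF that]]] h1(2)[OF Hyp_F[OF that]] h0(3)[OF that] by simp
  qed
qed

lemma Br1_tv_zero:
  assumes "H1 \<in> Hy" "H2 \<in> Hy" "tv H1 H2"
  shows "pBr1 (free_gen (Hyp H1)) \<otimes>\<^bsub>Br1\<^esub> pBr1 (free_gen (Hyp H2)) = \<zero>\<^bsub>Br1\<^esub>"
proof -
  have t: "Q.e H1 \<otimes>\<^bsub>BrA\<^esub> Q.e H2 \<in> I2" using I2(3) assms unfolding Q.te_def by blast
  have c: "Q.e H1 \<otimes>\<^bsub>BrA\<^esub> Q.e H2 \<in> carrier BrA" using assms by simp
  have "pBr1 (free_gen (Hyp H1)) \<otimes>\<^bsub>Br1\<^esub> pBr1 (free_gen (Hyp H2)) = I2 +>\<^bsub>BrA\<^esub> (Q.e H1 \<otimes>\<^bsub>BrA\<^esub> Q.e H2)"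
    using alg_homD(2)[OF Br1_quot(2) Q.e_closed[OF assms(1)] Q.e_closed[OF assms(2)]] by (simp add: Q.e_def)
  also have "\<dots> = I2 +>\<^bsub>BrA\<^esub> \<zero>\<^bsub>BrA\<^esub>"
    using Br1_quot(4)[OF c, of "\<zero>\<^bsub>BrA\<^esub>"] t c by (simp add: a_minus_def)
  also have "\<dots> = \<zero>\<^bsub>Br1\<^esub>" by (rule alg_hom_zero_minus(1)[OF Br_quot(1) Br1_quot(1,2)])
  finally show ?thesis .
qed

end

section \<open>Semisimplicity and dimension\<close>

lemma (in fin_groupoid) galg_dim:
  "vectorspace.fin_dim class_ring (galg :: ('k::field, 'm \<Rightarrow> 'k) module)"
  "vectorspace.dim class_ring (galg :: ('k::field, 'm \<Rightarrow> 'k) module) = card Ar"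
proof -
  let ?A = "galg :: ('k, 'm \<Rightarrow> 'k) module"
  let ?B = "dlt ` Ar :: ('m \<Rightarrow> 'k) set"
  interpret V: vectorspace class_ring ?A by (rule assoc_algebraD(2)[OF assoc_algebra_galg])
  have fin: "finite ?B" using fin_Ar by simp
  have sub: "?B \<subseteq> carrier ?A" using dlt_closed by (auto simp: galg_simps)
  have lc: "V.lincomb a ?B n = a (dlt n)" if n: "n \<in> Ar" for a n
  proof -
    have "V.lincomb a ?B = (\<Sum>v\<in>?B. sc (a v) v)"
      unfolding V.lincomb_def galg_smult by (rule galg_finsum) (auto intro: sc_closed dlt_closed)
    also have "\<dots> = (\<Sum>m\<in>Ar. sc (a (dlt m)) (dlt m))"
      by (rule sum.reindex_cong[of dlt]) (auto intro: inj_on_subset[OF inj_dlt])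
    finally have "V.lincomb a ?B n = (\<Sum>m\<in>Ar. if m = n then a (dlt n) else 0)"
      by (auto simp: sum_fun_apply sc_def dlt_def intro!: sum.cong)
    then show ?thesis using n fin_Ar by simp
  qed
  have li: "V.lin_indpt ?B"
  proof (rule V.finite_lin_indpt2[OF fin sub])
    fix a assume z: "V.lincomb a ?B = \<zero>\<^bsub>?A\<^esub>"
    have "a (dlt n) = 0" if "n \<in> Ar" for n
      using lc[OF that, of a] unfolding z galg_simps by simp
    then show "\<forall>v\<in>?B. a v = \<zero>\<^bsub>class_ring\<^esub>" by auto
  qed
  have gen: "V.gen_set ?B"
  proof
    show "V.span ?B \<subseteq> carrier ?A" using V.span_is_subset2[OF sub] .
    show "carrier ?A \<subseteq> V.span ?B"
    proof
      fix f assume "f \<in> carrier ?A"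
      then have f: "f \<in> supported Ar" by (simp add: galg_simps)
      \<comment> \<open>Coefficients of a linear combination are indexed by vectors rather than
        arrows, so the arrow is recovered from its basis vector.\<close>
      define a where "a v = f (inv_into UNIV dlt v)" for v :: "'m \<Rightarrow> 'k"
      have "V.lincomb a ?B \<in> carrier ?A" by (rule V.lincomb_closed[OF sub]) simp
      then have s: "V.lincomb a ?B \<in> supported Ar" by (simp add: galg_simps)
      have "V.lincomb a ?B n = f n" for n
      proof (cases "n \<in> Ar")
        case True
        then show ?thesis using lc[OF True, of a] by (simp add: a_def inv_f_f[OF inj_dlt])
      next
        case False
        then show ?thesis using f s by (simp add: supported_def)
      qed
      then have "f = V.lincomb a ?B" by (rule ext[symmetric])
      then show "f \<in> V.span ?B" unfolding V.finite_span[OF fin sub] by auto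
    qed
  qed
  have basis: "V.basis ?B" unfolding V.basis_def using li gen sub by blast
  show "V.fin_dim" unfolding V.fin_dim_def using fin sub gen by blast
  show "V.dim = card Ar" unfolding V.dim_basis[OF fin basis] by (rule card_image) (rule inj_on_subset[OF inj_dlt subset_UNIV])
qed

context refl_grp
begin

abbreviation "K \<equiv> pointwise_stabilizer W"

lemma pm_fiber:
  assumes w: "w \<in> W"
  shows "{u \<in> W. pm u x = pm w x} = (\<lambda>k. w \<circ> k) ` K x"
proof
  show "(\<lambda>k. w \<circ> k) ` K x \<subseteq> {u \<in> W. pm u x = pm w x}"
    using w comp_W by (auto simp: pointwise_stabilizer_def pm_eq_iff)
  show "{u \<in> W. pm u x = pm w x} \<subseteq> (\<lambda>k. w \<circ> k) ` K x"
  proof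
    fix u assume u: "u \<in> {u \<in> W. pm u x = pm w x}"
    have "iv w \<circ> u \<in> K x"
      using u comp_W[OF iv_W[OF w], of u] iv_apply(1)[OF w] by (auto simp: pointwise_stabilizer_def pm_eq_iff)
    moreover have "u = w \<circ> (iv w \<circ> u)" by (simp only: comp_assoc[symmetric] iv_comp(2)[OF w] id_comp)
    ultimately show "u \<in> (\<lambda>k. w \<circ> k) ` K x" by blast
  qed
qed

lemma id_K: "id \<in> K x"
  by (simp add: pointwise_stabilizer_def id_W)

lemma finite_K: "finite (K x)"
  using finite_W by (simp add: pointwise_stabilizer_def)

text \<open>The elements of \<open>W\<close> with a given restriction to \<open>x\<close> form a
  coset of the pointwise stabilizer, so all fibres of restriction have its size.\<close>

lemma card_pm: "card ((\<lambda>w. pm w x) ` W) * card (K x) = card W"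
proof -
  have c: "card {u \<in> W. pm u x = m} = card (K x)" if m: "m \<in> (\<lambda>w. pm w x) ` W" for m
  proof -
    obtain w where w: "w \<in> W" "m = pm w x" using m by blast
    have "inj_on (\<lambda>k. w \<circ> k) (K x)"
      by (rule inj_onI) (metis comp_assoc iv_comp(1)[OF w(1)] id_comp)
    then show ?thesis unfolding w(2) pm_fiber[OF w(1)] by (rule card_image)
  qed
  have "card W = (\<Sum>m\<in>(\<lambda>w. pm w x) ` W. \<Sum>u\<in>{u \<in> W. pm u x = m}. 1)"
    using sum.group[OF finite_W finite_imageI[OF finite_W], of "\<lambda>w. pm w x" "\<lambda>w. pm w x" "\<lambda>_. 1 :: nat"] by simp
  also have "\<dots> = (\<Sum>m\<in>(\<lambda>w. pm w x) ` W. card (K x))"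
    by (rule sum.cong[OF refl]) (simp add: c)
  finally show ?thesis by simp
qed

lemma K_UNIV: "K UNIV = {id}"
  using id_W by (auto simp: pointwise_stabilizer_def)

lemma K_conj: assumes "w \<in> W" shows "K (w ` x) = (\<lambda>k. w \<circ> k \<circ> iv w) ` K x"
proof
  show "(\<lambda>k. w \<circ> k \<circ> iv w) ` K x \<subseteq> K (w ` x)"
    using assms comp_W iv_W iv_apply(1)[OF assms] by (auto simp: pointwise_stabilizer_def)
  show "K (w ` x) \<subseteq> (\<lambda>k. w \<circ> k \<circ> iv w) ` K x"
  proof
    fix k assume k: "k \<in> K (w ` x)"
    have "iv w \<circ> k \<circ> w \<in> K x"
      using k assms comp_W iv_W iv_apply(1)[OF assms] by (auto simp: pointwise_stabilizer_def)
    moreover have "k = w \<circ> (iv w \<circ> k \<circ> w) \<circ> iv w"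
      using iv_apply(2)[OF assms] by (simp add: fun_eq_iff)
    ultimately show "k \<in> (\<lambda>k. w \<circ> k \<circ> iv w) ` K x" by blast
  qed
qed

lemma card_K_image: assumes "w \<in> W" shows "card (K (w ` x)) = card (K x)"
proof -
  have "inj_on (\<lambda>k. w \<circ> k \<circ> iv w) (K x)"
    by (rule inj_onI) (metis comp_assoc comp_id iv_comp(1)[OF assms] id_comp)
  then show ?thesis unfolding K_conj[OF assms] by (rule card_image)
qed

definition orb :: "'v set \<Rightarrow> 'v set set" where "orb H = {w ` H | w. w \<in> W}"

lemma orbits_eq: "hyperplane_orbits scale W = orb ` Hy"
  by (simp add: hyperplane_orbits_def orb_def)

lemma orb_self: "H \<in> orb H"
  unfolding orb_def mem_Collect_eq by (rule exI[of _ id]) (simp add: id_W)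

lemma orb_image: assumes w: "w \<in> W" shows "orb (w ` H) = orb H"
proof
  show "orb (w ` H) \<subseteq> orb H"
  proof
    fix J assume "J \<in> orb (w ` H)"
    then obtain u where u: "u \<in> W" "J = (u \<circ> w) ` H" unfolding orb_def by (auto simp only: image_comp)
    then show "J \<in> orb H" using comp_W[OF u(1) w] unfolding orb_def by blast
  qed
  show "orb H \<subseteq> orb (w ` H)"
  proof
    fix J assume "J \<in> orb H"
    then obtain u where u: "u \<in> W" "J = u ` H" unfolding orb_def by blast
    have "(u \<circ> iv w) ` w ` H = u ` iv w ` w ` H" by (simp only: image_comp comp_assoc)
    then have "J = (u \<circ> iv w) ` w ` H" using iv_image(1)[OF w, of H] u(2) by (simp only:)
    then show "J \<in> orb (w ` H)" using comp_W[OF u(1) iv_W[OF w]] unfolding orb_def by blast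
  qed
qed

lemma orb_fiber: assumes H: "H \<in> Hy" shows "{J \<in> Hy. orb J = orb H} = orb H"
proof
  show "{J \<in> Hy. orb J = orb H} \<subseteq> orb H" using orb_self by blast
  show "orb H \<subseteq> {J \<in> Hy. orb J = orb H}"
  proof
    fix J assume "J \<in> orb H"
    then obtain w where "w \<in> W" "J = w ` H" unfolding orb_def by blast
    then show "J \<in> {J \<in> Hy. orb J = orb H}" using W_Hy[of w H] H orb_image[of w H] by simp
  qed
qed

text \<open>The arrows are counted by their sources. The stabilizer of the whole space is trivial,
  which gives the term \<open>card W\<close>; along an orbit of hyperplanes the stabilizers are
  conjugate, so any representative gives the same summand.\<close>

lemma card_Ar:
  assumes H0: "\<And>\<O>. \<O> \<in> hyperplane_orbits scale W \<Longrightarrow> H0 \<O> \<in> \<O>"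
  shows "(of_nat (card Ar) :: rat) = of_nat (card W) + (\<Sum>\<O>\<in>hyperplane_orbits scale W.
         of_nat (card \<O>) * (of_nat (card W) / of_nat (card (K (H0 \<O>)))))"
proof -
  have q: "(of_nat (card ((\<lambda>w. pm w x) ` W)) :: rat) = of_nat (card W) / of_nat (card (K x))" for x
  proof -
    have "card (K x) \<noteq> 0" using id_K finite_K by auto
    then show ?thesis using arg_cong[OF card_pm[of x], of "of_nat :: nat \<Rightarrow> rat"] by (simp add: field_simps)
  qed
  have "card Ar = (\<Sum>x\<in>X. card ((\<lambda>w. pm w x) ` W))"
  proof -
    have "Ar = (\<Union>x\<in>X. (\<lambda>w. pm w x) ` W)" by (auto simp: Ar_def)
    moreover have "card (\<Union>x\<in>X. (\<lambda>w. pm w x) ` W) = (\<Sum>x\<in>X. card ((\<lambda>w. pm w x) ` W))"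
      by (rule card_UN_disjoint) (use finite_X finite_W in \<open>auto simp: pm_eq_iff\<close>)
    ultimately show ?thesis by simp
  qed
  then have "(of_nat (card Ar) :: rat) = (\<Sum>x\<in>X. of_nat (card W) / of_nat (card (K x)))" by (simp add: q)
  also have "\<dots> = of_nat (card W) + (\<Sum>H\<in>Hy. of_nat (card W) / of_nat (card (K H)))"
    unfolding X_def using finite_Hy UNIV_notin_Hy by (simp add: K_UNIV)
  also have "(\<Sum>H\<in>Hy. of_nat (card W) / of_nat (card (K H)) :: rat)
     = (\<Sum>\<O>\<in>orb ` Hy. \<Sum>H\<in>{H \<in> Hy. orb H = \<O>}. of_nat (card W) / of_nat (card (K H)))"
    by (rule sum.group[OF finite_Hy finite_imageI[OF finite_Hy], symmetric]) simp
  also have "\<dots> = (\<Sum>\<O>\<in>orb ` Hy. of_nat (card \<O>) * (of_nat (card W) / of_nat (card (K (H0 \<O>)))))"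
  proof (rule sum.cong[OF refl])
    fix \<O> assume O: "\<O> \<in> orb ` Hy"
    then obtain H where H: "H \<in> Hy" "\<O> = orb H" by blast
    have "H0 \<O> \<in> \<O>" using H0 O by (simp add: orbits_eq)
    then obtain w where w: "w \<in> W" "H0 \<O> = w ` H" unfolding H(2) orb_def by blast
    have "card (K J) = card (K (H0 \<O>))" if "J \<in> \<O>" for J
      using that w unfolding H(2) orb_def by (auto simp: card_K_image)
    then have "(\<Sum>J\<in>\<O>. of_nat (card W) / of_nat (card (K J)) :: rat)
      = (\<Sum>J\<in>\<O>. of_nat (card W) / of_nat (card (K (H0 \<O>))))" by (intro sum.cong refl) simp
    then show "(\<Sum>J\<in>{J \<in> Hy. orb J = \<O>}. of_nat (card W) / of_nat (card (K J)) :: rat)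
      = of_nat (card \<O>) * (of_nat (card W) / of_nat (card (K (H0 \<O>))))"
      unfolding H(2) orb_fiber[OF H(1)] by simp
  qed
  finally show ?thesis unfolding orbits_eq .
qed

end

lemma of_nat_poly_fract: "n \<noteq> 0 \<Longrightarrow> of_nat n \<noteq> (0 :: 'c::field_char_0 poly fract)"
  unfolding of_nat_fract Fract_one_hom(3) by simp

locale refl_gen = refl_alg scale W "indet :: 'c::field_char_0 poly fract" "const_fract \<circ> \<mu>"
  for scale :: "complex \<Rightarrow> 'v \<Rightarrow> 'v::ab_group_add" and W and \<mu> :: "('v \<Rightarrow> 'v) \<Rightarrow> 'c::field_char_0"
begin

abbreviation "A \<equiv> generic_Br1 scale W \<mu>"

lemmas A_def = generic_Br1_def[of scale W \<mu>]

definition extends_gens where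
  "extends_gens h \<longleftrightarrow> alg_hom A galg h \<and> (\<forall>w\<in>W. h (pBr1 (free_gen (Elt w))) = gw w) \<and>
     (\<forall>H\<in>Hy. h (pBr1 (free_gen (Hyp H))) = eh H)"

definition h where "h = (SOME h. extends_gens h)"

lemma h: "alg_hom A galg h \<and> (\<forall>w\<in>W. h (pBr1 (free_gen (Elt w))) = gw w) \<and>
     (\<forall>H\<in>Hy. h (pBr1 (free_gen (Hyp H))) = eh H)"
proof (rule Br1_to_galg)
  fix h' :: "_ \<Rightarrow> ('v \<Rightarrow> 'v option) \<Rightarrow> 'c poly fract"
  assume h': "alg_hom Br1 galg h'" "\<And>w. w \<in> W \<Longrightarrow> h' (pBr1 (free_gen (Elt w))) = gw w"
    "\<And>H. H \<in> Hy \<Longrightarrow> h' (pBr1 (free_gen (Hyp H))) = eh H"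
  have "alg_hom Br1 galg h' \<and> (\<forall>w\<in>W. h' (pBr1 (free_gen (Elt w))) = gw w) \<and>
     (\<forall>H\<in>Hy. h' (pBr1 (free_gen (Hyp H))) = eh H)"
  proof (intro conjI)
    show "alg_hom Br1 galg h'" by (fact h'(1))
    show "\<forall>w\<in>W. h' (pBr1 (free_gen (Elt w))) = gw w"
    proof
      fix w assume "w \<in> W"
      then show "h' (pBr1 (free_gen (Elt w))) = gw w" by (fact h'(2))
    qed
    show "\<forall>H\<in>Hy. h' (pBr1 (free_gen (Hyp H))) = eh H"
    proof
      fix H assume "H \<in> Hy"
      then show "h' (pBr1 (free_gen (Hyp H))) = eh H" by (fact h'(3))
    qed
  qed
  then have "extends_gens h'" unfolding extends_gens_def A_def .
  then have "extends_gens h" unfolding h_def by (rule someI[where P = extends_gens])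
  then show ?thesis unfolding extends_gens_def .
qed

sublocale A: bc_quot scale W "indet :: 'c poly fract" "const_fract \<circ> \<mu>" A pBr1
  unfolding A_def by (rule Br1_bc_quot)

sublocale A: bc_trunc scale W \<mu> A pBr1 h
proof (unfold_locales)
  show "carrier A = pBr1 ` carrier F" unfolding A_def by (rule pBr1_hom(2))
  show "A.e H1 \<otimes>\<^bsub>A\<^esub> A.e H2 = \<zero>\<^bsub>A\<^esub>" if "H1 \<in> Hy" "H2 \<in> Hy" "tv H1 H2" for H1 H2
    unfolding A.e_def unfolding A_def by (rule Br1_tv_zero[OF that])
  show "alg_hom A galg h" by (rule conjunct1[OF h])
  show "h (A.g w) = gw w" if "w \<in> W" for w
    unfolding A.g_def by (rule bspec[OF conjunct1[OF conjunct2[OF h]] that])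
  show "h (A.e H) = eh H" if "H \<in> Hy" for H
    unfolding A.e_def by (rule bspec[OF conjunct2[OF conjunct2[OF h]] that])
qed

lemma A_gen: "generic_Br1_gen scale W \<mu> (Elt w) = A.g w" "generic_Br1_gen scale W \<mu> (Hyp H) = A.e H"
  unfolding generic_Br1_gen_def Br_trunc_gen_def Br_gen_def A.g_def A.e_def by (rule refl)+

abbreviation "G \<equiv> (galg :: ('c poly fract, ('v \<Rightarrow> 'v option) \<Rightarrow> 'c poly fract) module)"

lemma G: "assoc_algebra G" by (rule assoc_algebra_galg)

lemma h_bij': "bij_betw h (carrier A) (carrier G)"
  using A.h_bij by (simp add: galg_simps)

text \<open>The isomorphism back from the groupoid algebra: \<open>j (dlt m)\<close> is the element
  of Br_1 that corresponds to the arrow \<open>m\<close>.\<close>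

definition j where "j = inv_into (carrier A) h"

lemma j_hom: "alg_hom G A j"
  unfolding j_def by (rule alg_hom_inverse[OF A.B A.h h_bij'])

lemma jh: "a \<in> carrier A \<Longrightarrow> j (h a) = a"
  unfolding j_def using h_bij' by (rule bij_betw_inv_into_left)

lemma hj: "f \<in> supported Ar \<Longrightarrow> h (j f) = f"
  unfolding j_def using bij_betw_inv_into_right[OF h_bij'] by (simp add: galg_simps)

text \<open>The Maschke complements are carried over from the groupoid algebra by \<open>j\<close>,
  and the size of a left ideal is the dimension of its image under \<open>h\<close>.\<close>

lemma A_semisimple: "semisimple_algebra A"
proof (rule semisimple_if_complemented[OF A.B, of "\<lambda>L. fv.dim (h ` L)"])
  have hs: "h ` carrier A = carrier G" using h_bij' by (simp add: bij_betw_def)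
  have js: "j ` carrier G = carrier A"
    unfolding j_def using bij_betw_inv_into[OF h_bij'] by (simp add: bij_betw_def)
  have injh: "inj_on h (carrier A)" using h_bij' by (simp add: bij_betw_def)
  have hL: "left_ideal G (h ` L)" if "left_ideal A L" for L by (rule alg_hom_left_ideal[OF A.B G A.h hs that])
  show "fv.dim (h ` L) < fv.dim (h ` L')" if L: "left_ideal A L" "left_ideal A L'" "L \<subset> L'" for L L'
  proof (rule galg_dim_less[OF hL[OF L(1)] hL[OF L(2)]])
    have "L' \<subseteq> carrier A" by (rule left_idealD(1)[OF A.B L(2)])
    then have "h ` L = h ` L' \<longleftrightarrow> L = L'"
      using inj_on_image_eq_iff[OF injh, of L L'] L(3) by (meson psubset_imp_subset subset_trans)
    then have "h ` L \<noteq> h ` L'" using L(3) by (simp only: psubset_eq simp_thms)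
    moreover have "h ` L \<subseteq> h ` L'" by (rule image_mono[OF psubset_imp_subset[OF L(3)]])
    ultimately show "h ` L \<subset> h ` L'" by (rule psubsetI[rotated])
  qed
  fix L assume L: "left_ideal A L"
  obtain C where C: "left_ideal G C" "h ` L \<inter> C = {0}" "\<forall>a\<in>supported Ar. \<exists>x\<in>h ` L. \<exists>y\<in>C. a = x + y"
    using galg_complement[OF of_nat_poly_fract hL[OF L]] by blast
  have jC: "left_ideal A (j ` C)" by (rule alg_hom_left_ideal[OF G A.B j_hom js C(1)])
  have Cs: "C \<subseteq> supported Ar" using left_idealD(1)[OF G C(1)] by (simp add: galg_simps)
  have Lc: "L \<subseteq> carrier A" by (rule left_idealD(1)[OF A.B L])
  have j0: "j 0 = \<zero>\<^bsub>A\<^esub>" using alg_hom_zero_minus(1)[OF G A.B j_hom] by (simp add: galg_simps)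
  have c1: "L \<inter> j ` C = {\<zero>\<^bsub>A\<^esub>}"
  proof
    show "L \<inter> j ` C \<subseteq> {\<zero>\<^bsub>A\<^esub>}"
    proof
      fix x assume "x \<in> L \<inter> j ` C"
      then obtain c where c: "c \<in> C" "x = j c" "x \<in> L" by blast
      then have "h x = c" using hj[OF subsetD[OF Cs c(1)]] by simp
      then have "c \<in> h ` L \<inter> C" using c by blast
      then show "x \<in> {\<zero>\<^bsub>A\<^esub>}" using C(2) c j0 by simp
    qed
    show "{\<zero>\<^bsub>A\<^esub>} \<subseteq> L \<inter> j ` C" using left_idealD(2)[OF A.B L] left_idealD(2)[OF A.B jC] by simp
  qed
  have c2: "\<exists>x\<in>L. \<exists>y\<in>j ` C. a = x \<oplus>\<^bsub>A\<^esub> y" if a: "a \<in> carrier A" for a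
  proof -
    obtain x' y where x': "x' \<in> h ` L" and y: "y \<in> C" "h a = x' + y"
      using bspec[OF C(3) A.h_supported[OF a]] by blast
    then obtain x where xy: "x \<in> L" "y \<in> C" "h a = h x + y" by blast
    have "a = j (h x + y)" using jh[OF a] xy by simp
    also have "\<dots> = j (h x) \<oplus>\<^bsub>A\<^esub> j y"
      using alg_homD(3)[OF j_hom, of "h x" y] A.h_supported[OF subsetD[OF Lc xy(1)]] subsetD[OF Cs xy(2)]
      unfolding galg_simps by simp
    also have "j (h x) = x" by (rule jh[OF subsetD[OF Lc xy(1)]])
    finally show ?thesis using xy(1,2) by (intro bexI[of _ x] bexI[of _ "j y"]) simp_all
  qed
  show "\<exists>C. left_ideal A C \<and> L \<inter> C = {\<zero>\<^bsub>A\<^esub>} \<and> (\<forall>a\<in>carrier A. \<exists>x\<in>L. \<exists>y\<in>C. a = x \<oplus>\<^bsub>A\<^esub> y)"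
    by (intro exI[of _ "j ` C"] conjI ballI jC c1 c2)
qed

lemma A_dim: "vectorspace.fin_dim class_ring A" "vectorspace.dim class_ring A = card Ar"
proof -
  have js: "j ` carrier G = carrier A" and injj: "inj_on j (carrier G)"
    unfolding j_def using bij_betw_inv_into[OF h_bij'] by (auto simp: bij_betw_def)
  interpret VG: vectorspace class_ring G by (rule assoc_algebraD(2)[OF G])
  interpret VA: vectorspace class_ring A by (rule assoc_algebraD(2)[OF A.B])
  have mh: "j \<in> LinearCombinations.module_hom class_ring G A"
    by (rule module_homI) (use alg_homD[OF j_hom] in auto)
  interpret L: linear_map class_ring G A j
    by unfold_locales (rule mh)
  show "VA.fin_dim" by (rule L.surj_fin_dim[OF galg_dim(1) js])
  show "VA.dim = card Ar" by (rule trans[OF L.dim_eq[OF galg_dim(1) injj js, symmetric] galg_dim(2)])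
qed

end

section \<open>Homomorphisms of representations\<close>

lemma group_repD:
  assumes "group_rep G (V, \<tau>)"
  shows "vectorspace class_ring V"
    "\<And>a v. a \<in> carrier G \<Longrightarrow> v \<in> carrier V \<Longrightarrow> \<tau> a v \<in> carrier V"
    "\<And>a v w. a \<in> carrier G \<Longrightarrow> v \<in> carrier V \<Longrightarrow> w \<in> carrier V \<Longrightarrow> \<tau> a (v \<oplus>\<^bsub>V\<^esub> w) = \<tau> a v \<oplus>\<^bsub>V\<^esub> \<tau> a w"
    "\<And>a c v. a \<in> carrier G \<Longrightarrow> v \<in> carrier V \<Longrightarrow> \<tau> a (c \<odot>\<^bsub>V\<^esub> v) = c \<odot>\<^bsub>V\<^esub> \<tau> a v"
    "\<And>v. v \<in> carrier V \<Longrightarrow> \<tau> \<one>\<^bsub>G\<^esub> v = v"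
    "\<And>a b v. a \<in> carrier G \<Longrightarrow> b \<in> carrier G \<Longrightarrow> v \<in> carrier V \<Longrightarrow> \<tau> (a \<otimes>\<^bsub>G\<^esub> b) v = \<tau> a (\<tau> b v)"
  using assms module_homD[of "\<tau> _" V V] unfolding group_rep_def by auto

lemma group_repI:
  assumes "vectorspace class_ring V"
    "\<And>a v. a \<in> carrier G \<Longrightarrow> v \<in> carrier V \<Longrightarrow> \<tau> a v \<in> carrier V"
    "\<And>a v w. a \<in> carrier G \<Longrightarrow> v \<in> carrier V \<Longrightarrow> w \<in> carrier V \<Longrightarrow> \<tau> a (v \<oplus>\<^bsub>V\<^esub> w) = \<tau> a v \<oplus>\<^bsub>V\<^esub> \<tau> a w"
    "\<And>a c v. a \<in> carrier G \<Longrightarrow> v \<in> carrier V \<Longrightarrow> \<tau> a (c \<odot>\<^bsub>V\<^esub> v) = c \<odot>\<^bsub>V\<^esub> \<tau> a v"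
    "\<And>v. v \<in> carrier V \<Longrightarrow> \<tau> \<one>\<^bsub>G\<^esub> v = v"
    "\<And>a b v. a \<in> carrier G \<Longrightarrow> b \<in> carrier G \<Longrightarrow> v \<in> carrier V \<Longrightarrow> \<tau> (a \<otimes>\<^bsub>G\<^esub> b) v = \<tau> a (\<tau> b v)"
  shows "group_rep G (V, \<tau>)"
  unfolding group_rep_def using assms by (auto intro!: module_homI)

lemma subspaceI:
  fixes V :: "('k::field, 'm) module"
  assumes V: "vectorspace class_ring V" and U: "U \<subseteq> carrier V" "\<zero>\<^bsub>V\<^esub> \<in> U"
    "\<And>v w. v \<in> U \<Longrightarrow> w \<in> U \<Longrightarrow> v \<oplus>\<^bsub>V\<^esub> w \<in> U" "\<And>c v. v \<in> U \<Longrightarrow> c \<odot>\<^bsub>V\<^esub> v \<in> U"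
  shows "VectorSpace.subspace class_ring U V"
proof -
  interpret V: vectorspace class_ring V by (rule V)
  show ?thesis
    unfolding VectorSpace.subspace_def LinearCombinations.submodule_def using U V V.module_axioms by simp
qed

lemma subspaceD:
  fixes V :: "('k::field, 'm) module"
  assumes "VectorSpace.subspace class_ring U V"
  shows "U \<subseteq> carrier V" "\<zero>\<^bsub>V\<^esub> \<in> U"
    "\<And>v w. v \<in> U \<Longrightarrow> w \<in> U \<Longrightarrow> v \<oplus>\<^bsub>V\<^esub> w \<in> U" "\<And>c v. v \<in> U \<Longrightarrow> c \<odot>\<^bsub>V\<^esub> v \<in> U"
  using assms unfolding VectorSpace.subspace_def LinearCombinations.submodule_def by auto

lemma subspace_finsum:
  fixes V :: "('k::field, 'm) module"
  assumes V: "vectorspace class_ring V" and U: "VectorSpace.subspace class_ring U V"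
    and S: "finite S" "\<And>i. i \<in> S \<Longrightarrow> f i \<in> U"
  shows "(\<Oplus>\<^bsub>V\<^esub>i\<in>S. f i) \<in> U"
proof -
  interpret V: abelian_group V by (rule vectorspaceD(1)[OF V])
  note UD = subspaceD[OF U]
  show ?thesis using S
  proof (induction S)
    case (insert i S)
    have "(\<Oplus>\<^bsub>V\<^esub>i\<in>insert i S. f i) = f i \<oplus>\<^bsub>V\<^esub> (\<Oplus>\<^bsub>V\<^esub>i\<in>S. f i)"
      by (rule V.finsum_insert) (use insert UD(1) in auto)
    then show ?case using insert UD(3) by simp
  qed (simp add: UD(2))
qed

lemma irreducible_actionD:
  assumes "irreducible_action Y (V, \<rho>)"
  shows "carrier V \<noteq> {\<zero>\<^bsub>V\<^esub>}"
    "\<And>U. VectorSpace.subspace class_ring U V \<Longrightarrow> (\<And>x v. x \<in> Y \<Longrightarrow> v \<in> U \<Longrightarrow> \<rho> x v \<in> U) \<Longrightarrow>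
      U = {\<zero>\<^bsub>V\<^esub>} \<or> U = carrier V"
  using assms unfolding irreducible_action_def by (auto simp: image_subset_iff)

lemma irreducible_actionI:
  assumes "carrier V \<noteq> {\<zero>\<^bsub>V\<^esub>}"
    "\<And>U. VectorSpace.subspace class_ring U V \<Longrightarrow> (\<And>x v. x \<in> Y \<Longrightarrow> v \<in> U \<Longrightarrow> \<rho> x v \<in> U) \<Longrightarrow>
      U \<noteq> {\<zero>\<^bsub>V\<^esub>} \<Longrightarrow> U = carrier V"
  shows "irreducible_action Y (V, \<rho>)"
  using assms unfolding irreducible_action_def by (auto simp: image_subset_iff)

text \<open>Kernel and image are invariant subspaces; the vector \<open>v0\<close> shows that the
  kernel is proper and the image nonzero, so irreducibility on both sides makes the map bijective.
  The two representations may have elements of different types.\<close>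

lemma schur:
  fixes V :: "('k::field, 'm) module" and V' :: "('k, 'n) module"
  assumes V: "vectorspace class_ring V" and V': "vectorspace class_ring V'"
    and irr: "irreducible_action Y (V, \<rho>)" and irr': "irreducible_action Y (V', \<rho>')"
    and cl: "\<And>x v. x \<in> Y \<Longrightarrow> v \<in> carrier V \<Longrightarrow> \<rho> x v \<in> carrier V"
    and \<rho>'0: "\<And>x. x \<in> Y \<Longrightarrow> \<rho>' x \<zero>\<^bsub>V'\<^esub> = \<zero>\<^bsub>V'\<^esub>"
    and \<phi>: "\<phi> \<in> LinearCombinations.module_hom class_ring V V'"
    and eq: "\<And>x v. x \<in> Y \<Longrightarrow> v \<in> carrier V \<Longrightarrow> \<phi> (\<rho> x v) = \<rho>' x (\<phi> v)"
    and nz: "v0 \<in> carrier V" "\<phi> v0 \<noteq> \<zero>\<^bsub>V'\<^esub>"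
  shows "rep_iso Y (V, \<rho>) (V', \<rho>')"
proof -
  interpret V: abelian_group V by (rule vectorspaceD(1)[OF V])
  interpret V': abelian_group V' by (rule vectorspaceD(1)[OF V'])
  note VD = vectorspaceD[OF V] and VD' = vectorspaceD[OF V'] and \<phi>D = module_homD[OF \<phi>]
  have \<phi>0: "\<phi> \<zero>\<^bsub>V\<^esub> = \<zero>\<^bsub>V'\<^esub>" using additive_zero[OF VD(1) VD'(1), of \<phi>] \<phi>D by blast
  define Ke where "Ke = {v \<in> carrier V. \<phi> v = \<zero>\<^bsub>V'\<^esub>}"
  have "VectorSpace.subspace class_ring Ke V"
    by (rule subspaceI[OF V]) (auto simp: Ke_def \<phi>0 \<phi>D VD VD')
  then have "Ke = {\<zero>\<^bsub>V\<^esub>} \<or> Ke = carrier V"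
    by (rule irreducible_actionD(2)[OF irr]) (auto simp: Ke_def cl eq \<rho>'0)
  then have Ke: "Ke = {\<zero>\<^bsub>V\<^esub>}" using nz by (auto simp: Ke_def)
  have inj: "inj_on \<phi> (carrier V)"
  proof (rule inj_onI)
    fix v w assume vw: "v \<in> carrier V" "w \<in> carrier V" "\<phi> v = \<phi> w"
    have m: "\<phi> (\<ominus>\<^bsub>V\<^esub> w) = \<ominus>\<^bsub>V'\<^esub> \<phi> w"
      using VD(9)[OF vw(2)] VD'(9)[OF \<phi>D(1)[OF vw(2)]] \<phi>D(3)[OF vw(2), of "-1"] by simp
    have "\<phi> (v \<oplus>\<^bsub>V\<^esub> \<ominus>\<^bsub>V\<^esub> w) = \<zero>\<^bsub>V'\<^esub>"
      using \<phi>D(2)[OF vw(1) V.a_inv_closed[OF vw(2)]] m vw \<phi>D(1) V'.r_neg by simp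
    then have "v \<oplus>\<^bsub>V\<^esub> \<ominus>\<^bsub>V\<^esub> w \<in> Ke" using vw by (simp add: Ke_def)
    then have "v \<oplus>\<^bsub>V\<^esub> \<ominus>\<^bsub>V\<^esub> w = \<zero>\<^bsub>V\<^esub>" using Ke by simp
    then show "v = w" using V.minus_equality[of v "\<ominus>\<^bsub>V\<^esub> w"] vw by simp
  qed
  have "VectorSpace.subspace class_ring (\<phi> ` carrier V) V'"
  proof (rule subspaceI[OF V'])
    show "\<phi> ` carrier V \<subseteq> carrier V'" using \<phi>D(1) by blast
    show "\<zero>\<^bsub>V'\<^esub> \<in> \<phi> ` carrier V" using \<phi>0 by (metis V.zero_closed imageI)
    fix v c assume "v \<in> \<phi> ` carrier V"
    then obtain x where x: "x \<in> carrier V" "v = \<phi> x" by blast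
    show "c \<odot>\<^bsub>V'\<^esub> v \<in> \<phi> ` carrier V"
      using \<phi>D(3)[OF x(1), of c] VD(2)[OF x(1), of c] x(2) by (metis imageI)
    fix w assume "w \<in> \<phi> ` carrier V"
    then obtain y where y: "y \<in> carrier V" "w = \<phi> y" by blast
    show "v \<oplus>\<^bsub>V'\<^esub> w \<in> \<phi> ` carrier V"
      using \<phi>D(2)[OF x(1) y(1)] V.add.m_closed[OF x(1) y(1)] x(2) y(2) by (metis imageI)
  qed
  then have "\<phi> ` carrier V = {\<zero>\<^bsub>V'\<^esub>} \<or> \<phi> ` carrier V = carrier V'"
    by (rule irreducible_actionD(2)[OF irr']) (use cl eq in \<open>force simp: eq[symmetric]\<close>)
  then have "\<phi> ` carrier V = carrier V'" using nz by blast
  then have "bij_betw \<phi> (carrier V) (carrier V')" using inj by (simp add: bij_betw_def)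
  then show ?thesis unfolding rep_iso_def using \<phi> eq by blast
qed

lemma rep_isoE:
  assumes "rep_iso Y (V, \<rho>) (V', \<rho>')"
  obtains \<phi> where "\<phi> \<in> LinearCombinations.module_hom class_ring V V'" "bij_betw \<phi> (carrier V) (carrier V')"
    "\<And>x v. x \<in> Y \<Longrightarrow> v \<in> carrier V \<Longrightarrow> \<phi> (\<rho> x v) = \<rho>' x (\<phi> v)"
  using assms unfolding rep_iso_def by blast

lemma rep_iso_trans:
  assumes "rep_iso Y M M'" "rep_iso Y M' M''"
  shows "rep_iso Y M M''"
proof -
  obtain V \<rho> V' \<rho>' V'' \<rho>'' where e: "M = (V, \<rho>)" "M' = (V', \<rho>')" "M'' = (V'', \<rho>'')"
    by (metis surj_pair)
  obtain \<phi> where \<phi>: "\<phi> \<in> LinearCombinations.module_hom class_ring V V'" "bij_betw \<phi> (carrier V) (carrier V')"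
    "\<And>x v. x \<in> Y \<Longrightarrow> v \<in> carrier V \<Longrightarrow> \<phi> (\<rho> x v) = \<rho>' x (\<phi> v)"
    using rep_isoE[OF assms(1)[unfolded e]] by blast
  obtain \<psi> where \<psi>: "\<psi> \<in> LinearCombinations.module_hom class_ring V' V''" "bij_betw \<psi> (carrier V') (carrier V'')"
    "\<And>x v. x \<in> Y \<Longrightarrow> v \<in> carrier V' \<Longrightarrow> \<psi> (\<rho>' x v) = \<rho>'' x (\<psi> v)"
    using rep_isoE[OF assms(2)[unfolded e]] by blast
  note pD = module_homD[OF \<phi>(1)] and qD = module_homD[OF \<psi>(1)]
  have "\<psi> \<circ> \<phi> \<in> LinearCombinations.module_hom class_ring V V''"
    by (rule module_homI) (simp_all add: pD qD)
  moreover have "bij_betw (\<psi> \<circ> \<phi>) (carrier V) (carrier V'')" by (rule bij_betw_trans[OF \<phi>(2) \<psi>(2)])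
  moreover have "(\<psi> \<circ> \<phi>) (\<rho> x v) = \<rho>'' x ((\<psi> \<circ> \<phi>) v)" if "x \<in> Y" "v \<in> carrier V" for x v
    using that by (simp add: \<phi>(3) \<psi>(3) pD)
  ultimately show ?thesis unfolding e rep_iso_def by blast
qed

lemma rep_iso_sym:
  assumes V: "vectorspace class_ring V" and cl: "\<And>x v. x \<in> Y \<Longrightarrow> v \<in> carrier V \<Longrightarrow> \<rho> x v \<in> carrier V"
    and iso: "rep_iso Y (V, \<rho>) (V', \<rho>')"
  shows "rep_iso Y (V', \<rho>') (V, \<rho>)"
proof -
  interpret V: abelian_group V by (rule vectorspaceD(1)[OF V])
  obtain \<phi> where \<phi>: "\<phi> \<in> LinearCombinations.module_hom class_ring V V'" "bij_betw \<phi> (carrier V) (carrier V')"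
    "\<And>x v. x \<in> Y \<Longrightarrow> v \<in> carrier V \<Longrightarrow> \<phi> (\<rho> x v) = \<rho>' x (\<phi> v)" using rep_isoE[OF iso] by blast
  note pD = module_homD[OF \<phi>(1)]
  let ?g = "inv_into (carrier V) \<phi>"
  have g: "?g (\<phi> v) = v" if "v \<in> carrier V" for v using \<phi>(2) that by (rule bij_betw_inv_into_left)
  have ex: "\<exists>v\<in>carrier V. w = \<phi> v" if "w \<in> carrier V'" for w using \<phi>(2) that unfolding bij_betw_def by blast
  have "?g \<in> LinearCombinations.module_hom class_ring V' V"
  proof (rule module_homI)
    fix w c assume "w \<in> carrier V'"
    then obtain v where v: "v \<in> carrier V" "w = \<phi> v" using ex by blast
    show "?g w \<in> carrier V" using v g by simp
    show "?g (c \<odot>\<^bsub>V'\<^esub> w) = c \<odot>\<^bsub>V\<^esub> ?g w"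
      using v g[OF v(1)] g[OF vectorspaceD(2)[OF V v(1), of c]] pD(3)[OF v(1), of c] by simp
    fix w' assume "w' \<in> carrier V'"
    then obtain v' where v': "v' \<in> carrier V" "w' = \<phi> v'" using ex by blast
    show "?g (w \<oplus>\<^bsub>V'\<^esub> w') = ?g w \<oplus>\<^bsub>V\<^esub> ?g w'"
      using v v' g[OF v(1)] g[OF v'(1)] g[OF V.add.m_closed[OF v(1) v'(1)]] pD(2)[OF v(1) v'(1)] by simp
  qed
  moreover have "bij_betw ?g (carrier V') (carrier V)" by (rule bij_betw_inv_into[OF \<phi>(2)])
  moreover have "?g (\<rho>' x w) = \<rho> x (?g w)" if x: "x \<in> Y" and w: "w \<in> carrier V'" for x w
  proof -
    obtain v where v: "v \<in> carrier V" "w = \<phi> v" using ex w by blast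
    show ?thesis using v g[OF v(1)] g[OF cl[OF x v(1)]] \<phi>(3)[OF x v(1)] by simp
  qed
  ultimately show ?thesis unfolding rep_iso_def by blast
qed

lemma irreducible_iso:
  fixes V :: "('k::field, 'm) module" and V' :: "('k, 'n) module"
  assumes V: "vectorspace class_ring V" and V': "vectorspace class_ring V'"
    and irr: "irreducible_action Y (V, \<rho>)" and iso: "rep_iso Y (V, \<rho>) (V', \<rho>')"
    and cl: "\<And>x v. x \<in> Y \<Longrightarrow> v \<in> carrier V \<Longrightarrow> \<rho> x v \<in> carrier V"
  shows "irreducible_action Y (V', \<rho>')"
proof -
  interpret V: abelian_group V by (rule vectorspaceD(1)[OF V])
  obtain \<phi> where \<phi>: "\<phi> \<in> LinearCombinations.module_hom class_ring V V'" "bij_betw \<phi> (carrier V) (carrier V')"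
    "\<And>x v. x \<in> Y \<Longrightarrow> v \<in> carrier V \<Longrightarrow> \<phi> (\<rho> x v) = \<rho>' x (\<phi> v)" using rep_isoE[OF iso] by blast
  note pD = module_homD[OF \<phi>(1)] and VD = vectorspaceD[OF V] and VD' = vectorspaceD[OF V']
  have \<phi>0: "\<phi> \<zero>\<^bsub>V\<^esub> = \<zero>\<^bsub>V'\<^esub>" using additive_zero[OF VD(1) VD'(1), of \<phi>] pD by blast
  have im: "\<phi> ` carrier V = carrier V'" and inj: "inj_on \<phi> (carrier V)" using \<phi>(2) by (auto simp: bij_betw_def)
  show ?thesis
  proof (rule irreducible_actionI)
    show "carrier V' \<noteq> {\<zero>\<^bsub>V'\<^esub>}"
    proof
      assume e: "carrier V' = {\<zero>\<^bsub>V'\<^esub>}"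
      have "v = \<zero>\<^bsub>V\<^esub>" if "v \<in> carrier V" for v
        using pD(1)[OF that] that inj \<phi>0 unfolding e inj_on_def by auto
      then show False using irreducible_actionD(1)[OF irr] V.zero_closed by blast
    qed
    fix U assume U: "VectorSpace.subspace class_ring U V'" and ivt: "\<And>x v. x \<in> Y \<Longrightarrow> v \<in> U \<Longrightarrow> \<rho>' x v \<in> U"
      and ne: "U \<noteq> {\<zero>\<^bsub>V'\<^esub>}"
    note UD = subspaceD[OF U]
    define P where "P = {v \<in> carrier V. \<phi> v \<in> U}"
    have "VectorSpace.subspace class_ring P V"
      by (rule subspaceI[OF V]) (auto simp: P_def \<phi>0 pD VD UD)
    then have "P = {\<zero>\<^bsub>V\<^esub>} \<or> P = carrier V"
      by (rule irreducible_actionD(2)[OF irr]) (auto simp: P_def cl \<phi>(3) ivt)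
    then show "U = carrier V'"
    proof
      assume P0: "P = {\<zero>\<^bsub>V\<^esub>}"
      have "U \<subseteq> {\<zero>\<^bsub>V'\<^esub>}"
      proof
        fix u assume u: "u \<in> U"
        then obtain v where "v \<in> carrier V" "u = \<phi> v" using im UD(1) by blast
        then have "v \<in> P" using u by (simp add: P_def)
        then show "u \<in> {\<zero>\<^bsub>V'\<^esub>}" using P0 \<phi>0 \<open>u = \<phi> v\<close> by simp
      qed
      then show ?thesis using ne UD(2) by blast
    next
      assume "P = carrier V"
      then have "\<phi> ` carrier V \<subseteq> U" unfolding P_def by blast
      then have "carrier V' \<subseteq> U" unfolding im .
      then show ?thesis using UD(1) by blast
    qed
  qed
qed

subsection \<open>Transport of structure\<close>

text \<open>Copies the structure of a vector space along an injection into another type. This is how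
  irreducible representations are brought into the universe \<open>nat \<Rightarrow> 'k\<close> over
  which \<Phi> ranges.\<close>

definition transport_space :: "('m \<Rightarrow> 'n) \<Rightarrow> ('k, 'm) module \<Rightarrow> ('k, 'n) module" where
  "transport_space f V = (let g = inv_into (carrier V) f in
     \<lparr>carrier = f ` carrier V, mult = undefined, one = undefined, zero = f \<zero>\<^bsub>V\<^esub>,
      add = (\<lambda>x y. f (g x \<oplus>\<^bsub>V\<^esub> g y)), smult = (\<lambda>c x. f (c \<odot>\<^bsub>V\<^esub> g x))\<rparr>)"

definition transport_action :: "('m \<Rightarrow> 'n) \<Rightarrow> ('k, 'm) module \<Rightarrow> ('a \<Rightarrow> 'm \<Rightarrow> 'm) \<Rightarrow> 'a \<Rightarrow> 'n \<Rightarrow> 'n" where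
  "transport_action f V \<rho> = (\<lambda>a x. f (\<rho> a (inv_into (carrier V) f x)))"

lemma transport_space:
  fixes V :: "('k::field, 'm) module"
  assumes V: "vectorspace class_ring V" and inj: "inj_on f (carrier V)"
  shows "vectorspace class_ring (transport_space f V)"
    and "f \<in> LinearCombinations.module_hom class_ring V (transport_space f V)"
    and "bij_betw f (carrier V) (carrier (transport_space f V))"
proof -
  interpret V: abelian_group V by (rule vectorspaceD(1)[OF V])
  note VD = vectorspaceD[OF V]
  let ?T = "transport_space f V"
  have g [simp]: "inv_into (carrier V) f (f v) = v" if "v \<in> carrier V" for v
    using inj that by (rule inv_into_f_f)
  have T: "carrier ?T = f ` carrier V" "zero ?T = f \<zero>\<^bsub>V\<^esub>"
    "add ?T = (\<lambda>x y. f (inv_into (carrier V) f x \<oplus>\<^bsub>V\<^esub> inv_into (carrier V) f y))"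
    "smult ?T = (\<lambda>c x. f (c \<odot>\<^bsub>V\<^esub> inv_into (carrier V) f x))"
    by (simp_all add: transport_space_def Let_def)
  show "f \<in> LinearCombinations.module_hom class_ring V ?T"
    by (rule module_homI) (simp_all add: T)
  show "bij_betw f (carrier V) (carrier ?T)" using inj by (simp add: bij_betw_def T)
  have ag: "abelian_group ?T"
  proof (rule abelian_groupI)
    fix x assume "x \<in> carrier ?T"
    then obtain v where v: "v \<in> carrier V" "x = f v" by (auto simp: T)
    show "\<exists>y\<in>carrier ?T. y \<oplus>\<^bsub>?T\<^esub> x = \<zero>\<^bsub>?T\<^esub>"
      by (rule bexI[of _ "f (\<ominus>\<^bsub>V\<^esub> v)"]) (use v in \<open>simp_all add: T V.l_neg\<close>)
  qed (auto simp: T V.a_ac)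
  show "vectorspace class_ring ?T"
    by (rule vectorspaceI[OF ag]) (auto simp: T VD)
qed

lemma transport_rep_iso:
  fixes V :: "('k::field, 'm) module"
  assumes V: "vectorspace class_ring V" and inj: "inj_on f (carrier V)"
  shows "rep_iso Y (V, \<rho>) (transport_space f V, transport_action f V \<rho>)"
  unfolding rep_iso_def using transport_space(2,3)[OF V inj] inv_into_f_f[OF inj]
  by (auto simp: transport_action_def intro!: bexI[of _ f])

lemma algebra_rep_iso:
  assumes \<rho>: "algebra_rep A (V, \<rho>)" and V': "vectorspace class_ring V'" and iso: "rep_iso (carrier A) (V, \<rho>) (V', \<rho>')"
    and A: "assoc_algebra A"
  shows "algebra_rep A (V', \<rho>')"
proof -
  note RD = algebra_repD[OF \<rho>] and VD = vectorspaceD[OF algebra_repD(1)[OF \<rho>]]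
  interpret V: abelian_group V by (rule VD(1))
  interpret A: ring A by (rule assoc_algebraD(1)[OF A])
  note VA = vectorspaceD[OF assoc_algebraD(2)[OF A]]
  obtain \<phi> where \<phi>: "\<phi> \<in> LinearCombinations.module_hom class_ring V V'" "bij_betw \<phi> (carrier V) (carrier V')"
    "\<And>x v. x \<in> carrier A \<Longrightarrow> v \<in> carrier V \<Longrightarrow> \<phi> (\<rho> x v) = \<rho>' x (\<phi> v)" using rep_isoE[OF iso] by blast
  note pD = module_homD[OF \<phi>(1)]
  have ex: "\<exists>v\<in>carrier V. w = \<phi> v" if "w \<in> carrier V'" for w using \<phi>(2) that unfolding bij_betw_def by blast
  note r = \<phi>(3)[symmetric]
  show ?thesis
  proof (rule algebra_repI[OF V'])
    fix w c assume "w \<in> carrier V'"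
    then obtain v where v: "v \<in> carrier V" "w = \<phi> v" using ex by blast
    show "\<rho>' \<one>\<^bsub>A\<^esub> w = w" using v by (simp add: r RD)
    fix a assume a: "a \<in> carrier A"
    show "\<rho>' a w \<in> carrier V'" using v a by (simp add: r RD pD)
    show "\<rho>' a (c \<odot>\<^bsub>V'\<^esub> w) = c \<odot>\<^bsub>V'\<^esub> \<rho>' a w" using v a by (simp add: r RD pD(3)[symmetric] VD)
    show "\<rho>' (c \<odot>\<^bsub>A\<^esub> a) w = c \<odot>\<^bsub>V'\<^esub> \<rho>' a w" using v a by (simp add: r RD pD(3)[symmetric] VA)
    show "\<rho>' (a \<otimes>\<^bsub>A\<^esub> b) w = \<rho>' a (\<rho>' b w)" if "b \<in> carrier A" for b using that v a by (simp add: r RD)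
    show "\<rho>' (a \<oplus>\<^bsub>A\<^esub> b) w = \<rho>' a w \<oplus>\<^bsub>V'\<^esub> \<rho>' b w" if "b \<in> carrier A" for b
      using that v a by (simp add: r RD pD(2)[symmetric])
    fix w' assume "w' \<in> carrier V'"
    then obtain v' where v': "v' \<in> carrier V" "w' = \<phi> v'" using ex by blast
    show "\<rho>' a (w \<oplus>\<^bsub>V'\<^esub> w') = \<rho>' a w \<oplus>\<^bsub>V'\<^esub> \<rho>' a w'" using v v' a by (simp add: r RD pD(2)[symmetric])
  qed
qed

lemma group_rep_iso:
  assumes \<rho>: "group_rep G (V, \<rho>)" and V': "vectorspace class_ring V'" and iso: "rep_iso (carrier G) (V, \<rho>) (V', \<rho>')"
    and G: "Group.monoid G"
  shows "group_rep G (V', \<rho>')"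
proof -
  note RD = group_repD[OF \<rho>] and VD = vectorspaceD[OF group_repD(1)[OF \<rho>]]
  interpret V: abelian_group V by (rule VD(1))
  interpret G: Group.monoid G by (rule G)
  obtain \<phi> where \<phi>: "\<phi> \<in> LinearCombinations.module_hom class_ring V V'" "bij_betw \<phi> (carrier V) (carrier V')"
    "\<And>x v. x \<in> carrier G \<Longrightarrow> v \<in> carrier V \<Longrightarrow> \<phi> (\<rho> x v) = \<rho>' x (\<phi> v)" using rep_isoE[OF iso] by blast
  note pD = module_homD[OF \<phi>(1)]
  have ex: "\<exists>v\<in>carrier V. w = \<phi> v" if "w \<in> carrier V'" for w using \<phi>(2) that unfolding bij_betw_def by blast
  note r = \<phi>(3)[symmetric]
  show ?thesis
  proof (rule group_repI[OF V'])
    fix w c assume "w \<in> carrier V'"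
    then obtain v where v: "v \<in> carrier V" "w = \<phi> v" using ex by blast
    show "\<rho>' \<one>\<^bsub>G\<^esub> w = w" using v by (simp add: r RD)
    fix a assume a: "a \<in> carrier G"
    show "\<rho>' a w \<in> carrier V'" using v a by (simp add: r RD pD)
    show "\<rho>' a (c \<odot>\<^bsub>V'\<^esub> w) = c \<odot>\<^bsub>V'\<^esub> \<rho>' a w" using v a by (simp add: r RD pD(3)[symmetric] VD)
    show "\<rho>' (a \<otimes>\<^bsub>G\<^esub> b) w = \<rho>' a (\<rho>' b w)" if "b \<in> carrier G" for b using that v a by (simp add: r RD)
    fix w' assume "w' \<in> carrier V'"
    then obtain v' where v': "v' \<in> carrier V" "w' = \<phi> v'" using ex by blast
    show "\<rho>' a (w \<oplus>\<^bsub>V'\<^esub> w') = \<rho>' a w \<oplus>\<^bsub>V'\<^esub> \<rho>' a w'" using v v' a by (simp add: r RD pD(2)[symmetric])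
  qed
qed

section \<open>Representations of a groupoid algebra\<close>

context fin_groupoid
begin

lemma rep_galg_ops:
  fixes V :: "('k::field, 'v) module"
  assumes \<sigma>: "algebra_rep galg (V, \<sigma>)"
  shows "\<And>m n v. m \<in> Ar \<Longrightarrow> n \<in> Ar \<Longrightarrow> v \<in> carrier V \<Longrightarrow>
      \<sigma> (dlt m) (\<sigma> (dlt n) v) = (if src m = tgt n then \<sigma> (dlt (cmp m n)) v else \<zero>\<^bsub>V\<^esub>)"
    and "\<And>v. v \<in> carrier V \<Longrightarrow> (\<Oplus>\<^bsub>V\<^esub>x\<in>Ob. \<sigma> (dlt (idn x)) v) = v"
    and "\<And>v. v \<in> carrier V \<Longrightarrow> \<sigma> 0 v = \<zero>\<^bsub>V\<^esub>"
proof -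
  note RD = algebra_repD[OF \<sigma>]
  note VD = vectorspaceD[OF RD(1)]
  interpret V: abelian_group V by (rule VD(1))
  have z: "0 = (0 :: 'k) \<odot>\<^bsub>galg\<^esub> gone" unfolding galg_smult by (rule ext) (simp add: sc_def)
  have gc: "gone \<in> carrier (galg :: ('k, 'm \<Rightarrow> 'k) module)" using gone_closed by (simp add: galg_simps)
  show zero: "\<sigma> 0 v = \<zero>\<^bsub>V\<^esub>" if v: "v \<in> carrier V" for v
    unfolding z RD(8)[OF gc v] by (rule VD(8)[OF RD(2)[OF gc v]])
  have dc: "dlt m \<in> carrier (galg :: ('k, 'm \<Rightarrow> 'k) module)" if "m \<in> Ar" for m using dlt_closed[OF that] by (simp add: galg_simps)
  show "\<sigma> (dlt m) (\<sigma> (dlt n) v) = (if src m = tgt n then \<sigma> (dlt (cmp m n)) v else \<zero>\<^bsub>V\<^esub>)"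
    if m: "m \<in> Ar" and n: "n \<in> Ar" and v: "v \<in> carrier V" for m n v
  proof -
    have "\<sigma> (dlt m) (\<sigma> (dlt n) v) = \<sigma> (gm (dlt m) (dlt n)) v"
      using RD(6)[OF dc[OF m] dc[OF n] v] by (simp only: galg_simps)
    then show ?thesis unfolding gm_dlt[OF m n] using zero[OF v] by (simp only: split: if_split) auto
  qed
  show "(\<Oplus>\<^bsub>V\<^esub>x\<in>Ob. \<sigma> (dlt (idn x)) v) = v" if v: "v \<in> carrier V" for v
  proof -
    have "(\<Oplus>\<^bsub>V\<^esub>x\<in>Ob. \<sigma> (dlt (idn x)) v) = \<sigma> (\<Oplus>\<^bsub>galg\<^esub>x\<in>Ob. dlt (idn x)) v"
      by (rule additive_finsum[symmetric, OF vectorspaceD(1)[OF assoc_algebraD(2)[OF assoc_algebra_galg]] VD(1)])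
        (use RD v dc idn_Ar in auto)
    also have "(\<Oplus>\<^bsub>galg\<^esub>x\<in>Ob. dlt (idn x)) = (gone :: 'm \<Rightarrow> 'k)"
      unfolding gone_def by (rule galg_finsum) (rule dlt_closed[OF idn_Ar])
    also have "\<sigma> gone v = v" using RD(5)[OF v] by (simp only: galg_simps)
    finally show ?thesis .
  qed
qed

text \<open>The arrows span the groupoid algebra, so stability under them extends to all
  elements.\<close>

lemma rep_galg_invariant:
  fixes V :: "('k::field, 'v) module"
  assumes \<sigma>: "algebra_rep galg (V, \<sigma>)" and U: "VectorSpace.subspace class_ring U V"
    and ivt: "\<And>m v. m \<in> Ar \<Longrightarrow> v \<in> U \<Longrightarrow> \<sigma> (dlt m) v \<in> U" and f: "f \<in> supported Ar" and v: "v \<in> U"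
  shows "\<sigma> f v \<in> U"
  using fin_Ar f
proof (induction rule: supported_induct)
  note RD = algebra_repD[OF \<sigma>, unfolded galg_simps(1)] and UD = subspaceD[OF U]
  have vc: "v \<in> carrier V" using UD(1) v by blast
  {
    case zero
    show ?case unfolding rep_galg_ops(3)[OF \<sigma> vc] by (rule UD(2))
  next
    case (dlt m)
    show ?case by (rule ivt[OF dlt v])
  next
    case (add f f')
    have "\<sigma> (f + f') v = \<sigma> f v \<oplus>\<^bsub>V\<^esub> \<sigma> f' v" using RD(7)[OF add(1,2) vc] by (simp only: galg_simps)
    then show ?case using UD(3)[OF add(3,4)] by (simp only:)
  next
    case (smult c f)
    have "\<sigma> (\<lambda>u. c * f u) v = c \<odot>\<^bsub>V\<^esub> \<sigma> f v" using RD(8)[OF smult(1) vc, of c] by (simp only: galg_simps)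
    then show ?case using UD(4)[OF smult(2)] by (simp only:)
  }
qed

lemma rep_galg_intertwiner:
  fixes V :: "('k::field, 'v) module" and V' :: "('k, 'w) module"
  assumes \<sigma>: "algebra_rep galg (V, \<sigma>)" and \<sigma>': "algebra_rep galg (V', \<sigma>')"
    and \<phi>: "\<phi> \<in> LinearCombinations.module_hom class_ring V V'"
    and tw: "\<And>m v. m \<in> Ar \<Longrightarrow> v \<in> carrier V \<Longrightarrow> \<phi> (\<sigma> (dlt m) v) = \<sigma>' (dlt m) (\<phi> v)"
    and f: "f \<in> supported Ar" and v: "v \<in> carrier V"
  shows "\<phi> (\<sigma> f v) = \<sigma>' f (\<phi> v)"
  using fin_Ar f
proof (induction rule: supported_induct)
  note RD = algebra_repD[OF \<sigma>, unfolded galg_simps(1)] and RD' = algebra_repD[OF \<sigma>', unfolded galg_simps(1)]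
    and pD = module_homD[OF \<phi>]
  have pv: "\<phi> v \<in> carrier V'" by (rule pD(1)[OF v])
  {
    case zero
    show ?case unfolding rep_galg_ops(3)[OF \<sigma> v] rep_galg_ops(3)[OF \<sigma>' pv]
      by (rule additive_zero[OF vectorspaceD(1)[OF RD(1)] vectorspaceD(1)[OF RD'(1)] pD(1,2)])
  next
    case (dlt m)
    show ?case by (rule tw[OF dlt v])
  next
    case (add f f')
    have "\<sigma> (f + f') v = \<sigma> f v \<oplus>\<^bsub>V\<^esub> \<sigma> f' v" using RD(7)[OF add(1,2) v] by (simp only: galg_simps)
    moreover have "\<sigma>' (f + f') (\<phi> v) = \<sigma>' f (\<phi> v) \<oplus>\<^bsub>V'\<^esub> \<sigma>' f' (\<phi> v)" using RD'(7)[OF add(1,2) pv] by (simp only: galg_simps)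
    ultimately show ?case using pD(2)[OF RD(2)[OF add(1) v] RD(2)[OF add(2) v]] add(3,4) by (simp only:)
  next
    case (smult c f)
    have "\<sigma> (\<lambda>u. c * f u) v = c \<odot>\<^bsub>V\<^esub> \<sigma> f v" using RD(8)[OF smult(1) v, of c] by (simp only: galg_simps)
    moreover have "\<sigma>' (\<lambda>u. c * f u) (\<phi> v) = c \<odot>\<^bsub>V'\<^esub> \<sigma>' f (\<phi> v)" using RD'(8)[OF smult(1) pv, of c] by (simp only: galg_simps)
    ultimately show ?case using pD(3)[OF RD(2)[OF smult(1) v], of c] smult(2) by (simp only:)
  }
qed

text \<open>A representation of the groupoid algebra amounts to one operator for each arrow, with
  products of noncomposable arrows equal to 0 and with identity operators adding up to 1. The
  hypothesis \<open>\<sigma>_def\<close> lets the caller name the linear extension.\<close>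

lemma rep_galg_from_ops:
  fixes V :: "('k::field, 'v) module"
  assumes V: "vectorspace class_ring V"
    and Dc: "\<And>m v. m \<in> Ar \<Longrightarrow> v \<in> carrier V \<Longrightarrow> D m v \<in> carrier V"
    and Da: "\<And>m v w. m \<in> Ar \<Longrightarrow> v \<in> carrier V \<Longrightarrow> w \<in> carrier V \<Longrightarrow> D m (v \<oplus>\<^bsub>V\<^esub> w) = D m v \<oplus>\<^bsub>V\<^esub> D m w"
    and Ds: "\<And>m c v. m \<in> Ar \<Longrightarrow> v \<in> carrier V \<Longrightarrow> D m (c \<odot>\<^bsub>V\<^esub> v) = c \<odot>\<^bsub>V\<^esub> D m v"
    and DD: "\<And>m n v. m \<in> Ar \<Longrightarrow> n \<in> Ar \<Longrightarrow> v \<in> carrier V \<Longrightarrow>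
      D m (D n v) = (if src m = tgt n then D (cmp m n) v else \<zero>\<^bsub>V\<^esub>)"
    and D1: "\<And>v. v \<in> carrier V \<Longrightarrow> (\<Oplus>\<^bsub>V\<^esub>x\<in>Ob. D (idn x) v) = v"
    and \<sigma>_def: "\<sigma> = (\<lambda>f v. \<Oplus>\<^bsub>V\<^esub>m\<in>Ar. f m \<odot>\<^bsub>V\<^esub> D m v)"
  shows "algebra_rep galg (V, \<sigma>)" "\<And>m v. m \<in> Ar \<Longrightarrow> v \<in> carrier V \<Longrightarrow> \<sigma> (dlt m) v = D m v"
proof -
  note VD = vectorspaceD[OF V]
  interpret V: abelian_group V by (rule VD(1))
  have \<sigma>c: "\<sigma> f v \<in> carrier V" if "v \<in> carrier V" for f v
    unfolding \<sigma>_def by (rule V.finsum_closed) (use that VD(2) Dc in auto)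
  have \<sigma>va: "\<sigma> f (v \<oplus>\<^bsub>V\<^esub> w) = \<sigma> f v \<oplus>\<^bsub>V\<^esub> \<sigma> f w" if vw: "v \<in> carrier V" "w \<in> carrier V" for f v w
  proof -
    have "\<sigma> f (v \<oplus>\<^bsub>V\<^esub> w) = (\<Oplus>\<^bsub>V\<^esub>m\<in>Ar. f m \<odot>\<^bsub>V\<^esub> D m v \<oplus>\<^bsub>V\<^esub> f m \<odot>\<^bsub>V\<^esub> D m w)"
      unfolding \<sigma>_def by (rule V.finsum_cong') (use vw in \<open>auto simp: VD(2,4) Dc Da\<close>)
    also have "\<dots> = \<sigma> f v \<oplus>\<^bsub>V\<^esub> \<sigma> f w"
      unfolding \<sigma>_def by (rule V.finsum_addf) (use vw in \<open>auto simp: VD(2) Dc\<close>)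
    finally show ?thesis .
  qed
  have \<sigma>fa: "\<sigma> (f + f') v = \<sigma> f v \<oplus>\<^bsub>V\<^esub> \<sigma> f' v" if v: "v \<in> carrier V" for f f' v
  proof -
    have "\<sigma> (f + f') v = (\<Oplus>\<^bsub>V\<^esub>m\<in>Ar. f m \<odot>\<^bsub>V\<^esub> D m v \<oplus>\<^bsub>V\<^esub> f' m \<odot>\<^bsub>V\<^esub> D m v)"
      unfolding \<sigma>_def by (rule V.finsum_cong') (use v in \<open>auto simp: VD(2,3) Dc\<close>)
    also have "\<dots> = \<sigma> f v \<oplus>\<^bsub>V\<^esub> \<sigma> f' v"
      unfolding \<sigma>_def by (rule V.finsum_addf) (use v in \<open>auto simp: VD(2) Dc\<close>)
    finally show ?thesis .
  qed
  have cm: "c \<odot>\<^bsub>V\<^esub> (d \<odot>\<^bsub>V\<^esub> v) = d \<odot>\<^bsub>V\<^esub> (c \<odot>\<^bsub>V\<^esub> v)" if "v \<in> carrier V" for c d v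
    using VD(5)[OF that, of c d] VD(5)[OF that, of d c] by (simp add: mult.commute)
  have \<sigma>out: "(\<Oplus>\<^bsub>V\<^esub>m\<in>Ar. c \<odot>\<^bsub>V\<^esub> (f m \<odot>\<^bsub>V\<^esub> D m v)) = c \<odot>\<^bsub>V\<^esub> \<sigma> f v" if v: "v \<in> carrier V" for c f v
    unfolding \<sigma>_def by (rule additive_finsum[symmetric, OF VD(1) VD(1)]) (use v in \<open>auto simp: VD(2,4) Dc\<close>)
  have \<sigma>vs: "\<sigma> f (c \<odot>\<^bsub>V\<^esub> v) = c \<odot>\<^bsub>V\<^esub> \<sigma> f v" if v: "v \<in> carrier V" for c f v
  proof -
    have "\<sigma> f (c \<odot>\<^bsub>V\<^esub> v) = (\<Oplus>\<^bsub>V\<^esub>m\<in>Ar. c \<odot>\<^bsub>V\<^esub> (f m \<odot>\<^bsub>V\<^esub> D m v))"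
      unfolding \<sigma>_def by (rule V.finsum_cong') (use v in \<open>auto simp: VD(2) Dc Ds cm[of _ c]\<close>)
    then show ?thesis using \<sigma>out[OF v] by simp
  qed
  have \<sigma>fs: "\<sigma> (sc c f) v = c \<odot>\<^bsub>V\<^esub> \<sigma> f v" if v: "v \<in> carrier V" for c f v
  proof -
    have "\<sigma> (sc c f) v = (\<Oplus>\<^bsub>V\<^esub>m\<in>Ar. c \<odot>\<^bsub>V\<^esub> (f m \<odot>\<^bsub>V\<^esub> D m v))"
      unfolding \<sigma>_def by (rule V.finsum_cong') (use v in \<open>auto simp: VD(2,5) Dc sc_def\<close>)
    then show ?thesis using \<sigma>out[OF v] by simp
  qed
  have \<sigma>0: "\<sigma> 0 v = \<zero>\<^bsub>V\<^esub>" if v: "v \<in> carrier V" for v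
  proof -
    have "sc 0 0 = (0 :: 'm \<Rightarrow> 'k)" by (rule sc_zero)
    then show ?thesis using \<sigma>fs[OF v, of 0 0] VD(8)[OF \<sigma>c[OF v]] by simp
  qed
  show \<sigma>d: "\<sigma> (dlt m) v = D m v" if m: "m \<in> Ar" and v: "v \<in> carrier V" for m v
  proof -
    have "\<sigma> (dlt m) v = (\<Oplus>\<^bsub>V\<^esub>n\<in>Ar. if m = n then D n v else \<zero>\<^bsub>V\<^esub>)"
      unfolding \<sigma>_def by (rule V.finsum_cong') (use v in \<open>auto simp: VD(2,6,8) Dc dlt_def\<close>)
    also have "\<dots> = D m v" by (rule V.finsum_singleton[OF m fin_Ar]) (use v Dc in auto)
    finally show ?thesis .
  qed
  have mult: "\<sigma> (gm f f') v = \<sigma> f (\<sigma> f' v)" if f: "f \<in> supported Ar" and f': "f' \<in> supported Ar" and v: "v \<in> carrier V" for f f' v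
    using fin_Ar f
  proof (induction rule: supported_induct)
    case zero
    show ?case unfolding gm_zero \<sigma>0[OF v] \<sigma>0[OF \<sigma>c[OF v]] ..
  next
    case (dlt m)
    show ?case using fin_Ar f'
    proof (induction rule: supported_induct)
      case zero
      have "D m \<zero>\<^bsub>V\<^esub> = \<zero>\<^bsub>V\<^esub>" by (rule additive_zero[OF VD(1) VD(1)]) (use dlt Dc Da in auto)
      then show ?case unfolding gm_zero \<sigma>0[OF v] using \<sigma>d[OF dlt V.zero_closed] by simp
    next
      case (dlt n)
      show ?case unfolding gm_dlt[OF \<open>m \<in> Ar\<close> dlt] \<sigma>d[OF dlt v] \<sigma>d[OF \<open>m \<in> Ar\<close> Dc[OF dlt v]] DD[OF \<open>m \<in> Ar\<close> dlt v]
        using \<sigma>0[OF v] \<sigma>d[OF cmp_Ar[OF \<open>m \<in> Ar\<close> dlt] v] by (cases "src m = tgt n") (simp_all only: if_True if_False simp_thms)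
    next
      case (add f1 f2)
      show ?case unfolding gm_add_right \<sigma>fa[OF v] add(3,4) \<sigma>va[OF \<sigma>c[OF v] \<sigma>c[OF v]] ..
    next
      case (smult c f1)
      show ?case unfolding sc_def[of c f1, symmetric] gm_sc_right \<sigma>fs[OF v] smult(2) \<sigma>vs[OF \<sigma>c[OF v]] ..
    qed
  next
    case (add f1 f2)
    show ?case unfolding gm_add_left \<sigma>fa[OF v] add(3,4) \<sigma>fa[OF \<sigma>c[OF v]] ..
  next
    case (smult c f1)
    show ?case unfolding sc_def[of c f1, symmetric] gm_sc_left \<sigma>fs[OF v] smult(2) \<sigma>fs[OF \<sigma>c[OF v]] ..
  qed
  have one: "\<sigma> gone v = v" if v: "v \<in> carrier V" for v
  proof -
    have "\<sigma> (\<Oplus>\<^bsub>galg\<^esub>x\<in>Ob. dlt (idn x)) v = (\<Oplus>\<^bsub>V\<^esub>x\<in>Ob. \<sigma> (dlt (idn x)) v)"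
      by (rule additive_finsum[OF vectorspaceD(1)[OF assoc_algebraD(2)[OF assoc_algebra_galg]] VD(1)])
        (simp_all only: galg_simps \<sigma>c \<sigma>fa v dlt_closed idn_Ar)
    also have "(\<Oplus>\<^bsub>galg\<^esub>x\<in>Ob. dlt (idn x)) = (gone :: 'm \<Rightarrow> 'k)"
      unfolding gone_def by (rule galg_finsum) (rule dlt_closed[OF idn_Ar])
    also have "(\<Oplus>\<^bsub>V\<^esub>x\<in>Ob. \<sigma> (dlt (idn x)) v) = (\<Oplus>\<^bsub>V\<^esub>x\<in>Ob. D (idn x) v)"
      by (rule V.finsum_cong') (use v Dc \<sigma>d idn_Ar in auto)
    finally show ?thesis using D1[OF v] by simp
  qed
  show "algebra_rep galg (V, \<sigma>)"
    by (rule algebra_repI[OF V]; unfold galg_smult galg_simps(1-5))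
      (simp_all only: \<sigma>c \<sigma>va \<sigma>vs one mult \<sigma>fa \<sigma>fs)
qed

end

context refl_grp
begin

section \<open>The normalizer of a reflection subgroup\<close>

text \<open>The setwise stabilizer, that is, the elements whose restriction to \<open>H\<close> is a
  loop at \<open>H\<close> in the groupoid. All computations use it in place of the normalizer, with
  which \<open>stab_normalizer_eq\<close> identifies it.\<close>

definition Nm :: "'v set \<Rightarrow> ('v \<Rightarrow> 'v) set" where "Nm H = {w \<in> W. w ` H = H}"

abbreviation "Wg \<equiv> refl_group scale W"

lemma Wg_simps [simp]: "carrier Wg = W" "mult Wg = (\<circ>)" "one Wg = id"
  by (simp_all add: refl_group_def GL_def)

lemma group_Wg: "Group.group Wg"
proof (rule groupI)
  fix x assume "x \<in> carrier Wg"
  then show "\<exists>y\<in>carrier Wg. y \<otimes>\<^bsub>Wg\<^esub> x = \<one>\<^bsub>Wg\<^esub>" using iv_W iv_comp by auto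
qed (auto simp: comp_W id_W comp_assoc)

lemma inv_Wg: "w \<in> W \<Longrightarrow> inv\<^bsub>Wg\<^esub> w = iv w"
  using group.inv_equality[OF group_Wg, of "iv w" w] iv_W iv_comp by simp

lemma Nm_W: "n \<in> Nm H \<Longrightarrow> n \<in> W" by (simp add: Nm_def)

lemma Nm_comp: "w \<in> W \<Longrightarrow> u \<in> W \<Longrightarrow> w \<circ> u \<in> Nm H \<longleftrightarrow> w ` u ` H = H"
  by (simp only: Nm_def mem_Collect_eq image_comp comp_W simp_thms)

lemma Nm_image: "n \<in> Nm H \<Longrightarrow> n ` H = H" by (simp add: Nm_def)

lemma Nm_closed: "n \<in> Nm H \<Longrightarrow> n' \<in> Nm H \<Longrightarrow> n \<circ> n' \<in> Nm H"
  by (simp add: Nm_comp Nm_W Nm_image)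

lemma iv_Nm: "n \<in> Nm H \<Longrightarrow> iv n \<in> Nm H"
  using iv_image(1)[of n H] by (simp add: Nm_def iv_W)

lemma id_Nm: "id \<in> Nm H" by (simp add: Nm_def id_W)

lemma K_Nm: "K H \<subseteq> Nm H" by (auto simp: pointwise_stabilizer_def Nm_def image_iff)

text \<open>A hyperplane can be recovered from its pointwise stabilizer. A reflection in
  \<open>H\<close> lies in \<open>K H\<close>; if this is also the stabilizer of the image of
  \<open>H\<close> under \<open>w\<close>, the reflection fixes that hyperplane pointwise, so its
  fixed space is both \<open>H\<close> and the image.\<close>

lemma stab_normalizer_eq:
  assumes H: "H \<in> Hy" shows "stab_normalizer scale W H = Nm H"
proof -
  have Ks: "K H \<subseteq> W" by (auto simp: pointwise_stabilizer_def)
  have c: "w <#\<^bsub>Wg\<^esub> K H #>\<^bsub>Wg\<^esub> inv\<^bsub>Wg\<^esub> w = K (w ` H)" if w: "w \<in> W" for w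
    unfolding K_conj[OF w] inv_Wg[OF w] l_coset_def r_coset_def Wg_simps by auto
  have kk: "K (w ` H) = K H \<longleftrightarrow> w ` H = H" if w: "w \<in> W" for w
  proof
    assume e: "K (w ` H) = K H"
    obtain s where s: "s \<in> R" "H = fixed_space s" using H by (auto simp: hyperplanes_def)
    have "s \<in> K H" using s by (auto simp: pointwise_stabilizer_def fixed_space_def R_W)
    then have "s v = v" if "v \<in> w ` H" for v using e that by (auto simp: pointwise_stabilizer_def)
    moreover have "s \<noteq> id" using s by (simp add: reflections_def)
    ultimately have "fixed_space s = w ` H" using fixes_hyperplane(2)[OF R_W[OF s(1)] W_Hy[OF w H]] by blast
    then show "w ` H = H" using s by simp
  qed simp
  show ?thesis
  proof (rule Set.set_eqI)
    fix w
    show "w \<in> stab_normalizer scale W H \<longleftrightarrow> w \<in> Nm H"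
    proof (cases "w \<in> W")
      case True
      have "(\<lambda>H\<in>{H. H \<subseteq> carrier Wg}. w <#\<^bsub>Wg\<^esub> H #>\<^bsub>Wg\<^esub> (inv\<^bsub>Wg\<^esub> w)) (K H) = K (w ` H)"
        using Ks c[OF True] by (simp only: restrict_apply mem_Collect_eq Wg_simps if_True simp_thms)
      then show ?thesis
        unfolding stab_normalizer_def normalizer_def stabilizer_def Nm_def
        using kk[OF True] True by (simp only: mem_Collect_eq Wg_simps simp_thms)
    next
      case False
      then show ?thesis
        unfolding stab_normalizer_def normalizer_def stabilizer_def Nm_def
        by (simp only: mem_Collect_eq Wg_simps simp_thms)
    qed
  qed
qed

lemma coset_simp: "K H #>\<^bsub>Wg\<^esub> n = (\<lambda>k. k \<circ> n) ` K H"
  by (auto simp: r_coset_def)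

text \<open>Brings the quotient group of the definition into a form where one computes with
  representatives in \<open>Nm H\<close>.\<close>

lemma stab_quotient:
  assumes H: "H \<in> Hy"
  shows "carrier (stab_quotient scale W H) = (\<lambda>n. K H #>\<^bsub>Wg\<^esub> n) ` Nm H"
    "\<one>\<^bsub>stab_quotient scale W H\<^esub> = K H"
    "\<And>n n'. n \<in> Nm H \<Longrightarrow> n' \<in> Nm H \<Longrightarrow>
      (K H #>\<^bsub>Wg\<^esub> n) \<otimes>\<^bsub>stab_quotient scale W H\<^esub> (K H #>\<^bsub>Wg\<^esub> n') = K H #>\<^bsub>Wg\<^esub> (n \<circ> n')"
    "Group.monoid (stab_quotient scale W H)"
proof -
  let ?Ng = "Wg\<lparr>carrier := Nm H\<rparr>"
  have Ng: "Group.group ?Ng"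
  proof (rule groupI)
    fix x assume "x \<in> carrier ?Ng"
    then have x: "x \<in> Nm H" by simp
    show "\<exists>y\<in>carrier ?Ng. y \<otimes>\<^bsub>?Ng\<^esub> x = \<one>\<^bsub>?Ng\<^esub>"
      by (rule bexI[of _ "iv x"]) (simp_all add: iv_Nm[OF x] iv_comp(1)[OF Nm_W[OF x]])
  qed (auto simp: Nm_closed id_Nm comp_assoc)
  interpret Ng: Group.group ?Ng by (rule Ng)
  have ivN: "inv\<^bsub>?Ng\<^esub> n = iv n" if "n \<in> Nm H" for n
    using Ng.inv_equality[of "iv n" n] iv_Nm iv_comp Nm_W that by simp
  have Kc: "k \<circ> k' \<in> K H" if "k \<in> K H" "k' \<in> K H" for k k'
    using that comp_W by (auto simp: pointwise_stabilizer_def)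
  have Ki: "iv k \<in> K H" if "k \<in> K H" for k
  proof -
    have k: "k \<in> W" "\<And>v. v \<in> H \<Longrightarrow> k v = v" using that by (auto simp: pointwise_stabilizer_def)
    have "iv k v = v" if "v \<in> H" for v using iv_apply(1)[OF k(1), of v] k(2)[OF that] by simp
    then show ?thesis using iv_W[OF k(1)] by (simp add: pointwise_stabilizer_def)
  qed
  have Kn: "n \<circ> k \<circ> iv n \<in> K H" if "n \<in> Nm H" "k \<in> K H" for n k
    using K_conj[OF Nm_W[OF that(1)], of H] that by (auto simp: Nm_def)
  have sub: "subgroup (K H) ?Ng"
  proof (rule Ng.subgroupI)
    show "K H \<subseteq> carrier ?Ng" using K_Nm by simp
    show "K H \<noteq> {}" using id_K[of H] by blast
    show "inv\<^bsub>?Ng\<^esub> k \<in> K H" if k: "k \<in> K H" for k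
    proof -
      have "k \<in> Nm H" using K_Nm k by blast
      then show ?thesis unfolding ivN[OF \<open>k \<in> Nm H\<close>] using Ki[OF k] by simp
    qed
    show "k \<otimes>\<^bsub>?Ng\<^esub> k' \<in> K H" if "k \<in> K H" "k' \<in> K H" for k k' using Kc[OF that] by simp
  qed
  have norm: "K H \<lhd> ?Ng"
    unfolding Ng.normal_inv_iff using sub Kn ivN by auto
  have cos: "K H #>\<^bsub>?Ng\<^esub> n = K H #>\<^bsub>Wg\<^esub> n" for n by (simp add: r_coset_def)
  have Q: "stab_quotient scale W H = ?Ng Mod K H"
    unfolding stab_quotient_def stab_normalizer_eq[OF H] ..
  show "carrier (stab_quotient scale W H) = (\<lambda>n. K H #>\<^bsub>Wg\<^esub> n) ` Nm H"
    unfolding Q FactGroup_def RCOSETS_def by (auto simp: cos)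
  show "\<one>\<^bsub>stab_quotient scale W H\<^esub> = K H" unfolding Q FactGroup_def by simp
  show "(K H #>\<^bsub>Wg\<^esub> n) \<otimes>\<^bsub>stab_quotient scale W H\<^esub> (K H #>\<^bsub>Wg\<^esub> n') = K H #>\<^bsub>Wg\<^esub> (n \<circ> n')"
    if "n \<in> Nm H" "n' \<in> Nm H" for n n'
    using normal.rcos_sum[OF norm, of n n'] that unfolding Q cos by (simp add: FactGroup_def)
  show "Group.monoid (stab_quotient scale W H)"
    unfolding Q using normal.factorgroup_is_group[OF norm] by (simp add: group_def)
qed

lemma coset_K: "k \<in> K H \<Longrightarrow> K H #>\<^bsub>Wg\<^esub> k = K H"
proof -
  assume k: "k \<in> K H"
  then have kW: "k \<in> W" by (simp add: pointwise_stabilizer_def)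
  have Kc: "a \<circ> b \<in> K H" if "a \<in> K H" "b \<in> K H" for a b
    using that comp_W by (auto simp: pointwise_stabilizer_def)
  have "inj_on (\<lambda>a. a \<circ> k) (K H)"
  proof (rule inj_onI)
    fix a b assume "a \<circ> k = b \<circ> k"
    then have "a \<circ> k \<circ> iv k = b \<circ> k \<circ> iv k" by (simp only:)
    then show "a = b" by (simp only: comp_assoc iv_comp(2)[OF kW] comp_id)
  qed
  then have "(\<lambda>a. a \<circ> k) ` K H = K H" using Kc k finite_K by (intro endo_inj_surj) auto
  then show ?thesis by (simp add: coset_simp)
qed

end

section \<open>Induced representations\<close>

context refl_gen
begin

lemma rep_pull: "algebra_rep A (V, \<rho>) \<Longrightarrow> algebra_rep G (V, \<lambda>f. \<rho> (j f))"
  by (rule algebra_rep_pullback[OF _ j_hom])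

lemma rep_push: "algebra_rep G (V, \<sigma>) \<Longrightarrow> algebra_rep A (V, \<lambda>a. \<sigma> (h a))"
  by (rule algebra_rep_pullback[OF _ A.h])

lemma jc: "f \<in> supported Ar \<Longrightarrow> j f \<in> carrier A"
  using alg_homD(1)[OF j_hom] by (simp add: galg_simps)

lemma kernel_eq: "Br1_to_group_kernel scale W \<mu> = Idl\<^bsub>A\<^esub> (A.e ` Hy)"
  unfolding Br1_to_group_kernel_def A_gen(2) ..

text \<open>The w e_H and the arrows starting at a hyperplane span the same subspace. One direction
  is visible in \<open>eh\<close>; for the other, \<open>T\<close> maps the span of these arrows
  injectively to itself, hence onto it.\<close>

lemma hyper_zero_iff:
  assumes \<rho>: "algebra_rep A (V, \<rho>)"
  shows "(\<forall>H\<in>Hy. \<forall>v\<in>carrier V. \<rho> (A.e H) v = \<zero>\<^bsub>V\<^esub>)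
     \<longleftrightarrow> (\<forall>m\<in>Ar. dom m \<noteq> UNIV \<longrightarrow> (\<forall>v\<in>carrier V. \<rho> (j (dlt m)) v = \<zero>\<^bsub>V\<^esub>))" (is "?L \<longleftrightarrow> ?R")
proof
  note RD = algebra_repD[OF \<rho>]
  note VD = vectorspaceD[OF RD(1)]
  interpret V: abelian_group V by (rule VD(1))
  define ArH where "ArH = {m \<in> Ar. dom m \<noteq> UNIV}"
  have finH: "finite ArH" using fin_Ar by (simp add: ArH_def)
  have sub: "f \<in> supported Ar" if "f \<in> supported ArH" for f :: "_ \<Rightarrow> 'c poly fract"
    using that by (auto simp: supported_def ArH_def)
  have domH: "dom m \<in> Hy" if "m \<in> ArH" for m using that src_Ob[of m] by (auto simp: ArH_def X_def)
  {
    assume R: ?R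
    have z: "\<forall>v\<in>carrier V. \<rho> (j f) v = \<zero>\<^bsub>V\<^esub>" if f: "f \<in> supported ArH" for f
      using finH f
    proof (induction rule: supported_induct)
      case zero
      show ?case using rep_galg_ops(3)[OF rep_pull[OF \<rho>]] by simp
    next
      case (dlt m)
      then show ?case using R by (simp add: ArH_def)
    next
      case (add f f')
      show ?case
      proof
        fix v assume v: "v \<in> carrier V"
        have "\<rho> (j (f + f')) v = \<rho> (j f) v \<oplus>\<^bsub>V\<^esub> \<rho> (j f') v"
          using algebra_repD(7)[OF rep_pull[OF \<rho>], of f f' v] sub[OF add(1)] sub[OF add(2)] v
          by (simp only: galg_simps)
        then show "\<rho> (j (f + f')) v = \<zero>\<^bsub>V\<^esub>" using add(3,4) v by simp
      qed
    next
      case (smult c f)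
      show ?case
      proof
        fix v assume v: "v \<in> carrier V"
        have "\<rho> (j (\<lambda>u. c * f u)) v = c \<odot>\<^bsub>V\<^esub> \<rho> (j f) v"
          using algebra_repD(8)[OF rep_pull[OF \<rho>], of f v c] sub[OF smult(1)] v
          by (simp only: galg_simps)
        then show "\<rho> (j (\<lambda>u. c * f u)) v = \<zero>\<^bsub>V\<^esub>" using smult(2) v VD(7) by simp
      qed
    qed
    show ?L
    proof (intro ballI)
      fix H v assume H: "H \<in> Hy" and v: "v \<in> carrier V"
      have pH: "dlt (pm w H) \<in> (supported ArH :: (_ \<Rightarrow> 'c poly fract) set)" if "w \<in> W" for w
        using ArI[OF that Hy_X[OF H]] H UNIV_notin_Hy by (auto simp: supported_def dlt_def ArH_def)
      have "eh H \<in> supported ArH" unfolding eh_def ph_def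
        by (intro fv.subspace_add[OF subspace_supported] fv.subspace_sum[OF subspace_supported] sc_closed pH id_W Tr_W)
      then have "\<rho> (j (h (A.e H))) v = \<zero>\<^bsub>V\<^esub>" using z v unfolding A.h_e[OF H] by blast
      then show "\<rho> (A.e H) v = \<zero>\<^bsub>V\<^esub>" unfolding jh[OF A.e_closed[OF H]] .
    qed
  next
    assume L: ?L
    show ?R
    proof (intro ballI impI)
      fix m v assume m: "m \<in> Ar" "dom m \<noteq> UNIV" and v: "v \<in> carrier V"
      have mH: "m \<in> ArH" using m by (simp add: ArH_def)
      have Tlin: "Vector_Spaces.linear (\<lambda>c f u. c * f u) (\<lambda>c f u. c * f u) A.T" by (rule A.T_linear)
      have Tcl: "A.T f \<in> supported ArH" if f: "f \<in> supported ArH" for f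
      proof -
        have "sc (f n) (h (A.bas n)) \<in> supported ArH" if n: "n \<in> Ar" for n
        proof (cases "n \<in> ArH")
          case True
          note H = domH[OF True]
          have nU: "dom n \<noteq> UNIV" using True by (simp add: ArH_def)
          have pH: "dlt (pm w (dom n)) \<in> (supported ArH :: (_ \<Rightarrow> 'c poly fract) set)" if "w \<in> W" for w
            using ArI[OF that Hy_X[OF H]] H UNIV_notin_Hy by (auto simp: supported_def dlt_def ArH_def)
          have "h (A.bas (pm (A.rp n) (dom n))) \<in> supported ArH"
            unfolding A.h_bas_Hy[OF A.rp(1)[OF n] H]
            by (intro fv.subspace_add[OF subspace_supported] fv.subspace_sum[OF subspace_supported] sc_closed pH A.rp(1)[OF n] comp_W Tr_W)
          then show ?thesis unfolding A.rp(2)[OF n] by (rule sc_closed)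
        next
          case False
          then have "f n = 0" using f by (simp add: supported_def)
          then have "sc (f n) (h (A.bas n)) = 0" by (intro ext) (simp add: sc_def)
          then show ?thesis using fv.subspace_0[OF subspace_supported] by simp
        qed
        then show ?thesis unfolding A.T_def by (rule fv.subspace_sum[OF subspace_supported])
      qed
      have Tinj: "f = 0" if "f \<in> supported ArH" "A.T f = 0" for f
        by (rule A.T_injective[OF sub[OF that(1)] that(2)])
      have dm: "dlt m \<in> (supported ArH :: (_ \<Rightarrow> 'c poly fract) set)" using mH by (auto simp: supported_def dlt_def)
      \<comment> \<open>Surjectivity on the arrows that start at a hyperplane expresses
        \<open>j (dlt m)\<close> through the w e_H alone.\<close>
      obtain f where f: "f \<in> supported ArH" "A.T f = dlt m"
        using injective_imp_surjective_on_supported[OF finH Tlin Tcl Tinj dm] by auto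
      have "j (dlt m) = A.\<theta> f"
        using jh[OF A.\<theta>_closed[of f]] unfolding A.h_\<theta> f(2) .
      moreover have "\<rho> (A.\<theta> f) v = (\<Oplus>\<^bsub>V\<^esub>n\<in>Ar. \<rho> (f n \<odot>\<^bsub>A\<^esub> A.bas n) v)"
        unfolding A.\<theta>_def
        by (rule additive_finsum[OF A.VB(1) VD(1)]) (use RD v A.VB(2) A.bas_closed in auto)
      moreover have "(\<Oplus>\<^bsub>V\<^esub>n\<in>Ar. \<rho> (f n \<odot>\<^bsub>A\<^esub> A.bas n) v) = (\<Oplus>\<^bsub>V\<^esub>n\<in>Ar. \<zero>\<^bsub>V\<^esub>)"
      proof (rule V.finsum_cong', rule refl)
        fix n assume n: "n \<in> Ar"
        note bn = A.bas_closed[OF n]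
        show "\<rho> (f n \<odot>\<^bsub>A\<^esub> A.bas n) v = \<zero>\<^bsub>V\<^esub>"
        proof (cases "n \<in> ArH")
          case True
          note H = domH[OF True]
          have nU: "dom n \<noteq> UNIV" using True by (simp add: ArH_def)
          have "A.bas n = A.g (A.rp n) \<otimes>\<^bsub>A\<^esub> A.e (dom n)" unfolding A.bas_def using nU by (simp only: if_False)
          then have "\<rho> (A.bas n) v = \<rho> (A.g (A.rp n)) (\<rho> (A.e (dom n)) v)"
            using RD(6)[OF A.g_closed[OF A.rp(1)[OF n]] A.e_closed[OF H] v] by simp
          also have "\<dots> = \<rho> (A.g (A.rp n)) \<zero>\<^bsub>V\<^esub>" using L H v by simp
          also have "\<dots> = \<zero>\<^bsub>V\<^esub>"
            by (rule additive_zero[where T = "\<rho> (A.g (A.rp n))", OF VD(1) VD(1) RD(2,3)[OF A.g_closed[OF A.rp(1)[OF n]]]])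
          finally show ?thesis using RD(8)[OF bn v] VD(7) by simp
        next
          case False
          then have "f n = 0" using f by (simp add: supported_def)
          then show ?thesis using RD(8)[OF bn v] VD(8)[OF RD(2)[OF bn v]] by simp
        qed
      qed auto
      ultimately show "\<rho> (j (dlt m)) v = \<zero>\<^bsub>V\<^esub>" by simp
    qed
  }
qed

text \<open>The annihilator of a representation is a two-sided ideal, so it contains the kernel of
  the map to kW as soon as it contains the e_H; \<open>hyper_zero_iff\<close> then passes from the
  e_H to arrows, where the condition is easier to test.\<close>

lemma factors_iff:
  assumes \<rho>: "algebra_rep A (V, \<rho>)"
  shows "factors_through_quot A (Br1_to_group_kernel scale W \<mu>) (V, \<rho>)
     \<longleftrightarrow> (\<forall>m\<in>Ar. dom m \<noteq> UNIV \<longrightarrow> (\<forall>v\<in>carrier V. \<rho> (j (dlt m)) v = \<zero>\<^bsub>V\<^esub>))"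
  unfolding hyper_zero_iff[OF \<rho>, symmetric]
proof
  let ?J = "Br1_to_group_kernel scale W \<mu>"
  note RD = algebra_repD[OF \<rho>]
  note VD = vectorspaceD[OF RD(1)]
  interpret V: abelian_group V by (rule VD(1))
  have eH: "A.e ` Hy \<subseteq> carrier A" using A.e_closed by blast
  have J: "ideal ?J A" unfolding kernel_eq by (rule A.B.genideal_ideal[OF eH])
  have eJ: "A.e ` Hy \<subseteq> ?J" unfolding kernel_eq by (rule A.B.genideal_self[OF eH])
  note Q = quot_algebra[OF A.B J]
  have \<rho>0: "\<rho> \<zero>\<^bsub>A\<^esub> v = \<zero>\<^bsub>V\<^esub>" if v: "v \<in> carrier V" for v
    using RD(8)[OF A.B.zero_closed v, of 0] VD(8)[OF RD(2)[OF A.B.zero_closed v]] A.VB(8)[OF A.B.zero_closed] by simp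
  {
    assume "factors_through_quot A ?J (V, \<rho>)"
    then obtain \<rho>' where "\<forall>a\<in>carrier A. \<forall>v\<in>carrier V. \<rho> a v = \<rho>' (?J +>\<^bsub>A\<^esub> a) v"
      unfolding factors_through_quot_def by auto
    note r = this[rule_format]
    show "\<forall>H\<in>Hy. \<forall>v\<in>carrier V. \<rho> (A.e H) v = \<zero>\<^bsub>V\<^esub>"
    proof (intro ballI)
      fix H v assume H: "H \<in> Hy" and v: "v \<in> carrier V"
      note ec = A.e_closed[OF H]
      have "A.e H \<ominus>\<^bsub>A\<^esub> \<zero>\<^bsub>A\<^esub> \<in> ?J" using eJ H ec by (auto simp: a_minus_def)
      then have "?J +>\<^bsub>A\<^esub> A.e H = ?J +>\<^bsub>A\<^esub> \<zero>\<^bsub>A\<^esub>" using Q(4)[OF ec A.B.zero_closed] by simp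
      then show "\<rho> (A.e H) v = \<zero>\<^bsub>V\<^esub>" using r[OF ec v] r[OF A.B.zero_closed v] \<rho>0[OF v] by simp
    qed
  next
    assume L: "\<forall>H\<in>Hy. \<forall>v\<in>carrier V. \<rho> (A.e H) v = \<zero>\<^bsub>V\<^esub>"
    define I where "I = {a \<in> carrier A. \<forall>v\<in>carrier V. \<rho> a v = \<zero>\<^bsub>V\<^esub>}"
    have \<rho>z: "\<rho> a \<zero>\<^bsub>V\<^esub> = \<zero>\<^bsub>V\<^esub>" if "a \<in> carrier A" for a
      by (rule additive_zero[OF VD(1) VD(1)]) (use RD that in auto)
    have neg: "\<rho> (\<ominus>\<^bsub>A\<^esub> a) v = \<ominus>\<^bsub>V\<^esub> \<rho> a v" if "a \<in> carrier A" "v \<in> carrier V" for a v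
      using A.VB(9)[OF that(1)] RD(8)[OF that, of "-1"] VD(9)[OF RD(2)[OF that]] by simp
    have "ideal I A"
    proof (rule idealI[OF A.B.ring_axioms])
      show "subgroup I (add_monoid A)"
      proof (rule A.B.add.subgroupI)
        show "I \<subseteq> carrier A" by (auto simp: I_def)
        show "I \<noteq> {}" using \<rho>0 by (auto simp: I_def)
        show "\<And>a. a \<in> I \<Longrightarrow> \<ominus>\<^bsub>A\<^esub> a \<in> I" by (simp add: I_def neg)
        show "\<And>a b. a \<in> I \<Longrightarrow> b \<in> I \<Longrightarrow> a \<oplus>\<^bsub>A\<^esub> b \<in> I" by (simp add: I_def RD)
      qed
    qed (auto simp: I_def RD \<rho>z)
    moreover have "A.e ` Hy \<subseteq> I" using L A.e_closed by (auto simp: I_def)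
    ultimately have JI: "?J \<subseteq> I" unfolding kernel_eq by (rule A.B.genideal_minimal)
    have ker: "\<rho> x v = \<rho> y v" if xy: "x \<in> carrier A" "y \<in> carrier A" "?J +>\<^bsub>A\<^esub> x = ?J +>\<^bsub>A\<^esub> y" and v: "v \<in> carrier V" for x y v
    proof -
      have "x \<ominus>\<^bsub>A\<^esub> y \<in> I" using Q(4)[OF xy(1,2)] xy(3) JI by blast
      then have "\<rho> x v \<oplus>\<^bsub>V\<^esub> \<ominus>\<^bsub>V\<^esub> \<rho> y v = \<zero>\<^bsub>V\<^esub>"
        using v xy RD(7)[OF xy(1) A.B.a_inv_closed[OF xy(2)] v] neg[OF xy(2) v] by (simp add: I_def a_minus_def)
      then show ?thesis
        using V.minus_equality[of "\<rho> x v" "\<ominus>\<^bsub>V\<^esub> \<rho> y v"] RD(2)[OF xy(1) v] RD(2)[OF xy(2) v] by simp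
    qed
    show "factors_through_quot A ?J (V, \<rho>)"
    proof (rule algebra_rep_factor[OF Q(2,3) \<rho> A.B])
      show "\<rho> x v = \<rho> y v" if "x \<in> carrier A" "y \<in> carrier A" "?J +>\<^bsub>A\<^esub> x = ?J +>\<^bsub>A\<^esub> y" "v \<in> carrier V" for x y v
        by (rule ker[OF that])
      fix \<rho>' assume a: "algebra_rep (quot_algebra A ?J) (V, \<rho>')"
        and b: "\<And>x v. x \<in> carrier A \<Longrightarrow> v \<in> carrier V \<Longrightarrow> \<rho>' (?J +>\<^bsub>A\<^esub> x) v = \<rho> x v"
      show "factors_through_quot A ?J (V, \<rho>)"
        unfolding factors_through_quot_def split by (rule exI[of _ \<rho>'], intro conjI ballI a, rule b[symmetric])
    qed
  }
qed

end

section \<open>The induced representation as a representation of Br_1\<close>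

locale ind = refl_gen scale W \<mu>
  for scale :: "complex \<Rightarrow> 'v \<Rightarrow> 'v::ab_group_add" and W and \<mu> :: "('v \<Rightarrow> 'v) \<Rightarrow> 'c::field_char_0" +
  fixes H :: "'v set" and V :: "('c::field_char_0 poly fract, 'm) module" and \<tau> :: "('v \<Rightarrow> 'v) set \<Rightarrow> 'm \<Rightarrow> 'm"
  assumes H: "H \<in> Hy" and \<tau>: "group_rep (stab_quotient scale W H) (V, \<tau>)"
begin

definition t :: "('v \<Rightarrow> 'v) \<Rightarrow> 'm \<Rightarrow> 'm" where "t n = \<tau> (K H #>\<^bsub>Wg\<^esub> n)"

lemmas V = group_repD(1)[OF \<tau>]
lemmas VD = vectorspaceD[OF V]

sublocale V: abelian_group V by (rule VD(1))

lemma coset_carrier: "n \<in> Nm H \<Longrightarrow> K H #>\<^bsub>Wg\<^esub> n \<in> carrier (stab_quotient scale W H)"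
  using stab_quotient(1)[OF H] by blast

lemma t_closed [simp]: "n \<in> Nm H \<Longrightarrow> v \<in> carrier V \<Longrightarrow> t n v \<in> carrier V"
  unfolding t_def by (rule group_repD(2)[OF \<tau> coset_carrier])

lemma t_add: "n \<in> Nm H \<Longrightarrow> v \<in> carrier V \<Longrightarrow> w \<in> carrier V \<Longrightarrow> t n (v \<oplus>\<^bsub>V\<^esub> w) = t n v \<oplus>\<^bsub>V\<^esub> t n w"
  unfolding t_def by (rule group_repD(3)[OF \<tau> coset_carrier])

lemma t_smult: "n \<in> Nm H \<Longrightarrow> v \<in> carrier V \<Longrightarrow> t n (c \<odot>\<^bsub>V\<^esub> v) = c \<odot>\<^bsub>V\<^esub> t n v"
  unfolding t_def by (rule group_repD(4)[OF \<tau> coset_carrier])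

lemma t_mult: "n \<in> Nm H \<Longrightarrow> n' \<in> Nm H \<Longrightarrow> v \<in> carrier V \<Longrightarrow> t (n \<circ> n') v = t n (t n' v)"
  unfolding t_def stab_quotient(3)[OF H, symmetric] by (rule group_repD(6)[OF \<tau> coset_carrier coset_carrier])

lemma t_K:
  assumes k: "k \<in> K H" and v: "v \<in> carrier V" shows "t k v = v"
proof -
  have "K H #>\<^bsub>Wg\<^esub> k = \<one>\<^bsub>stab_quotient scale W H\<^esub>"
    unfolding stab_quotient(2)[OF H] by (rule coset_K[OF k])
  then show ?thesis unfolding t_def by (simp only: group_repD(5)[OF \<tau> v])
qed

lemma t_zero: "n \<in> Nm H \<Longrightarrow> t n \<zero>\<^bsub>V\<^esub> = \<zero>\<^bsub>V\<^esub>"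
  by (rule additive_zero[OF VD(1) VD(1)]) (simp_all add: t_add)

text \<open>Only the space of the induced representation is taken over. Its action of
  \<open>W\<close> is recovered in \<open>\<rho>_g\<close> from the action of Br_1 that is
  constructed on the same space.\<close>

definition I where
  "I = fst (induced_rep Wg (stab_normalizer scale W H) (inflated_rep Wg (K H) (V, \<tau>)))"

lemma I_simps:
  "carrier I = {f \<in> W \<rightarrow>\<^sub>E carrier V. \<forall>n\<in>Nm H. \<forall>g\<in>W. f (n \<circ> g) = t n (f g)}"
  "zero I = (\<lambda>g\<in>W. \<zero>\<^bsub>V\<^esub>)" "add I = (\<lambda>f f'. \<lambda>g\<in>W. f g \<oplus>\<^bsub>V\<^esub> f' g)"
  "smult I = (\<lambda>c f. \<lambda>g\<in>W. c \<odot>\<^bsub>V\<^esub> f g)"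
  by (simp_all add: I_def induced_rep_def inflated_rep_def t_def stab_normalizer_eq[OF H])

lemma I_mem:
  assumes "\<And>g. g \<in> W \<Longrightarrow> f g \<in> carrier V" "\<And>n g. n \<in> Nm H \<Longrightarrow> g \<in> W \<Longrightarrow> f (n \<circ> g) = t n (f g)"
  shows "(\<lambda>g\<in>W. f g) \<in> carrier I"
  unfolding I_simps using assms comp_W Nm_W by auto

lemma I_D:
  assumes "f \<in> carrier I"
  shows "\<And>g. g \<in> W \<Longrightarrow> f g \<in> carrier V" "\<And>n g. n \<in> Nm H \<Longrightarrow> g \<in> W \<Longrightarrow> f (n \<circ> g) = t n (f g)"
    "f \<in> extensional W"
  using assms unfolding I_simps by (auto simp: PiE_def)

lemma I_eqI: "f \<in> carrier I \<Longrightarrow> f' \<in> carrier I \<Longrightarrow> (\<And>g. g \<in> W \<Longrightarrow> f g = f' g) \<Longrightarrow> f = f'"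
  by (rule extensionalityI[OF I_D(3) I_D(3)])

lemma I_add: "f \<in> carrier I \<Longrightarrow> f' \<in> carrier I \<Longrightarrow> f \<oplus>\<^bsub>I\<^esub> f' \<in> carrier I"
  unfolding I_simps(3) by (rule I_mem) (simp_all add: I_D t_add)

lemma I_smult: "f \<in> carrier I \<Longrightarrow> c \<odot>\<^bsub>I\<^esub> f \<in> carrier I"
  unfolding I_simps(4) by (rule I_mem) (simp_all add: I_D t_smult VD(2))

lemma I_zero: "\<zero>\<^bsub>I\<^esub> \<in> carrier I"
  unfolding I_simps(2) by (rule I_mem) (simp_all add: t_zero)

lemma I_apply [simp]:
  "g \<in> W \<Longrightarrow> (f \<oplus>\<^bsub>I\<^esub> f') g = f g \<oplus>\<^bsub>V\<^esub> f' g" "g \<in> W \<Longrightarrow> (c \<odot>\<^bsub>I\<^esub> f) g = c \<odot>\<^bsub>V\<^esub> f g"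
  "g \<in> W \<Longrightarrow> \<zero>\<^bsub>I\<^esub> g = \<zero>\<^bsub>V\<^esub>"
  by (simp_all add: I_simps)

lemma I_vs: "vectorspace class_ring I"
proof -
  have ag: "abelian_group I"
  proof (rule abelian_groupI)
    fix f assume f: "f \<in> carrier I"
    have m: "(-1) \<odot>\<^bsub>I\<^esub> f \<in> carrier I" by (rule I_smult[OF f])
    show "\<exists>f'\<in>carrier I. f' \<oplus>\<^bsub>I\<^esub> f = \<zero>\<^bsub>I\<^esub>"
      by (rule bexI[OF _ m], rule I_eqI[OF I_add[OF m f] I_zero]) (simp add: VD(9) I_D(1)[OF f] V.l_neg)
    show "\<zero>\<^bsub>I\<^esub> \<oplus>\<^bsub>I\<^esub> f = f" by (rule I_eqI[OF I_add[OF I_zero f] f]) (simp add: I_D(1)[OF f])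
    fix f' assume f': "f' \<in> carrier I"
    show "f \<oplus>\<^bsub>I\<^esub> f' \<in> carrier I" by (rule I_add[OF f f'])
    show "f \<oplus>\<^bsub>I\<^esub> f' = f' \<oplus>\<^bsub>I\<^esub> f"
      by (rule I_eqI[OF I_add[OF f f'] I_add[OF f' f]]) (simp add: I_D(1)[OF f] I_D(1)[OF f'] V.a_comm)
    fix f'' assume f'': "f'' \<in> carrier I"
    show "f \<oplus>\<^bsub>I\<^esub> f' \<oplus>\<^bsub>I\<^esub> f'' = f \<oplus>\<^bsub>I\<^esub> (f' \<oplus>\<^bsub>I\<^esub> f'')"
      by (rule I_eqI[OF I_add[OF I_add[OF f f'] f''] I_add[OF f I_add[OF f' f'']]])
        (simp add: I_D(1)[OF f] I_D(1)[OF f'] I_D(1)[OF f''] V.a_assoc)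
  qed (rule I_zero)
  show ?thesis
  proof (rule vectorspaceI[OF ag])
    fix c d f assume f: "f \<in> carrier I"
    note s = I_smult[OF f]
    show "c \<odot>\<^bsub>I\<^esub> f \<in> carrier I" by (rule s)
    show "(c + d) \<odot>\<^bsub>I\<^esub> f = c \<odot>\<^bsub>I\<^esub> f \<oplus>\<^bsub>I\<^esub> d \<odot>\<^bsub>I\<^esub> f"
      by (rule I_eqI[OF s I_add[OF s s]]) (simp add: VD(3) I_D(1)[OF f])
    show "(c * d) \<odot>\<^bsub>I\<^esub> f = c \<odot>\<^bsub>I\<^esub> (d \<odot>\<^bsub>I\<^esub> f)"
      by (rule I_eqI[OF s I_smult[OF s]]) (simp add: VD(5) I_D(1)[OF f])
    show "1 \<odot>\<^bsub>I\<^esub> f = f" by (rule I_eqI[OF s f]) (simp add: VD(6) I_D(1)[OF f])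
    fix f' assume f': "f' \<in> carrier I"
    show "c \<odot>\<^bsub>I\<^esub> (f \<oplus>\<^bsub>I\<^esub> f') = c \<odot>\<^bsub>I\<^esub> f \<oplus>\<^bsub>I\<^esub> c \<odot>\<^bsub>I\<^esub> f'"
      by (rule I_eqI[OF I_smult[OF I_add[OF f f']] I_add[OF s I_smult[OF f']]])
        (simp add: VD(4) I_D(1)[OF f] I_D(1)[OF f'])
  qed
qed

lemmas ID = vectorspaceD[OF I_vs]

lemma I_finsum:
  assumes "\<And>i. i \<in> S \<Longrightarrow> FF i \<in> carrier I" "g \<in> W"
  shows "(\<Oplus>\<^bsub>I\<^esub>i\<in>S. FF i) g = (\<Oplus>\<^bsub>V\<^esub>i\<in>S. FF i g)"
  by (rule additive_finsum[OF ID(1) VD(1)]) (use assms I_D in auto)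

text \<open>A restriction \<open>w\<close> on \<open>x\<close> determines \<open>f (g \<circ> w)\<close> when \<open>g w\<close> carries \<open>x\<close> to \<open>H\<close>, since \<open>K H\<close> acts trivially.\<close>

lemma I_restriction:
  assumes f: "f \<in> carrier I" and g: "g \<in> W" and u: "u \<in> W" "u' \<in> W" "pm u x = pm u' x" and x: "g ` u ` x = H"
  shows "f (g \<circ> u) = f (g \<circ> u')"
proof -
  define k where "k = g \<circ> u' \<circ> iv (g \<circ> u)"
  have gu: "g \<circ> u \<in> W" "g \<circ> u' \<in> W" using g u comp_W by auto
  have kW: "k \<in> W" unfolding k_def by (intro comp_W iv_W g u)
  have "k v = v" if "v \<in> H" for v
  proof -
    have "v \<in> (g \<circ> u) ` x" using that unfolding x[symmetric] image_comp .
    then obtain y where y: "v = (g \<circ> u) y" "y \<in> x" by (rule imageE)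
    then show ?thesis using iv_apply(1)[OF gu(1), of y] u(3) by (simp add: k_def pm_eq_iff)
  qed
  then have k: "k \<in> K H" using kW by (simp add: pointwise_stabilizer_def)
  have "k \<circ> (g \<circ> u) = g \<circ> u'"
    unfolding k_def by (simp only: comp_assoc[of _ "iv (g \<circ> u)" "g \<circ> u"] iv_comp(1)[OF gu(1)] comp_id)
  then have "f (g \<circ> u') = t k (f (g \<circ> u))"
    using I_D(2)[OF f, of k "g \<circ> u"] k K_Nm gu(1) by auto
  then show ?thesis using t_K[OF k I_D(1)[OF f gu(1)]] by simp
qed

text \<open>The space is graded by objects: the part of a function at \<open>x\<close> consists of
  its values at the group elements taking \<open>x\<close> to \<open>H\<close>. An arrow moves the
  part at its source to its range by right translation and kills the other parts.\<close>

definition D :: "('v \<Rightarrow> 'v option) \<Rightarrow> (('v \<Rightarrow> 'v) \<Rightarrow> 'm) \<Rightarrow> ('v \<Rightarrow> 'v) \<Rightarrow> 'm" where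
  "D m f = (\<lambda>g\<in>W. if g ` ran m = H then f (g \<circ> A.rp m) else \<zero>\<^bsub>V\<^esub>)"

lemma D_pm:
  assumes f: "f \<in> carrier I" and u: "u \<in> W" "x \<in> X" and g: "g \<in> W"
  shows "D (pm u x) f g = (if g ` u ` x = H then f (g \<circ> u) else \<zero>\<^bsub>V\<^esub>)"
proof -
  note r = A.rp[OF ArI[OF u], unfolded dom_pm]
  show ?thesis
    using I_restriction[OF f g u(1) r(1) r(2)[symmetric]] g by (simp add: D_def)
qed

lemma D_closed: assumes m: "m \<in> Ar" and f: "f \<in> carrier I" shows "D m f \<in> carrier I"
  unfolding D_def
proof (rule I_mem)
  show "(if g ` ran m = H then f (g \<circ> A.rp m) else \<zero>\<^bsub>V\<^esub>) \<in> carrier V" if "g \<in> W" for g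
    using I_D(1)[OF f comp_W[OF that A.rp(1)[OF m]]] by simp
  fix n g assume n: "n \<in> Nm H" and g: "g \<in> W"
  have "(n \<circ> g) ` ran m = H \<longleftrightarrow> g ` ran m = H"
  proof -
    have "(n \<circ> g) ` ran m = n ` g ` ran m" by (simp only: image_comp)
    then show ?thesis using Nm_image[OF n] W_bij[OF Nm_W[OF n]] by (metis bij_is_inj inj_image_eq_iff)
  qed
  then show "(if (n \<circ> g) ` ran m = H then f (n \<circ> g \<circ> A.rp m) else \<zero>\<^bsub>V\<^esub>)
      = t n (if g ` ran m = H then f (g \<circ> A.rp m) else \<zero>\<^bsub>V\<^esub>)"
    using I_D(2)[OF f n comp_W[OF g A.rp(1)[OF m]]] t_zero[OF n] by (simp add: comp_assoc)
qed

lemma D_apply: "g \<in> W \<Longrightarrow> D m f g = (if g ` ran m = H then f (g \<circ> A.rp m) else \<zero>\<^bsub>V\<^esub>)"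
  by (simp add: D_def)

lemma D_add:
  assumes "m \<in> Ar" "f \<in> carrier I" "f' \<in> carrier I"
  shows "D m (f \<oplus>\<^bsub>I\<^esub> f') = D m f \<oplus>\<^bsub>I\<^esub> D m f'"
  by (rule I_eqI) (use assms comp_W A.rp(1) in \<open>simp_all add: D_closed I_add D_apply\<close>)

lemma D_smult:
  assumes "m \<in> Ar" "f \<in> carrier I"
  shows "D m (c \<odot>\<^bsub>I\<^esub> f) = c \<odot>\<^bsub>I\<^esub> D m f"
  by (rule I_eqI) (use assms comp_W A.rp(1) in \<open>simp_all add: D_closed I_smult D_apply VD(7)\<close>)

lemma D_D:
  assumes m: "m \<in> Ar" and n: "n \<in> Ar" and f: "f \<in> carrier I"
  shows "D m (D n f) = (if dom m = ran n then D (m \<circ>\<^sub>m n) f else \<zero>\<^bsub>I\<^esub>)"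
proof -
  obtain w x where mw: "w \<in> W" "x \<in> X" "m = pm w x" using m by (rule ArE)
  obtain u y where nu: "u \<in> W" "y \<in> X" "n = pm u y" using n by (rule ArE)
  note fn = D_closed[OF n f]
  show ?thesis
  proof (cases "dom m = ran n")
    case True
    then have x: "x = u ` y" using mw nu by simp
    have c: "m \<circ>\<^sub>m n = pm (w \<circ> u) y" using mw nu x by (simp add: pm_comp)
    have wu: "w \<circ> u \<in> W" by (rule comp_W[OF mw(1) nu(1)])
    have "D m (D n f) = D (m \<circ>\<^sub>m n) f"
    proof (rule I_eqI[OF D_closed[OF m fn] D_closed[OF _ f]])
      show "m \<circ>\<^sub>m n \<in> Ar" unfolding c by (rule ArI[OF wu nu(2)])
      fix g assume g: "g \<in> W"
      show "D m (D n f) g = D (m \<circ>\<^sub>m n) f g"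
        unfolding c D_pm[OF f wu nu(2) g]
        unfolding mw(3) D_pm[OF fn mw(1,2) g]
        unfolding nu(3) D_pm[OF f nu(1,2) comp_W[OF g mw(1)]] x
        by (simp only: image_comp comp_assoc split: if_split) simp
    qed
    then show ?thesis using True by simp
  next
    case False
    then have x: "u ` y \<noteq> x" using mw nu by auto
    have "D m (D n f) = \<zero>\<^bsub>I\<^esub>"
    proof (rule I_eqI[OF D_closed[OF m fn] I_zero])
      fix g assume g: "g \<in> W"
      have gw: "g \<circ> w \<in> W" by (rule comp_W[OF g mw(1)])
      \<comment> \<open>If the arrows are not composable, \<open>g\<close> after \<open>w\<close>
        cannot take both the source of the first and the range of the second to \<open>H\<close>, so
        one of the two conditions in \<open>D\<close> fails.\<close>
      have "(g \<circ> w) ` u ` y \<noteq> (g \<circ> w) ` x" using x inj_image_eq_iff[OF bij_is_inj[OF W_bij[OF gw]]] by metis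
      then have "g ` w ` x = H \<Longrightarrow> (g \<circ> w) ` u ` y \<noteq> H" by (simp add: image_comp)
      then show "D m (D n f) g = \<zero>\<^bsub>I\<^esub> g"
        unfolding mw(3) D_pm[OF fn mw(1,2) g] unfolding nu(3) D_pm[OF f nu(1,2) gw] using g by simp
    qed
    then show ?thesis using False by simp
  qed
qed

text \<open>For given \<open>g\<close> exactly one object contributes, the one that \<open>g\<close>
  after \<open>w\<close> takes to \<open>H\<close>. For \<open>w = id\<close> this is the unit law
  of the representation; in general it shows that \<open>W\<close> acts by right translation, as on
  the induced representation.\<close>

lemma finsum_D:
  assumes w: "w \<in> W" and f: "f \<in> carrier I"
  shows "(\<Oplus>\<^bsub>I\<^esub>x\<in>X. D (pm w x) f) = (\<lambda>g\<in>W. f (g \<circ> w))"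
proof (rule I_eqI)
  interpret I: abelian_group I by (rule ID(1))
  have Dc: "D (pm w x) f \<in> carrier I" if "x \<in> X" for x by (rule D_closed[OF ArI[OF w that] f])
  show "(\<Oplus>\<^bsub>I\<^esub>x\<in>X. D (pm w x) f) \<in> carrier I" by (rule I.finsum_closed) (use Dc in auto)
  show "(\<lambda>g\<in>W. f (g \<circ> w)) \<in> carrier I"
    by (rule I_mem) (use I_D[OF f] comp_W w in \<open>simp_all add: comp_assoc\<close>)
  fix g assume g: "g \<in> W"
  define x0 where "x0 = iv (g \<circ> w) ` H"
  have gw: "g \<circ> w \<in> W" by (rule comp_W[OF g w])
  have x0: "x0 \<in> X" unfolding x0_def by (rule W_X[OF iv_W[OF gw] Hy_X[OF H]])
  have iff: "g ` w ` x = H \<longleftrightarrow> x0 = x" for x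
    using iv_image[OF gw] unfolding x0_def by (metis image_comp)
  have fc: "f (g \<circ> w) \<in> carrier V" by (rule I_D(1)[OF f gw])
  have "(\<Oplus>\<^bsub>I\<^esub>x\<in>X. D (pm w x) f) g = (\<Oplus>\<^bsub>V\<^esub>x\<in>X. D (pm w x) f g)" by (rule I_finsum[OF Dc g])
  also have "\<dots> = (\<Oplus>\<^bsub>V\<^esub>x\<in>X. if x0 = x then f (g \<circ> w) else \<zero>\<^bsub>V\<^esub>)"
    by (rule V.finsum_cong') (use D_pm[OF f w _ g] iff fc in auto)
  also have "\<dots> = f (g \<circ> w)" by (rule V.finsum_singleton[OF x0 finite_X]) (use fc in auto)
  finally show "(\<Oplus>\<^bsub>I\<^esub>x\<in>X. D (pm w x) f) g = (\<lambda>g\<in>W. f (g \<circ> w)) g" using g by simp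
qed

definition \<sigma> where "\<sigma> = (\<lambda>f' f. \<Oplus>\<^bsub>I\<^esub>m\<in>Ar. f' m \<odot>\<^bsub>I\<^esub> D m f)"

lemma finsum_D_id: "f \<in> carrier I \<Longrightarrow> (\<Oplus>\<^bsub>I\<^esub>x\<in>X. D (pm id x) f) = f"
  using finsum_D[OF id_W] I_eqI[of "restrict f W" f] by (simp add: extensional_restrict[OF I_D(3)])

lemma I_rep: "algebra_rep G (I, \<sigma>)" "\<And>m f. m \<in> Ar \<Longrightarrow> f \<in> carrier I \<Longrightarrow> \<sigma> (dlt m) f = D m f"
  using rep_galg_from_ops[OF I_vs D_closed D_add D_smult D_D finsum_D_id \<sigma>_def] by blast+

definition \<rho> where "\<rho> a = \<sigma> (h a)"

lemma I_A_rep: "algebra_rep A (I, \<rho>)"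
  unfolding \<rho>_def by (rule rep_push[OF I_rep(1)])

lemma \<rho>_dlt: "m \<in> Ar \<Longrightarrow> f \<in> carrier I \<Longrightarrow> \<rho> (j (dlt m)) f = D m f"
  unfolding \<rho>_def hj[OF dlt_closed] by (rule I_rep(2))

lemma \<rho>_g:
  assumes w: "w \<in> W" and f: "f \<in> carrier I" shows "\<rho> (A.g w) f = (\<lambda>g\<in>W. f (g \<circ> w))"
proof -
  have e: "(\<Oplus>\<^bsub>G\<^esub>x\<in>X. dlt (pm w x)) = (\<Sum>x\<in>X. dlt (pm w x))"
    by (rule galg_finsum, rule dlt_closed, rule ArI[OF w])
  have "\<rho> (A.g w) f = \<sigma> (\<Oplus>\<^bsub>G\<^esub>x\<in>X. dlt (pm w x)) f"
    unfolding \<rho>_def A.h_g[OF w] gw_def e by (rule refl)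
  also have "\<dots> = (\<Oplus>\<^bsub>I\<^esub>x\<in>X. \<sigma> (dlt (pm w x)) f)"
    by (rule additive_finsum[OF vectorspaceD(1)[OF assoc_algebraD(2)[OF G]] ID(1)])
      (simp_all add: algebra_repD(2,7)[OF I_rep(1)] f galg_simps(1) dlt_closed[OF ArI[OF w]])
  also have "\<dots> = (\<Oplus>\<^bsub>I\<^esub>x\<in>X. D (pm w x) f)"
  proof -
    interpret I: abelian_group I by (rule ID(1))
    show ?thesis by (rule I.finsum_cong') (use I_rep(2) f ArI[OF w] D_closed in auto)
  qed
  finally show ?thesis unfolding finsum_D[OF w f] .
qed

text \<open>Embeds \<theta> into its induced representation as the functions supported on
  \<open>Nm H\<close>. These make up the part at the object \<open>H\<close>, where evaluation at
  \<open>id\<close> is the inverse.\<close>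

definition ev :: "'m \<Rightarrow> ('v \<Rightarrow> 'v) \<Rightarrow> 'm" where
  "ev v = (\<lambda>g\<in>W. if g \<in> Nm H then t g v else \<zero>\<^bsub>V\<^esub>)"

lemma Nm_comp_iff:
  assumes n: "n \<in> Nm H" and g: "g \<in> W"
  shows "n \<circ> g \<in> Nm H \<longleftrightarrow> g \<in> Nm H"
proof -
  have "n ` g ` H = H \<longleftrightarrow> g ` H = H"
    using Nm_image[OF n] W_bij[OF Nm_W[OF n]] by (metis bij_is_inj inj_image_eq_iff)
  then show ?thesis using Nm_comp[OF Nm_W[OF n] g] g by (simp add: Nm_def)
qed

lemma ev_closed: "v \<in> carrier V \<Longrightarrow> ev v \<in> carrier I"
  unfolding ev_def by (rule I_mem) (auto simp: Nm_comp_iff t_mult t_zero)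

lemma ev_id: "v \<in> carrier V \<Longrightarrow> ev v id = v"
  using t_K[OF id_K] by (simp add: ev_def id_W id_Nm)

lemma ev_t:
  assumes n: "n \<in> Nm H" and v: "v \<in> carrier V" shows "D (pm n H) (ev v) = ev (t n v)"
proof (rule I_eqI[OF D_closed[OF ArI[OF Nm_W[OF n] Hy_X[OF H]] ev_closed[OF v]] ev_closed[OF t_closed[OF n v]]])
  fix g assume g: "g \<in> W"
  have nH: "n ` H = H" using n by (simp add: Nm_def)
  show "D (pm n H) (ev v) g = ev (t n v) g"
    unfolding D_pm[OF ev_closed[OF v] Nm_W[OF n] Hy_X[OF H] g] nH
    using g v n comp_W[OF g Nm_W[OF n]] Nm_comp[OF g Nm_W[OF n]] nH t_mult[of g n v]
    by (simp add: ev_def Nm_def)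
qed

text \<open>The part of a function at \<open>H\<close> is determined by its value at
  \<open>id\<close>, so the part of \<open>FF\<close> at any hyperplane of the orbit can be produced
  from any function with the right value there. Irreducibility and the surjectivity of
  \<open>ev\<close> both rest on this.\<close>

lemma D_from_id:
  assumes FF: "FF \<in> carrier I" and f: "f \<in> carrier I" and w: "w \<in> W" and e: "f id = FF (iv w)"
  shows "D (pm w H) f = D (pm id (w ` H)) FF"
proof (rule I_eqI)
  have wH: "w ` H \<in> X" by (rule W_X[OF w Hy_X[OF H]])
  show "D (pm w H) f \<in> carrier I" "D (pm id (w ` H)) FF \<in> carrier I"
    by (intro D_closed ArI w id_W wH Hy_X H f FF)+
  fix g assume g: "g \<in> W"
  show "D (pm w H) f g = D (pm id (w ` H)) FF g"
  proof (cases "g ` w ` H = H")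
    case True
    then have n: "g \<circ> w \<in> Nm H" using Nm_comp[OF g w] by simp
    have "f (g \<circ> w \<circ> id) = t (g \<circ> w) (f id)" by (rule I_D(2)[OF f n id_W])
    moreover have "FF (g \<circ> w \<circ> iv w) = t (g \<circ> w) (FF (iv w))" by (rule I_D(2)[OF FF n iv_W[OF w]])
    moreover have "g \<circ> w \<circ> iv w = g" by (simp only: comp_assoc iv_comp(2)[OF w] comp_id)
    ultimately show ?thesis
      unfolding D_pm[OF f w Hy_X[OF H] g] D_pm[OF FF id_W wH g] using True e by simp
  next
    case False
    then show ?thesis unfolding D_pm[OF f w Hy_X[OF H] g] D_pm[OF FF id_W wH g] by simp
  qed
qed

end

section \<open>Classification\<close>

context refl_gen
begin

abbreviation "DM \<rho> m \<equiv> \<rho> (j (dlt m))"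

lemma DM_closed: "algebra_rep A (V, \<rho>) \<Longrightarrow> m \<in> Ar \<Longrightarrow> v \<in> carrier V \<Longrightarrow> DM \<rho> m v \<in> carrier V"
  by (rule algebra_repD(2)[OF _ jc[OF dlt_closed]])

lemma DM_add: "algebra_rep A (V, \<rho>) \<Longrightarrow> m \<in> Ar \<Longrightarrow> v \<in> carrier V \<Longrightarrow> w \<in> carrier V \<Longrightarrow>
    DM \<rho> m (v \<oplus>\<^bsub>V\<^esub> w) = DM \<rho> m v \<oplus>\<^bsub>V\<^esub> DM \<rho> m w"
  by (rule algebra_repD(3)[OF _ jc[OF dlt_closed]])

lemma DM_smult: "algebra_rep A (V, \<rho>) \<Longrightarrow> m \<in> Ar \<Longrightarrow> v \<in> carrier V \<Longrightarrow>
    DM \<rho> m (c \<odot>\<^bsub>V\<^esub> v) = c \<odot>\<^bsub>V\<^esub> DM \<rho> m v"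
  by (rule algebra_repD(4)[OF _ jc[OF dlt_closed]])

lemma DM_zero: "algebra_rep A (V, \<rho>) \<Longrightarrow> m \<in> Ar \<Longrightarrow> DM \<rho> m \<zero>\<^bsub>V\<^esub> = \<zero>\<^bsub>V\<^esub>"
  by (rule additive_zero[OF vectorspaceD(1)[OF algebra_repD(1)] vectorspaceD(1)[OF algebra_repD(1)] DM_closed DM_add])

lemma DM_DM:
  assumes "algebra_rep A (V, \<rho>)" "m \<in> Ar" "n \<in> Ar" "v \<in> carrier V"
  shows "DM \<rho> m (DM \<rho> n v) = (if dom m = ran n then DM \<rho> (m \<circ>\<^sub>m n) v else \<zero>\<^bsub>V\<^esub>)"
  using rep_galg_ops(1)[OF rep_pull[OF assms(1)] assms(2-4)] .

lemma DM_pm: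
  assumes r: "algebra_rep A (V, \<rho>)" and w: "w \<in> W" "y \<in> X" and u: "u \<in> W" "x \<in> X" and v: "v \<in> carrier V"
  shows "DM \<rho> (pm w y) (DM \<rho> (pm u x) v) = (if u ` x = y then DM \<rho> (pm (w \<circ> u) x) v else \<zero>\<^bsub>V\<^esub>)"
  using DM_DM[OF r ArI[OF w] ArI[OF u] v] pm_comp[of u x y w] unfolding dom_pm ran_pm by (cases "u ` x = y") auto

lemma DM_generates:
  assumes r: "algebra_rep A (V, \<rho>)" and irr: "irreducible_action (carrier A) (V, \<rho>)"
    and U: "VectorSpace.subspace class_ring U V" "\<And>m v. m \<in> Ar \<Longrightarrow> v \<in> U \<Longrightarrow> DM \<rho> m v \<in> U"
  shows "U = {\<zero>\<^bsub>V\<^esub>} \<or> U = carrier V"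
proof (rule irreducible_actionD(2)[OF irr U(1)])
  fix a v assume a: "a \<in> carrier A" and v: "v \<in> U"
  have "\<rho> (j (h a)) v \<in> U"
    by (rule rep_galg_invariant[OF rep_pull[OF r] U A.h_supported[OF a] v])
  then show "\<rho> a v \<in> U" unfolding jh[OF a] .
qed

definition fixedM :: "_ \<Rightarrow> _ \<Rightarrow> 'v set \<Rightarrow> _" where
  "fixedM Mv r H = {x \<in> carrier Mv. DM r (pm id H) x = x}"

text \<open>
  The space \<open>p\<^sub>H M\<close>, where \<open>p\<^sub>H\<close> is the identity of \<open>H\<close> in the groupoid, carries an action of the
  stabilizer of \<open>H\<close>; \<open>M\<close> corresponds to \<open>(H, \<theta>)\<close> when that action is isomorphic to \<open>\<theta>\<close>.
\<close>

definition corr where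
  "corr H = (\<lambda>(V, \<tau>) (Mv, r). \<exists>\<beta>\<in>LinearCombinations.module_hom class_ring V Mv.
     bij_betw \<beta> (carrier V) (fixedM Mv r H) \<and>
     (\<forall>n\<in>Nm H. \<forall>v\<in>carrier V. \<beta> (\<tau> (K H #>\<^bsub>Wg\<^esub> n) v) = DM r (pm n H) (\<beta> v)))"

lemma corrE:
  assumes "corr H (V, \<tau>) (Mv, r)"
  obtains \<beta> where "\<beta> \<in> LinearCombinations.module_hom class_ring V Mv" "bij_betw \<beta> (carrier V) (fixedM Mv r H)"
    "\<And>n v. n \<in> Nm H \<Longrightarrow> v \<in> carrier V \<Longrightarrow> \<beta> (\<tau> (K H #>\<^bsub>Wg\<^esub> n) v) = DM r (pm n H) (\<beta> v)"
  using assms unfolding corr_def by auto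

text \<open>The vectors killed by every arrow that ends at \<open>H2\<close> form a submodule. If
  the orbits differ, no arrow leads from \<open>H1\<close> to \<open>H2\<close>, so it contains
  \<open>v1\<close>; it does not contain \<open>v2\<close>, which the identity arrow of
  \<open>H2\<close> fixes.\<close>

lemma corr_same_orbit:
  assumes r: "algebra_rep A (V, \<rho>)" and irr: "irreducible_action (carrier A) (V, \<rho>)"
    and H: "H1 \<in> Hy" "H2 \<in> Hy" and v1: "v1 \<in> fixedM V \<rho> H1" "v1 \<noteq> \<zero>\<^bsub>V\<^esub>" and v2: "v2 \<in> fixedM V \<rho> H2" "v2 \<noteq> \<zero>\<^bsub>V\<^esub>"
  shows "orb H1 = orb H2"
proof (rule ccontr)
  assume ne: "orb H1 \<noteq> orb H2"
  note RD = algebra_repD[OF r]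
  note VD = vectorspaceD[OF RD(1)]
  interpret V: abelian_group V by (rule VD(1))
  define U where "U = {y \<in> carrier V. \<forall>m\<in>Ar. ran m = H2 \<longrightarrow> DM \<rho> m y = \<zero>\<^bsub>V\<^esub>}"
  have "VectorSpace.subspace class_ring U V"
    by (rule subspaceI[OF RD(1)])
      (auto simp: U_def DM_zero[OF r] DM_add[OF r] DM_smult[OF r] VD(2,7))
  moreover have "DM \<rho> m y \<in> U" if m: "m \<in> Ar" and y: "y \<in> U" for m y
  proof -
    have yc: "y \<in> carrier V" using y by (simp add: U_def)
    have "DM \<rho> n (DM \<rho> m y) = \<zero>\<^bsub>V\<^esub>" if n: "n \<in> Ar" "ran n = H2" for n
      using DM_DM[OF r n(1) m yc] y n cmp_Ar[OF n(1) m] tgt_cmp[OF n(1) m] by (simp add: U_def)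
    then show ?thesis using DM_closed[OF r m yc] by (simp add: U_def)
  qed
  ultimately have U: "U = {\<zero>\<^bsub>V\<^esub>} \<or> U = carrier V" by (rule DM_generates[OF r irr])
  have v1c: "v1 \<in> carrier V" "DM \<rho> (pm id H1) v1 = v1" using v1 by (auto simp: fixedM_def)
  have v2c: "v2 \<in> carrier V" "DM \<rho> (pm id H2) v2 = v2" using v2 by (auto simp: fixedM_def)
  have "v1 \<in> U"
  proof -
    have "DM \<rho> m v1 = \<zero>\<^bsub>V\<^esub>" if m: "m \<in> Ar" "ran m = H2" for m
    proof -
      obtain w x where mw: "w \<in> W" "x \<in> X" "m = pm w x" using m(1) by (rule ArE)
      have "x \<noteq> H1" using mw m(2) ne orb_image[OF mw(1), of H1] by auto
      then have "DM \<rho> m (DM \<rho> (pm id H1) v1) = \<zero>\<^bsub>V\<^esub>"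
        using DM_pm[OF r mw(1,2) id_W Hy_X[OF H(1)] v1c(1)] mw(3) by simp
      then show ?thesis unfolding v1c(2) .
    qed
    then show ?thesis using v1c(1) by (simp add: U_def)
  qed
  then have "U = carrier V" using U v1(2) by blast
  then have "v2 \<in> U" using v2c(1) by simp
  then have "DM \<rho> (pm id H2) v2 = \<zero>\<^bsub>V\<^esub>" using ArI[OF id_W Hy_X[OF H(2)]] by (simp add: U_def)
  then show False using v2c(2) v2(2) by simp
qed

lemma fixedM_iso:
  assumes r: "algebra_rep A (V, \<rho>)" and r': "algebra_rep A (V', \<rho>')" and H: "H \<in> Hy"
    and \<phi>: "bij_betw \<phi> (carrier V) (carrier V')"
    and eq: "\<And>x v. x \<in> carrier A \<Longrightarrow> v \<in> carrier V \<Longrightarrow> \<phi> (\<rho> x v) = \<rho>' x (\<phi> v)"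
  shows "bij_betw \<phi> (fixedM V \<rho> H) (fixedM V' \<rho>' H)"
proof (rule bij_betw_subset[OF \<phi>])
  note jp = jc[OF dlt_closed[OF ArI[OF id_W Hy_X[OF H]]]]
  show "fixedM V \<rho> H \<subseteq> carrier V" by (auto simp: fixedM_def)
  show "\<phi> ` fixedM V \<rho> H = fixedM V' \<rho>' H"
  proof
    show "\<phi> ` fixedM V \<rho> H \<subseteq> fixedM V' \<rho>' H"
      using bij_betw_apply[OF \<phi>] by (auto simp: fixedM_def eq[OF jp, symmetric])
    show "fixedM V' \<rho>' H \<subseteq> \<phi> ` fixedM V \<rho> H"
    proof
      fix y assume y: "y \<in> fixedM V' \<rho>' H"
      then have "y \<in> carrier V'" by (simp add: fixedM_def)
      then obtain x where x: "x \<in> carrier V" "y = \<phi> x" using \<phi> unfolding bij_betw_def by blast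
      have "\<phi> (DM \<rho> (pm id H) x) = \<phi> x" using eq[OF jp x(1)] y x(2) by (simp add: fixedM_def)
      then have "DM \<rho> (pm id H) x = x"
        using \<phi> algebra_repD(2)[OF r jp x(1)] x(1) unfolding bij_betw_def inj_on_def by blast
      then show "y \<in> \<phi> ` fixedM V \<rho> H" using x by (simp add: fixedM_def)
    qed
  qed
qed

end

section \<open>Irreducibility and uniqueness of the induced representation\<close>

locale ind_irr = ind +
  assumes irr: "irreducible_action (carrier (stab_quotient scale W H)) (V, \<tau>)"
begin

lemma V_nonzero: obtains v where "v \<in> carrier V" "v \<noteq> \<zero>\<^bsub>V\<^esub>"
  using irreducible_actionD(1)[OF irr] V.zero_closed by blast

lemma t_irr:
  assumes U: "VectorSpace.subspace class_ring U V" "\<And>n v. n \<in> Nm H \<Longrightarrow> v \<in> U \<Longrightarrow> t n v \<in> U"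
  shows "U = {\<zero>\<^bsub>V\<^esub>} \<or> U = carrier V"
proof (rule irreducible_actionD(2)[OF irr U(1)])
  fix C v assume "C \<in> carrier (stab_quotient scale W H)" and v: "v \<in> U"
  then obtain n where "n \<in> Nm H" "C = K H #>\<^bsub>Wg\<^esub> n" unfolding stab_quotient(1)[OF H] by blast
  then show "\<tau> C v \<in> U" using U(2)[of n v] v by (simp add: t_def)
qed

lemma ev_nonzero: "v \<in> carrier V \<Longrightarrow> v \<noteq> \<zero>\<^bsub>V\<^esub> \<Longrightarrow> ev v \<noteq> \<zero>\<^bsub>I\<^esub>"
  using ev_id I_apply(3)[OF id_W] by metis

text \<open>The values at \<open>id\<close> of the functions in a submodule form an invariant
  subspace of \<theta>. It is nonzero, because an arrow moves any nonzero value to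
  \<open>id\<close>, and hence is everything; \<open>D_from_id\<close> then rebuilds each
  homogeneous part of an arbitrary function inside the submodule.\<close>

lemma I_irr: "irreducible_action (carrier A) (I, \<rho>)"
proof (rule irreducible_actionI)
  obtain v0 where v0: "v0 \<in> carrier V" "v0 \<noteq> \<zero>\<^bsub>V\<^esub>" by (rule V_nonzero)
  show "carrier I \<noteq> {\<zero>\<^bsub>I\<^esub>}" using ev_closed[OF v0(1)] ev_nonzero[OF v0] by blast
  fix U assume U: "VectorSpace.subspace class_ring U I"
    and ivt: "\<And>a f. a \<in> carrier A \<Longrightarrow> f \<in> U \<Longrightarrow> \<rho> a f \<in> U" and ne: "U \<noteq> {\<zero>\<^bsub>I\<^esub>}"
  note UD = subspaceD[OF U]
  have Uc: "f \<in> carrier I" if "f \<in> U" for f using that UD(1) by blast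
  have DU: "D m f \<in> U" if "m \<in> Ar" "f \<in> U" for m f
    using ivt[OF jc[OF dlt_closed[OF that(1)]] that(2)] \<rho>_dlt[OF that(1) Uc[OF that(2)]] by simp
  define U0 where "U0 = (\<lambda>f. f id) ` U"
  have U0I: "f id \<in> U0" if "f \<in> U" for f using that by (simp add: U0_def)
  have sub0: "VectorSpace.subspace class_ring U0 V"
  proof (rule subspaceI[OF V])
    show "U0 \<subseteq> carrier V" using I_D(1)[OF Uc id_W] by (auto simp: U0_def)
    show "\<zero>\<^bsub>V\<^esub> \<in> U0" using U0I[OF UD(2)] by (simp add: id_W)
    fix v c assume "v \<in> U0"
    then obtain f where f: "f \<in> U" "v = f id" by (auto simp: U0_def)
    show "c \<odot>\<^bsub>V\<^esub> v \<in> U0" using U0I[OF UD(4)[OF f(1), of c]] f(2) by (simp add: id_W)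
    fix w assume "w \<in> U0"
    then obtain f' where f': "f' \<in> U" "w = f' id" by (auto simp: U0_def)
    show "v \<oplus>\<^bsub>V\<^esub> w \<in> U0" using U0I[OF UD(3)[OF f(1) f'(1)]] f(2) f'(2) by (simp add: id_W)
  qed
  have inv0: "t n v \<in> U0" if n: "n \<in> Nm H" and v: "v \<in> U0" for n v
  proof -
    obtain f where f: "f \<in> U" "v = f id" using v by (auto simp: U0_def)
    have "D (pm n H) f id = f (id \<circ> n)"
      using D_pm[OF Uc[OF f(1)] Nm_W[OF n] Hy_X[OF H] id_W] Nm_image[OF n] by simp
    also have "id \<circ> n = n \<circ> id" by simp
    also have "f (n \<circ> id) = t n v" unfolding f(2) by (rule I_D(2)[OF Uc[OF f(1)] n id_W])
    finally have e: "D (pm n H) f id = t n v" .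
    show ?thesis using U0I[OF DU[OF ArI[OF Nm_W[OF n] Hy_X[OF H]] f(1)]] unfolding e .
  qed
  obtain f where f: "f \<in> U" "f \<noteq> \<zero>\<^bsub>I\<^esub>" using ne UD(2) by blast
  obtain g where g: "g \<in> W" "f g \<noteq> \<zero>\<^bsub>V\<^esub>"
    using I_eqI[OF Uc[OF f(1)] I_zero] f(2) I_apply(3) by metis
  have gx: "iv g ` H \<in> X" by (rule W_X[OF iv_W[OF g(1)] Hy_X[OF H]])
  have "D (pm g (iv g ` H)) f id = f g"
    using D_pm[OF Uc[OF f(1)] g(1) gx id_W] iv_image(2)[OF g(1), of H] by simp
  then have "U0 \<noteq> {\<zero>\<^bsub>V\<^esub>}" using U0I[OF DU[OF ArI[OF g(1) gx] f(1)]] g(2) by auto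
  then have U0: "U0 = carrier V" using t_irr[OF sub0 inv0] by blast
  have "FF \<in> U" if FF: "FF \<in> carrier I" for FF
  proof -
    \<comment> \<open>Objects outside the orbit of \<open>H\<close> carry the zero part; at the
      others the part comes from an element of \<open>U\<close> with a prescribed value at
      \<open>id\<close>.\<close>
    have "D (pm id x) FF \<in> U" if x: "x \<in> X" for x
    proof (cases "\<exists>w\<in>W. w ` H = x")
      case True
      then obtain w where w: "w \<in> W" "w ` H = x" by blast
      have "FF (iv w) \<in> U0" unfolding U0 by (rule I_D(1)[OF FF iv_W[OF w(1)]])
      then obtain f where f: "f \<in> U" "FF (iv w) = f id" by (auto simp: U0_def)
      have "D (pm w H) f = D (pm id x) FF"
        using D_from_id[OF FF Uc[OF f(1)] w(1) f(2)[symmetric]] unfolding w(2) .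
      then show ?thesis using DU[OF ArI[OF w(1) Hy_X[OF H]] f(1)] by simp
    next
      case False
      have "D (pm id x) FF = \<zero>\<^bsub>I\<^esub>"
      proof (rule I_eqI[OF D_closed[OF ArI[OF id_W x] FF] I_zero])
        fix g assume g: "g \<in> W"
        have "g ` x \<noteq> H" using False iv_W[OF g] iv_image(1)[OF g, of x] by metis
        then show "D (pm id x) FF g = \<zero>\<^bsub>I\<^esub> g" using D_pm[OF FF id_W x g] g by simp
      qed
      then show ?thesis using UD(2) by simp
    qed
    then have "(\<Oplus>\<^bsub>I\<^esub>x\<in>X. D (pm id x) FF) \<in> U" by (rule subspace_finsum[OF I_vs U finite_X])
    then show ?thesis unfolding finsum_D_id[OF FF] .
  qed
  then show "U = carrier I" using UD(1) by blast
qed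

lemma pmH: "pm id H \<in> Ar" by (rule ArI[OF id_W Hy_X[OF H]])

lemma I_new: "\<not> factors_through_quot A (Br1_to_group_kernel scale W \<mu>) (I, \<rho>)"
proof
  assume "factors_through_quot A (Br1_to_group_kernel scale W \<mu>) (I, \<rho>)"
  then have z: "\<forall>m\<in>Ar. dom m \<noteq> UNIV \<longrightarrow> (\<forall>v\<in>carrier I. DM \<rho> m v = \<zero>\<^bsub>I\<^esub>)" unfolding factors_iff[OF I_A_rep] .
  obtain v where v: "v \<in> carrier V" "v \<noteq> \<zero>\<^bsub>V\<^esub>" by (rule V_nonzero)
  have "H \<noteq> UNIV" using H UNIV_notin_Hy by blast
  then have "DM \<rho> (pm id H) (ev v) = \<zero>\<^bsub>I\<^esub>" using z pmH ev_closed[OF v(1)] by simp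
  moreover have "DM \<rho> (pm id H) (ev v) = ev v"
    using \<rho>_dlt[OF pmH ev_closed[OF v(1)]] ev_t[OF id_Nm v(1)] t_K[OF id_K v(1)] by simp
  ultimately show False using ev_nonzero[OF v] by simp
qed

lemma I_corr: "corr H (V, \<tau>) (I, \<rho>)"
proof -
  have eva: "ev \<in> LinearCombinations.module_hom class_ring V I"
  proof (rule module_homI)
    show "ev v \<in> carrier I" if "v \<in> carrier V" for v by (rule ev_closed[OF that])
    show "ev (v \<oplus>\<^bsub>V\<^esub> w) = ev v \<oplus>\<^bsub>I\<^esub> ev w" if "v \<in> carrier V" "w \<in> carrier V" for v w
      by (rule I_eqI) (use that in \<open>simp_all add: ev_closed I_add\<close>, simp add: ev_def t_add)
    show "ev (c \<odot>\<^bsub>V\<^esub> v) = c \<odot>\<^bsub>I\<^esub> ev v" if "v \<in> carrier V" for c v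
      by (rule I_eqI) (use that VD(2) in \<open>simp_all add: ev_closed I_smult\<close>, simp add: ev_def t_smult VD(7))
  qed
  have p: "DM \<rho> (pm n H) (ev v) = ev (t n v)" if "n \<in> Nm H" "v \<in> carrier V" for n v
    using \<rho>_dlt[OF ArI[OF Nm_W[OF that(1)] Hy_X[OF H]] ev_closed[OF that(2)]] ev_t[OF that] by simp
  have "bij_betw ev (carrier V) (fixedM I \<rho> H)"
  proof (rule bij_betw_imageI)
    show "inj_on ev (carrier V)" by (rule inj_onI) (metis ev_id)
    show "ev ` carrier V = fixedM I \<rho> H"
    proof
      show "ev ` carrier V \<subseteq> fixedM I \<rho> H"
        using p[OF id_Nm] t_K[OF id_K] ev_closed by (auto simp: fixedM_def)
      show "fixedM I \<rho> H \<subseteq> ev ` carrier V"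
      proof
        fix FF assume "FF \<in> fixedM I \<rho> H"
        then have FF: "FF \<in> carrier I" "D (pm id H) FF = FF" using \<rho>_dlt[OF pmH] by (auto simp: fixedM_def)
        have Fi: "FF id \<in> carrier V" by (rule I_D(1)[OF FF(1) id_W])
        have ivid: "iv id = id" using inv_id by (simp add: id_def)
        have "D (pm id H) (ev (FF id)) = D (pm id (id ` H)) FF"
          by (rule D_from_id[OF FF(1) ev_closed[OF Fi] id_W]) (simp only: ev_id[OF Fi] ivid)
        then have "ev (FF id) = FF" using FF(2) ev_t[OF id_Nm Fi] t_K[OF id_K Fi] by simp
        then show "FF \<in> ev ` carrier V" using Fi by (metis imageI)
      qed
    qed
  qed
  then show ?thesis unfolding corr_def using eva p by (auto simp: t_def intro!: bexI[of _ ev])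
qed

text \<open>The identity map is an isomorphism, since the space was taken from
  \<open>induced_rep\<close> and \<open>\<rho>_g\<close> shows that the actions agree.\<close>

lemma I_restrict:
  "rep_iso W (restrict_to_W scale W \<mu> (I, \<rho>))
     (induced_rep Wg (stab_normalizer scale W H) (inflated_rep Wg (K H) (V, \<tau>)))"
proof -
  have e: "induced_rep Wg (stab_normalizer scale W H) (inflated_rep Wg (K H) (V, \<tau>))
     = (I, \<lambda>g f. \<lambda>x\<in>W. f (x \<circ> g))"
    unfolding I_def by (simp add: induced_rep_def inflated_rep_def)
  show ?thesis
    unfolding e restrict_to_W_def rep_iso_def A_gen split
  proof (rule bexI[of _ "\<lambda>x. x"], intro conjI ballI)
    show "bij_betw (\<lambda>x. x) (carrier I) (carrier I)" by (rule bij_betw_byWitness[of _ "\<lambda>x. x"]) auto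
    show "\<rho> (A.g w) f = (\<lambda>x\<in>W. f (x \<circ> w))" if "w \<in> W" "f \<in> carrier I" for w f by (rule \<rho>_g[OF that])
    show "(\<lambda>x. x) \<in> LinearCombinations.module_hom class_ring I I" by (rule module_homI) simp_all
  qed
qed

text \<open>Frobenius reciprocity made explicit: a vector is sent to the function whose value at
  \<open>g\<close> is its part at the object that \<open>g\<close> takes to \<open>H\<close>, moved
  to \<open>H\<close> by \<open>g\<close> and read in \<theta>. The map is equivariant and nonzero,
  so Schur's lemma applies.\<close>

lemma corr_iso:
  assumes r: "algebra_rep A (Mv, r)" and irrM: "irreducible_action (carrier A) (Mv, r)" and c: "corr H (V, \<tau>) (Mv, r)"
  shows "rep_iso (carrier A) (Mv, r) (I, \<rho>)"
proof -
  note RD = algebra_repD[OF r]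
  note MD = vectorspaceD[OF RD(1)]
  interpret M: abelian_group Mv by (rule MD(1))
  let ?P = "fixedM Mv r H"
  obtain \<beta> where \<beta>: "\<beta> \<in> LinearCombinations.module_hom class_ring V Mv" "bij_betw \<beta> (carrier V) ?P"
    "\<And>n v. n \<in> Nm H \<Longrightarrow> v \<in> carrier V \<Longrightarrow> \<beta> (t n v) = DM r (pm n H) (\<beta> v)"
    using corrE[OF c] unfolding t_def by blast
  note bD = module_homD[OF \<beta>(1)]
  define \<gamma> where "\<gamma> = inv_into (carrier V) \<beta>"
  have \<gamma>\<beta>: "\<gamma> (\<beta> v) = v" if "v \<in> carrier V" for v unfolding \<gamma>_def using \<beta>(2) that by (rule bij_betw_inv_into_left)
  have exP: "\<exists>v\<in>carrier V. x = \<beta> v" if "x \<in> ?P" for x using \<beta>(2) that unfolding bij_betw_def by blast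
  have \<gamma>c: "\<gamma> x \<in> carrier V" if "x \<in> ?P" for x using exP[OF that] \<gamma>\<beta> by auto
  have \<gamma>a: "\<gamma> (x \<oplus>\<^bsub>Mv\<^esub> y) = \<gamma> x \<oplus>\<^bsub>V\<^esub> \<gamma> y" if "x \<in> ?P" "y \<in> ?P" for x y
  proof -
    have "\<exists>v\<in>carrier V. x = \<beta> v" "\<exists>w\<in>carrier V. y = \<beta> w" using exP that by blast+
    then obtain v w where "v \<in> carrier V" "x = \<beta> v" "w \<in> carrier V" "y = \<beta> w" by blast
    then show ?thesis using \<gamma>\<beta> bD(2)[of v w] by (metis V.add.m_closed)
  qed
  have \<gamma>s: "\<gamma> (c \<odot>\<^bsub>Mv\<^esub> x) = c \<odot>\<^bsub>V\<^esub> \<gamma> x" if "x \<in> ?P" for x c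
  proof -
    have "\<exists>v\<in>carrier V. x = \<beta> v" using exP that by blast
    then obtain v where "v \<in> carrier V" "x = \<beta> v" by blast
    then show ?thesis using \<gamma>\<beta> bD(3)[of v c] VD(2)[of v c] by metis
  qed
  have \<gamma>t: "\<gamma> (DM r (pm n H) x) = t n (\<gamma> x)" if "n \<in> Nm H" "x \<in> ?P" for n x
  proof -
    have "\<exists>v\<in>carrier V. x = \<beta> v" using exP that by blast
    then obtain v where "v \<in> carrier V" "x = \<beta> v" by blast
    then show ?thesis using \<gamma>\<beta> \<beta>(3)[OF that(1), of v] t_closed[OF that(1), of v] by metis
  qed
  have \<beta>0: "\<beta> \<zero>\<^bsub>V\<^esub> = \<zero>\<^bsub>Mv\<^esub>" by (rule additive_zero[OF VD(1) MD(1) bD(1,2)])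
  have \<gamma>0: "\<gamma> \<zero>\<^bsub>Mv\<^esub> = \<zero>\<^bsub>V\<^esub>" using \<gamma>\<beta>[OF V.zero_closed] \<beta>0 by simp
  \<comment> \<open>The restriction of \<open>g\<close> that ends at \<open>H\<close>; its image
    therefore lies in the part of the module at \<open>H\<close>.\<close>
  define y where "y g v = DM r (pm g (iv g ` H)) v" for g v
  have ivX: "iv g ` H \<in> X" if "g \<in> W" for g by (rule W_X[OF iv_W[OF that] Hy_X[OF H]])
  note HX = Hy_X[OF H]
  have yc: "y g v \<in> carrier Mv" if "g \<in> W" "v \<in> carrier Mv" for g v
    unfolding y_def by (rule DM_closed[OF r ArI[OF that(1) ivX[OF that(1)]] that(2)])
  have yP: "y g v \<in> ?P" if "g \<in> W" "v \<in> carrier Mv" for g v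
    using yc[OF that] DM_pm[OF r id_W HX that(1) ivX[OF that(1)] that(2)] iv_image(2)[OF that(1), of H]
    by (simp add: fixedM_def y_def)
  define \<psi> where "\<psi> v = (\<lambda>g\<in>W. \<gamma> (y g v))" for v
  have \<psi>c: "\<psi> v \<in> carrier I" if v: "v \<in> carrier Mv" for v
    unfolding \<psi>_def
  proof (rule I_mem)
    show "\<gamma> (y g v) \<in> carrier V" if "g \<in> W" for g by (rule \<gamma>c[OF yP[OF that v]])
    fix n g assume n: "n \<in> Nm H" and g: "g \<in> W"
    have nW: "n \<in> W" by (rule Nm_W[OF n])
    have e: "iv (n \<circ> g) ` H = iv g ` H"
    proof -
      have "(n \<circ> g) ` iv g ` H = n ` g ` iv g ` H" by (simp only: image_comp comp_assoc)
      then have "(n \<circ> g) ` iv g ` H = H" using iv_image(2)[OF g, of H] Nm_image[OF n] by (simp only:)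
      then show ?thesis using iv_image(1)[OF comp_W[OF nW g], of "iv g ` H"] by (simp only:)
    qed
    have "y (n \<circ> g) v = DM r (pm n H) (y g v)"
      unfolding y_def e using DM_pm[OF r nW HX g ivX[OF g] v] iv_image(2)[OF g, of H] by (simp only: if_True simp_thms)
    then show "\<gamma> (y (n \<circ> g) v) = t n (\<gamma> (y g v))" using \<gamma>t[OF n yP[OF g v]] by simp
  qed
  have \<psi>g: "\<psi> v g = \<gamma> (y g v)" if "g \<in> W" for v g using that by (simp add: \<psi>_def)
  have \<psi>hom: "\<psi> \<in> LinearCombinations.module_hom class_ring Mv I"
  proof (rule module_homI)
    show "\<psi> v \<in> carrier I" if "v \<in> carrier Mv" for v by (rule \<psi>c[OF that])
    show "\<psi> (v \<oplus>\<^bsub>Mv\<^esub> w) = \<psi> v \<oplus>\<^bsub>I\<^esub> \<psi> w" if vw: "v \<in> carrier Mv" "w \<in> carrier Mv" for v w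
    proof (rule I_eqI[OF \<psi>c[OF M.add.m_closed[OF vw]] I_add[OF \<psi>c[OF vw(1)] \<psi>c[OF vw(2)]]])
      fix g assume g: "g \<in> W"
      have "y g (v \<oplus>\<^bsub>Mv\<^esub> w) = y g v \<oplus>\<^bsub>Mv\<^esub> y g w" unfolding y_def by (rule DM_add[OF r ArI[OF g ivX[OF g]] vw])
      then show "\<psi> (v \<oplus>\<^bsub>Mv\<^esub> w) g = (\<psi> v \<oplus>\<^bsub>I\<^esub> \<psi> w) g"
        using g \<gamma>a[OF yP[OF g vw(1)] yP[OF g vw(2)]] by (simp add: \<psi>g)
    qed
    show "\<psi> (c \<odot>\<^bsub>Mv\<^esub> v) = c \<odot>\<^bsub>I\<^esub> \<psi> v" if v: "v \<in> carrier Mv" for c v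
    proof (rule I_eqI[OF \<psi>c[OF MD(2)[OF v]] I_smult[OF \<psi>c[OF v]]])
      fix g assume g: "g \<in> W"
      have "y g (c \<odot>\<^bsub>Mv\<^esub> v) = c \<odot>\<^bsub>Mv\<^esub> y g v" unfolding y_def by (rule DM_smult[OF r ArI[OF g ivX[OF g]] v])
      then show "\<psi> (c \<odot>\<^bsub>Mv\<^esub> v) g = (c \<odot>\<^bsub>I\<^esub> \<psi> v) g" using g \<gamma>s[OF yP[OF g v]] by (simp add: \<psi>g)
    qed
  qed
  have tw: "\<psi> (DM r m v) = DM \<rho> m (\<psi> v)" if m: "m \<in> Ar" and v: "v \<in> carrier Mv" for m v
  proof -
    obtain u x where mu: "u \<in> W" "x \<in> X" "m = pm u x" using m by (rule ArE)
    note mv = DM_closed[OF r m v]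
    have "\<psi> (DM r m v) = D m (\<psi> v)"
    proof (rule I_eqI[OF \<psi>c[OF mv] D_closed[OF m \<psi>c[OF v]]])
      fix g assume g: "g \<in> W"
      have gu: "g \<circ> u \<in> W" by (rule comp_W[OF g mu(1)])
      have yg: "y g (DM r m v) = (if u ` x = iv g ` H then DM r (pm (g \<circ> u) x) v else \<zero>\<^bsub>Mv\<^esub>)"
        unfolding y_def mu(3) by (rule DM_pm[OF r g ivX[OF g] mu(1,2) v])
      show "\<psi> (DM r m v) g = D m (\<psi> v) g"
      proof (cases "g ` u ` x = H")
        case True
        have e1: "u ` x = iv g ` H" using True iv_image(1)[OF g, of "u ` x"] by simp
        have "(g \<circ> u) ` x = H" using True by (simp only: image_comp)
        then have e2: "iv (g \<circ> u) ` H = x" using iv_image(1)[OF gu, of x] by (simp only:)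
        have "y g (DM r m v) = y (g \<circ> u) v" unfolding yg y_def[of "g \<circ> u"] e2 using e1 by (simp only: if_True simp_thms)
        then have "\<psi> (DM r m v) g = \<psi> v (g \<circ> u)" using \<psi>g[OF g] \<psi>g[OF gu] by simp
        then show ?thesis using D_pm[OF \<psi>c[OF v] mu(1,2) g] True mu(3) by simp
      next
        case False
        have e1: "u ` x \<noteq> iv g ` H" using False iv_image(2)[OF g, of H] by metis
        have "\<psi> (DM r m v) g = \<gamma> \<zero>\<^bsub>Mv\<^esub>" unfolding \<psi>g[OF g] yg using e1 by (simp only: if_False)
        then show ?thesis using D_pm[OF \<psi>c[OF v] mu(1,2) g] False mu(3) \<gamma>0 by simp
      qed
    qed
    then show ?thesis using \<rho>_dlt[OF m \<psi>c[OF v]] by simp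
  qed
  have tw': "\<psi> (r a v) = \<rho> a (\<psi> v)" if a: "a \<in> carrier A" and v: "v \<in> carrier Mv" for a v
  proof -
    have "\<psi> (r (j (h a)) v) = \<rho> (j (h a)) (\<psi> v)"
      by (rule rep_galg_intertwiner[OF rep_pull[OF r] rep_pull[OF I_A_rep] \<psi>hom tw A.h_supported[OF a] v])
    then show ?thesis unfolding jh[OF a] .
  qed
  \<comment> \<open>Schur's lemma asks for one vector with nonzero image: at \<open>id\<close> the
    map \<open>\<psi>\<close> undoes \<open>\<beta>\<close>.\<close>
  obtain v0 where v0: "v0 \<in> carrier V" "v0 \<noteq> \<zero>\<^bsub>V\<^esub>" by (rule V_nonzero)
  have b0: "\<beta> v0 \<in> carrier Mv" "\<beta> v0 \<in> ?P" using bD(1)[OF v0(1)] \<beta>(2) v0(1) unfolding bij_betw_def by auto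
  have "iv id ` H = H" using iv_image(1)[OF id_W, of H] by simp
  then have "y id (\<beta> v0) = \<beta> v0" using b0(2) by (simp add: y_def fixedM_def)
  then have "\<psi> (\<beta> v0) id = v0" using \<psi>g[OF id_W] \<gamma>\<beta>[OF v0(1)] by simp
  then have nz: "\<psi> (\<beta> v0) \<noteq> \<zero>\<^bsub>I\<^esub>" using v0(2) I_apply(3)[OF id_W] by metis
  have \<rho>0: "\<rho> a \<zero>\<^bsub>I\<^esub> = \<zero>\<^bsub>I\<^esub>" if "a \<in> carrier A" for a
    by (rule additive_zero[OF ID(1) ID(1)]) (use algebra_repD(2,3)[OF I_A_rep that] in auto)
  show ?thesis
    by (rule schur[OF RD(1) I_vs irrM I_irr RD(2) \<rho>0 \<psi>hom tw' b0(1) nz])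
qed

end

lemma subspace_vectorspace:
  fixes V :: "('k::field, 'm) module"
  assumes V: "vectorspace class_ring V" and U: "VectorSpace.subspace class_ring U V"
  shows "vectorspace class_ring (V\<lparr>carrier := U\<rparr>)"
proof -
  note VD = vectorspaceD[OF V] and UD = subspaceD[OF U]
  interpret V: abelian_group V by (rule VD(1))
  have c: "x \<in> carrier V" if "x \<in> U" for x using that UD(1) by blast
  have ag: "abelian_group (V\<lparr>carrier := U\<rparr>)"
  proof (rule abelian_groupI)
    fix x assume "x \<in> carrier (V\<lparr>carrier := U\<rparr>)"
    then have x: "x \<in> U" by simp
    show "\<exists>y\<in>carrier (V\<lparr>carrier := U\<rparr>). y \<oplus>\<^bsub>V\<lparr>carrier := U\<rparr>\<^esub> x = \<zero>\<^bsub>V\<lparr>carrier := U\<rparr>\<^esub>"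
    proof (rule bexI[of _ "(-1) \<odot>\<^bsub>V\<^esub> x"])
      show "(-1) \<odot>\<^bsub>V\<^esub> x \<in> carrier (V\<lparr>carrier := U\<rparr>)" using UD(4)[OF x, of "-1"] by simp
      show "(-1) \<odot>\<^bsub>V\<^esub> x \<oplus>\<^bsub>V\<lparr>carrier := U\<rparr>\<^esub> x = \<zero>\<^bsub>V\<lparr>carrier := U\<rparr>\<^esub>"
        using VD(9)[OF c[OF x]] V.l_neg[OF c[OF x]] by simp
    qed
    show "\<zero>\<^bsub>V\<lparr>carrier := U\<rparr>\<^esub> \<oplus>\<^bsub>V\<lparr>carrier := U\<rparr>\<^esub> x = x" using c[OF x] by simp
    fix y assume "y \<in> carrier (V\<lparr>carrier := U\<rparr>)"
    then have y: "y \<in> U" by simp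
    show "x \<oplus>\<^bsub>V\<lparr>carrier := U\<rparr>\<^esub> y \<in> carrier (V\<lparr>carrier := U\<rparr>)" using UD(3)[OF x y] by simp
    show "x \<oplus>\<^bsub>V\<lparr>carrier := U\<rparr>\<^esub> y = y \<oplus>\<^bsub>V\<lparr>carrier := U\<rparr>\<^esub> x" using V.a_comm[OF c[OF x] c[OF y]] by simp
    fix z assume "z \<in> carrier (V\<lparr>carrier := U\<rparr>)"
    then have z: "z \<in> U" by simp
    show "x \<oplus>\<^bsub>V\<lparr>carrier := U\<rparr>\<^esub> y \<oplus>\<^bsub>V\<lparr>carrier := U\<rparr>\<^esub> z = x \<oplus>\<^bsub>V\<lparr>carrier := U\<rparr>\<^esub> (y \<oplus>\<^bsub>V\<lparr>carrier := U\<rparr>\<^esub> z)"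
      using V.a_assoc[OF c[OF x] c[OF y] c[OF z]] by simp
  qed (simp add: UD(2))
  show ?thesis
    by (rule vectorspaceI[OF ag]) (simp_all add: UD(4) c VD(3,4,5,6))
qed

lemma rep_isoI:
  assumes "\<phi> \<in> LinearCombinations.module_hom class_ring V V'" "bij_betw \<phi> (carrier V) (carrier V')"
    "\<And>x v. x \<in> Y \<Longrightarrow> v \<in> carrier V \<Longrightarrow> \<phi> (\<rho> x v) = \<rho>' x (\<phi> v)"
  shows "rep_iso Y (V, \<rho>) (V', \<rho>')"
  unfolding rep_iso_def split
  by (rule bexI[OF _ assms(1)], intro conjI ballI, rule assms(2), rule assms(3))

lemma rep_isoE_ball:
  assumes "rep_iso Y (V, \<rho>) (V', \<rho>')"
  obtains \<phi> where "\<phi> \<in> LinearCombinations.module_hom class_ring V V'" "bij_betw \<phi> (carrier V) (carrier V')"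
    "\<forall>x\<in>Y. \<forall>v\<in>carrier V. \<phi> (\<rho> x v) = \<rho>' x (\<phi> v)"
  using assms unfolding rep_iso_def by auto

section \<open>From an irreducible representation of Br_1 to a vertex representation\<close>

context refl_gen
begin

lemma corrE_ball:
  assumes "corr H (V, \<tau>) (Mv, r)"
  obtains \<beta> where "\<beta> \<in> LinearCombinations.module_hom class_ring V Mv" "bij_betw \<beta> (carrier V) (fixedM Mv r H)"
    "\<forall>n\<in>Nm H. \<forall>v\<in>carrier V. \<beta> (\<tau> (K H #>\<^bsub>Wg\<^esub> n) v) = DM r (pm n H) (\<beta> v)"
  using assms unfolding corr_def by auto

abbreviation "Qt \<equiv> stab_quotient scale W"

lemma factors_through_iso:
  assumes r: "algebra_rep A (V, \<rho>)" and r': "algebra_rep A (V', \<rho>')"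
    and \<phi>: "\<phi> \<in> LinearCombinations.module_hom class_ring V V'" "bij_betw \<phi> (carrier V) (carrier V')"
      "\<And>x v. x \<in> carrier A \<Longrightarrow> v \<in> carrier V \<Longrightarrow> \<phi> (\<rho> x v) = \<rho>' x (\<phi> v)"
    and f: "factors_through_quot A (Br1_to_group_kernel scale W \<mu>) (V', \<rho>')"
  shows "factors_through_quot A (Br1_to_group_kernel scale W \<mu>) (V, \<rho>)"
  unfolding factors_iff[OF r]
proof (intro ballI impI)
  note VD = vectorspaceD[OF algebra_repD(1)[OF r]] and V'D = vectorspaceD[OF algebra_repD(1)[OF r']]
  interpret V: abelian_group V by (rule VD(1))
  have \<phi>0: "\<phi> \<zero>\<^bsub>V\<^esub> = \<zero>\<^bsub>V'\<^esub>" by (rule additive_zero[OF VD(1) V'D(1) module_homD(1,2)[OF \<phi>(1)]])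
  fix m v assume m: "m \<in> Ar" "dom m \<noteq> UNIV" and v: "v \<in> carrier V"
  note jm = jc[OF dlt_closed[OF m(1)]]
  have "\<phi> v \<in> carrier V'" by (rule module_homD(1)[OF \<phi>(1) v])
  then have "DM \<rho>' m (\<phi> v) = \<zero>\<^bsub>V'\<^esub>" using f[unfolded factors_iff[OF r']] m by blast
  then have "\<phi> (DM \<rho> m v) = \<phi> \<zero>\<^bsub>V\<^esub>" using \<phi>(3)[OF jm v] \<phi>0 by simp
  then show "DM \<rho> m v = \<zero>\<^bsub>V\<^esub>"
    by (rule inj_onD[OF bij_betw_imp_inj_on[OF \<phi>(2)] _ algebra_repD(2)[OF r jm v] V.zero_closed])
qed

lemma corrI:
  assumes "\<beta> \<in> LinearCombinations.module_hom class_ring V Mv" "bij_betw \<beta> (carrier V) (fixedM Mv r H)"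
    "\<And>n v. n \<in> Nm H \<Longrightarrow> v \<in> carrier V \<Longrightarrow> \<beta> (\<tau> (K H #>\<^bsub>Wg\<^esub> n) v) = DM r (pm n H) (\<beta> v)"
  shows "corr H (V, \<tau>) (Mv, r)"
  unfolding corr_def split
  by (rule bexI[OF _ assms(1)], intro conjI ballI, rule assms(2), rule assms(3))

lemma corr_iso_right:
  assumes H: "H \<in> Hy" and c: "corr H (V, \<tau>) (Mv, r)"
    and r: "algebra_rep A (Mv, r)" and r': "algebra_rep A (Mv', r')"
    and iso: "rep_iso (carrier A) (Mv, r) (Mv', r')"
  shows "corr H (V, \<tau>) (Mv', r')"
proof -
  obtain \<phi> where \<phi>0: "\<phi> \<in> LinearCombinations.module_hom class_ring Mv Mv'" "bij_betw \<phi> (carrier Mv) (carrier Mv')"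
      "\<forall>x\<in>carrier A. \<forall>v\<in>carrier Mv. \<phi> (r x v) = r' x (\<phi> v)"
    by (rule rep_isoE_ball[OF iso])
  note \<phi> = \<phi>0(1,2) \<phi>0(3)[rule_format]
  obtain \<beta> where \<beta>0: "\<beta> \<in> LinearCombinations.module_hom class_ring V Mv" "bij_betw \<beta> (carrier V) (fixedM Mv r H)"
      "\<forall>n\<in>Nm H. \<forall>v\<in>carrier V. \<beta> (\<tau> (K H #>\<^bsub>Wg\<^esub> n) v) = DM r (pm n H) (\<beta> v)"
    by (rule corrE_ball[OF c])
  note \<beta> = \<beta>0(1,2) \<beta>0(3)[rule_format]
  note bD = module_homD[OF \<beta>(1)] and fD = module_homD[OF \<phi>(1)]
  have fx: "bij_betw \<phi> (fixedM Mv r H) (fixedM Mv' r' H)" by (rule fixedM_iso[OF r r' H \<phi>(2)]) (rule \<phi>(3))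
  show ?thesis
  proof (rule corrI)
    show "\<phi> \<circ> \<beta> \<in> LinearCombinations.module_hom class_ring V Mv'" by (rule module_homI) (simp_all add: bD fD)
    show "bij_betw (\<phi> \<circ> \<beta>) (carrier V) (fixedM Mv' r' H)" by (rule bij_betw_trans[OF \<beta>(2) fx])
    show "(\<phi> \<circ> \<beta>) (\<tau> (K H #>\<^bsub>Wg\<^esub> n) v) = DM r' (pm n H) ((\<phi> \<circ> \<beta>) v)" if n: "n \<in> Nm H" and v: "v \<in> carrier V" for n v
      using \<phi>(3)[OF jc[OF dlt_closed[OF ArI[OF Nm_W[OF n] Hy_X[OF H]]]] bD(1)[OF v]] \<beta>(3)[OF n v] by simp
  qed
qed

lemma corr_iso_left:
  assumes H: "H \<in> Hy" and c: "corr H (V', \<tau>') (Mv, r)"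
    and iso: "rep_iso (carrier (Qt H)) (V, \<tau>) (V', \<tau>')"
  shows "corr H (V, \<tau>) (Mv, r)"
proof -
  obtain \<eta> where \<eta>0: "\<eta> \<in> LinearCombinations.module_hom class_ring V V'" "bij_betw \<eta> (carrier V) (carrier V')"
      "\<forall>x\<in>carrier (Qt H). \<forall>v\<in>carrier V. \<eta> (\<tau> x v) = \<tau>' x (\<eta> v)"
    by (rule rep_isoE_ball[OF iso])
  note \<eta> = \<eta>0(1,2) \<eta>0(3)[rule_format]
  obtain \<beta> where \<beta>0: "\<beta> \<in> LinearCombinations.module_hom class_ring V' Mv" "bij_betw \<beta> (carrier V') (fixedM Mv r H)"
      "\<forall>n\<in>Nm H. \<forall>v\<in>carrier V'. \<beta> (\<tau>' (K H #>\<^bsub>Wg\<^esub> n) v) = DM r (pm n H) (\<beta> v)"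
    by (rule corrE_ball[OF c])
  note \<beta> = \<beta>0(1,2) \<beta>0(3)[rule_format]
  note bD = module_homD[OF \<beta>(1)] and fD = module_homD[OF \<eta>(1)]
  show ?thesis
  proof (rule corrI)
    show "\<beta> \<circ> \<eta> \<in> LinearCombinations.module_hom class_ring V Mv" by (rule module_homI) (simp_all add: bD fD)
    show "bij_betw (\<beta> \<circ> \<eta>) (carrier V) (fixedM Mv r H)" by (rule bij_betw_trans[OF \<eta>(2) \<beta>(2)])
    show "(\<beta> \<circ> \<eta>) (\<tau> (K H #>\<^bsub>Wg\<^esub> n) v) = DM r (pm n H) ((\<beta> \<circ> \<eta>) v)" if n: "n \<in> Nm H" and v: "v \<in> carrier V" for n v
    proof -
      have "K H #>\<^bsub>Wg\<^esub> n \<in> carrier (Qt H)" unfolding stab_quotient(1)[OF H] using n by (rule imageI)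
      then show ?thesis using \<eta>(3)[OF _ v] \<beta>(3)[OF n fD(1)[OF v]] by simp
    qed
  qed
qed

text \<open>Both representations are isomorphic to the action of the stabilizer on the part of the
  module at \<open>H\<close>, so one identification is composed with the inverse of the
  other.\<close>

lemma corr_unique:
  assumes H: "H \<in> Hy" and \<tau>: "group_rep (Qt H) (V, \<tau>)" and \<tau>': "group_rep (Qt H) (V', \<tau>')"
    and c: "corr H (V, \<tau>) (Mv, r)" and c': "corr H (V', \<tau>') (Mv, r)"
  shows "rep_iso (carrier (Qt H)) (V, \<tau>) (V', \<tau>')"
proof -
  obtain \<beta> where \<beta>0: "\<beta> \<in> LinearCombinations.module_hom class_ring V Mv" "bij_betw \<beta> (carrier V) (fixedM Mv r H)"
      "\<forall>n\<in>Nm H. \<forall>v\<in>carrier V. \<beta> (\<tau> (K H #>\<^bsub>Wg\<^esub> n) v) = DM r (pm n H) (\<beta> v)"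
    by (rule corrE_ball[OF c])
  note \<beta> = \<beta>0(1,2) \<beta>0(3)[rule_format]
  obtain \<beta>' where \<beta>'0: "\<beta>' \<in> LinearCombinations.module_hom class_ring V' Mv" "bij_betw \<beta>' (carrier V') (fixedM Mv r H)"
      "\<forall>n\<in>Nm H. \<forall>v\<in>carrier V'. \<beta>' (\<tau>' (K H #>\<^bsub>Wg\<^esub> n) v) = DM r (pm n H) (\<beta>' v)"
    by (rule corrE_ball[OF c'])
  note \<beta>' = \<beta>'0(1,2) \<beta>'0(3)[rule_format]
  note bD = module_homD[OF \<beta>(1)] and b'D = module_homD[OF \<beta>'(1)]
  note VD = vectorspaceD[OF group_repD(1)[OF \<tau>]] and V'D = vectorspaceD[OF group_repD(1)[OF \<tau>']]
  interpret V: abelian_group V by (rule VD(1))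
  interpret V': abelian_group V' by (rule V'D(1))
  define \<gamma> where "\<gamma> = inv_into (carrier V') \<beta>'"
  have \<gamma>\<beta>: "\<gamma> (\<beta>' v) = v" if "v \<in> carrier V'" for v unfolding \<gamma>_def using \<beta>'(2) that by (rule bij_betw_inv_into_left)
  define \<eta> where "\<eta> = \<gamma> \<circ> \<beta>"
  have ex: "\<exists>v'\<in>carrier V'. \<beta> v = \<beta>' v'" if "v \<in> carrier V" for v
    using bij_betw_apply[OF \<beta>(2) that] \<beta>'(2) unfolding bij_betw_def by blast
  have \<eta>: "\<eta> v \<in> carrier V' \<and> \<beta>' (\<eta> v) = \<beta> v" if v: "v \<in> carrier V" for v
  proof -
    obtain v' where "v' \<in> carrier V'" "\<beta> v = \<beta>' v'" using ex[OF v] by blast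
    then show ?thesis using \<gamma>\<beta>[of v'] by (simp add: \<eta>_def)
  qed
  note \<eta>c = conjunct1[OF \<eta>] and \<eta>b = conjunct2[OF \<eta>]
  have inj: "x = y" if "\<beta>' x = \<beta>' y" "x \<in> carrier V'" "y \<in> carrier V'" for x y
    using that by (rule inj_onD[OF bij_betw_imp_inj_on[OF \<beta>'(2)]])
  show ?thesis
  proof (rule rep_isoI)
    show "\<eta> \<in> LinearCombinations.module_hom class_ring V V'"
    proof (rule module_homI)
      show "\<eta> v \<in> carrier V'" if "v \<in> carrier V" for v by (rule \<eta>c[OF that])
      show "\<eta> (v \<oplus>\<^bsub>V\<^esub> w) = \<eta> v \<oplus>\<^bsub>V'\<^esub> \<eta> w" if "v \<in> carrier V" "w \<in> carrier V" for v w
        by (rule inj) (simp_all add: \<eta>b \<eta>c bD b'D that)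
      show "\<eta> (c \<odot>\<^bsub>V\<^esub> v) = c \<odot>\<^bsub>V'\<^esub> \<eta> v" if "v \<in> carrier V" for c v
        by (rule inj) (simp_all add: \<eta>b \<eta>c bD b'D VD(2) V'D(2) that)
    qed
    show "bij_betw \<eta> (carrier V) (carrier V')"
      unfolding \<eta>_def \<gamma>_def by (rule bij_betw_trans[OF \<beta>(2) bij_betw_inv_into[OF \<beta>'(2)]])
    show "\<eta> (\<tau> x v) = \<tau>' x (\<eta> v)" if x: "x \<in> carrier (Qt H)" and v: "v \<in> carrier V" for x v
    proof (rule inj)
      obtain n where n: "n \<in> Nm H" "x = K H #>\<^bsub>Wg\<^esub> n" using x unfolding stab_quotient(1)[OF H] by blast
      note xv = group_repD(2)[OF \<tau> x v]
      show "\<eta> (\<tau> x v) \<in> carrier V'" by (rule \<eta>c[OF xv])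
      show "\<tau>' x (\<eta> v) \<in> carrier V'" by (rule group_repD(2)[OF \<tau>' x \<eta>c[OF v]])
      have "\<beta>' (\<eta> (\<tau> x v)) = DM r (pm n H) (\<beta> v)" unfolding \<eta>b[OF xv] unfolding n(2) by (rule \<beta>(3)[OF n(1) v])
      also have "\<dots> = \<beta>' (\<tau>' x (\<eta> v))" unfolding n(2) \<beta>'(3)[OF n(1) \<eta>c[OF v]] \<eta>b[OF v] ..
      finally show "\<beta>' (\<eta> (\<tau> x v)) = \<beta>' (\<tau>' x (\<eta> v))" .
    qed
  qed
qed

lemma corr_nonzero:
  fixes V :: "('c poly fract, 'm) module"
  assumes V: "vectorspace class_ring V" "carrier V \<noteq> {\<zero>\<^bsub>V\<^esub>}" and r: "algebra_rep A (Mv, r)"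
    and c: "corr H (V, \<tau>) (Mv, r)"
  obtains y where "y \<in> fixedM Mv r H" "y \<noteq> \<zero>\<^bsub>Mv\<^esub>"
proof -
  note VD = vectorspaceD[OF V(1)] and MD = vectorspaceD[OF algebra_repD(1)[OF r]]
  interpret V: abelian_group V by (rule VD(1))
  obtain \<beta> where \<beta>0: "\<beta> \<in> LinearCombinations.module_hom class_ring V Mv" "bij_betw \<beta> (carrier V) (fixedM Mv r H)"
      "\<forall>n\<in>Nm H. \<forall>v\<in>carrier V. \<beta> (\<tau> (K H #>\<^bsub>Wg\<^esub> n) v) = DM r (pm n H) (\<beta> v)"
    by (rule corrE_ball[OF c])
  note \<beta> = \<beta>0(1,2) \<beta>0(3)[rule_format]
  have \<beta>0: "\<beta> \<zero>\<^bsub>V\<^esub> = \<zero>\<^bsub>Mv\<^esub>" by (rule additive_zero[OF VD(1) MD(1) module_homD(1,2)[OF \<beta>(1)]])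
  obtain v where v: "v \<in> carrier V" "v \<noteq> \<zero>\<^bsub>V\<^esub>" using V(2) V.zero_closed by blast
  have "\<beta> v \<noteq> \<zero>\<^bsub>Mv\<^esub>"
    unfolding \<beta>0[symmetric] using inj_onD[OF bij_betw_imp_inj_on[OF \<beta>(2)] _ v(1) V.zero_closed] v(2) by blast
  then show thesis by (rule that[OF bij_betw_apply[OF \<beta>(2) v(1)]])
qed

lemma fixedM_subspace:
  assumes r: "algebra_rep A (Mv, r)" and H: "H \<in> Hy"
  shows "VectorSpace.subspace class_ring (fixedM Mv r H) Mv"
proof (rule subspaceI[OF algebra_repD(1)[OF r]])
  note p = ArI[OF id_W Hy_X[OF H]] and MD = vectorspaceD[OF algebra_repD(1)[OF r]]
  interpret M: abelian_group Mv by (rule MD(1))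
  show "fixedM Mv r H \<subseteq> carrier Mv" by (auto simp: fixedM_def)
  show "\<zero>\<^bsub>Mv\<^esub> \<in> fixedM Mv r H" using DM_zero[OF r p] by (simp add: fixedM_def)
  show "v \<oplus>\<^bsub>Mv\<^esub> w \<in> fixedM Mv r H" if "v \<in> fixedM Mv r H" "w \<in> fixedM Mv r H" for v w
    using that DM_add[OF r p, of v w] by (simp add: fixedM_def)
  show "c \<odot>\<^bsub>Mv\<^esub> v \<in> fixedM Mv r H" if "v \<in> fixedM Mv r H" for c v
    using that DM_smult[OF r p, of v c] MD(2)[of v c] by (simp add: fixedM_def)
qed

lemma fixedM_DM:
  assumes r: "algebra_rep A (Mv, r)" and u: "u \<in> W" "x \<in> X" "u ` x = H" and H: "H \<in> Hy" and v: "v \<in> carrier Mv"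
  shows "DM r (pm u x) v \<in> fixedM Mv r H"
  using DM_pm[OF r id_W Hy_X[OF H] u(1,2) v] u(3) DM_closed[OF r ArI[OF u(1,2)] v] by (simp add: fixedM_def)

text \<open>The restriction of \<open>u\<close> to \<open>H\<close> is invertible in the groupoid,
  so it cannot kill a vector at \<open>H\<close>. This allows the hyperplane found in a module to be
  replaced by the chosen representative of its orbit.\<close>

lemma fixedM_move:
  assumes r: "algebra_rep A (Mv, r)" and u: "u \<in> W" and H: "H \<in> Hy" and y: "y \<in> fixedM Mv r H" "y \<noteq> \<zero>\<^bsub>Mv\<^esub>"
  obtains z where "z \<in> fixedM Mv r (u ` H)" "z \<noteq> \<zero>\<^bsub>Mv\<^esub>"
proof (rule that)
  have yc: "y \<in> carrier Mv" "DM r (pm id H) y = y" using y(1) by (auto simp: fixedM_def)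
  note uH = W_Hy[OF u H]
  show "DM r (pm u H) y \<in> fixedM Mv r (u ` H)" by (rule fixedM_DM[OF r u Hy_X[OF H] refl uH yc(1)])
  have "DM r (pm (iv u) (u ` H)) (DM r (pm u H) y) = y"
    using DM_pm[OF r iv_W[OF u] Hy_X[OF uH] u Hy_X[OF H] yc(1)] yc(2) unfolding iv_comp(1)[OF u] by simp
  then show "DM r (pm u H) y \<noteq> \<zero>\<^bsub>Mv\<^esub>" using DM_zero[OF r ArI[OF iv_W[OF u] Hy_X[OF uH]]] y(2) by metis
qed

lemma new_irrepD:
  assumes "(Mv, r) \<in> Br1_new_irreps scale W \<mu>"
  shows "algebra_rep A (Mv, r)" "irreducible_action (carrier A) (Mv, r)"
    "\<not> factors_through_quot A (Br1_to_group_kernel scale W \<mu>) (Mv, r)"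
  using assms unfolding Br1_new_irreps_def algebra_irreps_def by blast+

text \<open>If the representation does not factor through kW, some arrow starting at a hyperplane
  acts nontrivially; it does so through the identity of its source, which therefore has a nonzero
  image.\<close>

lemma new_irrep_fixed:
  assumes M: "(Mv, r) \<in> Br1_new_irreps scale W \<mu>"
  obtains H y where "H \<in> Hy" "y \<in> fixedM Mv r H" "y \<noteq> \<zero>\<^bsub>Mv\<^esub>"
proof -
  note r = new_irrepD(1)[OF M]
  obtain m v where m: "m \<in> Ar" "dom m \<noteq> UNIV" and v: "v \<in> carrier Mv" and ne: "DM r m v \<noteq> \<zero>\<^bsub>Mv\<^esub>"
    using new_irrepD(3)[OF M] unfolding factors_iff[OF r] by blast
  obtain w x where mw: "w \<in> W" "x \<in> X" "m = pm w x" using m(1) by (rule ArE)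
  have x: "x \<in> Hy" using mw m(2) by (auto simp: X_def)
  have "DM r (pm w x) (DM r (pm id x) v) = DM r m v"
    using DM_pm[OF r mw(1,2) id_W mw(2) v] mw(3) by simp
  then have "DM r (pm id x) v \<noteq> \<zero>\<^bsub>Mv\<^esub>" using DM_zero[OF r ArI[OF mw(1,2)]] ne by metis
  moreover have "id ` x = x" by simp
  ultimately show thesis using that[OF x fixedM_DM[OF r id_W mw(2) _ x v]] by blast
qed

lemma pm_coset:
  assumes n: "n \<in> Nm H" and n': "K H #>\<^bsub>Wg\<^esub> n = K H #>\<^bsub>Wg\<^esub> n'"
  shows "pm n' H = pm n H"
proof -
  have "id \<circ> n' \<in> (\<lambda>k. k \<circ> n') ` K H" by (rule image_eqI[of _ "\<lambda>k. k \<circ> n'" id]) (rule refl, rule id_K)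
  then have "id \<circ> n' \<in> (\<lambda>k. k \<circ> n) ` K H" using n' unfolding coset_simp by (simp only:)
  then obtain k where k: "id \<circ> n' = k \<circ> n" "k \<in> K H" by (rule imageE)
  show ?thesis unfolding pm_eq_iff
  proof (intro conjI ballI refl)
    fix v assume v: "v \<in> H"
    have "n' v = k (n v)" using fun_cong[OF k(1), of v] by simp
    moreover have "n v \<in> H" using Nm_image[OF n] v by blast
    ultimately show "n' v = n v" using k(2) by (simp add: pointwise_stabilizer_def)
  qed
qed

text \<open>A coset acts through a chosen representative; by \<open>pm_coset\<close> all
  representatives have the same restriction to \<open>H\<close>, hence the same operator.\<close>

definition vertex_action where
  "vertex_action r H C = DM r (pm (SOME n. n \<in> Nm H \<and> C = K H #>\<^bsub>Wg\<^esub> n) H)"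

lemma vertex_action:
  assumes n: "n \<in> Nm H"
  shows "vertex_action r H (K H #>\<^bsub>Wg\<^esub> n) = DM r (pm n H)"
proof -
  define n' where "n' = (SOME n'. n' \<in> Nm H \<and> K H #>\<^bsub>Wg\<^esub> n = K H #>\<^bsub>Wg\<^esub> n')"
  have "n' \<in> Nm H \<and> K H #>\<^bsub>Wg\<^esub> n = K H #>\<^bsub>Wg\<^esub> n'"
    unfolding n'_def by (rule someI[of _ n]) (intro conjI n refl)
  then have "pm n' H = pm n H" using pm_coset[OF n] by blast
  then show ?thesis unfolding vertex_action_def n'_def[symmetric] by (simp only:)
qed

lemma vertex_rep:
  assumes r: "algebra_rep A (Mv, r)" and H: "H \<in> Hy"
  shows "group_rep (Qt H) (Mv\<lparr>carrier := fixedM Mv r H\<rparr>, vertex_action r H)"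
proof (rule group_repI)
  let ?V = "Mv\<lparr>carrier := fixedM Mv r H\<rparr>"
  have fc: "v \<in> carrier Mv" if "v \<in> carrier ?V" for v using that by (simp add: fixedM_def)
  note HX = Hy_X[OF H]
  show "vectorspace class_ring ?V" by (rule subspace_vectorspace[OF algebra_repD(1)[OF r] fixedM_subspace[OF r H]])
  have ex: "\<exists>n\<in>Nm H. C = K H #>\<^bsub>Wg\<^esub> n" if "C \<in> carrier (Qt H)" for C
    using that unfolding stab_quotient(1)[OF H] by blast
  show "vertex_action r H \<one>\<^bsub>Qt H\<^esub> v = v" if v: "v \<in> carrier ?V" for v
  proof -
    have "\<one>\<^bsub>Qt H\<^esub> = K H #>\<^bsub>Wg\<^esub> id" unfolding stab_quotient(2)[OF H] coset_K[OF id_K] ..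
    then have "vertex_action r H \<one>\<^bsub>Qt H\<^esub> = vertex_action r H (K H #>\<^bsub>Wg\<^esub> id)" by (rule arg_cong)
    then have "vertex_action r H \<one>\<^bsub>Qt H\<^esub> = DM r (pm id H)" unfolding vertex_action[OF id_Nm] .
    then have "vertex_action r H \<one>\<^bsub>Qt H\<^esub> v = DM r (pm id H) v" by (rule fun_cong)
    also have "\<dots> = v" using v by (simp add: fixedM_def)
    finally show ?thesis .
  qed
  fix C assume C: "C \<in> carrier (Qt H)"
  obtain n where n: "n \<in> Nm H" "C = K H #>\<^bsub>Wg\<^esub> n" using ex[OF C] by blast
  note p = ArI[OF Nm_W[OF n(1)] HX]
  have e: "vertex_action r H C = DM r (pm n H)" unfolding n(2) by (rule vertex_action[OF n(1)])
  fix v assume v: "v \<in> carrier ?V"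
  show "vertex_action r H C v \<in> carrier ?V"
    unfolding e using fixedM_DM[OF r Nm_W[OF n(1)] HX Nm_image[OF n(1)] H fc[OF v]] by simp
  show "vertex_action r H C (v \<oplus>\<^bsub>?V\<^esub> w) = vertex_action r H C v \<oplus>\<^bsub>?V\<^esub> vertex_action r H C w"
    if w: "w \<in> carrier ?V" for w unfolding e using DM_add[OF r p fc[OF v] fc[OF w]] by simp
  show "vertex_action r H C (c \<odot>\<^bsub>?V\<^esub> v) = c \<odot>\<^bsub>?V\<^esub> vertex_action r H C v" for c
    unfolding e using DM_smult[OF r p fc[OF v]] by simp
  fix C' assume C': "C' \<in> carrier (Qt H)"
  obtain n' where n': "n' \<in> Nm H" "C' = K H #>\<^bsub>Wg\<^esub> n'" using ex[OF C'] by blast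
  have e': "vertex_action r H C' = DM r (pm n' H)" unfolding n'(2) by (rule vertex_action[OF n'(1)])
  have ee: "vertex_action r H (C \<otimes>\<^bsub>Qt H\<^esub> C') = DM r (pm (n \<circ> n') H)"
    unfolding n(2) n'(2) stab_quotient(3)[OF H n(1) n'(1)] by (rule vertex_action[OF Nm_closed[OF n(1) n'(1)]])
  show "vertex_action r H (C \<otimes>\<^bsub>Qt H\<^esub> C') v = vertex_action r H C (vertex_action r H C' v)"
    unfolding ee e e' using DM_pm[OF r Nm_W[OF n(1)] HX Nm_W[OF n'(1)] HX fc[OF v]] Nm_image[OF n'(1)] by simp
qed

text \<open>For an invariant subspace of the part at \<open>H\<close>, the vectors that all arrows
  ending at \<open>H\<close> send into it form a submodule containing it. A nonzero subspace thus
  makes this submodule everything, and applying the identity arrow of \<open>H\<close> shows that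
  the subspace is the whole part.\<close>

lemma vertex_irreducible:
  assumes r: "algebra_rep A (Mv, r)" and irr: "irreducible_action (carrier A) (Mv, r)" and H: "H \<in> Hy"
    and y: "y \<in> fixedM Mv r H" "y \<noteq> \<zero>\<^bsub>Mv\<^esub>"
  shows "irreducible_action (carrier (Qt H)) (Mv\<lparr>carrier := fixedM Mv r H\<rparr>, vertex_action r H)"
proof (rule irreducible_actionI)
  let ?V = "Mv\<lparr>carrier := fixedM Mv r H\<rparr>"
  note RD = algebra_repD[OF r]
  note MD = vectorspaceD[OF RD(1)]
  interpret M: abelian_group Mv by (rule MD(1))
  note HX = Hy_X[OF H]
  show "carrier ?V \<noteq> {\<zero>\<^bsub>?V\<^esub>}" using y by auto
  fix U assume U: "VectorSpace.subspace class_ring U ?V"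
    and ivt: "\<And>C v. C \<in> carrier (Qt H) \<Longrightarrow> v \<in> U \<Longrightarrow> vertex_action r H C v \<in> U" and ne: "U \<noteq> {\<zero>\<^bsub>?V\<^esub>}"
  have UD: "U \<subseteq> fixedM Mv r H" "\<zero>\<^bsub>Mv\<^esub> \<in> U" "\<And>v w. v \<in> U \<Longrightarrow> w \<in> U \<Longrightarrow> v \<oplus>\<^bsub>Mv\<^esub> w \<in> U"
      "\<And>c v. v \<in> U \<Longrightarrow> c \<odot>\<^bsub>Mv\<^esub> v \<in> U"
    using subspaceD[OF U] by simp_all
  have Uf: "v \<in> carrier Mv \<and> DM r (pm id H) v = v" if "v \<in> U" for v using that UD(1) by (auto simp: fixedM_def)
  define U' where "U' = {v \<in> carrier Mv. \<forall>m\<in>Ar. ran m = H \<longrightarrow> DM r m v \<in> U}"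
  have sub: "VectorSpace.subspace class_ring U' Mv"
    by (rule subspaceI[OF RD(1)]) (auto simp: U'_def DM_zero[OF r] DM_add[OF r] DM_smult[OF r] UD(2,3,4) MD(2))
  have inv': "DM r m v \<in> U'" if m: "m \<in> Ar" and v: "v \<in> U'" for m v
  proof -
    have vc: "v \<in> carrier Mv" using v by (simp add: U'_def)
    have "DM r n (DM r m v) \<in> U" if n: "n \<in> Ar" "ran n = H" for n
      using DM_DM[OF r n(1) m vc] v n cmp_Ar[OF n(1) m] tgt_cmp[OF n(1) m] UD(2) by (simp add: U'_def)
    then show ?thesis using DM_closed[OF r m vc] by (simp add: U'_def)
  qed
  have U': "U' = {\<zero>\<^bsub>Mv\<^esub>} \<or> U' = carrier Mv" by (rule DM_generates[OF r irr sub inv'])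
  have UU': "v \<in> U'" if v: "v \<in> U" for v
  proof -
    note vf = Uf[OF v, THEN conjunct1] Uf[OF v, THEN conjunct2]
    have "DM r m v \<in> U" if m: "m \<in> Ar" "ran m = H" for m
    proof -
      obtain w x where mw: "w \<in> W" "x \<in> X" "m = pm w x" using m(1) by (rule ArE)
      have e: "DM r m v = (if H = x then DM r (pm w H) v else \<zero>\<^bsub>Mv\<^esub>)"
        using DM_pm[OF r mw(1,2) id_W HX vf(1)] unfolding vf(2) mw(3) image_id comp_id id_apply .
      show ?thesis
      proof (cases "H = x")
        case True
        have n: "w \<in> Nm H" using mw m(2) True by (simp add: Nm_def)
        have "K H #>\<^bsub>Wg\<^esub> w \<in> carrier (Qt H)" unfolding stab_quotient(1)[OF H] using n by (rule imageI)
        then have "vertex_action r H (K H #>\<^bsub>Wg\<^esub> w) v \<in> U" by (rule ivt[OF _ v])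
        then show ?thesis unfolding vertex_action[OF n] e using True by simp
      qed (simp add: e UD(2))
    qed
    then show ?thesis using vf(1) by (simp add: U'_def)
  qed
  have "\<exists>v\<in>U. v \<noteq> \<zero>\<^bsub>Mv\<^esub>" using ne UD(2) by auto
  then have "U' \<noteq> {\<zero>\<^bsub>Mv\<^esub>}" using UU' by blast
  then have U'c: "U' = carrier Mv" using U' by blast
  have "fixedM Mv r H \<subseteq> U"
  proof
    fix v assume "v \<in> fixedM Mv r H"
    then have v: "v \<in> U'" "DM r (pm id H) v = v" unfolding U'c by (auto simp: fixedM_def)
    from v(1) have a: "DM r m v \<in> U" if "m \<in> Ar" "ran m = H" for m using that by (simp add: U'_def)
    have "ran (pm id H) = H" by simp
    from a[OF ArI[OF id_W HX] this] show "v \<in> U" unfolding v(2) .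
  qed
  then show "U = carrier ?V" using UD(1) by auto
qed

lemma vertex_corr: "H \<in> Hy \<Longrightarrow> corr H (Mv\<lparr>carrier := fixedM Mv r H\<rparr>, vertex_action r H) (Mv, r)"
  by (rule corrI[of "\<lambda>x. x"], rule module_homI)
    (auto simp: fixedM_def vertex_action intro!: bij_betw_byWitness[of _ "\<lambda>x. x"])

text \<open>An irreducible module is generated by any nonzero vector \<open>y\<close>, so a vector
  is determined by the coordinates of a chosen algebra element that sends \<open>y\<close> to it.
  The finitely many arrows are numbered to make these coordinates a function on \<open>nat\<close>.
  Such an injection is all that transport of structure requires.\<close>

lemma irreducible_embeds:
  assumes r: "algebra_rep A (Mv, r)" and irr: "irreducible_action (carrier A) (Mv, r)"
  obtains f :: "_ \<Rightarrow> nat \<Rightarrow> 'c poly fract" where "inj_on f (carrier Mv)"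
proof -
  note RD = algebra_repD[OF r]
  note MD = vectorspaceD[OF RD(1)]
  interpret M: abelian_group Mv by (rule MD(1))
  obtain y where y: "y \<in> carrier Mv" "y \<noteq> \<zero>\<^bsub>Mv\<^esub>" using irreducible_actionD(1)[OF irr] M.zero_closed by blast
  define U where "U = (\<lambda>a. r a y) ` carrier A"
  have UI: "r a y \<in> U" if "a \<in> carrier A" for a using that by (simp add: U_def)
  have sub: "VectorSpace.subspace class_ring U Mv"
  proof (rule subspaceI[OF RD(1)])
    show "U \<subseteq> carrier Mv" using RD(2)[OF _ y(1)] by (auto simp: U_def)
    have "r (0 \<odot>\<^bsub>A\<^esub> \<one>\<^bsub>A\<^esub>) y = \<zero>\<^bsub>Mv\<^esub>"
      using RD(8)[OF A.B.one_closed y(1), of 0] MD(8)[OF RD(2)[OF A.B.one_closed y(1)]] by (rule trans)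
    then show "\<zero>\<^bsub>Mv\<^esub> \<in> U" using UI[OF A.VB(2)[OF A.B.one_closed, of 0]] by (simp only:)
    fix v c assume "v \<in> U"
    then obtain a where a: "a \<in> carrier A" "v = r a y" by (auto simp: U_def)
    show "c \<odot>\<^bsub>Mv\<^esub> v \<in> U" unfolding a(2) RD(8)[OF a(1) y(1), symmetric] by (rule UI[OF A.VB(2)[OF a(1)]])
    fix w assume "w \<in> U"
    then obtain b where b: "b \<in> carrier A" "w = r b y" by (auto simp: U_def)
    show "v \<oplus>\<^bsub>Mv\<^esub> w \<in> U" unfolding a(2) b(2) RD(7)[OF a(1) b(1) y(1), symmetric]
      by (rule UI[OF A.B.add.m_closed[OF a(1) b(1)]])
  qed
  have ivt: "r a v \<in> U" if a: "a \<in> carrier A" and v: "v \<in> U" for a v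
  proof -
    obtain b where b: "b \<in> carrier A" "v = r b y" using v by (auto simp: U_def)
    show ?thesis unfolding b(2) RD(6)[OF a b(1) y(1), symmetric] by (rule UI[OF A.B.m_closed[OF a b(1)]])
  qed
  have "y \<in> U" using UI[OF A.B.one_closed] unfolding RD(5)[OF y(1)] .
  then have "U \<noteq> {\<zero>\<^bsub>Mv\<^esub>}" using y(2) by blast
  then have U: "U = carrier Mv" using irreducible_actionD(2)[OF irr sub ivt] by blast
  define c where "c v = (SOME a. a \<in> carrier A \<and> r a y = v)" for v
  have c: "c v \<in> carrier A \<and> r (c v) y = v" if v: "v \<in> carrier Mv" for v
  proof -
    have "\<exists>a. a \<in> carrier A \<and> r a y = v" using v unfolding U[symmetric] U_def by blast
    then show ?thesis unfolding c_def by (rule someI_ex)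
  qed
  obtain mn where mn: "bij_betw mn {0..<card Ar} Ar" using ex_bij_betw_nat_finite[OF fin_Ar] by blast
  have "inj_on (\<lambda>v i. h (c v) (mn i)) (carrier Mv)"
  proof (rule inj_onI)
    fix v w assume v: "v \<in> carrier Mv" and w: "w \<in> carrier Mv" and e: "(\<lambda>i. h (c v) (mn i)) = (\<lambda>i. h (c w) (mn i))"
    note cv = conjunct1[OF c[OF v]] and cw = conjunct1[OF c[OF w]]
    have "h (c v) = h (c w)"
    proof (rule ext)
      fix m
      show "h (c v) m = h (c w) m"
      proof (cases "m \<in> Ar")
        case True
        then obtain i where "m = mn i" using mn unfolding bij_betw_def by blast
        then show ?thesis using fun_cong[OF e, of i] by simp
      next
        case False
        then show ?thesis using A.h_supported[OF cv] A.h_supported[OF cw] by (simp add: supported_def)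
      qed
    qed
    then have "c v = c w" using jh[OF cv] jh[OF cw] by metis
    then show "v = w" using c[OF v] c[OF w] by metis
  qed
  then show thesis by (rule that)
qed

definition corr_rep where
  "corr_rep H \<theta> M \<longleftrightarrow> M \<in> Br1_new_irreps scale W \<mu> \<and> corr H \<theta> M \<and>
     rep_iso W (restrict_to_W scale W \<mu> M) (induced_rep Wg (stab_normalizer scale W H) (inflated_rep Wg (K H) \<theta>))"

end

section \<open>The correspondence between irreducible representations\<close>

lemma (in ind_irr) exists_corr_rep:
  "\<exists>M :: ('b poly fract, ('a, 'b poly fract) bc set, nat \<Rightarrow> 'b poly fract) rep. corr_rep H (V, \<tau>) M"
proof -
  obtain f :: "_ \<Rightarrow> nat \<Rightarrow> 'b poly fract" where f: "inj_on f (carrier I)" by (rule irreducible_embeds[OF I_A_rep I_irr])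
  define M where "M = transport_space f I"
  define r where "r = transport_action f I \<rho>"
  note ts = transport_space[OF I_vs f, folded M_def]
  have iso: "rep_iso (carrier A) (I, \<rho>) (M, r)" unfolding M_def r_def by (rule transport_rep_iso[OF I_vs f])
  have Mr: "algebra_rep A (M, r)" by (rule algebra_rep_iso[OF I_A_rep ts(1) iso A.B])
  have irrM: "irreducible_action (carrier A) (M, r)"
    by (rule irreducible_iso[OF I_vs ts(1) I_irr iso]) (rule algebra_repD(2)[OF I_A_rep])
  obtain \<phi> where \<phi>0: "\<phi> \<in> LinearCombinations.module_hom class_ring I M" "bij_betw \<phi> (carrier I) (carrier M)"
      "\<forall>x\<in>carrier A. \<forall>v\<in>carrier I. \<phi> (\<rho> x v) = r x (\<phi> v)"
    by (rule rep_isoE_ball[OF iso])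
  note \<phi> = \<phi>0(1,2) \<phi>0(3)[rule_format]
  have "\<not> factors_through_quot A (Br1_to_group_kernel scale W \<mu>) (M, r)"
  proof
    assume f: "factors_through_quot A (Br1_to_group_kernel scale W \<mu>) (M, r)"
    have "factors_through_quot A (Br1_to_group_kernel scale W \<mu>) (I, \<rho>)"
      by (rule factors_through_iso[OF I_A_rep Mr \<phi>(1,2) _ f]) (rule \<phi>(3))
    then show False using I_new by blast
  qed
  then have new: "(M, r) \<in> Br1_new_irreps scale W \<mu>"
    unfolding Br1_new_irreps_def algebra_irreps_def using Mr irrM by blast
  have c: "corr H (V, \<tau>) (M, r)" by (rule corr_iso_right[OF H I_corr I_A_rep Mr iso])
  have iso': "rep_iso W (I, \<lambda>w. \<rho> (A.g w)) (M, \<lambda>w. r (A.g w))"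
    by (rule rep_isoI[OF \<phi>(1,2)]) (rule \<phi>(3)[OF A.g_closed])
  have "rep_iso W (M, \<lambda>w. r (A.g w)) (I, \<lambda>w. \<rho> (A.g w))"
    by (rule rep_iso_sym[OF I_vs _ iso']) (rule algebra_repD(2)[OF I_A_rep A.g_closed])
  then have "rep_iso W (restrict_to_W scale W \<mu> (M, r)) (restrict_to_W scale W \<mu> (I, \<rho>))"
    unfolding restrict_to_W_def split A_gen .
  then have "corr_rep H (V, \<tau>) (M, r)"
    unfolding corr_rep_def using new c rep_iso_trans[OF _ I_restrict] by blast
  then show ?thesis by (rule exI)
qed

context refl_gen
begin

lemma ind_irrI:
  assumes "H \<in> Hy" "(V, \<tau>) \<in> group_irreps (Qt H)" shows "ind_irr scale W \<mu> H V \<tau>"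
proof -
  have "group_rep (Qt H) (V, \<tau>)" "irreducible_action (carrier (Qt H)) (V, \<tau>)"
    using assms(2) unfolding group_irreps_def by blast+
  then show ?thesis
    by (intro ind_irr.intro ind.intro ind_axioms.intro ind_irr_axioms.intro refl_gen_axioms assms(1))
qed

text \<open>Indexed by hyperplanes instead of orbits; composition with the choice of representatives
  \<open>H0\<close> gives the \<Phi> of the theorem.\<close>

definition Phi :: "'v set \<Rightarrow> ('c poly fract, ('v \<Rightarrow> 'v) set, nat \<Rightarrow> 'c poly fract) rep \<Rightarrow>
    ('c poly fract, ('v, 'c poly fract) bc set, nat \<Rightarrow> 'c poly fract) rep" where
  "Phi H \<theta> = (SOME M. corr_rep H \<theta> M)"

lemma corr_rep_Phi:
  assumes H: "H \<in> Hy" and \<theta>: "\<theta> \<in> group_irreps (Qt H)"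
  shows "corr_rep H \<theta> (Phi H \<theta>)"
proof -
  obtain V \<tau> where e: "\<theta> = (V, \<tau>)" by (cases \<theta>)
  show ?thesis unfolding Phi_def unfolding e
    by (rule someI_ex[OF ind_irr.exists_corr_rep[OF ind_irrI[OF H \<theta>[unfolded e]]]])
qed

text \<open>By \<open>corr_iso\<close> both modules are isomorphic to the one induced from
  \<theta>.\<close>

lemma corr_imp_iso:
  assumes H: "H \<in> Hy" and \<theta>: "(V, \<tau>) \<in> group_irreps (Qt H)"
    and M: "(Mv, r) \<in> Br1_new_irreps scale W \<mu>" "corr H (V, \<tau>) (Mv, r)"
    and M': "(Mv', r') \<in> Br1_new_irreps scale W \<mu>" "corr H (V, \<tau>) (Mv', r')"
  shows "rep_iso (carrier A) (Mv, r) (Mv', r')"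
proof -
  note i = ind_irr.corr_iso[OF ind_irrI[OF H \<theta>]]
  note D' = new_irrepD[OF M'(1)]
  show ?thesis
  proof (rule rep_iso_trans[OF i[OF new_irrepD(1,2)[OF M(1)] M(2)]])
    show "rep_iso (carrier A) (ind.I scale W H V \<tau>, ind.\<rho> scale W \<mu> H V \<tau>) (Mv', r')"
      by (rule rep_iso_sym[OF algebra_repD(1)[OF D'(1)] _ i[OF D'(1,2) M'(2)]]) (rule algebra_repD(2)[OF D'(1)])
  qed
qed

text \<open>The representation is the action on the part of the module at \<open>H\<close>, copied
  into the universe of \<Phi> along the embedding of the module.\<close>

lemma new_irrep_corr:
  assumes M: "(Mv, r) \<in> Br1_new_irreps scale W \<mu>" and H: "H \<in> Hy" and y: "y \<in> fixedM Mv r H" "y \<noteq> \<zero>\<^bsub>Mv\<^esub>"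
  obtains \<theta> :: "('c poly fract, ('v \<Rightarrow> 'v) set, nat \<Rightarrow> 'c poly fract) rep"
  where "\<theta> \<in> group_irreps (Qt H)" "corr H \<theta> (Mv, r)"
proof -
  note D = new_irrepD[OF M]
  let ?V = "Mv\<lparr>carrier := fixedM Mv r H\<rparr>" and ?\<tau> = "vertex_action r H"
  note g = vertex_rep[OF D(1) H]
  note vs = group_repD(1)[OF g] and cl = group_repD(2)[OF g]
  obtain f :: "_ \<Rightarrow> nat \<Rightarrow> 'c poly fract" where "inj_on f (carrier Mv)" by (rule irreducible_embeds[OF D(1,2)])
  then have f: "inj_on f (carrier ?V)" by (rule inj_on_subset) (auto simp: fixedM_def)
  let ?V' = "transport_space f ?V" and ?\<tau>' = "transport_action f ?V ?\<tau>"
  have iso: "rep_iso (carrier (Qt H)) (?V, ?\<tau>) (?V', ?\<tau>')" by (rule transport_rep_iso[OF vs f])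
  note vs' = transport_space(1)[OF vs f]
  have g': "group_rep (Qt H) (?V', ?\<tau>')" by (rule group_rep_iso[OF g vs' iso stab_quotient(4)[OF H]])
  have irr: "irreducible_action (carrier (Qt H)) (?V', ?\<tau>')"
    by (rule irreducible_iso[OF vs vs' vertex_irreducible[OF D(1,2) H y] iso]) (rule cl)
  show thesis
  proof (rule that)
    show "(?V', ?\<tau>') \<in> group_irreps (Qt H)" unfolding group_irreps_def using g' irr by blast
    show "corr H (?V', ?\<tau>') (Mv, r)"
      by (rule corr_iso_left[OF H vertex_corr[OF H]], rule rep_iso_sym[OF vs _ iso], rule cl)
  qed
qed

lemma iso_imp_orbit:
  assumes H: "H \<in> Hy" "H' \<in> Hy" and \<theta>: "(V, \<tau>) \<in> group_irreps (Qt H)" "(V', \<tau>') \<in> group_irreps (Qt H')"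
    and M: "(Mv, r) \<in> Br1_new_irreps scale W \<mu>" "corr H (V, \<tau>) (Mv, r)"
    and M': "(Mv', r') \<in> Br1_new_irreps scale W \<mu>" "corr H' (V', \<tau>') (Mv', r')"
    and iso: "rep_iso (carrier A) (Mv, r) (Mv', r')"
  shows "orb H = orb H'"
proof -
  have V: "vectorspace class_ring V" "carrier V \<noteq> {\<zero>\<^bsub>V\<^esub>}" "vectorspace class_ring V'" "carrier V' \<noteq> {\<zero>\<^bsub>V'\<^esub>}"
    using \<theta> unfolding group_irreps_def by (auto dest: group_repD(1) irreducible_actionD(1))
  note D' = new_irrepD[OF M'(1)]
  obtain y where y: "y \<in> fixedM Mv' r' H" "y \<noteq> \<zero>\<^bsub>Mv'\<^esub>"
    by (rule corr_nonzero[OF V(1,2) D'(1) corr_iso_right[OF H(1) M(2) new_irrepD(1)[OF M(1)] D'(1) iso]])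
  obtain z where z: "z \<in> fixedM Mv' r' H'" "z \<noteq> \<zero>\<^bsub>Mv'\<^esub>"
    by (rule corr_nonzero[OF V(3,4) D'(1) M'(2)])
  show ?thesis by (rule corr_same_orbit[OF D'(1,2) H y z])
qed

lemma iso_iff:
  assumes H: "H \<in> Hy" and \<theta>: "(V, \<tau>) \<in> group_irreps (Qt H)" "(V', \<tau>') \<in> group_irreps (Qt H)"
    and M: "(Mv, r) \<in> Br1_new_irreps scale W \<mu>" "corr H (V, \<tau>) (Mv, r)"
    and M': "(Mv', r') \<in> Br1_new_irreps scale W \<mu>" "corr H (V', \<tau>') (Mv', r')"
  shows "rep_iso (carrier A) (Mv, r) (Mv', r') \<longleftrightarrow> rep_iso (carrier (Qt H)) (V, \<tau>) (V', \<tau>')"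
proof
  have g: "group_rep (Qt H) (V, \<tau>)" "group_rep (Qt H) (V', \<tau>')" using \<theta> unfolding group_irreps_def by blast+
  assume "rep_iso (carrier A) (Mv, r) (Mv', r')"
  then show "rep_iso (carrier (Qt H)) (V, \<tau>) (V', \<tau>')"
    by (rule corr_unique[OF H g corr_iso_right[OF H M(2) new_irrepD(1)[OF M(1)] new_irrepD(1)[OF M'(1)]] M'(2)])
next
  assume "rep_iso (carrier (Qt H)) (V, \<tau>) (V', \<tau>')"
  then show "rep_iso (carrier A) (Mv, r) (Mv', r')"
    by (rule corr_imp_iso[OF H \<theta>(1) M M'(1) corr_iso_left[OF H M'(2)]])
qed

lemma Phi_iso_iff:
  assumes H: "H \<in> Hy" "H' \<in> Hy" and \<theta>: "\<theta> \<in> group_irreps (Qt H)" "\<theta>' \<in> group_irreps (Qt H')"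
  shows "rep_iso (carrier A) (Phi H \<theta>) (Phi H' \<theta>') \<Longrightarrow> orb H = orb H'"
    and "H = H' \<Longrightarrow> rep_iso (carrier A) (Phi H \<theta>) (Phi H' \<theta>') \<longleftrightarrow> rep_iso (carrier (Qt H)) \<theta> \<theta>'"
proof -
  obtain V \<tau> where e: "\<theta> = (V, \<tau>)" by (cases \<theta>)
  obtain V' \<tau>' where e': "\<theta>' = (V', \<tau>')" by (cases \<theta>')
  obtain Mv r where m: "Phi H \<theta> = (Mv, r)" by (cases "Phi H \<theta>")
  obtain Mv' r' where m': "Phi H' \<theta>' = (Mv', r')" by (cases "Phi H' \<theta>'")
  have c: "(Mv, r) \<in> Br1_new_irreps scale W \<mu>" "corr H (V, \<tau>) (Mv, r)"
    using corr_rep_Phi[OF H(1) \<theta>(1), unfolded corr_rep_def m] unfolding e by blast+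
  have c': "(Mv', r') \<in> Br1_new_irreps scale W \<mu>" "corr H' (V', \<tau>') (Mv', r')"
    using corr_rep_Phi[OF H(2) \<theta>(2), unfolded corr_rep_def m'] unfolding e' by blast+
  show "orb H = orb H'" if "rep_iso (carrier A) (Phi H \<theta>) (Phi H' \<theta>')"
    by (rule iso_imp_orbit[OF H \<theta>[unfolded e e'] c c' that[unfolded m m']])
  show "rep_iso (carrier A) (Phi H \<theta>) (Phi H' \<theta>') \<longleftrightarrow> rep_iso (carrier (Qt H)) \<theta> \<theta>'" if "H = H'"
    unfolding m m' unfolding e e'
    by (rule iso_iff[OF H(1) \<theta>(1)[unfolded e] \<theta>(2)[folded that, unfolded e'] c c'[folded that]])
qed

lemma Phi_surj:
  assumes M: "M \<in> Br1_new_irreps scale W \<mu>" and H0: "\<And>\<O>. \<O> \<in> orb ` Hy \<Longrightarrow> H0 \<O> \<in> \<O>"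
  obtains \<O> \<theta> where "\<O> \<in> orb ` Hy" "\<theta> \<in> group_irreps (Qt (H0 \<O>))" "rep_iso (carrier A) (Phi (H0 \<O>) \<theta>) M"
proof -
  obtain Mv r where e: "M = (Mv, r)" by (cases M)
  note M' = M[unfolded e]
  obtain H1 y where y: "H1 \<in> Hy" "y \<in> fixedM Mv r H1" "y \<noteq> \<zero>\<^bsub>Mv\<^esub>" by (rule new_irrep_fixed[OF M'])
  have O: "orb H1 \<in> orb ` Hy" using y(1) by (rule imageI)
  \<comment> \<open>The hyperplane found in the module need not be the chosen representative of its
    orbit; \<open>u\<close> connects the two, and the fixed vector is moved along it.\<close>
  obtain u where u: "u \<in> W" "H0 (orb H1) = u ` H1" using H0[OF O] unfolding orb_def by blast
  note H = W_Hy[OF u(1) y(1), folded u(2)]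
  obtain z where z: "z \<in> fixedM Mv r (H0 (orb H1))" "z \<noteq> \<zero>\<^bsub>Mv\<^esub>"
    unfolding u(2) by (rule fixedM_move[OF new_irrepD(1)[OF M'] u(1) y])
  obtain \<theta> :: "('c poly fract, ('v \<Rightarrow> 'v) set, nat \<Rightarrow> 'c poly fract) rep"
    where \<theta>: "\<theta> \<in> group_irreps (Qt (H0 (orb H1)))" "corr (H0 (orb H1)) \<theta> (Mv, r)"
    by (rule new_irrep_corr[OF M' H z])
  obtain V \<tau> where t: "\<theta> = (V, \<tau>)" by (cases \<theta>)
  obtain Pv p where P: "Phi (H0 (orb H1)) \<theta> = (Pv, p)" by (cases "Phi (H0 (orb H1)) \<theta>")
  have c: "(Pv, p) \<in> Br1_new_irreps scale W \<mu>" "corr (H0 (orb H1)) (V, \<tau>) (Pv, p)"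
    using corr_rep_Phi[OF H \<theta>(1), unfolded corr_rep_def P] unfolding t by blast+
  have "rep_iso (carrier A) (Phi (H0 (orb H1)) \<theta>) M"
    unfolding P e by (rule corr_imp_iso[OF H \<theta>(1)[unfolded t] c M' \<theta>(2)[unfolded t]])
  then show thesis by (rule that[OF O \<theta>(1)])
qed

end

section \<open>Assembly of the structure theorem for Br_1\<close>

theorem theorem1p1:
  fixes scale :: "complex \<Rightarrow> 'v \<Rightarrow> 'v::ab_group_add"
    and W :: "('v \<Rightarrow> 'v) set"
    and \<mu> :: "('v \<Rightarrow> 'v) \<Rightarrow> 'c::field_char_0"
    and H0 :: "'v set set \<Rightarrow> 'v set"
  assumes "complex_reflection_group scale W"
    and "\<forall>s\<in>reflections scale W. \<forall>t\<in>reflections scale W. \<forall>w\<in>W. w \<circ> s = t \<circ> w \<longrightarrow> \<mu> s = \<mu> t"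
    and "\<forall>\<O>\<in>hyperplane_orbits scale W. H0 \<O> \<in> \<O>"
  shows
    "semisimple_algebra (generic_Br1 scale W \<mu>)
     \<and>
     (\<exists>\<Phi> :: 'v set set \<Rightarrow> ('c poly fract, ('v \<Rightarrow> 'v) set, nat \<Rightarrow> 'c poly fract) rep \<Rightarrow>
              ('c poly fract, ('v, 'c poly fract) bc set, nat \<Rightarrow> 'c poly fract) rep.
        (\<forall>\<O>\<in>hyperplane_orbits scale W. \<forall>\<theta>\<in>group_irreps (stab_quotient scale W (H0 \<O>)).
           \<Phi> \<O> \<theta> \<in> Br1_new_irreps scale W \<mu>) \<and>
        (\<forall>\<O>\<in>hyperplane_orbits scale W. \<forall>\<theta>\<in>group_irreps (stab_quotient scale W (H0 \<O>)).
         \<forall>\<O>'\<in>hyperplane_orbits scale W. \<forall>\<theta>'\<in>group_irreps (stab_quotient scale W (H0 \<O>')).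
           rep_iso (carrier (generic_Br1 scale W \<mu>)) (\<Phi> \<O> \<theta>) (\<Phi> \<O>' \<theta>') \<longleftrightarrow>
           \<O> = \<O>' \<and> rep_iso (carrier (stab_quotient scale W (H0 \<O>))) \<theta> \<theta>') \<and>
        (\<forall>M :: ('c poly fract, ('v, 'c poly fract) bc set, 'm) rep.
           M \<in> Br1_new_irreps scale W \<mu> \<longrightarrow>
           (\<exists>\<O>\<in>hyperplane_orbits scale W. \<exists>\<theta>\<in>group_irreps (stab_quotient scale W (H0 \<O>)).
              rep_iso (carrier (generic_Br1 scale W \<mu>)) (\<Phi> \<O> \<theta>) M)) \<and>
        (\<forall>\<O>\<in>hyperplane_orbits scale W. \<forall>\<theta>\<in>group_irreps (stab_quotient scale W (H0 \<O>)).
           rep_iso W (restrict_to_W scale W \<mu> (\<Phi> \<O> \<theta>))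
             (induced_rep (refl_group scale W) (stab_normalizer scale W (H0 \<O>))
               (inflated_rep (refl_group scale W) (pointwise_stabilizer W (H0 \<O>)) \<theta>))))
     \<and>
     vectorspace.fin_dim class_ring (generic_Br1 scale W \<mu>)
     \<and>
     (of_nat (vectorspace.dim class_ring (generic_Br1 scale W \<mu>)) :: rat) =
       of_nat (card W) + (\<Sum>\<O>\<in>hyperplane_orbits scale W.
         of_nat (card \<O>) * (of_nat (card W) / of_nat (card (pointwise_stabilizer W (H0 \<O>)))))"
proof -
  have const: "const_fract (\<mu> s) = const_fract (\<mu> t)"
    if "s \<in> reflections scale W" "t \<in> reflections scale W" "w \<in> W" "w \<circ> s = t \<circ> w" for s t w
    using assms(2) that by metis
  interpret refl_gen scale W \<mu>
  proof unfold_locales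
    show "complex_reflection_group scale W" by (rule assms(1))
    show "(const_fract \<circ> \<mu>) s = (const_fract \<circ> \<mu>) t"
      if "s \<in> reflections scale W" "t \<in> reflections scale W" "w \<in> W" "w \<circ> s = t \<circ> w" for s t w
      unfolding o_apply by (rule const[OF that])
  qed
  have O: "H0 \<O> \<in> \<O> \<and> H0 \<O> \<in> Hy \<and> orb (H0 \<O>) = \<O>" if "\<O> \<in> hyperplane_orbits scale W" for \<O>
  proof -
    have "\<O> \<in> orb ` Hy" using that unfolding orbits_eq .
    then obtain H where H: "H \<in> Hy" "\<O> = orb H" by blast
    have m: "H0 \<O> \<in> \<O>" using assms(3) that by blast
    then obtain w where w: "w \<in> W" "H0 \<O> = w ` H" unfolding H(2) orb_def by blast
    have "H0 \<O> \<in> Hy" unfolding w(2) by (rule W_Hy[OF w(1) H(1)])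
    moreover have "orb (H0 \<O>) = \<O>" unfolding w(2) orb_image[OF w(1)] by (rule H(2)[symmetric])
    ultimately show ?thesis using m by (intro conjI)
  qed
  note H0 = O[THEN conjunct1] and H0_Hy = O[THEN conjunct2, THEN conjunct1] and H0_orb = O[THEN conjunct2, THEN conjunct2]
  note P = corr_rep_Phi[OF H0_Hy, unfolded corr_rep_def]
  show ?thesis
  proof (intro conjI exI[of _ "\<lambda>\<O>. Phi (H0 \<O>)"] ballI allI impI)
    show "semisimple_algebra A" by (rule A_semisimple)
    show "vectorspace.fin_dim class_ring A" by (rule A_dim(1))
    show "(of_nat (vectorspace.dim class_ring A) :: rat) =
       of_nat (card W) + (\<Sum>\<O>\<in>hyperplane_orbits scale W.
         of_nat (card \<O>) * (of_nat (card W) / of_nat (card (K (H0 \<O>)))))"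
      unfolding A_dim(2) by (rule card_Ar[OF H0])
  next
    fix \<O> and \<theta> :: "('c poly fract, ('v \<Rightarrow> 'v) set, nat \<Rightarrow> 'c poly fract) rep"
    assume "\<O> \<in> hyperplane_orbits scale W" "\<theta> \<in> group_irreps (stab_quotient scale W (H0 \<O>))"
    note P' = P[OF this]
    show "Phi (H0 \<O>) \<theta> \<in> Br1_new_irreps scale W \<mu>" using P' by blast
    show "rep_iso W (restrict_to_W scale W \<mu> (Phi (H0 \<O>) \<theta>))
             (induced_rep (refl_group scale W) (stab_normalizer scale W (H0 \<O>))
               (inflated_rep (refl_group scale W) (pointwise_stabilizer W (H0 \<O>)) \<theta>))" using P' by blast
  next
    fix \<O> \<O>' and \<theta> \<theta>' :: "('c poly fract, ('v \<Rightarrow> 'v) set, nat \<Rightarrow> 'c poly fract) rep"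
    assume a: "\<O> \<in> hyperplane_orbits scale W" "\<theta> \<in> group_irreps (stab_quotient scale W (H0 \<O>))"
      "\<O>' \<in> hyperplane_orbits scale W" "\<theta>' \<in> group_irreps (stab_quotient scale W (H0 \<O>'))"
    note I = Phi_iso_iff[OF H0_Hy[OF a(1)] H0_Hy[OF a(3)] a(2,4)]
    have i1: "\<O> = \<O>'" if "rep_iso (carrier A) (Phi (H0 \<O>) \<theta>) (Phi (H0 \<O>') \<theta>')"
      using I(1)[OF that] unfolding H0_orb[OF a(1)] H0_orb[OF a(3)] .
    have i2: "rep_iso (carrier A) (Phi (H0 \<O>) \<theta>) (Phi (H0 \<O>') \<theta>')
       \<longleftrightarrow> rep_iso (carrier (stab_quotient scale W (H0 \<O>))) \<theta> \<theta>'" if "\<O> = \<O>'"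
      by (rule I(2)) (simp only: that)
    show "rep_iso (carrier A) (Phi (H0 \<O>) \<theta>) (Phi (H0 \<O>') \<theta>') \<longleftrightarrow>
           \<O> = \<O>' \<and> rep_iso (carrier (stab_quotient scale W (H0 \<O>))) \<theta> \<theta>'"
      using i1 i2 by blast
  next
    \<comment> \<open>The elements of \<open>M\<close> may have any type: only \<theta> and the
      values of \<Phi> are confined to the chosen universe, and \<open>rep_iso\<close> compares
      across types.\<close>
    fix M :: "('c poly fract, ('v, 'c poly fract) bc set, 'm) rep"
    assume M: "M \<in> Br1_new_irreps scale W \<mu>"
    obtain \<O> and \<theta> :: "('c poly fract, ('v \<Rightarrow> 'v) set, nat \<Rightarrow> 'c poly fract) rep" where "\<O> \<in> orb ` Hy" "\<theta> \<in> group_irreps (stab_quotient scale W (H0 \<O>))" "rep_iso (carrier A) (Phi (H0 \<O>) \<theta>) M"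
      by (rule Phi_surj[OF M H0[unfolded orbits_eq]])
    then show "\<exists>\<O>\<in>hyperplane_orbits scale W. \<exists>\<theta>\<in>group_irreps (stab_quotient scale W (H0 \<O>)).
              rep_iso (carrier A) (Phi (H0 \<O>) \<theta>) M" unfolding orbits_eq by blast
  qed
qed

end
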